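(* Let $G$ be a one-parameter metabelian nilpotent Lie group of dimension $n$, let $\Gamma$ be a discrete uniform subgroup of $G$, and let $M,\ \mathcal V,\ \Sigma,\ \chi_l$ be as defined in the context. Then the quasi-regular representation $\tau=\mathrm{Ind}_\Gamma^G1$ decomposes as $$\tau\simeq\rho=\bigoplus_{l\in\Sigma}\mathrm{Ind}_M^G\chi_l+\bigoplus_{l\in\mathcal V}\chi_l .$$
   Context: A one-parameter metabelian nilpotent Lie group is a connected, simply connected nilpotent Lie group $G$ whose Lie algebra $\mathfrak g$ is nonabelian and has an abelian ideal of codimension one. A discrete subgroup $\Gamma\subset G$ is uniform if $G/\Gamma$ is compact. $\mathfrak g$ is given the rational structure $\mathfrak g_{\mathbb Q}=\mathbb Q\text{-span}\{\log\Gamma\}$; a subspace $\mathfrak h\subset\mathfrak g$ is rational if $\mathfrak h=\mathbb R\text{-span}(\mathfrak h\cap\mathfrak g_{\mathbb Q})$. Fix $M=\exp(\mathfrak m)$, where $\mathfrak m$ is a rational abelian ideal of $\mathfrak g$ of codimension one, and a basis $(X_1,\dots,X_n)$ of $\mathfrak g$ such that: $\mathbb R\text{-span}\{X_1,\dots,X_i\}$ is an ideal for every $i$; $\Gamma=\exp(\mathbb ZX_1)\cdots\exp(\mathbb ZX_n)$; $[\mathfrak g,\mathfrak g]=\mathbb R\text{-span}\{X_1,\dots,X_p\}$ and $\mathfrak m=\mathbb R\text{-span}\{X_1,\dots,X_{n-1}\}$. Let $(X_1^*,\dots,X_n^* )$ be the dual basis of $\mathfrak g^*$, and view $\mathfrak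 m^*\subset\mathfrak g^*$ as the span of $X_1^*,\dots,X_{n-1}^*$. Put $\mathcal V=\mathbb ZX_{p+1}^*+\cdots+\mathbb ZX_n^*$ and $\mathcal W=\{l\in\mathbb ZX_1^*+\cdots+\mathbb ZX_{n-1}^*:\ l|_{[\mathfrak g,\mathfrak g]}\neq0\}$. For $l\in\mathfrak m^*$, $g\in G$ let $\mathrm{Ad}_0^*g\,l=(\mathrm{Ad}^*g\,l)|_{\mathfrak m}$, where $\mathrm{Ad}^*$ is the coadjoint action. The set $\mathcal W$ is invariant under $\mathrm{Ad}^*_0\Gamma$; $\Sigma$ denotes a crosssection (set of representatives) for the $\Gamma$-orbits in $\mathcal W$ under this action. Characters: $\chi_l(\exp X)=e^{2i\pi\langle l,X\rangle}$, for $X\in\mathfrak m$ if $l\in\Sigma$ (a character of $M$), and for $X\in\mathfrak g$ if $l\in\mathcal V$ (a character of $G$). $\tau$ acts on $\mathbf L^2(G/\Gamma)$ (for the $G$-invariant probability measure) by $(\tau(a)f)(g)=f(a^{-1}g)$. $\mathrm{Ind}_M^G\chi_l$ acts by left translations on the completion of the space of continuous $F:G\to\mathbb C$ with compact support modulo $M$ and $F(gm)=\chi_l(m)^{-1}F(g)$, for the $L^2(G/M)$-norm. $\simeq$ denotes unitary equivalence and direct sums are Hilbert direct sums. *)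

theory Defs
  imports "HOL-Analysis.Analysis" "HOL-Algebra.Left_Coset"
begin

section \<open>Smooth maps and Lie groups\<close>

text \<open>Meaningful for open \<open>S\<close> in a finite-dimensional space, where continuity of all
  directional derivatives is continuity of the derivative.\<close>

primrec Ck_on ::
  "nat \<Rightarrow> ('a::real_normed_vector \<Rightarrow> 'b::real_normed_vector) \<Rightarrow> 'a set \<Rightarrow> bool" where
  "Ck_on 0 f S \<longleftrightarrow> continuous_on S f"
| "Ck_on (Suc k) f S \<longleftrightarrow>
     (\<exists>f'. (\<forall>x\<in>S. (f has_derivative f' x) (at x)) \<and> (\<forall>v. Ck_on k (\<lambda>x. f' x v) S))"

definition smooth_on ::
  "('a::real_normed_vector \<Rightarrow> 'b::real_normed_vector) \<Rightarrow> 'a set \<Rightarrow> bool" where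
  "smooth_on f S \<longleftrightarrow> (\<forall>k. Ck_on k f S)"

type_synonym ('g, 'a) chart = "'g set \<times> ('g \<Rightarrow> 'a)"

definition smooth_atlas :: "('g::topological_space, 'a::euclidean_space) chart set \<Rightarrow> bool" where
  "smooth_atlas \<A> \<longleftrightarrow>
     (\<Union>(U, \<phi>)\<in>\<A>. U) = UNIV \<and>
     (\<forall>(U, \<phi>)\<in>\<A>. open U \<and> open (\<phi> ` U) \<and> homeomorphism U (\<phi> ` U) \<phi> (inv_into U \<phi>)) \<and>
     (\<forall>(U, \<phi>)\<in>\<A>. \<forall>(V, \<psi>)\<in>\<A>. smooth_on (\<psi> \<circ> inv_into U \<phi>) (\<phi> ` (U \<inter> V)))"

text \<open>Continuity is required separately; it makes the domains of the coordinate
  expressions open. Second countability is automatic in the connected case.\<close>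

definition lie_group ::
  "'g::t2_space monoid \<Rightarrow> ('g, 'a::euclidean_space) chart set \<Rightarrow> bool" where
  "lie_group G \<A> \<longleftrightarrow>
     group G \<and> carrier G = UNIV \<and> smooth_atlas \<A> \<and>
     continuous_on UNIV (\<lambda>(x, y). x \<otimes>\<^bsub>G\<^esub> y) \<and>
     continuous_on UNIV (\<lambda>x. inv\<^bsub>G\<^esub> x) \<and>
     (\<forall>(U, \<phi>)\<in>\<A>. \<forall>(V, \<psi>)\<in>\<A>. \<forall>(W, \<kappa>)\<in>\<A>.
        smooth_on (\<lambda>(x, y). \<kappa> (inv_into U \<phi> x \<otimes>\<^bsub>G\<^esub> inv_into V \<psi> y))
          {(x, y). x \<in> \<phi> ` U \<and> y \<in> \<psi> ` V \<and> inv_into U \<phi> x \<otimes>\<^bsub>G\<^esub> inv_into V \<psi> y \<in> W}) \<and>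
     (\<forall>(U, \<phi>)\<in>\<A>. \<forall>(V, \<psi>)\<in>\<A>.
        smooth_on (\<lambda>x. \<psi> (inv\<^bsub>G\<^esub> (inv_into U \<phi> x))) {x \<in> \<phi> ` U. inv\<^bsub>G\<^esub> (inv_into U \<phi> x) \<in> V})"

text \<open>The vector space \<open>'a\<close> is identified with the tangent space at the identity through the
  (bijective) differential of \<open>e\<close> at the origin. Under this identification \<open>e\<close> is the
  exponential map: \<open>t \<mapsto> e (t X)\<close> is the one-parameter subgroup with initial velocity \<open>X\<close>.\<close>

definition lie_exponential ::
  "'g::t2_space monoid \<Rightarrow> ('g, 'a::euclidean_space) chart set \<Rightarrow> ('a \<Rightarrow> 'g) \<Rightarrow> bool" where
  "lie_exponential G \<A> e \<longleftrightarrow>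
     (\<forall>X s t. e ((s + t) *\<^sub>R X) = e (s *\<^sub>R X) \<otimes>\<^bsub>G\<^esub> e (t *\<^sub>R X)) \<and>
     continuous_on UNIV e \<and>
     (\<forall>(U, \<phi>)\<in>\<A>. smooth_on (\<phi> \<circ> e) (e -` U)) \<and>
     (\<forall>(U, \<phi>)\<in>\<A>. \<one>\<^bsub>G\<^esub> \<in> U \<longrightarrow> (\<exists>D. ((\<phi> \<circ> e) has_derivative D) (at 0) \<and> bij D))"

text \<open>\<open>Ad g Y\<close> is the generator of the one-parameter subgroup \<open>t \<mapsto> g e(tY) g\<^sup>-\<^sup>1\<close>, and the
  bracket is given by \<open>ad = d(Ad)\<close>.\<close>

definition Ad :: "'g monoid \<Rightarrow> ('a::euclidean_space \<Rightarrow> 'g) \<Rightarrow> 'g \<Rightarrow> 'a \<Rightarrow> 'a" where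
  "Ad G e g Y = (THE Z. \<forall>t. g \<otimes>\<^bsub>G\<^esub> e (t *\<^sub>R Y) \<otimes>\<^bsub>G\<^esub> inv\<^bsub>G\<^esub> g = e (t *\<^sub>R Z))"

definition bracket :: "'g monoid \<Rightarrow> ('a::euclidean_space \<Rightarrow> 'g) \<Rightarrow> 'a \<Rightarrow> 'a \<Rightarrow> 'a" where
  "bracket G e X Y = vector_derivative (\<lambda>t. Ad G e (e (t *\<^sub>R X)) Y) (at 0)"


section \<open>One-parameter metabelian nilpotent Lie groups\<close>

text \<open>In this section \<open>br\<close> is the bracket of a Lie algebra with underlying space \<open>'a\<close>.\<close>

definition bracket_span ::
  "('a::real_vector \<Rightarrow> 'a \<Rightarrow> 'a) \<Rightarrow> 'a set \<Rightarrow> 'a set \<Rightarrow> 'a set" where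
  "bracket_span br A B = span {br x y | x y. x \<in> A \<and> y \<in> B}"

primrec lower_central :: "('a::real_vector \<Rightarrow> 'a \<Rightarrow> 'a) \<Rightarrow> nat \<Rightarrow> 'a set" where
  "lower_central br 0 = UNIV"
| "lower_central br (Suc k) = bracket_span br UNIV (lower_central br k)"

definition nilpotent_lie :: "('a::real_vector \<Rightarrow> 'a \<Rightarrow> 'a) \<Rightarrow> bool" where
  "nilpotent_lie br \<longleftrightarrow> (\<exists>k. lower_central br k = {0})"

definition lie_ideal :: "('a::real_vector \<Rightarrow> 'a \<Rightarrow> 'a) \<Rightarrow> 'a set \<Rightarrow> bool" where
  "lie_ideal br I \<longleftrightarrow> subspace I \<and> (\<forall>x. \<forall>y\<in>I. br x y \<in> I)"

definition abelian_ideal_codim1 :: "('a::euclidean_space \<Rightarrow> 'a \<Rightarrow> 'a) \<Rightarrow> 'a set \<Rightarrow> bool" where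
  "abelian_ideal_codim1 br I \<longleftrightarrow>
     lie_ideal br I \<and> (\<forall>x\<in>I. \<forall>y\<in>I. br x y = 0) \<and> dim I + 1 = DIM('a)"

definition one_parameter_metabelian ::
  "'g::t2_space monoid \<Rightarrow> ('g, 'a::euclidean_space) chart set \<Rightarrow> ('a \<Rightarrow> 'g) \<Rightarrow> bool" where
  "one_parameter_metabelian G \<A> e \<longleftrightarrow>
     lie_group G \<A> \<and> lie_exponential G \<A> e \<and>
     connected (UNIV :: 'g set) \<and> simply_connected (UNIV :: 'g set) \<and>
     nilpotent_lie (bracket G e) \<and>
     (\<exists>X Y. bracket G e X Y \<noteq> 0) \<and>
     (\<exists>I. abelian_ideal_codim1 (bracket G e) I)"


section \<open>Homogeneous spaces\<close>

text \<open>The quotient topology on the space \<open>G/H\<close> of left cosets.\<close>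

definition coset_topology :: "'g::topological_space monoid \<Rightarrow> 'g set \<Rightarrow> 'g set topology" where
  "coset_topology G H =
     topology (\<lambda>W. W \<subseteq> lcosets\<^bsub>G\<^esub> H \<and> open {g \<in> carrier G. g <#\<^bsub>G\<^esub> H \<in> W})"

lemma openin_coset_topology:
  assumes "carrier G = UNIV"
  shows "openin (coset_topology G H) W \<longleftrightarrow>
           W \<subseteq> lcosets\<^bsub>G\<^esub> H \<and> open {g. g <#\<^bsub>G\<^esub> H \<in> W}"
proof -
  have "istopology (\<lambda>W. W \<subseteq> lcosets\<^bsub>G\<^esub> H \<and> open {g. g <#\<^bsub>G\<^esub> H \<in> W})"
    unfolding istopology_def
  proof (intro conjI allI impI)
    fix S T
    assume "S \<subseteq> lcosets\<^bsub>G\<^esub> H \<and> open {g. g <#\<^bsub>G\<^esub> H \<in> S}"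
      and "T \<subseteq> lcosets\<^bsub>G\<^esub> H \<and> open {g. g <#\<^bsub>G\<^esub> H \<in> T}"
    then show "S \<inter> T \<subseteq> lcosets\<^bsub>G\<^esub> H" "open {g. g <#\<^bsub>G\<^esub> H \<in> S \<inter> T}"
      by (auto simp: Collect_conj_eq)
  next
    fix \<K>
    assume *: "\<forall>K\<in>\<K>. K \<subseteq> lcosets\<^bsub>G\<^esub> H \<and> open {g. g <#\<^bsub>G\<^esub> H \<in> K}"
    then show "\<Union>\<K> \<subseteq> lcosets\<^bsub>G\<^esub> H" by blast
    have "{g. g <#\<^bsub>G\<^esub> H \<in> \<Union>\<K>} = (\<Union>K\<in>\<K>. {g. g <#\<^bsub>G\<^esub> H \<in> K})" by blast
    with * show "open {g. g <#\<^bsub>G\<^esub> H \<in> \<Union>\<K>}" by auto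
  qed
  then show ?thesis
    by (simp add: coset_topology_def assms topology_inverse')
qed

definition discrete_uniform_subgroup :: "'g::topological_space monoid \<Rightarrow> 'g set \<Rightarrow> bool" where
  "discrete_uniform_subgroup G \<Gamma> \<longleftrightarrow>
     subgroup \<Gamma> G \<and> discrete \<Gamma> \<and> compact_space (coset_topology G \<Gamma>)"

definition invariant_borel_measure ::
  "'g::topological_space monoid \<Rightarrow> 'g set \<Rightarrow> 'g set measure \<Rightarrow> bool" where
  "invariant_borel_measure G H \<mu> \<longleftrightarrow>
     space \<mu> = lcosets\<^bsub>G\<^esub> H \<and>
     sets \<mu> = sigma_sets (lcosets\<^bsub>G\<^esub> H) {W. openin (coset_topology G H) W} \<and>
     (\<forall>a\<in>carrier G. \<forall>A\<in>sets \<mu>. emeasure \<mu> ((\<lambda>C. a <#\<^bsub>G\<^esub> C) ` A) = emeasure \<mu> A)"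

definition invariant_prob_measure ::
  "'g::topological_space monoid \<Rightarrow> 'g set \<Rightarrow> 'g set measure \<Rightarrow> bool" where
  "invariant_prob_measure G H \<mu> \<longleftrightarrow>
     invariant_borel_measure G H \<mu> \<and> emeasure \<mu> (space \<mu>) = 1"

text \<open>A nonzero invariant measure that is finite on compact sets; for the groups at hand it is
  regular, and it is unique up to a positive factor.\<close>

definition invariant_radon_measure ::
  "'g::topological_space monoid \<Rightarrow> 'g set \<Rightarrow> 'g set measure \<Rightarrow> bool" where
  "invariant_radon_measure G H \<nu> \<longleftrightarrow>
     invariant_borel_measure G H \<nu> \<and> emeasure \<nu> (space \<nu>) \<noteq> 0 \<and>
     (\<forall>K\<in>sets \<nu>. compactin (coset_topology G H) K \<longrightarrow> emeasure \<nu> K < \<infinity>)"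


section \<open>Unitary representations\<close>

text \<open>A Hilbert space is presented by representatives of its vectors (as is usual for \<open>L\<^sup>2\<close>):
  the inner product, linear in the first argument, is only positive semidefinite on \<open>vecs\<close>, and
  vectors at distance zero are to be identified (\<open>rep_eq\<close>).\<close>

record ('g, 'v) rep =
  vecs :: "'v set"
  vadd :: "'v \<Rightarrow> 'v \<Rightarrow> 'v"
  vscale :: "complex \<Rightarrow> 'v \<Rightarrow> 'v"
  vinner :: "'v \<Rightarrow> 'v \<Rightarrow> complex"
  act :: "'g \<Rightarrow> 'v \<Rightarrow> 'v"

definition rep_dist :: "('g, 'v) rep \<Rightarrow> 'v \<Rightarrow> 'v \<Rightarrow> real" where
  "rep_dist R x y =
     (let d = vadd R x (vscale R (-1) y) in sqrt (Re (vinner R d d)))"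

definition rep_eq :: "('g, 'v) rep \<Rightarrow> 'v \<Rightarrow> 'v \<Rightarrow> bool" where
  "rep_eq R x y \<longleftrightarrow> rep_dist R x y = 0"

text \<open>\<open>T\<close> induces a surjective linear isometry between the Hilbert spaces of classes modulo
  \<open>rep_eq\<close>, and intertwines the actions; it respects the classes because it is isometric.\<close>

definition unitarily_equivalent :: "('g, 'v) rep \<Rightarrow> ('g, 'w) rep \<Rightarrow> bool" where
  "unitarily_equivalent R S \<longleftrightarrow>
     (\<exists>T. (\<forall>x\<in>vecs R. T x \<in> vecs S) \<and>
          (\<forall>x\<in>vecs R. \<forall>y\<in>vecs R. rep_eq S (T (vadd R x y)) (vadd S (T x) (T y))) \<and>
          (\<forall>c. \<forall>x\<in>vecs R. rep_eq S (T (vscale R c x)) (vscale S c (T x))) \<and>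
          (\<forall>x\<in>vecs R. \<forall>y\<in>vecs R. vinner S (T x) (T y) = vinner R x y) \<and>
          (\<forall>z\<in>vecs S. \<exists>x\<in>vecs R. rep_eq S (T x) z) \<and>
          (\<forall>a. \<forall>x\<in>vecs R. rep_eq S (T (act R a x)) (act S a (T x))))"

text \<open>The completion: vectors are represented by Cauchy sequences.\<close>

definition hilbert_completion :: "('g, 'v) rep \<Rightarrow> ('g, nat \<Rightarrow> 'v) rep" where
  "hilbert_completion R =
     \<lparr>vecs = {u. (\<forall>n. u n \<in> vecs R) \<and>
                 (\<forall>\<epsilon>>0. \<exists>N. \<forall>m\<ge>N. \<forall>n\<ge>N. rep_dist R (u m) (u n) < \<epsilon>)},
      vadd = (\<lambda>u v n. vadd R (u n) (v n)),
      vscale = (\<lambda>c u n. vscale R c (u n)),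
      vinner = (\<lambda>u v. lim (\<lambda>n. vinner R (u n) (v n))),
      act = (\<lambda>a u n. act R a (u n))\<rparr>"

text \<open>Hilbert direct sums. The values of \<open>x\<close> outside \<open>I\<close> are irrelevant, since they do not
  contribute to the inner product.\<close>

definition hilbert_sum :: "'i set \<Rightarrow> ('i \<Rightarrow> ('g, 'v) rep) \<Rightarrow> ('g, 'i \<Rightarrow> 'v) rep" where
  "hilbert_sum I R =
     \<lparr>vecs = {x. (\<forall>i\<in>I. x i \<in> vecs (R i)) \<and> (\<lambda>i. Re (vinner (R i) (x i) (x i))) summable_on I},
      vadd = (\<lambda>x y i. vadd (R i) (x i) (y i)),
      vscale = (\<lambda>c x i. vscale (R i) c (x i)),
      vinner = (\<lambda>x y. \<Sum>\<^sub>\<infinity>i\<in>I. vinner (R i) (x i) (y i)),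
      act = (\<lambda>a x i. act (R i) a (x i))\<rparr>"

definition hilbert_plus :: "('g, 'v) rep \<Rightarrow> ('g, 'w) rep \<Rightarrow> ('g, 'v \<times> 'w) rep" where
  "hilbert_plus R S =
     \<lparr>vecs = vecs R \<times> vecs S,
      vadd = (\<lambda>(x, y) (x', y'). (vadd R x x', vadd S y y')),
      vscale = (\<lambda>c (x, y). (vscale R c x, vscale S c y)),
      vinner = (\<lambda>(x, y) (x', y'). vinner R x x' + vinner S y y'),
      act = (\<lambda>a (x, y). (act R a x, act S a y))\<rparr>"

definition character_rep :: "('g \<Rightarrow> complex) \<Rightarrow> ('g, complex) rep" where
  "character_rep \<theta> =
     \<lparr>vecs = UNIV, vadd = (+), vscale = (*), vinner = (\<lambda>z w. z * cnj w),
      act = (\<lambda>a z. \<theta> a * z)\<rparr>"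

definition quasi_regular_rep :: "'g monoid \<Rightarrow> 'g set measure \<Rightarrow> ('g, 'g set \<Rightarrow> complex) rep" where
  "quasi_regular_rep G \<mu> =
     \<lparr>vecs = {f. f \<in> borel_measurable \<mu> \<and> integrable \<mu> (\<lambda>C. (cmod (f C))\<^sup>2)},
      vadd = (\<lambda>f f' C. f C + f' C),
      vscale = (\<lambda>c f C. c * f C),
      vinner = (\<lambda>f f'. \<integral>C. f C * cnj (f' C) \<partial>\<mu>),
      act = (\<lambda>a f C. f (inv\<^bsub>G\<^esub> a <#\<^bsub>G\<^esub> C))\<rparr>"

text \<open>For a unitary character \<open>\<theta>\<close> of \<open>H\<close> the product \<open>F * cnj F'\<close> is constant on left cosets of
  \<open>H\<close>, so the choice of a representative below is immaterial.\<close>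

definition induced_pre_rep ::
  "'g::topological_space monoid \<Rightarrow> 'g set \<Rightarrow> ('g \<Rightarrow> complex) \<Rightarrow> 'g set measure
     \<Rightarrow> ('g, 'g \<Rightarrow> complex) rep" where
  "induced_pre_rep G H \<theta> \<nu> =
     \<lparr>vecs = {F. continuous_on UNIV F \<and>
                 (\<exists>K. compactin (coset_topology G H) K \<and> (\<forall>g. F g \<noteq> 0 \<longrightarrow> g <#\<^bsub>G\<^esub> H \<in> K)) \<and>
                 (\<forall>g. \<forall>h\<in>H. F (g \<otimes>\<^bsub>G\<^esub> h) = inverse (\<theta> h) * F g)},
      vadd = (\<lambda>F F' g. F g + F' g),
      vscale = (\<lambda>c F g. c * F g),
      vinner = (\<lambda>F F'. \<integral>C. (let g = (SOME g. g \<in> C) in F g * cnj (F' g)) \<partial>\<nu>),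
      act = (\<lambda>a F g. F (inv\<^bsub>G\<^esub> a \<otimes>\<^bsub>G\<^esub> g))\<rparr>"

definition Ind ::
  "'g::topological_space monoid \<Rightarrow> 'g set \<Rightarrow> ('g \<Rightarrow> complex) \<Rightarrow> 'g set measure
     \<Rightarrow> ('g, nat \<Rightarrow> 'g \<Rightarrow> complex) rep" where
  "Ind G H \<theta> \<nu> = hilbert_completion (induced_pre_rep G H \<theta> \<nu>)"


section \<open>Rational structure, adapted bases and the parameter sets\<close>

text \<open>\<open>e -` \<Gamma>\<close> is \<open>log \<Gamma>\<close>.\<close>

definition rational_structure :: "('a::real_vector \<Rightarrow> 'g) \<Rightarrow> 'g set \<Rightarrow> 'a set" where
  "rational_structure e \<Gamma> = module.span (\<lambda>(q::rat) x. of_rat q *\<^sub>R x) (e -` \<Gamma>)"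

definition rational_subspace :: "('a::real_vector \<Rightarrow> 'g) \<Rightarrow> 'g set \<Rightarrow> 'a set \<Rightarrow> bool" where
  "rational_subspace e \<Gamma> h \<longleftrightarrow> h = span (h \<inter> rational_structure e \<Gamma>)"

text \<open>The ordered product \<open>e(k\<^sub>1 X\<^sub>1) \<cdots> e(k\<^sub>n X\<^sub>n)\<close>.\<close>

definition malcev_product ::
  "'g monoid \<Rightarrow> ('a::real_vector \<Rightarrow> 'g) \<Rightarrow> (nat \<Rightarrow> 'a) \<Rightarrow> nat \<Rightarrow> (nat \<Rightarrow> int) \<Rightarrow> 'g" where
  "malcev_product G e X n k =
     foldr (\<lambda>i g. e (of_int (k i) *\<^sub>R X i) \<otimes>\<^bsub>G\<^esub> g) [1..<Suc n] \<one>\<^bsub>G\<^esub>"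

definition adapted_basis ::
  "'g monoid \<Rightarrow> ('a::euclidean_space \<Rightarrow> 'g) \<Rightarrow> 'g set \<Rightarrow> 'a set \<Rightarrow> nat \<Rightarrow> nat \<Rightarrow> (nat \<Rightarrow> 'a) \<Rightarrow> bool" where
  "adapted_basis G e \<Gamma> \<mm> n p X \<longleftrightarrow>
     inj_on X {1..n} \<and> independent (X ` {1..n}) \<and> span (X ` {1..n}) = UNIV \<and>
     (\<forall>i\<in>{1..n}. lie_ideal (bracket G e) (span (X ` {1..i}))) \<and>
     \<Gamma> = range (malcev_product G e X n) \<and>
     p \<le> n \<and> bracket_span (bracket G e) UNIV UNIV = span (X ` {1..p}) \<and>
     \<mm> = span (X ` {1..n-1})"

definition dual_basis :: "(nat \<Rightarrow> 'a::real_vector) \<Rightarrow> nat \<Rightarrow> nat \<Rightarrow> 'a \<Rightarrow> real" where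
  "dual_basis X n i v = representation (X ` {1..n}) v (X i)"

definition V_set :: "(nat \<Rightarrow> 'a::real_vector) \<Rightarrow> nat \<Rightarrow> nat \<Rightarrow> ('a \<Rightarrow> real) set" where
  "V_set X n p =
     range (\<lambda>(k::nat \<Rightarrow> int) v. \<Sum>i\<in>{p+1..n}. of_int (k i) * dual_basis X n i v)"

definition W_set ::
  "('a::real_vector \<Rightarrow> 'a \<Rightarrow> 'a) \<Rightarrow> (nat \<Rightarrow> 'a) \<Rightarrow> nat \<Rightarrow> ('a \<Rightarrow> real) set" where
  "W_set br X n =
     {l \<in> range (\<lambda>(k::nat \<Rightarrow> int) v. \<Sum>i\<in>{1..n-1}. of_int (k i) * dual_basis X n i v).
        \<exists>x\<in>bracket_span br UNIV UNIV. l x \<noteq> 0}"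

definition coAd :: "'g monoid \<Rightarrow> ('a::euclidean_space \<Rightarrow> 'g) \<Rightarrow> 'g \<Rightarrow> ('a \<Rightarrow> real) \<Rightarrow> 'a \<Rightarrow> real" where
  "coAd G e g l = (\<lambda>v. l (Ad G e (inv\<^bsub>G\<^esub> g) v))"

text \<open>The dual of the ideal spanned by \<open>X\<^sub>1, \<dots>, X\<^sub>n\<^sub>-\<^sub>1\<close> is viewed as the span of the first
  \<open>n - 1\<close> dual basis vectors, so the restriction of a functional to this ideal becomes the
  functional with the same values on \<open>X\<^sub>1, \<dots>, X\<^sub>n\<^sub>-\<^sub>1\<close> that vanishes on \<open>X\<^sub>n\<close>.\<close>

definition restrict_functional ::
  "(nat \<Rightarrow> 'a::real_vector) \<Rightarrow> nat \<Rightarrow> ('a \<Rightarrow> real) \<Rightarrow> 'a \<Rightarrow> real" where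
  "restrict_functional X n l = (\<lambda>v. \<Sum>i\<in>{1..n-1}. l (X i) * dual_basis X n i v)"

definition coAd0 ::
  "'g monoid \<Rightarrow> ('a::euclidean_space \<Rightarrow> 'g) \<Rightarrow> (nat \<Rightarrow> 'a) \<Rightarrow> nat \<Rightarrow> 'g \<Rightarrow> ('a \<Rightarrow> real) \<Rightarrow> 'a \<Rightarrow> real" where
  "coAd0 G e X n g l = restrict_functional X n (coAd G e g l)"

definition cross_section :: "('g \<Rightarrow> 'b \<Rightarrow> 'b) \<Rightarrow> 'g set \<Rightarrow> 'b set \<Rightarrow> 'b set \<Rightarrow> bool" where
  "cross_section \<alpha> \<Gamma> W S \<longleftrightarrow>
     S \<subseteq> W \<and> (\<forall>w\<in>W. \<exists>!s. s \<in> S \<and> s \<in> (\<lambda>\<gamma>. \<alpha> \<gamma> w) ` \<Gamma>)"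

text \<open>\<open>e\<close> is bijective for connected, simply connected nilpotent groups.\<close>

definition character :: "('a \<Rightarrow> 'g) \<Rightarrow> ('a \<Rightarrow> real) \<Rightarrow> 'g \<Rightarrow> complex" where
  "character e l g = exp (2 * \<i> * complex_of_real (pi * l (inv_into UNIV e g)))"

end

theory Submission
  imports Defs
begin

text \<open>Write \<open>T = X\<^sub>n\<close>. Since \<open>G\<close> is simply connected, every \<open>g\<close> is uniquely \<open>e(tT) e(x)\<close> with
  \<open>x \<in> \<mm>\<close>, so that \<open>G\<close> is a semidirect product of \<open>\<real>\<close> and \<open>\<mm>\<close> on which \<open>e(tT)\<close> acts by
  \<open>exp(t ad T)\<close>. For \<open>l \<in> \<Sigma>\<close> and \<open>F\<close> in the space of \<open>Ind \<chi>\<^sub>l\<close>, the sum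
  \<open>\<Sum>\<^sub>k F(g e(kT))\<close> over the integers is right invariant under \<open>\<Gamma>\<close>, because \<open>l\<close> is integral.
  By unfolding, its inner product with the sum for \<open>F'\<close> and \<open>l'\<close> reduces to
  integrals over the line of products of \<open>F\<close> with the translates of \<open>F'\<close>, and the invariant mean
  kills those belonging to different functionals: elements of \<open>\<W>\<close> have trivial stabilizer in
  \<open>exp(\<int>T)\<close>, and distinct elements of \<open>\<Sigma>\<close> have distinct orbits. Together with the characters
  from \<open>\<V>\<close> these sums give an equivariant isometry on a dense subspace of \<open>\<rho>\<close>. Its image is dense:
  continuous functions on \<open>G/\<Gamma>\<close> are, by a partition of unity in \<open>t\<close> and uniform approximation by
  trigonometric polynomials in \<open>x\<close>, limits of such sums over all integral functionals; an integral
  functional outside \<open>\<W>\<close> is fixed by \<open>\<Gamma>\<close> and its sums are approximated by the characters.\<close>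

subsection \<open>Pre-Hilbert spaces given by representatives\<close>

text \<open>The group is given by charts and \<open>e\<close> alone: neither a Campbell-Hausdorff
  formula nor the bijectivity of \<open>e\<close> is assumed. The substitute is that a one-parameter
  subgroup is determined by its velocity. This makes \<open>Ad\<close> linear, nilpotency makes it
  polynomial along a flow, and the group law in semidirect coordinates becomes explicit; simple
  connectedness then enters to show that the covering map \<open>P\<close> has trivial kernel. No
  Haar measure is constructed. Vanishing means come from a symmetry instead of a computation: some
  left translation reverses the sign of the function. The image of \<open>\<nu>\<close> on the line
  is a multiple of Lebesgue measure with an unknown factor, and the constant
  \<open>\<kappa>0\<close> records it. Vectors are representatives of classes, and those of
  \<open>Ind\<close> are Cauchy sequences. The isometry is therefore written down only on a core of
  finitely many constant sequences; its extension to the whole space is abstract and rests on the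
  completeness of both sides.\<close>

locale prehilbert =
  fixes R :: "('g, 'v) rep"
  assumes add_in: "\<And>x y. x \<in> vecs R \<Longrightarrow> y \<in> vecs R \<Longrightarrow> vadd R x y \<in> vecs R"
    and scale_in: "\<And>c x. x \<in> vecs R \<Longrightarrow> vscale R c x \<in> vecs R"
    and inner_add: "\<And>x y z. x \<in> vecs R \<Longrightarrow> y \<in> vecs R \<Longrightarrow> z \<in> vecs R \<Longrightarrow>
        vinner R (vadd R x y) z = vinner R x z + vinner R y z"
    and inner_scale: "\<And>c x z. x \<in> vecs R \<Longrightarrow> z \<in> vecs R \<Longrightarrow>
        vinner R (vscale R c x) z = c * vinner R x z"
    and inner_cnj: "\<And>x y. x \<in> vecs R \<Longrightarrow> y \<in> vecs R \<Longrightarrow> vinner R y x = cnj (vinner R x y)"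
    and inner_ge0: "\<And>x. x \<in> vecs R \<Longrightarrow> 0 \<le> Re (vinner R x x)"
begin

lemma inner_add2:
  "x \<in> vecs R \<Longrightarrow> y \<in> vecs R \<Longrightarrow> z \<in> vecs R \<Longrightarrow>
    vinner R z (vadd R x y) = vinner R z x + vinner R z y"
  by (metis add_in complex_cnj_add inner_add inner_cnj)

lemma inner_scale2:
  "x \<in> vecs R \<Longrightarrow> z \<in> vecs R \<Longrightarrow> vinner R z (vscale R c x) = cnj c * vinner R z x"
  by (metis complex_cnj_mult inner_cnj inner_scale scale_in)

lemma Im_inner_self: "x \<in> vecs R \<Longrightarrow> Im (vinner R x x) = 0"
  using inner_cnj[of x x] by (metis Im_complex_of_real complex_In_mult_cnj_zero Reals_cnj_iff complex_is_Real_iff)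

lemma inner_self: "x \<in> vecs R \<Longrightarrow> vinner R x x = of_real (Re (vinner R x x))"
  by (simp add: Im_inner_self complex_eq_iff)

abbreviation nrm :: "'v \<Rightarrow> real" where "nrm x \<equiv> sqrt (Re (vinner R x x))"
abbreviation sub :: "'v \<Rightarrow> 'v \<Rightarrow> 'v" where "sub x y \<equiv> vadd R x (vscale R (-1) y)"

lemma sub_in: "x \<in> vecs R \<Longrightarrow> y \<in> vecs R \<Longrightarrow> sub x y \<in> vecs R"
  by (simp add: add_in scale_in)

lemma nrm_power2: "x \<in> vecs R \<Longrightarrow> (nrm x)\<^sup>2 = Re (vinner R x x)"
  by (simp add: inner_ge0)

lemma rep_dist_nrm: "rep_dist R x y = nrm (sub x y)"
  by (simp add: rep_dist_def Let_def)

lemmas inner_simps = inner_add inner_add2 inner_scale inner_scale2 add_in scale_in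

lemma dist_power2:
  assumes "x \<in> vecs R" "y \<in> vecs R"
  shows "(rep_dist R x y)\<^sup>2 = Re (vinner R x x) - 2 * Re (vinner R x y) + Re (vinner R y y)"
proof -
  have "(rep_dist R x y)\<^sup>2 = Re (vinner R (sub x y) (sub x y))"
    using assms by (simp add: rep_dist_nrm nrm_power2 sub_in)
  also have "\<dots> = Re (vinner R x x) - Re (vinner R x y) - Re (vinner R y x) + Re (vinner R y y)"
    using assms by (simp add: inner_simps)
  finally show ?thesis using inner_cnj[of x y] assms by simp
qed

lemma dist_ge0: "x \<in> vecs R \<Longrightarrow> y \<in> vecs R \<Longrightarrow> 0 \<le> rep_dist R x y"
  by (simp add: rep_dist_nrm sub_in inner_ge0)

lemma dist_sym: "x \<in> vecs R \<Longrightarrow> y \<in> vecs R \<Longrightarrow> rep_dist R x y = rep_dist R y x"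
proof -
  assume a: "x \<in> vecs R" "y \<in> vecs R"
  have "(rep_dist R x y)\<^sup>2 = (rep_dist R y x)\<^sup>2"
    using a inner_cnj[of x y] by (simp add: dist_power2)
  then show ?thesis using dist_ge0 a by (metis power2_eq_imp_eq)
qed

lemma dist_refl: "x \<in> vecs R \<Longrightarrow> rep_dist R x x = 0"
  using dist_power2[of x x] by simp

lemma cauchy_schwarz:
  assumes x: "x \<in> vecs R" and y: "y \<in> vecs R"
  shows "cmod (vinner R x y) \<le> nrm x * nrm y"
proof -
  define a b c where "a = Re (vinner R x x)" and "b = Re (vinner R y y)" and "c = vinner R x y"
  \<comment> \<open>The multiple \<open>s = t c\<close> carries the phase of \<open>c\<close>, so
    that only a real quadratic in \<open>t\<close> remains.\<close>
  have pos: "0 \<le> a + 2 * t * (cmod c)\<^sup>2 + t\<^sup>2 * (cmod c)\<^sup>2 * b" for t :: real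
  proof -
    define s where "s = of_real t * c"
    have "0 \<le> Re (vinner R (vadd R x (vscale R s y)) (vadd R x (vscale R s y)))"
      using x y by (intro inner_ge0 add_in scale_in)
    also have "\<dots> = a + Re (cnj s * c) + Re (s * cnj c) + Re (s * cnj s * vinner R y y)"
      using x y inner_cnj[of x y] by (simp add: inner_simps a_def c_def algebra_simps)
    also have "Re (s * cnj s * vinner R y y) = (cmod s)\<^sup>2 * b"
      using inner_self[OF y] by (metis b_def complex_norm_square Re_complex_of_real of_real_mult)
    also have "cnj s * c = of_real (t * (cmod c)\<^sup>2)"
      by (simp add: s_def complex_norm_square mult_ac del: of_real_power)
    also have "s * cnj c = of_real (t * (cmod c)\<^sup>2)"
      by (simp add: s_def complex_norm_square mult_ac del: of_real_power)
    also have "(cmod s)\<^sup>2 = t\<^sup>2 * (cmod c)\<^sup>2"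
      by (simp add: s_def norm_mult power_mult_distrib)
    finally show ?thesis by simp
  qed
  have a: "0 \<le> a" and b: "0 \<le> b" using x y by (auto simp: a_def b_def inner_ge0)
  have "(cmod c)\<^sup>2 \<le> a * b"
  proof (cases "cmod c = 0")
    case False
    then have c: "(cmod c)\<^sup>2 > 0" by simp
    show ?thesis
    proof (cases "b = 0")
      case True
      \<comment> \<open>For a null \<open>y\<close> the quadratic is affine in \<open>t\<close>, and
        this \<open>t\<close> gives it the value -1. Otherwise \<open>-1/b\<close> is the
        minimizer.\<close>
      have "0 \<le> a + 2 * (- (a + 1) / (2 * (cmod c)\<^sup>2)) * (cmod c)\<^sup>2"
        using pos[of "- (a + 1) / (2 * (cmod c)\<^sup>2)"] True by simp
      then show ?thesis using c by (simp add: field_simps)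
    next
      case bn: False
      have "0 \<le> a + 2 * (-1/b) * (cmod c)\<^sup>2 + (-1/b)\<^sup>2 * (cmod c)\<^sup>2 * b" by (rule pos)
      also have "\<dots> = a - (cmod c)\<^sup>2 / b" using bn by (simp add: field_simps power2_eq_square)
      finally show ?thesis using bn b by (simp add: field_simps)
    qed
  qed (use a b in simp)
  then have "cmod c \<le> sqrt (a * b)" by (simp add: real_le_rsqrt)
  then show ?thesis by (simp add: a_def b_def c_def real_sqrt_mult)
qed

lemma dist_triangle:
  assumes x: "x \<in> vecs R" and y: "y \<in> vecs R" and z: "z \<in> vecs R"
  shows "rep_dist R x z \<le> rep_dist R x y + rep_dist R y z"
proof -
  define u v where "u = sub x y" and "v = sub y z"
  have uv: "u \<in> vecs R" "v \<in> vecs R" using assms by (auto simp: u_def v_def sub_in)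
  have "(rep_dist R x z)\<^sup>2 = Re (vinner R u u) + 2 * Re (vinner R u v) + Re (vinner R v v)"
    using assms inner_cnj[of x y] inner_cnj[of y z] inner_cnj[of x z]
    by (simp add: dist_power2 u_def v_def inner_simps)
  also have "\<dots> \<le> (nrm u)\<^sup>2 + 2 * (nrm u * nrm v) + (nrm v)\<^sup>2"
    using cauchy_schwarz[OF uv] complex_Re_le_cmod[of "vinner R u v"] uv
    by (simp add: nrm_power2)
  also have "\<dots> = (nrm u + nrm v)\<^sup>2" by (simp add: power2_sum)
  finally have "(rep_dist R x z)\<^sup>2 \<le> (nrm u + nrm v)\<^sup>2" .
  then have "rep_dist R x z \<le> nrm u + nrm v"
    using uv by (meson power2_le_imp_le add_nonneg_nonneg inner_ge0 real_sqrt_ge_zero)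
  then show ?thesis by (simp add: u_def v_def rep_dist_nrm)
qed

lemma inner_diff_le:
  assumes "x \<in> vecs R" "x' \<in> vecs R" "y \<in> vecs R" "y' \<in> vecs R"
  shows "cmod (vinner R x y - vinner R x' y') \<le> rep_dist R x x' * nrm y + nrm x' * rep_dist R y y'"
proof -
  have "vinner R x y - vinner R x' y' = vinner R (sub x x') y + vinner R x' (sub y y')"
    using assms by (simp add: inner_simps)
  also have "cmod \<dots> \<le> cmod (vinner R (sub x x') y) + cmod (vinner R x' (sub y y'))"
    by (rule norm_triangle_ineq)
  also have "\<dots> \<le> rep_dist R x x' * nrm y + nrm x' * rep_dist R y y'"
    unfolding rep_dist_nrm using assms by (intro add_mono cauchy_schwarz sub_in)
  finally show ?thesis .
qed

lemma nrm_diff_le: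
  assumes "x \<in> vecs R" "y \<in> vecs R"
  shows "nrm x \<le> nrm y + rep_dist R x y"
proof -
  \<comment> \<open>The record \<open>rep\<close> names no zero vector. The multiple by 0 serves as
    one: its inner product with every vector vanishes.\<close>
  define z where "z = vscale R 0 x"
  have z: "z \<in> vecs R" using assms by (simp add: z_def scale_in)
  have "rep_dist R w z = nrm w" if "w \<in> vecs R" for w
  proof -
    have "(rep_dist R w z)\<^sup>2 = (nrm w)\<^sup>2"
      using assms that by (simp add: dist_power2 nrm_power2 z_def inner_simps)
    then show ?thesis using dist_ge0[OF that z] by (meson inner_ge0 power2_eq_imp_eq real_sqrt_ge_zero that)
  qed
  then show ?thesis using dist_triangle[of x y z] assms z by auto
qed

lemma inner_tendsto:
  assumes u: "\<And>n. u n \<in> vecs R" and v: "\<And>n. v n \<in> vecs R" and x: "x \<in> vecs R" and y: "y \<in> vecs R"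
    and ux: "(\<lambda>n. rep_dist R (u n) x) \<longlonglongrightarrow> 0" and vy: "(\<lambda>n. rep_dist R (v n) y) \<longlonglongrightarrow> 0"
  shows "(\<lambda>n. vinner R (u n) (v n)) \<longlonglongrightarrow> vinner R x y"
proof -
  have "(\<lambda>n. vinner R (u n) (v n) - vinner R x y) \<longlonglongrightarrow> 0"
  proof (rule tendsto_norm_zero_cancel, rule tendsto_sandwich[of "\<lambda>_. 0"])
    show "\<forall>\<^sub>F n in sequentially. cmod (vinner R (u n) (v n) - vinner R x y)
        \<le> rep_dist R (u n) x * (nrm y + rep_dist R (v n) y) + nrm x * rep_dist R (v n) y"
    proof (intro always_eventually allI)
      fix n
      have "cmod (vinner R (u n) (v n) - vinner R x y)
        \<le> rep_dist R (u n) x * nrm (v n) + nrm x * rep_dist R (v n) y"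
        by (rule inner_diff_le) (use assms in auto)
      also have "\<dots> \<le> rep_dist R (u n) x * (nrm y + rep_dist R (v n) y) + nrm x * rep_dist R (v n) y"
        using nrm_diff_le[OF v y, of n] dist_ge0[OF u x, of n] inner_ge0[OF x]
        by (intro add_mono mult_left_mono) auto
      finally show "cmod (vinner R (u n) (v n) - vinner R x y)
        \<le> rep_dist R (u n) x * (nrm y + rep_dist R (v n) y) + nrm x * rep_dist R (v n) y" .
    qed
    have "(\<lambda>n. rep_dist R (u n) x * (nrm y + rep_dist R (v n) y) + nrm x * rep_dist R (v n) y)
       \<longlonglongrightarrow> 0 * (nrm y + 0) + nrm x * 0"
      by (intro tendsto_intros ux vy)
    then show "(\<lambda>n. rep_dist R (u n) x * (nrm y + rep_dist R (v n) y) + nrm x * rep_dist R (v n) y)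
       \<longlonglongrightarrow> 0" by simp
  qed auto
  then show ?thesis by (simp add: LIM_zero_iff)
qed

text \<open>Expanding the square of the distance leaves 0. In this way linearity and equivariance up
  to \<open>rep_eq\<close> are read off from inner products.\<close>

lemma rep_eqI:
  assumes "x \<in> vecs R" "y \<in> vecs R"
    and "vinner R x x = vinner R x y" "vinner R y y = vinner R x y"
  shows "rep_eq R x y"
  using dist_power2[of x y] assms unfolding rep_eq_def by simp

end

definition rep_cauchy :: "('g, 'v) rep \<Rightarrow> (nat \<Rightarrow> 'v) \<Rightarrow> bool" where
  "rep_cauchy R u \<longleftrightarrow> (\<forall>n. u n \<in> vecs R) \<and>
     (\<forall>\<epsilon>>0. \<exists>N. \<forall>m\<ge>N. \<forall>n\<ge>N. rep_dist R (u m) (u n) < \<epsilon>)"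

definition rep_complete :: "('g, 'v) rep \<Rightarrow> bool" where
  "rep_complete R \<longleftrightarrow>
     (\<forall>u. rep_cauchy R u \<longrightarrow> (\<exists>x\<in>vecs R. (\<lambda>n. rep_dist R (u n) x) \<longlonglongrightarrow> 0))"

lemma (in prehilbert) convergent_rep_cauchy:
  assumes u: "\<And>n. u n \<in> vecs R" and x: "x \<in> vecs R" and ux: "(\<lambda>n. rep_dist R (u n) x) \<longlonglongrightarrow> 0"
  shows "rep_cauchy R u"
  unfolding rep_cauchy_def
proof (intro conjI allI impI u)
  fix \<epsilon> :: real assume "\<epsilon> > 0"
  then obtain N where N: "\<And>n. n \<ge> N \<Longrightarrow> \<bar>rep_dist R (u n) x\<bar> < \<epsilon>/2"
    using ux unfolding LIMSEQ_def dist_real_def by (metis diff_zero half_gt_zero_iff)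
  show "\<exists>N. \<forall>m\<ge>N. \<forall>n\<ge>N. rep_dist R (u m) (u n) < \<epsilon>"
  proof (intro exI allI impI)
    fix m n assume "m \<ge> N" "n \<ge> N"
    then show "rep_dist R (u m) (u n) < \<epsilon>"
      using dist_triangle[OF u x u, of m n] N[of m] N[of n] dist_sym[OF u x, of n] by linarith
  qed
qed

lemma (in prehilbert) convergent_of_dense:
  assumes "D \<subseteq> vecs R" and "x \<in> vecs R"
    and "\<And>\<epsilon>. \<epsilon> > 0 \<Longrightarrow> \<exists>d\<in>D. rep_dist R x d < \<epsilon>"
  obtains d where "\<And>n. d n \<in> D" "(\<lambda>n. rep_dist R (d n) x) \<longlonglongrightarrow> 0"
proof -
  have "\<forall>n. \<exists>d\<in>D. rep_dist R x d < 1 / real (Suc n)" using assms(3) by simp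
  then obtain d where d: "\<And>n. d n \<in> D" "\<And>n. rep_dist R x (d n) < 1 / real (Suc n)" by metis
  have "(\<lambda>n. rep_dist R (d n) x) \<longlonglongrightarrow> 0"
  proof (rule tendsto_sandwich[of "\<lambda>_. 0" _ _ "\<lambda>n. 1 / real (Suc n)"])
    show "\<forall>\<^sub>F n in sequentially. rep_dist R (d n) x \<le> 1 / real (Suc n)"
      using d assms dist_sym by (intro always_eventually) (metis less_imp_le subsetD)
    show "\<forall>\<^sub>F n in sequentially. 0 \<le> rep_dist R (d n) x"
      using d assms dist_ge0 by (intro always_eventually) (metis subsetD)
    show "(\<lambda>n. 1 / real (Suc n)) \<longlonglongrightarrow> 0"
      using LIMSEQ_inverse_real_of_nat by (simp add: inverse_eq_divide)
  qed auto
  with d that show ?thesis by blast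
qed

text \<open>The extension by continuity of an isometry between dense subsets is relational here:
  \<open>K x z\<close> says that some sequence of the core converges to \<open>z\<close> while its image converges to \<open>x\<close>.\<close>

lemma unitarily_equivalent_of_core:
  assumes R: "prehilbert R" and S: "prehilbert S" and Rc: "rep_complete R" and Sc: "rep_complete S"
    and D: "D \<subseteq> vecs S" and U: "\<And>z. z \<in> D \<Longrightarrow> U z \<in> vecs R"
    and iso: "\<And>z w. z \<in> D \<Longrightarrow> w \<in> D \<Longrightarrow> vinner R (U z) (U w) = vinner S z w"
    and dS: "\<And>z \<epsilon>. z \<in> vecs S \<Longrightarrow> \<epsilon> > 0 \<Longrightarrow> \<exists>d\<in>D. rep_dist S z d < \<epsilon>"
    and dR: "\<And>x \<epsilon>. x \<in> vecs R \<Longrightarrow> \<epsilon> > 0 \<Longrightarrow> \<exists>d\<in>D. rep_dist R x (U d) < \<epsilon>"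
    and aD: "\<And>a z. z \<in> D \<Longrightarrow> act S a z \<in> D"
    and eqv: "\<And>a z. z \<in> D \<Longrightarrow> rep_eq R (U (act S a z)) (act R a (U z))"
    and aR: "\<And>a x. x \<in> vecs R \<Longrightarrow> act R a x \<in> vecs R"
    and aS: "\<And>a x. x \<in> vecs S \<Longrightarrow> act S a x \<in> vecs S"
    and uR: "\<And>a x y. x \<in> vecs R \<Longrightarrow> y \<in> vecs R \<Longrightarrow> vinner R (act R a x) (act R a y) = vinner R x y"
    and uS: "\<And>a x y. x \<in> vecs S \<Longrightarrow> y \<in> vecs S \<Longrightarrow> vinner S (act S a x) (act S a y) = vinner S x y"
  shows "unitarily_equivalent R S"
proof -
  interpret R: prehilbert R by fact
  interpret S: prehilbert S by fact
  have Dv: "d \<in> vecs S" if "d \<in> D" for d using that D by auto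
  define K where "K x z \<longleftrightarrow> x \<in> vecs R \<and> z \<in> vecs S \<and>
     (\<exists>d. (\<forall>n::nat. d n \<in> D) \<and> (\<lambda>n. rep_dist R (U (d n)) x) \<longlonglongrightarrow> 0 \<and>
       (\<lambda>n. rep_dist S (d n) z) \<longlonglongrightarrow> 0)" for x z
  \<comment> \<open>Inner products pass to the limit along the approximating sequences. This also
    settles well-definedness: two partners of the same vector have the same inner products, hence
    they are \<open>rep_eq\<close>.\<close>
  have Kiso: "vinner S z z' = vinner R x x'" if k: "K x z" "K x' z'" for x z x' z'
  proof -
    obtain d d' where d: "\<And>n. d n \<in> D" "(\<lambda>n. rep_dist R (U (d n)) x) \<longlonglongrightarrow> 0"
        "(\<lambda>n. rep_dist S (d n) z) \<longlonglongrightarrow> 0"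
      and d': "\<And>n. d' n \<in> D" "(\<lambda>n. rep_dist R (U (d' n)) x') \<longlonglongrightarrow> 0"
        "(\<lambda>n. rep_dist S (d' n) z') \<longlonglongrightarrow> 0"
      using k unfolding K_def by metis
    have "(\<lambda>n. vinner S (d n) (d' n)) \<longlonglongrightarrow> vinner S z z'"
      using k d d' Dv by (intro S.inner_tendsto) (auto simp: K_def)
    moreover have "(\<lambda>n. vinner R (U (d n)) (U (d' n))) \<longlonglongrightarrow> vinner R x x'"
      using k d d' U by (intro R.inner_tendsto) (auto simp: K_def)
    ultimately show ?thesis using iso d d' LIMSEQ_unique by auto
  qed
  have distU: "rep_dist R (U d) (U d') = rep_dist S d d'" if "d \<in> D" "d' \<in> D" for d d'
  proof -
    have "(rep_dist R (U d) (U d'))\<^sup>2 = (rep_dist S d d')\<^sup>2"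
      using that by (simp add: R.dist_power2 S.dist_power2 U Dv iso)
    then show ?thesis using that U Dv R.dist_ge0 S.dist_ge0 by (meson power2_eq_imp_eq)
  qed
  have cauchyU: "rep_cauchy R (\<lambda>n. U (d n)) \<longleftrightarrow> rep_cauchy S d" if "\<And>n. d n \<in> D" for d
    unfolding rep_cauchy_def using that distU U Dv by simp
  have Kex: "\<exists>z. K x z" if x: "x \<in> vecs R" for x
  proof -
    have "\<And>\<epsilon>. \<epsilon> > 0 \<Longrightarrow> \<exists>d\<in>U ` D. rep_dist R x d < \<epsilon>" using dR[OF x] by blast
    then obtain c where c: "\<And>n. c n \<in> U ` D" "(\<lambda>n. rep_dist R (c n) x) \<longlonglongrightarrow> 0"
      using R.convergent_of_dense[of "U ` D" x] x U by blast
    from c(1) have "\<forall>n. \<exists>d\<in>D. c n = U d" by blast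
    then obtain d where d: "\<And>n. d n \<in> D" "\<And>n. c n = U (d n)" by metis
    have "rep_cauchy R (\<lambda>n. U (d n))"
      using R.convergent_rep_cauchy[of "\<lambda>n. U (d n)" x] d c x U by auto
    then have "rep_cauchy S d" using cauchyU d by blast
    then obtain z where "z \<in> vecs S" "(\<lambda>n. rep_dist S (d n) z) \<longlonglongrightarrow> 0"
      using Sc unfolding rep_complete_def by blast
    then show ?thesis using d c x unfolding K_def by auto
  qed
  have Kex2: "\<exists>x. K x z" if z: "z \<in> vecs S" for z
  proof -
    obtain d where d: "\<And>n. d n \<in> D" "(\<lambda>n. rep_dist S (d n) z) \<longlonglongrightarrow> 0"
      using S.convergent_of_dense[OF D z dS[OF z]] by blast
    have "rep_cauchy S d" using S.convergent_rep_cauchy[of d z] d z Dv by auto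
    then have "rep_cauchy R (\<lambda>n. U (d n))" using cauchyU d by blast
    then obtain x where "x \<in> vecs R" "(\<lambda>n. rep_dist R (U (d n)) x) \<longlonglongrightarrow> 0"
      using Rc unfolding rep_complete_def by blast
    then show ?thesis using d z unfolding K_def by auto
  qed
  \<comment> \<open>Any choice is good, because all partners of a vector are \<open>rep_eq\<close>;
    the algebraic laws for \<open>T\<close> accordingly hold up to \<open>rep_eq\<close>.\<close>
  define T where "T x = (SOME z. K x z)" for x
  have KT: "K x (T x)" if "x \<in> vecs R" for x
    unfolding T_def using Kex[OF that] by (rule someI_ex)
  have Tv: "T x \<in> vecs S" if "x \<in> vecs R" for x using KT[OF that] by (simp add: K_def)
  have Tiso: "vinner S (T x) (T y) = vinner R x y" if "x \<in> vecs R" "y \<in> vecs R" for x y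
    using Kiso KT that by blast
  show ?thesis
    unfolding unitarily_equivalent_def
  proof (intro exI[of _ T] conjI ballI allI)
    fix x y assume xy: "x \<in> vecs R" "y \<in> vecs R"
    show "rep_eq S (T (vadd R x y)) (vadd S (T x) (T y))"
      by (rule S.rep_eqI)
        (use xy in \<open>auto simp: Tv Tiso R.inner_simps S.inner_simps\<close>)
  next
    fix c x assume x: "x \<in> vecs R"
    show "rep_eq S (T (vscale R c x)) (vscale S c (T x))"
      by (rule S.rep_eqI)
        (use x in \<open>auto simp: Tv Tiso R.inner_simps S.inner_simps\<close>)
  next
    fix z assume z: "z \<in> vecs S"
    then obtain x where x: "K x z" using Kex2 by blast
    then have xv: "x \<in> vecs R" by (simp add: K_def)
    show "\<exists>x\<in>vecs R. rep_eq S (T x) z"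
      by (rule bexI[OF _ xv], rule S.rep_eqI)
        (use x xv z KT[OF xv] Kiso in \<open>auto simp: Tv\<close>)
  next
    fix a x assume x: "x \<in> vecs R"
    from KT[OF x] obtain d where d: "\<And>n. d n \<in> D" "(\<lambda>n. rep_dist R (U (d n)) x) \<longlonglongrightarrow> 0"
        "(\<lambda>n. rep_dist S (d n) (T x)) \<longlonglongrightarrow> 0"
      unfolding K_def by metis
    have distS: "rep_dist S (act S a y) (act S a z) = rep_dist S y z"
      if "y \<in> vecs S" "z \<in> vecs S" for y z
    proof -
      have "(rep_dist S (act S a y) (act S a z))\<^sup>2 = (rep_dist S y z)\<^sup>2"
        using that by (simp add: S.dist_power2 uS aS)
      then show ?thesis using that aS S.dist_ge0 by (meson power2_eq_imp_eq)
    qed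
    have distR: "rep_dist R (act R a y) (act R a z) = rep_dist R y z"
      if "y \<in> vecs R" "z \<in> vecs R" for y z
    proof -
      have "(rep_dist R (act R a y) (act R a z))\<^sup>2 = (rep_dist R y z)\<^sup>2"
        using that by (simp add: R.dist_power2 uR aR)
      then show ?thesis using that aR R.dist_ge0 by (meson power2_eq_imp_eq)
    qed
    have "rep_dist R (U (act S a (d n))) (act R a x) = rep_dist R (U (d n)) x" for n
    proof -
      have v: "U (act S a (d n)) \<in> vecs R" "act R a (U (d n)) \<in> vecs R" "act R a x \<in> vecs R"
        using d x by (auto simp: U aD aR)
      have z: "rep_dist R (U (act S a (d n))) (act R a (U (d n))) = 0"
        using eqv[OF d(1)] by (simp add: rep_eq_def)
      have "rep_dist R (U (act S a (d n))) (act R a x) = rep_dist R (act R a (U (d n))) (act R a x)"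
        using R.dist_triangle[OF v] R.dist_triangle[OF v(2,1,3)] z R.dist_sym[OF v(1,2)] by linarith
      also have "\<dots> = rep_dist R (U (d n)) x" using d x U distR by simp
      finally show ?thesis .
    qed
    then have "K (act R a x) (act S a (T x))"
      unfolding K_def using d x
      by (auto simp: aR aS Tv aD Dv distS intro!: exI[of _ "\<lambda>n. act S a (d n)"])
    then show "rep_eq S (T (act R a x)) (act S a (T x))"
      by (intro S.rep_eqI) (use KT[OF aR[OF x], of a] in \<open>simp_all add: Tv aS aR x Kiso[of "act R a x" _ "act R a x"]\<close>)
  qed (use Tv Tiso in auto)
qed

definition unitary_rep :: "('g, 'v) rep \<Rightarrow> bool" where
  "unitary_rep R \<longleftrightarrow> prehilbert R \<and>
     (\<forall>a. \<forall>x\<in>vecs R. act R a x \<in> vecs R) \<and>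
     (\<forall>a. \<forall>x\<in>vecs R. \<forall>y\<in>vecs R. vinner R (act R a x) (act R a y) = vinner R x y)"

subsection \<open>Completions\<close>

lemma rep_cauchy_completion: "vecs (hilbert_completion R) = {u. rep_cauchy R u}"
  by (auto simp: hilbert_completion_def rep_cauchy_def)

context prehilbert begin

abbreviation "C \<equiv> hilbert_completion R"

lemma rep_cauchy_bounded:
  assumes u: "rep_cauchy R u" obtains B where "\<And>n. nrm (u n) \<le> B"
proof -
  have uv: "u n \<in> vecs R" for n using u by (simp add: rep_cauchy_def)
  obtain N where N: "\<And>m n. m \<ge> N \<Longrightarrow> n \<ge> N \<Longrightarrow> rep_dist R (u m) (u n) < 1"
    using u unfolding rep_cauchy_def by (metis zero_less_one)
  define B where "B = Max ((\<lambda>n. nrm (u n)) ` {..N}) + 1"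
  have "nrm (u n) \<le> B" for n
  proof (cases "n \<le> N")
    case True
    then have "nrm (u n) \<le> Max ((\<lambda>n. nrm (u n)) ` {..N})" by (intro Max_ge) auto
    then show ?thesis by (simp add: B_def)
  next
    case False
    have "nrm (u n) \<le> nrm (u N) + rep_dist R (u n) (u N)" by (intro nrm_diff_le uv)
    also have "\<dots> \<le> Max ((\<lambda>n. nrm (u n)) ` {..N}) + 1"
      using N[of n N] False by (intro add_mono Max_ge) auto
    finally show ?thesis by (simp add: B_def)
  qed
  then show ?thesis using that by blast
qed

text \<open>The completion defines its inner product by \<open>lim\<close>, which is meaningful only
  for convergent sequences. Convergence follows from \<open>inner_diff_le\<close>, as Cauchy
  sequences are bounded in norm.\<close>

lemma inner_rep_cauchy_convergent:
  assumes u: "rep_cauchy R u" and v: "rep_cauchy R v"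
  shows "convergent (\<lambda>n. vinner R (u n) (v n))"
proof -
  have uv: "u n \<in> vecs R" "v n \<in> vecs R" for n using u v by (auto simp: rep_cauchy_def)
  obtain B1 where B1: "\<And>n. nrm (u n) \<le> B1" using rep_cauchy_bounded[OF u] by blast
  obtain B2 where B2: "\<And>n. nrm (v n) \<le> B2" using rep_cauchy_bounded[OF v] by blast
  define B where "B = max B1 B2 + 1"
  have "0 \<le> nrm (u 0)" using uv inner_ge0 by simp
  then have B: "nrm (u n) \<le> B" "nrm (v n) \<le> B" "B > 0" for n
    using B1[of n] B2[of n] B1[of 0] unfolding B_def by linarith+
  have "Cauchy (\<lambda>n. vinner R (u n) (v n))"
  proof (rule metric_CauchyI)
    fix e :: real assume e: "e > 0"
    then have e': "e / (2 * B) > 0" using B by simp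
    obtain N1 where N1: "\<And>m n. m \<ge> N1 \<Longrightarrow> n \<ge> N1 \<Longrightarrow> rep_dist R (u m) (u n) < e / (2 * B)"
      using u e' unfolding rep_cauchy_def by metis
    obtain N2 where N2: "\<And>m n. m \<ge> N2 \<Longrightarrow> n \<ge> N2 \<Longrightarrow> rep_dist R (v m) (v n) < e / (2 * B)"
      using v e' unfolding rep_cauchy_def by metis
    show "\<exists>M. \<forall>m\<ge>M. \<forall>n\<ge>M. dist (vinner R (u m) (v m)) (vinner R (u n) (v n)) < e"
    proof (intro exI[of _ "max N1 N2"] allI impI)
      fix m n assume mn: "m \<ge> max N1 N2" "n \<ge> max N1 N2"
      have "cmod (vinner R (u m) (v m) - vinner R (u n) (v n))
          \<le> rep_dist R (u m) (u n) * nrm (v m) + nrm (u n) * rep_dist R (v m) (v n)"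
        by (rule inner_diff_le) (use uv in auto)
      also have "\<dots> \<le> rep_dist R (u m) (u n) * B + B * rep_dist R (v m) (v n)"
        using B uv dist_ge0 inner_ge0 by (intro add_mono mult_left_mono mult_right_mono) auto
      also have "\<dots> < e / (2 * B) * B + B * (e / (2 * B))"
        using N1[of m n] N2[of m n] mn B(3)
        by (intro add_strict_mono mult_strict_right_mono mult_strict_left_mono) auto
      also have "\<dots> = e" using B(3) by (simp add: field_simps)
      finally show "dist (vinner R (u m) (v m)) (vinner R (u n) (v n)) < e" by (simp add: dist_norm)
    qed
  qed
  then show ?thesis by (simp add: Cauchy_convergent_iff)
qed

lemma inner_completion:
  assumes "rep_cauchy R u" "rep_cauchy R v"
  shows "(\<lambda>n. vinner R (u n) (v n)) \<longlonglongrightarrow> vinner C u v"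
  using inner_rep_cauchy_convergent[OF assms] by (simp add: hilbert_completion_def convergent_LIMSEQ_iff)

lemma dist_add:
  assumes "x \<in> vecs R" "y \<in> vecs R" "x' \<in> vecs R" "y' \<in> vecs R"
  shows "rep_dist R (vadd R x y) (vadd R x' y') \<le> rep_dist R x x' + rep_dist R y y'"
proof -
  let ?u = "sub x x'" and ?v = "sub y y'"
  have v: "?u \<in> vecs R" "?v \<in> vecs R" using assms by (auto intro: sub_in)
  have "(rep_dist R (vadd R x y) (vadd R x' y'))\<^sup>2
      = Re (vinner R ?u ?u) + 2 * Re (vinner R ?u ?v) + Re (vinner R ?v ?v)"
    using assms inner_cnj[of x y] inner_cnj[of x y'] inner_cnj[of x' y] inner_cnj[of x' y']
      inner_cnj[of x x'] inner_cnj[of y y']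
    by (simp add: dist_power2 inner_simps)
  also have "\<dots> \<le> (nrm ?u)\<^sup>2 + 2 * (nrm ?u * nrm ?v) + (nrm ?v)\<^sup>2"
    using cauchy_schwarz[OF v] complex_Re_le_cmod[of "vinner R ?u ?v"] v
    by (simp add: nrm_power2)
  also have "\<dots> = (nrm ?u + nrm ?v)\<^sup>2" by (simp add: power2_sum)
  finally have "rep_dist R (vadd R x y) (vadd R x' y') \<le> nrm ?u + nrm ?v"
    using v by (meson power2_le_imp_le add_nonneg_nonneg inner_ge0 real_sqrt_ge_zero)
  then show ?thesis by (simp add: rep_dist_nrm)
qed

lemma dist_scale:
  assumes "x \<in> vecs R" "x' \<in> vecs R"
  shows "rep_dist R (vscale R c x) (vscale R c x') = cmod c * rep_dist R x x'"
proof -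
  have c: "c * (cnj c * z) = of_real ((cmod c)\<^sup>2) * z" for z
    by (simp only: mult.assoc[symmetric] complex_norm_square)
  have "(rep_dist R (vscale R c x) (vscale R c x'))\<^sup>2 = (cmod c * rep_dist R x x')\<^sup>2"
    using assms by (simp add: dist_power2 power_mult_distrib inner_simps c algebra_simps
      del: of_real_power)
  then show ?thesis
    using assms by (meson dist_ge0 mult_nonneg_nonneg norm_ge_zero power2_eq_imp_eq scale_in)
qed

lemma rep_cauchy_add:
  assumes u: "rep_cauchy R u" and v: "rep_cauchy R v"
  shows "rep_cauchy R (\<lambda>n. vadd R (u n) (v n))"
  unfolding rep_cauchy_def
proof (intro conjI allI impI)
  have uv: "u n \<in> vecs R" "v n \<in> vecs R" for n using u v by (auto simp: rep_cauchy_def)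
  then show "vadd R (u n) (v n) \<in> vecs R" for n by (simp add: add_in)
  fix e :: real assume e: "e > 0"
  obtain N1 where N1: "\<And>m n. m \<ge> N1 \<Longrightarrow> n \<ge> N1 \<Longrightarrow> rep_dist R (u m) (u n) < e / 2"
    using u e unfolding rep_cauchy_def by (metis half_gt_zero)
  obtain N2 where N2: "\<And>m n. m \<ge> N2 \<Longrightarrow> n \<ge> N2 \<Longrightarrow> rep_dist R (v m) (v n) < e / 2"
    using v e unfolding rep_cauchy_def by (metis half_gt_zero)
  show "\<exists>N. \<forall>m\<ge>N. \<forall>n\<ge>N. rep_dist R (vadd R (u m) (v m)) (vadd R (u n) (v n)) < e"
  proof (intro exI[of _ "max N1 N2"] allI impI)
    fix m n assume "m \<ge> max N1 N2" "n \<ge> max N1 N2"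
    then show "rep_dist R (vadd R (u m) (v m)) (vadd R (u n) (v n)) < e"
      using dist_add[of "u m" "v m" "u n" "v n"] uv N1[of m n] N2[of m n] by force
  qed
qed

lemma rep_cauchy_scale:
  assumes u: "rep_cauchy R u" shows "rep_cauchy R (\<lambda>n. vscale R c (u n))"
  unfolding rep_cauchy_def
proof (intro conjI allI impI)
  have uv: "u n \<in> vecs R" for n using u by (auto simp: rep_cauchy_def)
  then show "vscale R c (u n) \<in> vecs R" for n by (simp add: scale_in)
  fix e :: real assume e: "e > 0"
  have c: "cmod c + 1 > 0" by (simp add: add_nonneg_pos)
  then have "e / (cmod c + 1) > 0" using e by simp
  then obtain N where N: "\<And>m n. m \<ge> N \<Longrightarrow> n \<ge> N \<Longrightarrow> rep_dist R (u m) (u n) < e / (cmod c + 1)"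
    using u unfolding rep_cauchy_def by metis
  show "\<exists>N. \<forall>m\<ge>N. \<forall>n\<ge>N. rep_dist R (vscale R c (u m)) (vscale R c (u n)) < e"
  proof (intro exI[of _ N] allI impI)
    fix m n assume mn: "m \<ge> N" "n \<ge> N"
    have "cmod c * rep_dist R (u m) (u n) \<le> (cmod c + 1) * rep_dist R (u m) (u n)"
      using dist_ge0 uv by (intro mult_right_mono) auto
    also have "\<dots> < e" using N[OF mn] c by (simp add: field_simps)
    finally show "rep_dist R (vscale R c (u m)) (vscale R c (u n)) < e"
      using uv by (simp add: dist_scale)
  qed
qed

lemma rep_cauchy_const: "x \<in> vecs R \<Longrightarrow> rep_cauchy R (\<lambda>_. x)"
  by (auto simp: rep_cauchy_def dist_refl)

lemma completion_simps:
  "vadd C u v n = vadd R (u n) (v n)" "vscale C c u n = vscale R c (u n)" "act C a u n = act R a (u n)"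
  by (simp_all add: hilbert_completion_def)

lemma prehilbert_completion: "prehilbert C"
proof
  fix x y z :: "nat \<Rightarrow> 'v" and c :: complex
  assume "x \<in> vecs C" then have x: "rep_cauchy R x" by (simp add: rep_cauchy_completion)
  then have xv: "x n \<in> vecs R" for n by (auto simp: rep_cauchy_def)
  show "vscale C c x \<in> vecs C"
  proof -
    have "vscale C c x = (\<lambda>n. vscale R c (x n))" by (simp add: hilbert_completion_def)
    then show ?thesis using rep_cauchy_scale[OF x] by (simp add: rep_cauchy_completion)
  qed
  show "0 \<le> Re (vinner C x x)"
    using tendsto_Re[OF inner_completion[OF x x]] xv inner_ge0 by (intro LIMSEQ_le_const) auto
  { assume "y \<in> vecs C" then have y: "rep_cauchy R y" by (simp add: rep_cauchy_completion)
    then have yv: "y n \<in> vecs R" for n by (auto simp: rep_cauchy_def)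
    show *: "vadd C x y \<in> vecs C"
    proof -
      have "vadd C x y = (\<lambda>n. vadd R (x n) (y n))" by (simp add: hilbert_completion_def)
      then show ?thesis using rep_cauchy_add[OF x y] by (simp add: rep_cauchy_completion)
    qed
    show "vinner C y x = cnj (vinner C x y)"
    proof -
      have "(\<lambda>n. vinner R (y n) (x n)) \<longlonglongrightarrow> cnj (vinner C x y)"
        using tendsto_cnj[OF inner_completion[OF x y]] xv yv inner_cnj[OF xv yv] by simp
      then show ?thesis using inner_completion[OF y x] LIMSEQ_unique by blast
    qed
    { assume "z \<in> vecs C" then have z: "rep_cauchy R z" by (simp add: rep_cauchy_completion)
      then have zv: "z n \<in> vecs R" for n by (auto simp: rep_cauchy_def)
      have a: "rep_cauchy R (vadd C x y)" using * by (simp add: rep_cauchy_completion)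
      have "(\<lambda>n. vinner R (vadd C x y n) (z n)) \<longlonglongrightarrow> vinner C x z + vinner C y z"
        using tendsto_add[OF inner_completion[OF x z] inner_completion[OF y z]] xv yv zv
        by (simp add: completion_simps inner_add)
      then show "vinner C (vadd C x y) z = vinner C x z + vinner C y z"
        using inner_completion[OF a z] LIMSEQ_unique by blast }
  }
  { assume "z \<in> vecs C" then have z: "rep_cauchy R z" by (simp add: rep_cauchy_completion)
      then have zv: "z n \<in> vecs R" for n by (auto simp: rep_cauchy_def)
      have a: "rep_cauchy R (vscale C c x)"
        using rep_cauchy_scale[OF x] by (simp add: hilbert_completion_def)
      have "(\<lambda>n. vinner R (vscale C c x n) (z n)) \<longlonglongrightarrow> c * vinner C x z"
        using tendsto_mult_left[OF inner_completion[OF x z], of c] xv zv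
        by (simp add: completion_simps inner_scale)
      then show "vinner C (vscale C c x) z = c * vinner C x z"
        using inner_completion[OF a z] LIMSEQ_unique by blast }
qed

lemma dist_completion:
  assumes u: "rep_cauchy R u" and v: "rep_cauchy R v"
  shows "(\<lambda>n. rep_dist R (u n) (v n)) \<longlonglongrightarrow> rep_dist C u v"
proof -
  define d where "d n = sub (u n) (v n)" for n
  have d: "rep_cauchy R d" unfolding d_def using u v by (intro rep_cauchy_add rep_cauchy_scale)
  have "vadd C u (vscale C (-1) v) = d" by (simp add: fun_eq_iff d_def completion_simps)
  then show ?thesis
    using tendsto_real_sqrt[OF tendsto_Re[OF inner_completion[OF d d]]]
    by (simp add: rep_dist_def Let_def d_def)
qed

text \<open>Constant sequences represent the original space inside the completion. The bound is kept
  for all late indices, not just for one, because the proof of completeness uses it in that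
  form.\<close>

lemma completion_dense:
  assumes u: "u \<in> vecs C" and e: "\<epsilon> > 0"
  shows "\<exists>n. \<forall>m\<ge>n. rep_dist C u (\<lambda>_. u m) < \<epsilon>"
proof -
  have u: "rep_cauchy R u" using u by (simp add: rep_cauchy_completion)
  then have uv: "u n \<in> vecs R" for n by (auto simp: rep_cauchy_def)
  obtain N where N: "\<And>m n. m \<ge> N \<Longrightarrow> n \<ge> N \<Longrightarrow> rep_dist R (u m) (u n) < \<epsilon> / 2"
    using u e unfolding rep_cauchy_def by (metis half_gt_zero)
  show ?thesis
  proof (intro exI[of _ N] allI impI)
    fix m assume m: "m \<ge> N"
    have "rep_dist C u (\<lambda>_. u m) \<le> \<epsilon> / 2"
      by (rule LIMSEQ_le_const2[OF dist_completion[OF u rep_cauchy_const[OF uv]]])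
        (use N m in \<open>auto intro!: exI[of _ N] less_imp_le\<close>)
    then show "rep_dist C u (\<lambda>_. u m) < \<epsilon>" using e by simp
  qed
qed

text \<open>Diagonal argument: the k-th member is replaced by one of its terms \<open>w k\<close> at
  distance below \<open>1 / real (Suc k)\<close>. The sequence \<open>w\<close> is Cauchy in the
  original space and is itself the limit.\<close>

lemma complete_completion: "rep_complete C"
  unfolding rep_complete_def
proof (intro allI impI)
  interpret C: prehilbert C by (rule prehilbert_completion)
  fix U assume U: "rep_cauchy C U"
  then have Uv: "U k \<in> vecs C" for k by (simp add: rep_cauchy_def)
  have "\<exists>m. rep_dist C (U k) (\<lambda>_. U k m) < 1 / real (Suc k)" for k
    using completion_dense[OF Uv[of k], of "1 / real (Suc k)"] by auto
  then obtain m where m: "\<And>k. rep_dist C (U k) (\<lambda>_. U k (m k)) < 1 / real (Suc k)" by metis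
  define w where "w k = U k (m k)" for k
  have wv: "w k \<in> vecs R" for k using Uv[of k] by (simp add: rep_cauchy_completion rep_cauchy_def w_def)
  have cw: "(\<lambda>_. w k) \<in> vecs C" for k using rep_cauchy_const[OF wv] by (simp add: rep_cauchy_completion)
  have dw: "rep_dist R (w j) (w k) = rep_dist C (\<lambda>_. w j) (\<lambda>_. w k)" for j k
    using dist_completion[OF rep_cauchy_const[OF wv] rep_cauchy_const[OF wv]]
    by (simp add: LIMSEQ_const_iff)
  have w: "rep_cauchy R w"
    unfolding rep_cauchy_def
  proof (intro conjI allI impI wv)
    fix e :: real assume e: "e > 0"
    obtain N where N: "\<And>m n. m \<ge> N \<Longrightarrow> n \<ge> N \<Longrightarrow> rep_dist C (U m) (U n) < e / 3"
      using U e unfolding rep_cauchy_def by (metis zero_less_divide_iff zero_less_numeral)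
    obtain K where K: "1 / real (Suc K) < e / 3" using e nat_approx_posE[of "e/3"] by auto
    show "\<exists>N. \<forall>m\<ge>N. \<forall>n\<ge>N. rep_dist R (w m) (w n) < e"
    proof (intro exI[of _ "max N K"] allI impI)
      fix i j assume ij: "i \<ge> max N K" "j \<ge> max N K"
      have "1 / real (Suc i) \<le> 1 / real (Suc K)" "1 / real (Suc j) \<le> 1 / real (Suc K)"
        using ij by (auto intro!: divide_left_mono)
      then have 1: "rep_dist C (U i) (\<lambda>_. w i) < e/3" "rep_dist C (U j) (\<lambda>_. w j) < e/3"
        using m[of i] m[of j] K by (auto simp: w_def)
      have 2: "rep_dist C (\<lambda>_. w i) (U i) < e/3" using 1 C.dist_sym Uv cw by metis
      have "rep_dist C (\<lambda>_. w i) (\<lambda>_. w j) \<le> rep_dist C (\<lambda>_. w i) (U i) + rep_dist C (U i) (\<lambda>_. w j)"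
        by (intro C.dist_triangle cw Uv)
      also have "rep_dist C (U i) (\<lambda>_. w j) \<le> rep_dist C (U i) (U j) + rep_dist C (U j) (\<lambda>_. w j)"
        by (intro C.dist_triangle cw Uv)
      finally show "rep_dist R (w i) (w j) < e" unfolding dw using 1 2 N[of i j] ij by auto
    qed
  qed
  have wC: "w \<in> vecs C" using w by (simp add: rep_cauchy_completion)
  have "(\<lambda>k. rep_dist C (U k) w) \<longlonglongrightarrow> 0"
  proof (rule LIMSEQ_I)
    fix e :: real assume e: "e > 0"
    obtain N where N: "\<forall>k\<ge>N. rep_dist C w (\<lambda>_. w k) < e/2"
      using completion_dense[OF wC, of "e/2"] e by auto
    obtain K where K: "1 / real (Suc K) < e / 2" using e nat_approx_posE[of "e/2"] by auto
    show "\<exists>no. \<forall>n\<ge>no. norm (rep_dist C (U n) w - 0) < e"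
    proof (intro exI[of _ "max N K"] allI impI)
      fix k assume k: "k \<ge> max N K"
      have "1 / real (Suc k) \<le> 1 / real (Suc K)" using k by (auto intro!: divide_left_mono)
      then have "rep_dist C (U k) (\<lambda>_. w k) < e/2" using m[of k] K by (auto simp: w_def)
      moreover have "rep_dist C (\<lambda>_. w k) w < e/2" using N k C.dist_sym[OF wC cw] by (metis max.boundedE)
      ultimately show "norm (rep_dist C (U k) w - 0) < e"
        using C.dist_triangle[OF Uv[of k] cw[of k] wC] C.dist_ge0[OF Uv[of k] wC] by auto
    qed
  qed
  then show "\<exists>x\<in>vecs C. (\<lambda>n. rep_dist C (U n) x) \<longlonglongrightarrow> 0" using wC by blast
qed

end

lemma unitary_completion:
  assumes "unitary_rep R" shows "unitary_rep (hilbert_completion R)"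
proof -
  interpret prehilbert R using assms by (simp add: unitary_rep_def)
  have ac: "rep_cauchy R (\<lambda>n. act R a (u n))" if u: "rep_cauchy R u" for a u
  proof -
    have v: "u n \<in> vecs R" "act R a (u n) \<in> vecs R" for n
      using u assms by (auto simp: rep_cauchy_def unitary_rep_def)
    have "rep_dist R (act R a (u m)) (act R a (u n)) = rep_dist R (u m) (u n)" for m n
    proof -
      have "(rep_dist R (act R a (u m)) (act R a (u n)))\<^sup>2 = (rep_dist R (u m) (u n))\<^sup>2"
        using v assms by (simp add: dist_power2 unitary_rep_def)
      then show ?thesis using v dist_ge0 by (meson power2_eq_imp_eq)
    qed
    then show ?thesis using u v by (simp add: rep_cauchy_def)
  qed
  show ?thesis
    unfolding unitary_rep_def
  proof (intro conjI allI ballI prehilbert_completion)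
    fix a x assume "x \<in> vecs C"
    then have x: "rep_cauchy R x" by (simp add: rep_cauchy_completion)
    have "act C a x = (\<lambda>n. act R a (x n))" by (simp add: hilbert_completion_def)
    then show "act C a x \<in> vecs C" using ac[OF x] by (simp add: rep_cauchy_completion)
    fix y assume "y \<in> vecs C"
    then have y: "rep_cauchy R y" by (simp add: rep_cauchy_completion)
    have "x n \<in> vecs R" "y n \<in> vecs R" for n using x y by (auto simp: rep_cauchy_def)
    then show "vinner C (act C a x) (act C a y) = vinner C x y"
      using assms by (simp add: hilbert_completion_def unitary_rep_def)
  qed
qed

lemma unitary_prehilbert: "unitary_rep R \<Longrightarrow> prehilbert R"
  by (simp add: unitary_rep_def)

subsection \<open>Direct sums\<close>

locale hilbert_family =
  fixes I :: "'i set" and S :: "'i \<Rightarrow> ('g, 'v) rep"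
  assumes family: "\<And>i. i \<in> I \<Longrightarrow> prehilbert (S i)"
begin

abbreviation "H \<equiv> hilbert_sum I S"

definition sq :: "('i \<Rightarrow> 'v) \<Rightarrow> 'i \<Rightarrow> real" where
  "sq x i = Re (vinner (S i) (x i) (x i))"

lemma vecs_sum: "x \<in> vecs H \<longleftrightarrow> (\<forall>i\<in>I. x i \<in> vecs (S i)) \<and> sq x summable_on I"
  by (simp add: hilbert_sum_def sq_def[abs_def])

lemma sq_ge0: "\<forall>i\<in>I. x i \<in> vecs (S i) \<Longrightarrow> i \<in> I \<Longrightarrow> 0 \<le> sq x i"
  by (simp add: sq_def family prehilbert.inner_ge0)

lemma two_sq_add:
  assumes "i \<in> I" "x i \<in> vecs (S i)" "y i \<in> vecs (S i)"
  shows "cmod (vinner (S i) (x i) (y i)) \<le> sq x i + sq y i"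
proof -
  interpret prehilbert "S i" by (rule family) fact
  have "cmod (vinner (S i) (x i) (y i)) \<le> nrm (x i) * nrm (y i)" by (rule cauchy_schwarz) fact+
  also have "\<dots> \<le> (nrm (x i))\<^sup>2 + (nrm (y i))\<^sup>2"
    using sum_squares_bound[of "nrm (x i)" "nrm (y i)"] zero_le_power2[of "nrm (x i)"] zero_le_power2[of "nrm (y i)"]
    by linarith
  also have "\<dots> = sq x i + sq y i" using assms by (simp add: nrm_power2 sq_def inner_ge0)
  finally show ?thesis .
qed

lemma summable_inner:
  assumes x: "x \<in> vecs H" and y: "y \<in> vecs H"
  shows "(\<lambda>i. vinner (S i) (x i) (y i)) summable_on I"
proof (rule abs_summable_summable, rule summable_on_comparison_test)
  show "(\<lambda>i. sq x i + sq y i) summable_on I"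
    using x y by (intro summable_on_add) (auto simp: vecs_sum)
qed (use x y in \<open>auto simp: vecs_sum intro: two_sq_add\<close>)

lemma summable_sq_le:
  assumes "f summable_on I" "\<And>i. i \<in> I \<Longrightarrow> 0 \<le> g i" "\<And>i. i \<in> I \<Longrightarrow> g i \<le> (f i :: real)"
  shows "g summable_on I"
  using assms by (rule_tac summable_on_comparison_test[of f]) auto

lemma vadd_vecs:
  assumes x: "x \<in> vecs H" and y: "y \<in> vecs H" shows "vadd H x y \<in> vecs H"
proof -
  have v: "vadd H x y i = vadd (S i) (x i) (y i)" for i by (simp add: hilbert_sum_def)
  have xy: "x i \<in> vecs (S i)" "y i \<in> vecs (S i)" if "i \<in> I" for i using x y that by (auto simp: vecs_sum)
  have "sq (vadd H x y) i \<le> 3 * sq x i + 3 * sq y i" if i: "i \<in> I" for i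
  proof -
    interpret prehilbert "S i" by (rule family) fact
    have "sq (vadd H x y) i = sq x i + Re (vinner (S i) (x i) (y i)) + Re (vinner (S i) (y i) (x i)) + sq y i"
      using xy[OF i] by (simp add: sq_def v inner_simps)
    then show ?thesis
      using two_sq_add[where x=x and y=y, OF i xy[OF i]]
        two_sq_add[where x=y and y=x, OF i xy(2)[OF i] xy(1)[OF i]]
        complex_Re_le_cmod[of "vinner (S i) (x i) (y i)"] complex_Re_le_cmod[of "vinner (S i) (y i) (x i)"]
      by linarith
  qed
  moreover have "(\<lambda>i. 3 * sq x i + 3 * sq y i) summable_on I"
    using x y by (intro summable_on_add summable_on_cmult_right) (auto simp: vecs_sum)
  moreover have vi: "\<forall>i\<in>I. vadd H x y i \<in> vecs (S i)"
    using xy family by (auto simp: v prehilbert.add_in)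
  ultimately show ?thesis
    unfolding vecs_sum using sq_ge0[OF vi] by (auto intro: summable_sq_le)
qed

lemma vscale_vecs:
  assumes x: "x \<in> vecs H" shows "vscale H c x \<in> vecs H"
proof -
  have v: "vscale H c x i = vscale (S i) c (x i)" for i by (simp add: hilbert_sum_def)
  have xi: "x i \<in> vecs (S i)" if "i \<in> I" for i using x that by (auto simp: vecs_sum)
  have "sq (vscale H c x) i = (cmod c)\<^sup>2 * sq x i" if i: "i \<in> I" for i
  proof -
    interpret prehilbert "S i" by (rule family) fact
    have "vinner (S i) (vscale H c x i) (vscale H c x i) = of_real ((cmod c)\<^sup>2) * vinner (S i) (x i) (x i)"
      using xi[OF i] by (simp add: v inner_simps complex_norm_square del: of_real_power)
    then show ?thesis by (simp add: sq_def del: of_real_power)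
  qed
  then have "sq (vscale H c x) summable_on I \<longleftrightarrow> (\<lambda>i. (cmod c)\<^sup>2 * sq x i) summable_on I"
    by (rule summable_on_cong)
  moreover have "(\<lambda>i. (cmod c)\<^sup>2 * sq x i) summable_on I"
    using x by (intro summable_on_cmult_right) (auto simp: vecs_sum)
  ultimately show ?thesis
    unfolding vecs_sum using xi family by (auto simp: v prehilbert.scale_in)
qed

lemma prehilbert_sum: "prehilbert H"
proof
  have inn: "vinner H x y = (\<Sum>\<^sub>\<infinity>i\<in>I. vinner (S i) (x i) (y i))" for x y
    by (simp add: hilbert_sum_def)
  have ad: "vadd H x y i = vadd (S i) (x i) (y i)" "vscale H c x i = vscale (S i) c (x i)" for x y c i
    by (simp_all add: hilbert_sum_def)
  fix x y z :: "'i \<Rightarrow> 'v" and c :: complex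
  assume x: "x \<in> vecs H"
  show "vscale H c x \<in> vecs H" by (rule vscale_vecs) fact
  have xi: "x i \<in> vecs (S i)" if "i \<in> I" for i using x that by (auto simp: vecs_sum)
  have "Re (vinner H x x) = (\<Sum>\<^sub>\<infinity>i\<in>I. sq x i)"
    unfolding inn sq_def using infsum_Re[OF summable_inner[OF x x]] by simp
  also have "\<dots> \<ge> 0" using x by (intro infsum_nonneg sq_ge0) (auto simp: vecs_sum)
  finally show "0 \<le> Re (vinner H x x)" .
  { assume z: "z \<in> vecs H"
    have zi: "z i \<in> vecs (S i)" if "i \<in> I" for i using z that by (auto simp: vecs_sum)
    have "vinner H (vscale H c x) z = (\<Sum>\<^sub>\<infinity>i\<in>I. c * vinner (S i) (x i) (z i))"
      unfolding inn ad by (rule infsum_cong) (use xi zi family in \<open>auto simp: prehilbert.inner_scale\<close>)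
    also have "\<dots> = c * vinner H x z" unfolding inn by (rule infsum_cmult_right')
    finally show "vinner H (vscale H c x) z = c * vinner H x z" . }
  { assume y: "y \<in> vecs H"
    have yi: "y i \<in> vecs (S i)" if "i \<in> I" for i using y that by (auto simp: vecs_sum)
    show "vadd H x y \<in> vecs H" by (rule vadd_vecs) fact+
    have "vinner H y x = (\<Sum>\<^sub>\<infinity>i\<in>I. cnj (vinner (S i) (x i) (y i)))"
      unfolding inn by (rule infsum_cong) (use xi yi family in \<open>auto intro: prehilbert.inner_cnj\<close>)
    then show "vinner H y x = cnj (vinner H x y)" unfolding inn by (simp add: infsum_cnj)
    assume z: "z \<in> vecs H"
    have zi: "z i \<in> vecs (S i)" if "i \<in> I" for i using z that by (auto simp: vecs_sum)
    have "vinner H (vadd H x y) z = (\<Sum>\<^sub>\<infinity>i\<in>I. vinner (S i) (x i) (z i) + vinner (S i) (y i) (z i))"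
      unfolding inn ad by (rule infsum_cong) (use xi yi zi family in \<open>auto simp: prehilbert.inner_add\<close>)
    also have "\<dots> = vinner H x z + vinner H y z"
      unfolding inn using x y z by (intro infsum_add summable_inner)
    finally show "vinner H (vadd H x y) z = vinner H x z + vinner H y z" . }
qed

lemma dist_sum:
  assumes x: "x \<in> vecs H" and y: "y \<in> vecs H"
  shows "(\<lambda>i. (rep_dist (S i) (x i) (y i))\<^sup>2) summable_on I"
    and "(rep_dist H x y)\<^sup>2 = (\<Sum>\<^sub>\<infinity>i\<in>I. (rep_dist (S i) (x i) (y i))\<^sup>2)"
proof -
  interpret H: prehilbert H by (rule prehilbert_sum)
  define d where "d = vadd H x (vscale H (-1) y)"
  have d: "d \<in> vecs H" unfolding d_def using x y by (rule H.sub_in)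
  have sq: "sq d i = (rep_dist (S i) (x i) (y i))\<^sup>2" if i: "i \<in> I" for i
  proof -
    interpret prehilbert "S i" by (rule family) fact
    have "x i \<in> vecs (S i)" "y i \<in> vecs (S i)" using x y i by (auto simp: vecs_sum)
    then show ?thesis
      by (simp add: sq_def d_def hilbert_sum_def rep_dist_def Let_def sub_in inner_ge0)
  qed
  show s: "(\<lambda>i. (rep_dist (S i) (x i) (y i))\<^sup>2) summable_on I"
    using d sq summable_on_cong[of I "sq d"] by (simp add: vecs_sum)
  have "(rep_dist H x y)\<^sup>2 = Re (vinner H d d)"
    using d by (simp add: rep_dist_def Let_def d_def[symmetric] H.inner_ge0)
  also have "\<dots> = (\<Sum>\<^sub>\<infinity>i\<in>I. sq d i)"
    using infsum_Re[OF summable_inner[OF d d]] by (simp add: hilbert_sum_def sq_def[abs_def])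
  also have "\<dots> = (\<Sum>\<^sub>\<infinity>i\<in>I. (rep_dist (S i) (x i) (y i))\<^sup>2)" by (rule infsum_cong) (rule sq)
  finally show "(rep_dist H x y)\<^sup>2 = (\<Sum>\<^sub>\<infinity>i\<in>I. (rep_dist (S i) (x i) (y i))\<^sup>2)" .
qed

text \<open>By the triangle inequality in each component and
  \<open>(a + b)\<^sup>2 \<le> 2 a\<^sup>2 + 2 b\<^sup>2\<close>. It places a componentwise limit in
  the direct sum before distances to it may be computed by \<open>dist_sum\<close>.\<close>

lemma vecs_of_near:
  assumes x: "x \<in> vecs H" and y: "\<forall>i\<in>I. y i \<in> vecs (S i)"
    and s: "(\<lambda>i. (rep_dist (S i) (x i) (y i))\<^sup>2) summable_on I"
  shows "y \<in> vecs H"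
proof -
  have "sq y i \<le> 2 * sq x i + 2 * (rep_dist (S i) (x i) (y i))\<^sup>2" if i: "i \<in> I" for i
  proof -
    interpret prehilbert "S i" by (rule family) fact
    have v: "x i \<in> vecs (S i)" "y i \<in> vecs (S i)" using x y i by (auto simp: vecs_sum)
    have "nrm (y i) \<le> nrm (x i) + rep_dist (S i) (x i) (y i)"
      using nrm_diff_le[OF v(2,1)] dist_sym[OF v] by simp
    then have "(nrm (y i))\<^sup>2 \<le> (nrm (x i) + rep_dist (S i) (x i) (y i))\<^sup>2"
      using v inner_ge0 by (intro power_mono) auto
    also have "\<dots> \<le> 2 * (nrm (x i))\<^sup>2 + 2 * (rep_dist (S i) (x i) (y i))\<^sup>2"
      using sum_squares_bound[of "nrm (x i)" "rep_dist (S i) (x i) (y i)"] by (simp add: power2_sum)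
    finally show ?thesis using v by (simp add: nrm_power2 sq_def inner_ge0)
  qed
  moreover have "(\<lambda>i. 2 * sq x i + 2 * (rep_dist (S i) (x i) (y i))\<^sup>2) summable_on I"
    using x s by (intro summable_on_add summable_on_cmult_right) (auto simp: vecs_sum)
  ultimately have "sq y summable_on I" using sq_ge0[OF y] by (auto intro: summable_sq_le)
  then show ?thesis using y by (simp add: vecs_sum)
qed

text \<open>As for the sequence space of square-summable sequences: limits are taken in each
  component, and a bound uniform in the finite index sets makes the convergence
  simultaneous.\<close>

lemma complete_sum:
  assumes c: "\<And>i. i \<in> I \<Longrightarrow> rep_complete (S i)"
  shows "rep_complete H"
  unfolding rep_complete_def
proof (intro allI impI)
  interpret H: prehilbert H by (rule prehilbert_sum)
  fix u assume u: "rep_cauchy H u"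
  then have uv: "u n \<in> vecs H" for n by (simp add: rep_cauchy_def)
  have ui: "u n i \<in> vecs (S i)" if "i \<in> I" for n i using uv[of n] that by (simp add: vecs_sum)
  have fin: "(\<Sum>i\<in>F. (rep_dist (S i) (u m i) (u n i))\<^sup>2) \<le> (rep_dist H (u m) (u n))\<^sup>2"
    if "finite F" "F \<subseteq> I" for F m n
    unfolding dist_sum(2)[OF uv uv] using that dist_sum(1)[OF uv uv]
    by (intro finite_sum_le_infsum) auto
  have "rep_cauchy (S i) (\<lambda>n. u n i)" if i: "i \<in> I" for i
    unfolding rep_cauchy_def
  proof (intro conjI allI impI)
    interpret prehilbert "S i" by (rule family) fact
    show "u n i \<in> vecs (S i)" for n using ui i by simp
    fix e :: real assume "e > 0"
    then obtain N where N: "\<And>m n. m \<ge> N \<Longrightarrow> n \<ge> N \<Longrightarrow> rep_dist H (u m) (u n) < e"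
      using u unfolding rep_cauchy_def by metis
    have "rep_dist (S i) (u m i) (u n i) \<le> rep_dist H (u m) (u n)" for m n
      using fin[of "{i}" m n] i H.dist_ge0[OF uv uv, of m n] power2_le_imp_le by auto
    then show "\<exists>N. \<forall>m\<ge>N. \<forall>n\<ge>N. rep_dist (S i) (u m i) (u n i) < e"
      using N by (meson le_less_trans)
  qed
  then have "\<forall>i\<in>I. \<exists>y\<in>vecs (S i). (\<lambda>n. rep_dist (S i) (u n i) y) \<longlonglongrightarrow> 0"
    using c unfolding rep_complete_def by blast
  then obtain y where y: "\<And>i. i \<in> I \<Longrightarrow> y i \<in> vecs (S i)"
      and lim: "\<And>i. i \<in> I \<Longrightarrow> (\<lambda>n. rep_dist (S i) (u n i) (y i)) \<longlonglongrightarrow> 0"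
    by metis
  have lim2: "(\<lambda>n. rep_dist (S i) (u m i) (u n i)) \<longlonglongrightarrow> rep_dist (S i) (u m i) (y i)" if i: "i \<in> I" for i m
  proof -
    interpret prehilbert "S i" by (rule family) fact
    have "norm (rep_dist (S i) (u m i) (u n i) - rep_dist (S i) (u m i) (y i))
       \<le> rep_dist (S i) (u n i) (y i)" for n
      using dist_triangle[of "u m i" "y i" "u n i"] dist_triangle[of "u m i" "u n i" "y i"]
        dist_sym[of "u n i" "y i"] ui[OF i] y[OF i] by (auto simp: abs_le_iff)
    then have "(\<lambda>n. rep_dist (S i) (u m i) (u n i) - rep_dist (S i) (u m i) (y i)) \<longlonglongrightarrow> 0"
      by (intro Lim_null_comparison[OF _ lim[OF i]]) auto
    then show ?thesis by (simp add: LIM_zero_iff)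
  qed
  \<comment> \<open>For a finite set of indices \<open>n\<close> tends to infinity in the Cauchy
    bound; the resulting estimate does not depend on the set and so holds for the infinite
    sum.\<close>
  have bound: "\<exists>N. \<forall>m\<ge>N. (\<lambda>i. (rep_dist (S i) (u m i) (y i))\<^sup>2) summable_on I \<and>
      (\<Sum>\<^sub>\<infinity>i\<in>I. (rep_dist (S i) (u m i) (y i))\<^sup>2) \<le> e\<^sup>2" if e: "e > 0" for e
  proof -
    obtain N where N: "\<And>m n. m \<ge> N \<Longrightarrow> n \<ge> N \<Longrightarrow> rep_dist H (u m) (u n) < e"
      using u e unfolding rep_cauchy_def by metis
    show ?thesis
    proof (intro exI[of _ N] allI impI)
      fix m assume m: "m \<ge> N"
      have le: "(\<Sum>i\<in>F. (rep_dist (S i) (u m i) (y i))\<^sup>2) \<le> e\<^sup>2" if F: "finite F" "F \<subseteq> I" for F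
      proof (rule LIMSEQ_le_const2)
        show "(\<lambda>n. \<Sum>i\<in>F. (rep_dist (S i) (u m i) (u n i))\<^sup>2) \<longlonglongrightarrow> (\<Sum>i\<in>F. (rep_dist (S i) (u m i) (y i))\<^sup>2)"
          using F by (intro tendsto_sum tendsto_power lim2) auto
        have "(\<Sum>i\<in>F. (rep_dist (S i) (u m i) (u n i))\<^sup>2) \<le> e\<^sup>2" if "n \<ge> N" for n
        proof -
          have "(rep_dist H (u m) (u n))\<^sup>2 \<le> e\<^sup>2"
            using N[OF m that] H.dist_ge0[OF uv uv, of m n] by (intro power_mono) auto
          then show ?thesis using fin[OF F, of m n] by linarith
        qed
        then show "\<exists>N. \<forall>n\<ge>N. (\<Sum>i\<in>F. (rep_dist (S i) (u m i) (u n i))\<^sup>2) \<le> e\<^sup>2" by blast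
      qed
      have s: "(\<lambda>i. (rep_dist (S i) (u m i) (y i))\<^sup>2) summable_on I"
        using le by (intro nonneg_bdd_above_summable_on bdd_aboveI[of _ "e\<^sup>2"]) auto
      moreover have "(\<Sum>\<^sub>\<infinity>i\<in>I. (rep_dist (S i) (u m i) (y i))\<^sup>2) \<le> e\<^sup>2"
        using le by (intro infsum_le_finite_sums[OF s]) auto
      ultimately show "(\<lambda>i. (rep_dist (S i) (u m i) (y i))\<^sup>2) summable_on I \<and>
        (\<Sum>\<^sub>\<infinity>i\<in>I. (rep_dist (S i) (u m i) (y i))\<^sup>2) \<le> e\<^sup>2" by blast
    qed
  qed
  obtain N1 where "(\<lambda>i. (rep_dist (S i) (u N1 i) (y i))\<^sup>2) summable_on I"
    using bound[of 1] by auto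
  then have yv: "y \<in> vecs H" using vecs_of_near[OF uv] y by blast
  have "(\<lambda>n. rep_dist H (u n) y) \<longlonglongrightarrow> 0"
  proof (rule LIMSEQ_I)
    fix e :: real assume e: "e > 0"
    obtain N where N: "\<And>m. m \<ge> N \<Longrightarrow> (\<Sum>\<^sub>\<infinity>i\<in>I. (rep_dist (S i) (u m i) (y i))\<^sup>2) \<le> (e/2)\<^sup>2"
      using bound[of "e/2"] e by auto
    have "rep_dist H (u m) y \<le> e/2" if "m \<ge> N" for m
      by (rule power2_le_imp_le) (use N[OF that] e in \<open>simp_all add: dist_sum(2)[OF uv yv]\<close>)
    then have "norm (rep_dist H (u m) y - 0) < e" if "m \<ge> N" for m
      using that e H.dist_ge0[OF uv yv, of m] by fastforce
    then show "\<exists>no. \<forall>n\<ge>no. norm (rep_dist H (u n) y - 0) < e" by blast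
  qed
  then show "\<exists>x\<in>vecs H. (\<lambda>n. rep_dist H (u n) x) \<longlonglongrightarrow> 0" using yv by blast
qed

lemma unitary_sum:
  assumes "\<And>i. i \<in> I \<Longrightarrow> unitary_rep (S i)"
  shows "unitary_rep H"
  unfolding unitary_rep_def
proof (intro conjI allI ballI prehilbert_sum)
  fix a x assume x: "x \<in> vecs H"
  have "sq (act H a x) i = sq x i" if "i \<in> I" for i
    using x assms[OF that] that by (auto simp: sq_def hilbert_sum_def unitary_rep_def)
  then show "act H a x \<in> vecs H"
    using x assms summable_on_cong[of I "sq (act H a x)" "sq x"]
    by (auto simp: vecs_sum) (auto simp: hilbert_sum_def unitary_rep_def)
  fix y assume y: "y \<in> vecs H"
  show "vinner H (act H a x) (act H a y) = vinner H x y"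
    unfolding hilbert_sum_def rep.simps
    by (rule infsum_cong) (use x y assms in \<open>auto simp: vecs_sum unitary_rep_def\<close>)
qed

text \<open>A vector is close to any vector that approximates finitely many of its
  components and is null elsewhere.\<close>

lemma finite_support_dense:
  assumes x: "x \<in> vecs H" and e: "\<epsilon> > 0"
    and dense: "\<And>i z \<delta>. i \<in> I \<Longrightarrow> z \<in> vecs (S i) \<Longrightarrow> \<delta> > 0 \<Longrightarrow> \<exists>d\<in>E i. rep_dist (S i) z d < \<delta>"
    and E: "\<And>i. i \<in> I \<Longrightarrow> E i \<subseteq> vecs (S i)"
    and o: "\<And>i. i \<in> I \<Longrightarrow> o' i \<in> E i \<and> vinner (S i) (o' i) (o' i) = 0"
  obtains F y where "finite F" "F \<subseteq> I" "y \<in> vecs H" "\<And>i. i \<in> F \<Longrightarrow> y i \<in> E i"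
    "\<And>i. i \<notin> F \<Longrightarrow> y i = o' i" "rep_dist H x y < \<epsilon>"
proof -
  have xi: "x i \<in> vecs (S i)" if "i \<in> I" for i using x that by (simp add: vecs_sum)
  have s: "sq x summable_on I" using x by (simp add: vecs_sum)
  have e2: "\<epsilon>\<^sup>2 / 3 > 0" using e by simp
  have "\<epsilon>\<^sup>2 / 4 > 0" using e by simp
  from infsum_finite_approximation[OF s this]
  obtain F where F: "finite F" "F \<subseteq> I" and t: "dist (sum (sq x) F) (infsum (sq x) I) \<le> \<epsilon>\<^sup>2 / 4"
    by blast
  \<comment> \<open>Head and tail receive the shares \<open>\<epsilon>\<^sup>2 / 3\<close> and
    \<open>\<epsilon>\<^sup>2 / 4\<close>. The summand 1 next to \<open>card F\<close> keeps the
    denominator positive when \<open>F\<close> is empty.\<close>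
  obtain \<delta> where \<delta>: "\<delta> > 0" "real (card F) * \<delta>\<^sup>2 \<le> \<epsilon>\<^sup>2 / 3"
  proof
    show "\<epsilon> / sqrt (3 * (real (card F) + 1)) > 0" using e by simp
    show "real (card F) * (\<epsilon> / sqrt (3 * (real (card F) + 1)))\<^sup>2 \<le> \<epsilon>\<^sup>2 / 3"
      by (simp add: power_divide field_simps)
  qed
  have "\<forall>i\<in>F. \<exists>d\<in>E i. rep_dist (S i) (x i) d < \<delta>" using dense F xi \<delta> by blast
  then obtain d where d: "\<And>i. i \<in> F \<Longrightarrow> d i \<in> E i" "\<And>i. i \<in> F \<Longrightarrow> rep_dist (S i) (x i) (d i) < \<delta>"
    by metis
  define y where "y i = (if i \<in> F then d i else o' i)" for i
  have yi: "y i \<in> vecs (S i)" if "i \<in> I" for i using that d o subsetD[OF E] by (auto simp: y_def)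
  have distF: "(rep_dist (S i) (x i) (y i))\<^sup>2 \<le> \<delta>\<^sup>2" if i: "i \<in> F" for i
  proof -
    interpret prehilbert "S i" using family F i by blast
    have "0 \<le> rep_dist (S i) (x i) (y i)" using i F xi yi dist_ge0 by blast
    then show ?thesis using d(2)[OF i] i by (intro power_mono) (auto simp: y_def)
  qed
  have distN: "(rep_dist (S i) (x i) (y i))\<^sup>2 = sq x i" if i: "i \<in> I - F" for i
  proof -
    interpret prehilbert "S i" using family i by blast
    \<comment> \<open>By Cauchy-Schwarz a null vector is orthogonal to everything, so putting it in
      place of \<open>x i\<close> costs exactly \<open>sq x i\<close>.\<close>
    have "cmod (vinner (S i) (x i) (y i)) \<le> nrm (x i) * nrm (y i)"
      using i xi yi by (intro cauchy_schwarz) auto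
    also have "nrm (y i) = 0" using i o by (simp add: y_def)
    finally have "vinner (S i) (x i) (y i) = 0" by simp
    moreover have "vinner (S i) (y i) (y i) = 0" using i o by (simp add: y_def)
    ultimately show ?thesis using i xi yi by (simp add: dist_power2 sq_def)
  qed
  let ?g = "\<lambda>i. (rep_dist (S i) (x i) (y i))\<^sup>2"
  have sN: "sq x summable_on I - F" using s summable_on_subset_banach by blast
  have gN: "?g summable_on I - F" using sN distN summable_on_cong[of "I - F" ?g "sq x"] by simp
  have gI: "?g summable_on I"
    using summable_on_Un_disjoint[OF summable_on_finite[OF F(1)] gN] F by (simp add: Un_absorb1)
  have yv: "y \<in> vecs H" using vecs_of_near[OF x] yi gI by blast
  have "(rep_dist H x y)\<^sup>2 = sum ?g F + infsum ?g (I - F)"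
    unfolding dist_sum(2)[OF x yv] using infsum_Un_disjoint[OF summable_on_finite[OF F(1)] gN] F
    by (simp add: Un_absorb1)
  also have "infsum ?g (I - F) = infsum (sq x) (I - F)" by (rule infsum_cong) (rule distN)
  also have "\<dots> = infsum (sq x) I - sum (sq x) F"
    using infsum_Diff[OF s summable_on_finite[OF F(1)] F(2)] F by simp
  finally have "(rep_dist H x y)\<^sup>2 = sum ?g F + (infsum (sq x) I - sum (sq x) F)" .
  moreover have "sum ?g F \<le> real (card F) * \<delta>\<^sup>2" using distF by (intro sum_bounded_above)
  ultimately have "(rep_dist H x y)\<^sup>2 < \<epsilon>\<^sup>2"
    using t \<delta> e2 unfolding dist_real_def by linarith
  then have "rep_dist H x y < \<epsilon>" using e power2_less_imp_less less_imp_le by blast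
  with F yv d show ?thesis by (intro that[of F y]) (auto simp: y_def)
qed

end

subsection \<open>Binary sums and characters\<close>

lemma prehilbert_plus:
  assumes "prehilbert R" "prehilbert S" shows "prehilbert (hilbert_plus R S)"
proof -
  interpret R: prehilbert R by fact
  interpret S: prehilbert S by fact
  show ?thesis
    by standard (auto simp: hilbert_plus_def R.inner_simps S.inner_simps algebra_simps
        R.inner_ge0 S.inner_ge0, metis R.inner_cnj S.inner_cnj)
qed

lemma unitary_plus:
  assumes "unitary_rep R" "unitary_rep S" shows "unitary_rep (hilbert_plus R S)"
  unfolding unitary_rep_def
  by (intro conjI prehilbert_plus unitary_prehilbert assms)
    (use assms in \<open>auto simp: hilbert_plus_def unitary_rep_def\<close>)

lemma dist_plus:
  assumes "prehilbert R" "prehilbert S" "x \<in> vecs R" "x' \<in> vecs R" "y \<in> vecs S" "y' \<in> vecs S"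
  shows "(rep_dist (hilbert_plus R S) (x, y) (x', y'))\<^sup>2 = (rep_dist R x x')\<^sup>2 + (rep_dist S y y')\<^sup>2"
proof -
  interpret R: prehilbert R by fact
  interpret S: prehilbert S by fact
  interpret P: prehilbert "hilbert_plus R S" by (intro prehilbert_plus assms)
  have "(x, y) \<in> vecs (hilbert_plus R S)" "(x', y') \<in> vecs (hilbert_plus R S)"
    using assms by (auto simp: hilbert_plus_def)
  then show ?thesis
    using assms by (simp add: P.dist_power2 R.dist_power2 S.dist_power2) (simp add: hilbert_plus_def)
qed

lemma complete_plus:
  assumes R: "prehilbert R" and S: "prehilbert S" and "rep_complete R" "rep_complete S"
  shows "rep_complete (hilbert_plus R S)"
  unfolding rep_complete_def
proof (intro allI impI)
  interpret R: prehilbert R by fact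
  interpret S: prehilbert S by fact
  interpret P: prehilbert "hilbert_plus R S" by (intro prehilbert_plus assms)
  fix u assume u: "rep_cauchy (hilbert_plus R S) u"
  define a b where "a n = fst (u n)" and "b n = snd (u n)" for n
  have uab: "u n = (a n, b n)" for n by (simp add: a_def b_def)
  have uv: "u n \<in> vecs (hilbert_plus R S)" for n using u by (simp add: rep_cauchy_def)
  then have "u n \<in> vecs R \<times> vecs S" for n by (simp add: hilbert_plus_def)
  then have ab: "a n \<in> vecs R" "b n \<in> vecs S" for n by (auto simp: a_def b_def mem_Times_iff)
  have le: "rep_dist R (a m) (a n) \<le> rep_dist (hilbert_plus R S) (u m) (u n)"
       "rep_dist S (b m) (b n) \<le> rep_dist (hilbert_plus R S) (u m) (u n)" for m n
  proof -
    have e: "(rep_dist (hilbert_plus R S) (u m) (u n))\<^sup>2 = (rep_dist R (a m) (a n))\<^sup>2 + (rep_dist S (b m) (b n))\<^sup>2"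
      unfolding uab by (intro dist_plus R S ab)
    show "rep_dist R (a m) (a n) \<le> rep_dist (hilbert_plus R S) (u m) (u n)"
      by (rule power2_le_imp_le[OF _ P.dist_ge0[OF uv uv]]) (simp add: e)
    show "rep_dist S (b m) (b n) \<le> rep_dist (hilbert_plus R S) (u m) (u n)"
      by (rule power2_le_imp_le[OF _ P.dist_ge0[OF uv uv]]) (simp add: e)
  qed
  have "rep_cauchy R a" "rep_cauchy S b"
    using u le ab unfolding rep_cauchy_def by (meson le_less_trans)+
  then obtain x y where x: "x \<in> vecs R" "(\<lambda>n. rep_dist R (a n) x) \<longlonglongrightarrow> 0"
     and y: "y \<in> vecs S" "(\<lambda>n. rep_dist S (b n) y) \<longlonglongrightarrow> 0"
    using assms unfolding rep_complete_def by blast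
  have v: "(x, y) \<in> vecs (hilbert_plus R S)" using x y by (simp add: hilbert_plus_def)
  have "rep_dist (hilbert_plus R S) (u n) (x, y) = sqrt ((rep_dist R (a n) x)\<^sup>2 + (rep_dist S (b n) y)\<^sup>2)" for n
    using dist_plus[OF R S ab(1) x(1) ab(2) y(1), of n n] P.dist_ge0[OF uv[of n] v]
    by (simp add: uab real_sqrt_unique)
  moreover have "(\<lambda>n. sqrt ((rep_dist R (a n) x)\<^sup>2 + (rep_dist S (b n) y)\<^sup>2)) \<longlonglongrightarrow> sqrt (0\<^sup>2 + 0\<^sup>2)"
    by (intro tendsto_intros x y)
  ultimately show "\<exists>x\<in>vecs (hilbert_plus R S). (\<lambda>n. rep_dist (hilbert_plus R S) (u n) x) \<longlonglongrightarrow> 0"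
    using v by (intro bexI[of _ "(x, y)"]) simp_all
qed

lemma prehilbert_character: "prehilbert (character_rep \<theta>)"
  by standard (auto simp: character_rep_def algebra_simps complex_mult_cnj)

lemma unitary_character: "(\<And>a. cmod (\<theta> a) = 1) \<Longrightarrow> unitary_rep (character_rep \<theta>)"
  unfolding unitary_rep_def
proof (intro conjI prehilbert_character allI ballI)
  fix a x y assume "\<And>a. cmod (\<theta> a) = 1"
  then have "\<theta> a * cnj (\<theta> a) = 1" by (simp add: complex_norm_square[symmetric])
  then show "vinner (character_rep \<theta>) (act (character_rep \<theta>) a x) (act (character_rep \<theta>) a y)
     = vinner (character_rep \<theta>) x y"
    by (simp add: character_rep_def)
qed (simp add: character_rep_def)

lemma dist_character: "rep_dist (character_rep \<theta>) x y = dist x y"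
  by (simp add: character_rep_def rep_dist_def Let_def dist_norm complex_mult_cnj cmod_def)

lemma complete_character: "rep_complete (character_rep \<theta>)"
  unfolding rep_complete_def
proof (intro allI impI)
  fix u assume "rep_cauchy (character_rep \<theta>) u"
  then have "Cauchy u" by (simp add: rep_cauchy_def dist_character Cauchy_def)
  then obtain x where "u \<longlonglongrightarrow> x" by (auto simp: Cauchy_convergent_iff convergent_def)
  then have "(\<lambda>n. dist (u n) x) \<longlonglongrightarrow> 0" using tendsto_dist_iff by blast
  then show "\<exists>x\<in>vecs (character_rep \<theta>). (\<lambda>n. rep_dist (character_rep \<theta>) (u n) x) \<longlonglongrightarrow> 0"
    by (simp add: dist_character) (auto simp: character_rep_def)
qed

subsection \<open>One-parameter subgroups and the adjoint action\<close>

locale lie_exp =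
  fixes G :: "'g::t2_space monoid" (structure)
    and \<A> :: "('g, 'a::euclidean_space) chart set"
    and e :: "'a \<Rightarrow> 'g"
  assumes lg: "lie_group G \<A>" and le: "lie_exponential G \<A> e"
begin

sublocale group G using lg by (simp add: lie_group_def)

lemma carrier [simp]: "carrier G = UNIV" using lg by (simp add: lie_group_def)

lemma atlas: "smooth_atlas \<A>" using lg by (simp add: lie_group_def)

lemma chart_at: obtains U \<phi> where "(U, \<phi>) \<in> \<A>" "g \<in> U"
proof -
  have "(\<Union>(U, \<phi>)\<in>\<A>. U) = UNIV" using atlas by (simp add: smooth_atlas_def)
  then have "g \<in> (\<Union>(U, \<phi>)\<in>\<A>. U)" by simp
  then show ?thesis using that by auto
qed

lemma continuous_mult:
  assumes "continuous_on S f" "continuous_on S g"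
  shows "continuous_on S (\<lambda>x. f x \<otimes> g x)"
proof -
  have "continuous_on UNIV (\<lambda>(x, y). x \<otimes> y)" using lg by (simp add: lie_group_def)
  from continuous_on_compose2[OF this continuous_on_Pair[OF assms]] show ?thesis by simp
qed

lemma continuous_inv:
  assumes "continuous_on S f" shows "continuous_on S (\<lambda>x. inv (f x))"
proof -
  have "continuous_on UNIV (\<lambda>x. inv x)" using lg by (simp add: lie_group_def)
  from continuous_on_compose2[OF this assms] show ?thesis by simp
qed

lemma cancel [simp]: "inv g \<otimes> (g \<otimes> x) = x" "g \<otimes> (inv g \<otimes> x) = x"
  by (simp_all add: m_assoc[symmetric])

lemma e_add: "e ((s + t) *\<^sub>R X) = e (s *\<^sub>R X) \<otimes> e (t *\<^sub>R X)"
  using le by (simp add: lie_exponential_def)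

lemma e_0 [simp]: "e 0 = \<one>"
  using e_add[of 0 0 0] by (metis carrier UNIV_I add.right_neutral r_cancel_one' scaleR_zero_right)

lemma e_minus: "e (- X) = inv (e X)"
  using e_add[of 1 "-1" X] inv_equality[of "e (- X)" "e X"] e_add[of "-1" 1 X] by simp

lemma continuous_e: "continuous_on S f \<Longrightarrow> continuous_on S (\<lambda>x. e (f x))"
  using le continuous_on_compose2[of UNIV e S f] by (auto simp: lie_exponential_def)

end

locale lie_chart = lie_exp G \<A> e
  for G :: "'g::t2_space monoid" (structure)
    and \<A> :: "('g, 'a::euclidean_space) chart set" and e :: "'a \<Rightarrow> 'g" +
  fixes U :: "'g set" and \<phi> :: "'g \<Rightarrow> 'a"
  assumes chart: "(U, \<phi>) \<in> \<A>" and one_U: "\<one> \<in> U"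
begin

definition "\<psi> = inv_into U \<phi>"
definition "f = (\<lambda>x. \<phi> (e x))"
definition "p0 = \<phi> \<one>"

lemma chart_props:
  shows open_U: "open U" and open_S: "open (\<phi> ` U)" and homeo: "homeomorphism U (\<phi> ` U) \<phi> \<psi>"
  using atlas chart by (auto simp: smooth_atlas_def \<psi>_def)

lemma psi_phi [simp]: "x \<in> U \<Longrightarrow> \<psi> (\<phi> x) = x"
  using homeo by (simp add: homeomorphism_def)

lemma phi_psi [simp]: "y \<in> \<phi> ` U \<Longrightarrow> \<phi> (\<psi> y) = y"
  using homeo by (auto simp: homeomorphism_def)

lemma f_0: "f 0 = p0" by (simp add: f_def p0_def)

lemma psi_p0 [simp]: "\<psi> p0 = \<one>" by (simp add: p0_def one_U)

lemma p0_S: "p0 \<in> \<phi> ` U" using one_U by (simp add: p0_def)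

lemma open_W: "open (e -` U)"
  using continuous_e[of UNIV "\<lambda>x. x"] open_U by (intro open_vimage) auto

lemma zero_W: "0 \<in> e -` U" using one_U by simp

text \<open>The differential at 0 of the exponential map, read in the chart. The chart is not
  adapted to \<open>e\<close>, so velocities of curves appear as \<open>D z\<close> and are pulled
  back by \<open>iD\<close>.\<close>

definition "D = (SOME D. (f has_derivative D) (at 0) \<and> bij D)"

definition "iD = inv_into UNIV D"

lemma D: "(f has_derivative D) (at 0)" "bij D"
proof -
  have "\<exists>D. (f has_derivative D) (at 0) \<and> bij D"
    using le chart one_U unfolding lie_exponential_def f_def comp_def by blast
  from someI_ex[OF this] show "(f has_derivative D) (at 0)" "bij D" by (auto simp: D_def)
qed

lemma linear_D: "linear D" using D(1) has_derivative_linear by blast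

lemma linear_iD: "linear (iD)"
  using linear_D D(2) unfolding iD_def by (simp add: bij_is_inj inj_linear_imp_inv_linear)

lemma iD [simp]: "iD (D x) = x" "D (iD x) = x"
  using D(2) by (auto simp: iD_def bij_is_inj bij_is_surj surj_f_inv_f)

text \<open>Inverse function theorem for the exponential map in the chart; \<open>g\<close> is a
  local logarithm.\<close>

lemma local_log:
  obtains N V g where "open N" "0 \<in> N" "N \<subseteq> e -` U" "open V" "homeomorphism N V f g"
    "(g has_derivative iD) (at p0)"
proof -
  have "smooth_on f (e -` U)"
    using le chart unfolding lie_exponential_def f_def comp_def by fast
  then have "Ck_on (Suc 0) f (e -` U)" by (simp add: smooth_on_def)
  then obtain f' where f': "\<And>x. x \<in> e -` U \<Longrightarrow> (f has_derivative f' x) (at x)"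
      and c: "\<And>v. continuous_on (e -` U) (\<lambda>x. f' x v)"
    by auto
  have D0: "f' 0 = D" using f'[OF zero_W] D(1) by (rule has_derivative_unique)
  define F where "F x = Blinfun (f' x)" for x
  have F: "blinfun_apply (F x) = f' x" if "x \<in> e -` U" for x
    unfolding F_def using f'[OF that] by (simp add: bounded_linear_Blinfun_apply has_derivative_bounded_linear)
  \<comment> \<open>Smoothness gives continuity of each directional derivative. In finite dimension
    this amounts to continuity in the operator norm, which the inverse function theorem asks
    for.\<close>
  have contF: "continuous_on (e -` U) F"
  proof (rule continuous_on_blinfun_componentwise)
    fix i :: 'a assume "i \<in> Basis"
    show "continuous_on (e -` U) (\<lambda>x. blinfun_apply (F x) i)"
      by (rule continuous_on_eq[OF c]) (simp add: F)
  qed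
  have bl: "bounded_linear (iD)" using linear_iD by (simp add: linear_conv_bounded_linear)
  have "Blinfun (iD) o\<^sub>L F 0 = id_blinfun"
    by (rule blinfun_eqI) (use F[OF zero_W] D0 bl in \<open>simp add: bounded_linear_Blinfun_apply\<close>)
  then obtain N V g g' where N: "open N" "N \<subseteq> e -` U" "0 \<in> N" "open V" "f 0 \<in> V" "homeomorphism N V f g"
    and g: "\<And>y. y \<in> V \<Longrightarrow> (g has_derivative (g' y)) (at y)"
    "\<And>y. y \<in> V \<Longrightarrow> g' y = inv_into UNIV (blinfun_apply (F(g y)))"
    using inverse_function_theorem[OF open_W _ contF zero_W, of f] f' F by metis
  have "g p0 = 0" using N by (metis homeomorphism_def f_0)
  then have "(g has_derivative iD) (at p0)" using g[of p0] N F[OF zero_W] D0 by (simp add: f_0 iD_def)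
  with N show ?thesis using that by blast
qed

text \<open>Near 0 the curve is \<open>e (w t)\<close> with \<open>w\<close> the local logarithm.
  Injectivity of \<open>e\<close> near 0 turns the homomorphism law into
  \<open>w t = 2 w (t/2)\<close>, differentiability at 0 then forces \<open>w\<close> to be linear,
  and doubling carries the identity from small \<open>t\<close> to all \<open>t\<close>.\<close>

lemma one_param:
  assumes hom: "\<And>s t. c (s + t) = c s \<otimes> c t" and cont: "continuous_on UNIV c"
    and der: "((\<lambda>t. \<phi> (c t)) has_vector_derivative D z) (at 0)"
  shows "c t = e (t *\<^sub>R z)"
proof -
  obtain N V g where N: "open N" "0 \<in> N" "N \<subseteq> e -` U" "open V" "homeomorphism N V f g"
    and g: "(g has_derivative iD) (at p0)"
    by (rule local_log)
  have gf: "g (f x) = x" if "x \<in> N" for x using that N by (simp add: homeomorphism_def)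
  have inj: "x = y" if "x \<in> N" "y \<in> N" "e x = e y" for x y
    using gf that by (metis f_def)
  obtain r where r: "r > 0" "ball 0 r \<subseteq> N" using N open_contains_ball by blast
  have c0: "c 0 = \<one>" using hom[of 0 0] by (metis carrier UNIV_I add.right_neutral r_cancel_one')
  \<comment> \<open>The radius is halved so that with \<open>w (t/2)\<close> in this ball the vector
    \<open>2 *\<^sub>R w (t/2)\<close> still lies in \<open>N\<close>, where \<open>e\<close> is
    injective.\<close>
  have Vr: "open (f ` ball 0 (r/2))"
  proof -
    have "open (V \<inter> g -` ball 0 (r/2))"
      using N by (intro continuous_open_preimage) (auto simp: homeomorphism_def)
    moreover have "V \<inter> g -` ball 0 (r/2) = f ` ball 0 (r/2)"
    proof -
      have "ball 0 (r/2) \<subseteq> N" using r by auto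
      then have "f ` ball 0 (r/2) \<subseteq> V" using N(5) by (auto simp: homeomorphism_def)
      moreover have "f (g y) = y" if "y \<in> V" for y using N(5) that by (simp add: homeomorphism_def)
      moreover have "ball 0 (r/2) \<subseteq> N" using r by auto
      ultimately have V: "f ` ball 0 (r/2) \<subseteq> V" "\<And>y. y \<in> V \<Longrightarrow> f (g y) = y" "ball 0 (r/2) \<subseteq> N" by blast+
      show ?thesis
      proof (intro equalityI subsetI)
        fix y assume "y \<in> V \<inter> g -` ball 0 (r/2)"
        then have "f (g y) = y" "g y \<in> ball 0 (r/2)" using V by auto
        then show "y \<in> f ` ball 0 (r/2)" by (metis imageI)
      next
        fix y assume "y \<in> f ` ball 0 (r/2)"
        then obtain x where x: "x \<in> ball 0 (r/2)" "y = f x" by blast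
        then have "g y = x" using gf V(3) by blast
        then show "y \<in> V \<inter> g -` ball 0 (r/2)" using x V(1) by blast
      qed
    qed
    ultimately show ?thesis by simp
  qed
  have "open (U \<inter> \<phi> -` (f ` ball 0 (r/2)))"
    using homeo open_U Vr by (intro continuous_open_preimage) (auto simp: homeomorphism_def)
  then have "open (c -` (U \<inter> \<phi> -` (f ` ball 0 (r/2))))" using cont open_vimage by blast
  moreover have "0 \<in> c -` (U \<inter> \<phi> -` (f ` ball 0 (r/2)))"
    using c0 one_U r by (auto simp: image_iff f_def intro!: bexI[of _ 0])
  ultimately obtain \<delta> where \<delta>: "\<delta> > 0" "ball 0 \<delta> \<subseteq> c -` (U \<inter> \<phi> -` (f ` ball 0 (r/2)))"
    using open_contains_ball by blast
  define w where "w t = g (\<phi> (c t))" for t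
  have w: "w t \<in> ball 0 (r/2)" "e (w t) = c t" if t: "\<bar>t\<bar> < \<delta>" for t
  proof -
    have "t \<in> ball 0 \<delta>" using t by simp
    then have cU: "c t \<in> U" and "\<phi> (c t) \<in> f ` ball 0 (r/2)" using \<delta> by auto
    then obtain x where x: "x \<in> ball 0 (r/2)" "\<phi> (c t) = f x" by blast
    have xN: "x \<in> N" using x r by auto
    then have "w t = x" using gf x by (simp add: w_def)
    moreover have "e x = c t" using x cU xN N(3) by (metis f_def psi_phi subsetD vimageD)
    ultimately show "w t \<in> ball 0 (r/2)" "e (w t) = c t" using x by auto
  qed
  have half: "w t = 2 *\<^sub>R w (t/2)" if t: "\<bar>t\<bar> < \<delta>" for t
  proof (rule inj)
    have t2: "\<bar>t/2\<bar> < \<delta>" using t \<delta> by simp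
    show "w t \<in> N" using w(1)[OF t] r by auto
    show "2 *\<^sub>R w (t/2) \<in> N" using w(1)[OF t2] r by auto
    show "e (w t) = e (2 *\<^sub>R w (t/2))"
      using w(2)[OF t] w(2)[OF t2] hom[of "t/2" "t/2"] e_add[of 1 1 "w (t/2)"] by simp
  qed
  have pow: "w t = 2^k *\<^sub>R w (t/2^k)" if t: "\<bar>t\<bar> < \<delta>" for t k
  proof (induction k)
    case (Suc k)
    have "\<bar>t\<bar> / 2^k \<le> \<bar>t\<bar> / 1" by (intro divide_left_mono) auto
    then have "\<bar>t/2^k\<bar> < \<delta>" using t by simp
    from half[OF this] show ?case using Suc by (simp add: field_simps)
  qed simp
  have w0: "w 0 = 0" using gf[OF N(2)] c0 by (simp add: w_def f_def)
  have wder: "(w has_derivative (\<lambda>t. t *\<^sub>R z)) (at 0)"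
  proof -
    have 1: "((\<lambda>t. \<phi> (c t)) has_derivative (\<lambda>t. t *\<^sub>R D z)) (at 0)"
      using der by (simp add: has_vector_derivative_def)
    have 2: "(g has_derivative iD) (at (\<phi> (c 0)))" using g c0 by (simp add: p0_def)
    have "(w has_derivative (\<lambda>t. iD (t *\<^sub>R D z))) (at 0)"
      unfolding w_def[abs_def] using has_derivative_compose[OF 1 2] .
    then show ?thesis by (simp add: linear_scale[OF linear_iD])
  qed
  \<comment> \<open>At \<open>t / 2^k\<close> the error of the linear approximation is small
    relative to \<open>t / 2^k\<close>; multiplying by \<open>2^k\<close> returns to
    \<open>t\<close> with a relative error that is still small.\<close>
  have wt: "w t = t *\<^sub>R z" if t: "\<bar>t\<bar> < \<delta>" for t
  proof -
    have "norm (w t - t *\<^sub>R z) \<le> 0 + \<epsilon>" if \<epsilon>: "\<epsilon> > 0" for \<epsilon>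
    proof -
      have "\<epsilon> / (\<bar>t\<bar> + 1) > 0" using \<epsilon> by (simp add: add_nonneg_pos)
      then obtain d where d: "d > 0" "\<And>y. norm y < d \<Longrightarrow> norm (w y - y *\<^sub>R z) \<le> \<epsilon> / (\<bar>t\<bar> + 1) * norm y"
        using wder w0 unfolding has_derivative_at_alt by (metis diff_zero)
      obtain k where k: "\<bar>t\<bar> / d < 2^k" using real_arch_pow[of 2 "\<bar>t\<bar> / d"] by auto
      then have "norm (t / 2^k) < d" using d by (simp add: field_simps)
      from d(2)[OF this] have "norm (w (t/2^k) - (t/2^k) *\<^sub>R z) \<le> \<epsilon> / (\<bar>t\<bar> + 1) * (\<bar>t\<bar> / 2^k)" by simp
      then have "2^k * norm (w (t/2^k) - (t/2^k) *\<^sub>R z) \<le> 2^k * (\<epsilon> / (\<bar>t\<bar> + 1) * (\<bar>t\<bar> / 2^k))"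
        by (rule mult_left_mono) simp
      also have "\<dots> = \<epsilon> / (\<bar>t\<bar> + 1) * \<bar>t\<bar>" by simp
      finally have "2^k * norm (w (t/2^k) - (t/2^k) *\<^sub>R z) \<le> \<epsilon> / (\<bar>t\<bar> + 1) * \<bar>t\<bar>" .
      moreover have "norm (w t - t *\<^sub>R z) = 2^k * norm (w (t/2^k) - (t/2^k) *\<^sub>R z)"
      proof -
        have "w t - t *\<^sub>R z = 2^k *\<^sub>R (w (t/2^k) - (t/2^k) *\<^sub>R z)"
          by (subst pow[OF t, of k]) (simp add: scaleR_diff_right)
        then show ?thesis by simp
      qed
      moreover have "\<epsilon> / (\<bar>t\<bar> + 1) * \<bar>t\<bar> \<le> \<epsilon>" using \<epsilon> by (simp add: field_simps)
      ultimately show ?thesis by linarith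
    qed
    then have "norm (w t - t *\<^sub>R z) \<le> 0" by (rule field_le_epsilon)
    then show ?thesis by simp
  qed
  have small: "c t = e (t *\<^sub>R z)" if "\<bar>t\<bar> < \<delta>" for t using w(2)[OF that] wt[OF that] by simp
  have double: "c (2^k * t) = e ((2^k * t) *\<^sub>R z)" if "\<bar>t\<bar> < \<delta>" for t k
  proof (induction k)
    case (Suc k)
    have *: "2^Suc k * t = 2^k * t + 2^k * t" by simp
    show ?case unfolding * hom e_add Suc ..
  qed (use small that in simp)
  obtain k where k: "\<bar>t\<bar> / \<delta> < 2^k" using real_arch_pow[of 2 "\<bar>t\<bar> / \<delta>"] by auto
  then have "\<bar>t/2^k\<bar> < \<delta>" using \<delta> by (simp add: field_simps)
  from double[OF this, of k] show ?thesis by simp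
qed

text \<open>Compare velocities at 0, where \<open>D\<close> is injective. This is the uniqueness
  behind the definite description in \<open>Ad\<close>.\<close>

lemma e_direction_unique:
  assumes "\<And>t. e (t *\<^sub>R Z) = e (t *\<^sub>R Z')" shows "Z = Z'"
proof -
  have d: "((\<lambda>t. f (t *\<^sub>R Z)) has_derivative (\<lambda>t. D (t *\<^sub>R Z))) (at 0)" for Z
  proof -
    have "((\<lambda>t. t *\<^sub>R Z) has_derivative (\<lambda>t. t *\<^sub>R Z)) (at (0::real))"
      by (auto intro!: derivative_eq_intros)
    from has_derivative_compose[OF this, of f D] D(1) show ?thesis by simp
  qed
  have "(\<lambda>t. D (t *\<^sub>R Z)) = (\<lambda>t::real. D (t *\<^sub>R Z'))"
    using d[of Z] d[of Z'] assms unfolding f_def by (simp add: has_derivative_unique)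
  then have "D (1 *\<^sub>R Z) = D (1 *\<^sub>R Z')" by (rule fun_cong)
  then show ?thesis using iD(1) by (metis scaleR_one)
qed

lemma f_curve_deriv: "((\<lambda>t. \<phi> (e (t *\<^sub>R Y))) has_vector_derivative D Y) (at 0)"
proof -
  have "((\<lambda>t. t *\<^sub>R Y) has_derivative (\<lambda>t. t *\<^sub>R Y)) (at (0::real))"
    by (auto intro!: derivative_eq_intros)
  from has_derivative_compose[OF this, of f D] D(1)
  show ?thesis by (simp add: f_def has_vector_derivative_def linear_scale[OF linear_D])
qed

definition "m = (\<lambda>(x, y). \<phi> (\<psi> x \<otimes> \<psi> y))"
definition "\<Omega> = {(x, y). x \<in> \<phi> ` U \<and> y \<in> \<phi> ` U \<and> \<psi> x \<otimes> \<psi> y \<in> U}"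

lemma m_smooth: "smooth_on m \<Omega>"
  using lg chart unfolding lie_group_def m_def \<Omega>_def \<psi>_def by fast

lemma p0_Omega: "(p0, p0) \<in> \<Omega>" by (simp add: \<Omega>_def p0_S one_U)

lemma m_derivs:
  obtains m' m'' where "\<And>z. z \<in> \<Omega> \<Longrightarrow> (m has_derivative m' z) (at z)"
    "\<And>v z. z \<in> \<Omega> \<Longrightarrow> ((\<lambda>z. m' z v) has_derivative m'' v z) (at z)"
proof -
  have "Ck_on (Suc (Suc 0)) m \<Omega>" using m_smooth by (simp add: smooth_on_def)
  then obtain m' where 1: "\<And>z. z \<in> \<Omega> \<Longrightarrow> (m has_derivative m' z) (at z)"
    and "\<forall>v. Ck_on (Suc 0) (\<lambda>z. m' z v) \<Omega>" unfolding Ck_on.simps(2)[of "Suc 0"] by blast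
  then have "\<forall>v. \<exists>m''. \<forall>z\<in>\<Omega>. ((\<lambda>z. m' z v) has_derivative m'' z) (at z)" by simp blast
  then obtain m'' where "\<And>v z. z \<in> \<Omega> \<Longrightarrow> ((\<lambda>z. m' z v) has_derivative m'' v z) (at z)" by metis
  with 1 that show ?thesis by blast
qed

text \<open>With one argument at the identity the group law is the identity map in the other, which
  gives both partial derivatives; linearity combines them.\<close>

lemma m_deriv_p0:
  assumes "(m has_derivative m') (at (p0, p0))" shows "m' (u, v) = u + v"
proof -
  have ev: "\<forall>\<^sub>F x in at p0. x \<in> \<phi> ` U"
    using open_S p0_S by (meson eventually_at_topological)
  have mm: "m (x, p0) = x" "m (p0, x) = x" if "x \<in> \<phi> ` U" for x
    using that by (auto simp: m_def)
  have "((\<lambda>x. m (x, p0)) has_derivative (\<lambda>u. m' (u, 0))) (at p0)"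
    by (rule has_derivative_compose[of "\<lambda>x. (x, p0)" _ p0 UNIV m, simplified])
      (auto intro!: derivative_eq_intros assms)
  moreover have "((\<lambda>x. m (x, p0)) has_derivative (\<lambda>u. u)) (at p0)"
    by (rule has_derivative_transform_eventually[OF has_derivative_ident eventually_mono[OF ev]])
      (simp_all add: mm p0_S)
  ultimately have 1: "m' (u, 0) = u" for u using has_derivative_unique by metis
  have "((\<lambda>x. m (p0, x)) has_derivative (\<lambda>u. m' (0, u))) (at p0)"
    by (rule has_derivative_compose[of "\<lambda>x. (p0, x)" _ p0 UNIV m, simplified])
      (auto intro!: derivative_eq_intros assms)
  moreover have "((\<lambda>x. m (p0, x)) has_derivative (\<lambda>u. u)) (at p0)"
    by (rule has_derivative_transform_eventually[OF has_derivative_ident eventually_mono[OF ev]])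
      (simp_all add: mm p0_S)
  ultimately have 2: "m' (0, u) = u" for u using has_derivative_unique by metis
  have "m' (u, v) = m' ((u, 0) + (0, v))" by simp
  also have "\<dots> = m' (u, 0) + m' (0, v)" using linear_add[OF has_derivative_linear[OF assms]] .
  finally show ?thesis using 1 2 by simp
qed

lemma product_curve_deriv:
  assumes c: "c 0 = \<one>" "d 0 = \<one>" "continuous_on UNIV c" "continuous_on UNIV d"
    and "((\<lambda>t. \<phi> (c t)) has_vector_derivative u) (at (0::real))"
    and "((\<lambda>t. \<phi> (d t)) has_vector_derivative v) (at 0)"
  shows "((\<lambda>t. \<phi> (c t \<otimes> d t)) has_vector_derivative u + v) (at 0)"
proof -
  obtain m' where m': "(m has_derivative m') (at (p0, p0))"
    using m_derivs p0_Omega by metis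
  have "((\<lambda>t. (\<phi> (c t), \<phi> (d t))) has_derivative (\<lambda>t. (t *\<^sub>R u, t *\<^sub>R v))) (at 0)"
    using assms by (intro has_derivative_Pair) (auto simp: has_vector_derivative_def)
  from has_derivative_compose[OF this, of m m'] m' c
  have 1: "((\<lambda>t. m (\<phi> (c t), \<phi> (d t))) has_derivative (\<lambda>t. t *\<^sub>R (u + v))) (at 0)"
    by (simp add: p0_def m_deriv_p0[OF m'] scaleR_add_right)
  have "\<forall>\<^sub>F t in at 0. c t \<in> U \<and> d t \<in> U"
  proof -
    have "open (c -` U \<inter> d -` U)" using assms open_U open_vimage by blast
    moreover have "0 \<in> c -` U \<inter> d -` U" using c one_U by simp
    ultimately show ?thesis unfolding eventually_at_topological by blast
  qed
  then have "((\<lambda>t. \<phi> (c t \<otimes> d t)) has_derivative (\<lambda>t. t *\<^sub>R (u + v))) (at 0)"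
    by (intro has_derivative_transform_eventually[OF 1])
      (use c one_U in \<open>auto simp: m_def elim!: eventually_mono\<close>)
  then show ?thesis by (simp add: has_vector_derivative_def)
qed

lemma smooth_on_deriv:
  assumes "smooth_on h Z" "z \<in> Z" obtains h' where "(h has_derivative h') (at z)"
proof -
  have "Ck_on (Suc 0) h Z" using assms by (simp add: smooth_on_def)
  then show ?thesis using assms(2) that by auto
qed

text \<open>The point \<open>g\<close> may lie outside the chart \<open>U\<close>. Conjugation is
  therefore split into left multiplication by \<open>g\<close>, ending in a chart around
  \<open>g\<close>, and right multiplication by \<open>inv g\<close>, returning to
  \<open>U\<close>.\<close>

lemma conj_deriv: "\<exists>K. ((\<lambda>x. \<phi> (g \<otimes> \<psi> x \<otimes> inv g)) has_derivative K) (at p0)"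
proof -
  obtain V \<kappa> where V: "(V, \<kappa>) \<in> \<A>" "g \<in> V" by (rule chart_at)
  obtain V' \<kappa>' where V': "(V', \<kappa>') \<in> \<A>" "inv g \<in> V'" by (rule chart_at)
  let ?i = "inv_into V \<kappa>" and ?i' = "inv_into V' \<kappa>'"
  have ik: "?i (\<kappa> x) = x" if "x \<in> V" for x
  proof -
    have "homeomorphism V (\<kappa> ` V) \<kappa> ?i" using atlas V unfolding smooth_atlas_def by fast
    then show ?thesis using that by (simp add: homeomorphism_def)
  qed
  have ik': "?i' (\<kappa>' x) = x" if "x \<in> V'" for x
  proof -
    have "homeomorphism V' (\<kappa>' ` V') \<kappa>' ?i'" using atlas V' unfolding smooth_atlas_def by fast
    then show ?thesis using that by (simp add: homeomorphism_def)
  qed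
  have openV: "open V" using atlas V unfolding smooth_atlas_def by fast
  define a where "a = (\<lambda>(x, y). \<kappa> (?i x \<otimes> \<psi> y))"
  define b where "b = (\<lambda>(x, y). \<phi> (?i x \<otimes> ?i' y))"
  have "smooth_on a {(x, y). x \<in> \<kappa> ` V \<and> y \<in> \<phi> ` U \<and> ?i x \<otimes> \<psi> y \<in> V}"
    using lg V chart unfolding lie_group_def a_def \<psi>_def by fast
  moreover have "(\<kappa> g, p0) \<in> {(x, y). x \<in> \<kappa> ` V \<and> y \<in> \<phi> ` U \<and> ?i x \<otimes> \<psi> y \<in> V}"
    using V p0_S by (simp add: ik)
  ultimately obtain a' where a': "(a has_derivative a') (at (\<kappa> g, p0))"
    by (rule smooth_on_deriv)
  have "smooth_on b {(x, y). x \<in> \<kappa> ` V \<and> y \<in> \<kappa>' ` V' \<and> ?i x \<otimes> ?i' y \<in> U}"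
    using lg V V' chart unfolding lie_group_def b_def by fast
  moreover have "(\<kappa> g, \<kappa>' (inv g)) \<in> {(x, y). x \<in> \<kappa> ` V \<and> y \<in> \<kappa>' ` V' \<and> ?i x \<otimes> ?i' y \<in> U}"
    using V V' one_U by (simp add: ik ik')
  ultimately obtain b' where b': "(b has_derivative b') (at (\<kappa> g, \<kappa>' (inv g)))"
    by (rule smooth_on_deriv)
  have 1: "((\<lambda>x. a (\<kappa> g, x)) has_derivative (\<lambda>u. a' (0, u))) (at p0)"
    by (rule has_derivative_compose[of "\<lambda>x. (\<kappa> g, x)" _ p0 UNIV a, simplified])
      (auto intro!: derivative_eq_intros a')
  have 2: "((\<lambda>x. b (x, \<kappa>' (inv g))) has_derivative (\<lambda>u. b' (u, 0))) (at (\<kappa> g))"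
    by (rule has_derivative_compose[of "\<lambda>x. (x, \<kappa>' (inv g))" _ "\<kappa> g" UNIV b, simplified])
      (auto intro!: derivative_eq_intros b')
  have "a (\<kappa> g, p0) = \<kappa> g" using V by (simp add: a_def ik)
  with has_derivative_compose[OF 1, of "\<lambda>x. b (x, \<kappa>' (inv g))"] 2
  have 3: "((\<lambda>x. b (a (\<kappa> g, x), \<kappa>' (inv g))) has_derivative (\<lambda>u. b' (a' (0, u), 0))) (at p0)"
    by simp
  have "open (\<phi> ` U \<inter> \<psi> -` ((\<lambda>y. g \<otimes> y) -` V))"
    by (intro continuous_open_preimage open_S open_vimage openV continuous_mult continuous_intros)
      (use homeo in \<open>simp add: homeomorphism_def\<close>)
  moreover have "p0 \<in> \<phi> ` U \<inter> \<psi> -` ((\<lambda>y. g \<otimes> y) -` V)" using V p0_S by simp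
  ultimately have "\<forall>\<^sub>F x in at p0. x \<in> \<phi> ` U \<inter> \<psi> -` ((\<lambda>y. g \<otimes> y) -` V)"
    unfolding eventually_at_topological by blast
  then have "((\<lambda>x. \<phi> (g \<otimes> \<psi> x \<otimes> inv g)) has_derivative (\<lambda>u. b' (a' (0, u), 0))) (at p0)"
    by (intro has_derivative_transform_eventually[OF 3])
      (use V V' in \<open>auto simp: a_def b_def ik ik' elim!: eventually_mono\<close>)
  then show ?thesis by blast
qed

text \<open>The conjugated curve is again a one-parameter subgroup, and its velocity is the image of
  \<open>D Y\<close> under the derivative of conjugation. Linearity of the generator in
  \<open>Y\<close> is inherited from that derivative.\<close>

lemma Ad_linear_ex: "\<exists>L. linear L \<and> (\<forall>Y t. g \<otimes> e (t *\<^sub>R Y) \<otimes> inv g = e (t *\<^sub>R L Y))"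
proof -
  obtain K where K: "((\<lambda>x. \<phi> (g \<otimes> \<psi> x \<otimes> inv g)) has_derivative K) (at p0)"
    using conj_deriv by blast
  have lK: "linear K" using K has_derivative_linear by blast
  show ?thesis
  proof (intro exI[of _ "\<lambda>Y. iD (K (D Y))"] conjI allI)
    show "linear (\<lambda>Y. iD (K (D Y)))"
      using linear_compose[OF linear_compose[OF linear_D lK] linear_iD] by (simp add: comp_def)
    fix Y t
    show "g \<otimes> e (t *\<^sub>R Y) \<otimes> inv g = e (t *\<^sub>R iD (K (D Y)))"
    proof (rule one_param)
      show "g \<otimes> e ((s + t) *\<^sub>R Y) \<otimes> inv g = g \<otimes> e (s *\<^sub>R Y) \<otimes> inv g \<otimes> (g \<otimes> e (t *\<^sub>R Y) \<otimes> inv g)" for s t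
        unfolding e_add by (simp add: m_assoc)
      show "continuous_on UNIV (\<lambda>t. g \<otimes> e (t *\<^sub>R Y) \<otimes> inv g)"
        by (intro continuous_mult continuous_e continuous_intros)
      have 1: "((\<lambda>t. \<phi> (e (t *\<^sub>R Y))) has_derivative (\<lambda>t. t *\<^sub>R D Y)) (at 0)"
        using f_curve_deriv by (simp add: has_vector_derivative_def)
      have 2: "((\<lambda>x. \<phi> (g \<otimes> \<psi> x \<otimes> inv g)) has_derivative K) (at (\<phi> (e (0 *\<^sub>R Y))))"
        using K by (simp add: p0_def)
      have 3: "((\<lambda>t. \<phi> (g \<otimes> \<psi> (\<phi> (e (t *\<^sub>R Y))) \<otimes> inv g)) has_derivative (\<lambda>t. t *\<^sub>R K (D Y))) (at 0)"
        using has_derivative_compose[OF 1 2] by (simp add: linear_scale[OF lK])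
      have "open ((\<lambda>t. e (t *\<^sub>R Y)) -` U)"
        by (intro open_vimage open_U continuous_e continuous_intros)
      moreover have "(0::real) \<in> (\<lambda>t. e (t *\<^sub>R Y)) -` U" using one_U by simp
      ultimately have "\<forall>\<^sub>F t in at 0. e (t *\<^sub>R Y) \<in> U" unfolding eventually_at_topological by blast
      then have "((\<lambda>t. \<phi> (g \<otimes> e (t *\<^sub>R Y) \<otimes> inv g)) has_derivative (\<lambda>t. t *\<^sub>R K (D Y))) (at 0)"
        by (intro has_derivative_transform_eventually[OF 3])
          (use one_U in \<open>auto elim!: eventually_mono\<close>)
      then show "((\<lambda>t. \<phi> (g \<otimes> e (t *\<^sub>R Y) \<otimes> inv g)) has_vector_derivative D (iD (K (D Y)))) (at 0)"
        by (simp add: has_vector_derivative_def)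
    qed
  qed
qed

lemma Ad_eqI:
  assumes "\<And>t. g \<otimes> e (t *\<^sub>R Y) \<otimes> inv g = e (t *\<^sub>R Z)" shows "Ad G e g Y = Z"
  unfolding Ad_def
proof (rule the_equality)
  fix Z' assume "\<forall>t. g \<otimes> e (t *\<^sub>R Y) \<otimes> inv g = e (t *\<^sub>R Z')"
  then show "Z' = Z" using e_direction_unique assms by metis
qed (use assms in simp)

lemma Ad_linear: "linear (Ad G e g)" and Ad_conj: "g \<otimes> e (t *\<^sub>R Y) \<otimes> inv g = e (t *\<^sub>R Ad G e g Y)"
proof -
  obtain L where L: "linear L" "\<And>Y t. g \<otimes> e (t *\<^sub>R Y) \<otimes> inv g = e (t *\<^sub>R L Y)"
    using Ad_linear_ex by blast
  have "Ad G e g = L" using Ad_eqI L(2) by blast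
  with L show "linear (Ad G e g)" "g \<otimes> e (t *\<^sub>R Y) \<otimes> inv g = e (t *\<^sub>R Ad G e g Y)" by auto
qed

lemma Ad_mult: "Ad G e (g \<otimes> h) Y = Ad G e g (Ad G e h Y)"
proof (rule Ad_eqI)
  fix t
  have "g \<otimes> h \<otimes> e (t *\<^sub>R Y) \<otimes> inv (g \<otimes> h) = g \<otimes> (h \<otimes> e (t *\<^sub>R Y) \<otimes> inv h) \<otimes> inv g"
    by (simp add: m_assoc inv_mult_group)
  then show "g \<otimes> h \<otimes> e (t *\<^sub>R Y) \<otimes> inv (g \<otimes> h) = e (t *\<^sub>R Ad G e g (Ad G e h Y))"
    by (simp add: Ad_conj)
qed

lemma Ad_one: "Ad G e \<one> Y = Y"
  by (rule Ad_eqI) simp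

text \<open>\<open>bracket\<close> is a \<open>vector_derivative\<close>, so it has its meaning only
  if this derivative exists. In the chart \<open>Ad\<close> consists of partial derivatives of the
  group law at points moving with \<open>t\<close>, and these are differentiable in \<open>t\<close>
  because the group law is twice differentiable.\<close>

lemma Ad_deriv_ex: "\<exists>L. ((\<lambda>t. Ad G e (e (t *\<^sub>R X)) Y) has_vector_derivative L) (at 0)"
proof -
  obtain m' m'' where m': "\<And>z. z \<in> \<Omega> \<Longrightarrow> (m has_derivative m' z) (at z)"
    and m'': "\<And>v z. z \<in> \<Omega> \<Longrightarrow> ((\<lambda>z. m' z v) has_derivative m'' v z) (at z)"
    by (rule m_derivs) blast
  define a where "a t = f (t *\<^sub>R X)" for t :: real
  define w where "w t = m' (a t, p0) (0, D Y)" for t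
  define K where "K t = m' (a t, a (- t)) (w t, 0)" for t
  have eU: "\<forall>\<^sub>F t in at 0. e (t *\<^sub>R Z) \<in> U" for Z
  proof -
    have "open ((\<lambda>t. e (t *\<^sub>R Z)) -` U)"
      by (intro open_vimage open_U continuous_e continuous_intros)
    moreover have "(0::real) \<in> (\<lambda>t. e (t *\<^sub>R Z)) -` U" using one_U by simp
    ultimately show ?thesis unfolding eventually_at_topological by blast
  qed
  \<comment> \<open>Conjugation is two multiplications: the second argument of \<open>m\<close> is
    differentiated at \<open>(a t, p0)\<close>, then the first argument at
    \<open>(a t, a (- t))\<close>.\<close>
  have KAd: "D (Ad G e (e (t *\<^sub>R X)) Y) = K t"
    if t: "e (t *\<^sub>R X) \<in> U" "e ((- t) *\<^sub>R X) \<in> U" for t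
  proof -
    let ?g = "e (t *\<^sub>R X)"
    have inv: "inv ?g = e ((- t) *\<^sub>R X)" by (simp add: e_minus[symmetric])
    have at: "a t \<in> \<phi> ` U" "a (- t) \<in> \<phi> ` U" "\<psi> (a t) = ?g" "\<psi> (a (- t)) = inv ?g"
      using t inv by (auto simp: a_def f_def)
    have O1: "(a t, p0) \<in> \<Omega>" using at t p0_S by (simp add: \<Omega>_def)
    have O2: "(a t, a (- t)) \<in> \<Omega>" using at one_U by (simp add: \<Omega>_def)
    have b: "((\<lambda>s. f (s *\<^sub>R Y)) has_derivative (\<lambda>s. s *\<^sub>R D Y)) (at 0)"
      using f_curve_deriv by (simp add: has_vector_derivative_def f_def)
    have "((\<lambda>s. (a t, f (s *\<^sub>R Y))) has_derivative (\<lambda>s. (0, s *\<^sub>R D Y))) (at 0)"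
      by (intro has_derivative_Pair b has_derivative_const)
    from has_derivative_compose[OF this, of m "m' (a t, p0)"] m'[OF O1]
    have 1: "((\<lambda>s. m (a t, f (s *\<^sub>R Y))) has_derivative (\<lambda>s. m' (a t, p0) (0, s *\<^sub>R D Y))) (at 0)"
      by (simp add: f_0)
    have ma: "m (a t, p0) = a t" using at by (simp add: m_def) (simp add: a_def f_def)
    have "((\<lambda>s. (m (a t, f (s *\<^sub>R Y)), a (- t))) has_derivative (\<lambda>s. (m' (a t, p0) (0, s *\<^sub>R D Y), 0))) (at 0)"
      by (intro has_derivative_Pair 1 has_derivative_const)
    from has_derivative_compose[OF this, of m "m' (a t, a (- t))"] m'[OF O2]
    have 2: "((\<lambda>s. m (m (a t, f (s *\<^sub>R Y)), a (- t))) has_derivative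
        (\<lambda>s. m' (a t, a (- t)) (m' (a t, p0) (0, s *\<^sub>R D Y), 0))) (at 0)"
      by (simp add: f_0 ma)
    have "open ((\<lambda>s. ?g \<otimes> e (s *\<^sub>R Y)) -` U)"
      by (intro open_vimage open_U continuous_mult continuous_e continuous_intros)
    moreover have "(0::real) \<in> (\<lambda>s. ?g \<otimes> e (s *\<^sub>R Y)) -` U" using t by simp
    ultimately have "\<forall>\<^sub>F s in at 0. ?g \<otimes> e (s *\<^sub>R Y) \<in> U" unfolding eventually_at_topological by blast
    with eU[of Y] have ev: "\<forall>\<^sub>F s in at 0. ?g \<otimes> e (s *\<^sub>R Y) \<in> U \<and> e (s *\<^sub>R Y) \<in> U"
      by (simp add: eventually_conj)
    have "((\<lambda>s. \<phi> (?g \<otimes> e (s *\<^sub>R Y) \<otimes> inv ?g)) has_derivative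
        (\<lambda>s. m' (a t, a (- t)) (m' (a t, p0) (0, s *\<^sub>R D Y), 0))) (at 0)"
      by (rule has_derivative_transform_eventually[OF 2])
        (use ev at t one_U in \<open>auto simp: m_def f_def elim!: eventually_mono\<close>)
    then have A: "((\<lambda>s. f (s *\<^sub>R Ad G e ?g Y)) has_derivative
        (\<lambda>s. m' (a t, a (- t)) (m' (a t, p0) (0, s *\<^sub>R D Y), 0))) (at 0)"
      by (simp add: Ad_conj f_def)
    have B: "((\<lambda>s. f (s *\<^sub>R Ad G e ?g Y)) has_derivative (\<lambda>s. s *\<^sub>R D (Ad G e ?g Y))) (at 0)"
      using f_curve_deriv by (simp add: has_vector_derivative_def f_def)
    from has_derivative_unique[OF A B] show ?thesis
      by (auto simp: K_def w_def fun_eq_iff dest: spec[of _ 1])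
  qed
  have a_der: "(a has_derivative (\<lambda>t. t *\<^sub>R D X)) (at 0)"
    using f_curve_deriv by (simp add: has_vector_derivative_def f_def a_def[abs_def])
  have am_der: "((\<lambda>t. a (- t)) has_derivative (\<lambda>t. (- t) *\<^sub>R D X)) (at 0)"
  proof -
    have "((\<lambda>t::real. - t) has_derivative (\<lambda>t. - t)) (at 0)" by (auto intro!: derivative_eq_intros)
    from has_derivative_compose[OF this, of a "\<lambda>t. t *\<^sub>R D X"] a_der show ?thesis by simp
  qed
  have a0: "a 0 = p0" by (simp add: a_def f_0)
  have d1: "(\<lambda>t. m' (a t, p0) v) differentiable (at 0)" for v
  proof -
    have "((\<lambda>t. (a t, p0)) has_derivative (\<lambda>t. (t *\<^sub>R D X, 0))) (at 0)"
      by (intro has_derivative_Pair a_der has_derivative_const)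
    from has_derivative_compose[OF this, of "\<lambda>z. m' z v" "m'' v (p0, p0)"] m''[OF p0_Omega, of v] a0
    show ?thesis unfolding differentiable_def by auto
  qed
  have d2: "(\<lambda>t. m' (a t, a (- t)) v) differentiable (at 0)" for v
  proof -
    have "((\<lambda>t. (a t, a (- t))) has_derivative (\<lambda>t. (t *\<^sub>R D X, (- t) *\<^sub>R D X))) (at 0)"
      by (intro has_derivative_Pair a_der am_der)
    from has_derivative_compose[OF this, of "\<lambda>z. m' z v" "m'' v (p0, p0)"] m''[OF p0_Omega, of v] a0
    show ?thesis unfolding differentiable_def by auto
  qed
  have wd: "w differentiable (at 0)" unfolding w_def[abs_def] by (rule d1)
  \<comment> \<open>In \<open>K t\<close> both the linear map and its argument depend on
    \<open>t\<close>, whereas \<open>m''\<close> differentiates \<open>m'\<close> in fixed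
    directions only. Expanding the argument in the basis leaves products of differentiable
    functions.\<close>
  have Kdiff: "(\<lambda>t. \<Sum>i\<in>Basis. (w t \<bullet> i) *\<^sub>R m' (a t, a (- t)) (i, 0)) differentiable (at 0)"
    using wd d2
    by (intro differentiable_sum differentiable_scaleR differentiable_inner) auto
  have Ksum: "K t = (\<Sum>i\<in>Basis. (w t \<bullet> i) *\<^sub>R m' (a t, a (- t)) (i, 0))"
    if t: "e (t *\<^sub>R X) \<in> U" "e ((- t) *\<^sub>R X) \<in> U" for t
  proof -
    have "\<psi> (a t) \<otimes> \<psi> (a (- t)) = \<one>"
      using t by (simp add: a_def f_def e_minus)
    then have O2: "(a t, a (- t)) \<in> \<Omega>" using t one_U by (auto simp: \<Omega>_def a_def f_def)
    have lin: "linear (m' (a t, a (- t)))" using m'[OF O2] has_derivative_linear by blast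
    have "(w t, 0) = (\<Sum>i\<in>Basis. (w t \<bullet> i) *\<^sub>R (i, 0::'a))"
      by (simp add: prod_eq_iff fst_sum snd_sum euclidean_representation)
    then show ?thesis unfolding K_def
      by (simp only: linear_sum[OF lin] linear_scale[OF lin])
  qed
  obtain K' where K': "((\<lambda>t. \<Sum>i\<in>Basis. (w t \<bullet> i) *\<^sub>R m' (a t, a (- t)) (i, 0)) has_derivative K') (at 0)"
    using Kdiff unfolding differentiable_def by blast
  have blinv: "bounded_linear (iD)" using linear_iD by (simp add: linear_conv_bounded_linear)
  have eq: "Ad G e (e (t *\<^sub>R X)) Y = iD (\<Sum>i\<in>Basis. (w t \<bullet> i) *\<^sub>R m' (a t, a (- t)) (i, 0))"
    if t: "e (t *\<^sub>R X) \<in> U" "e ((- t) *\<^sub>R X) \<in> U" for t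
    using KAd[OF t] Ksum[OF t] by (metis iD(1))
  have ev: "\<forall>\<^sub>F t in at 0. e (t *\<^sub>R X) \<in> U \<and> e ((- t) *\<^sub>R X) \<in> U"
    using eventually_conj[OF eU[of X] eU[of "- X"]] by simp
  have "((\<lambda>t. Ad G e (e (t *\<^sub>R X)) Y) has_derivative (\<lambda>t. iD (K' t))) (at 0)"
  proof (rule has_derivative_transform_eventually[OF bounded_linear.has_derivative[OF blinv K']])
    show "\<forall>\<^sub>F t in at 0. iD (\<Sum>i\<in>Basis. (w t \<bullet> i) *\<^sub>R m' (a t, a (- t)) (i, 0)) = Ad G e (e (t *\<^sub>R X)) Y"
      using ev eq by (auto elim!: eventually_mono)
    show "iD (\<Sum>i\<in>Basis. (w 0 \<bullet> i) *\<^sub>R m' (a 0, a (- 0)) (i, 0)) = Ad G e (e (0 *\<^sub>R X)) Y"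
      by (rule eq[symmetric]) (simp_all add: one_U)
  qed simp
  then have "(\<lambda>t. Ad G e (e (t *\<^sub>R X)) Y) differentiable (at 0)" unfolding differentiable_def by blast
  then show ?thesis using vector_derivative_works by blast
qed

lemma bracket_deriv:
  "((\<lambda>t. Ad G e (e (t *\<^sub>R X)) Y) has_vector_derivative bracket G e X Y) (at 0)"
  unfolding bracket_def using Ad_deriv_ex vector_derivative_at by metis

text \<open>Commutation makes the product a homomorphism in \<open>t\<close>, and its velocity is
  the sum because the derivative of the group law at the identity is addition.\<close>

lemma product_one_param:
  assumes comm: "\<And>s t. e (s *\<^sub>R X) \<otimes> e (t *\<^sub>R Y) = e (t *\<^sub>R Y) \<otimes> e (s *\<^sub>R X)"
  shows "e (t *\<^sub>R X) \<otimes> e (t *\<^sub>R Y) = e (t *\<^sub>R (X + Y))"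
proof (rule one_param)
  fix s t
  show "e ((s + t) *\<^sub>R X) \<otimes> e ((s + t) *\<^sub>R Y) = e (s *\<^sub>R X) \<otimes> e (s *\<^sub>R Y) \<otimes> (e (t *\<^sub>R X) \<otimes> e (t *\<^sub>R Y))"
    unfolding e_add by (simp add: m_assoc) (metis UNIV_I carrier comm m_assoc)
next
  show "continuous_on UNIV (\<lambda>t. e (t *\<^sub>R X) \<otimes> e (t *\<^sub>R Y))"
    by (intro continuous_mult continuous_e continuous_intros)
  have "((\<lambda>t. \<phi> (e (t *\<^sub>R X) \<otimes> e (t *\<^sub>R Y))) has_vector_derivative (D X + D Y)) (at 0)"
    by (intro product_curve_deriv f_curve_deriv continuous_e continuous_intros) auto
  then show "((\<lambda>t. \<phi> (e (t *\<^sub>R X) \<otimes> e (t *\<^sub>R Y))) has_vector_derivative D (X + Y)) (at 0)"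
    by (simp add: linear_add[OF linear_D])
qed

end

section \<open>Flows of the adjoint action for nilpotent brackets\<close>

context lie_chart begin

lemma bracket_linear: "linear (bracket G e X)"
proof (rule linearI)
  fix Y Z :: 'a and c :: real
  have "((\<lambda>t. Ad G e (e (t *\<^sub>R X)) Y + Ad G e (e (t *\<^sub>R X)) Z) has_vector_derivative
      bracket G e X Y + bracket G e X Z) (at 0)"
    by (intro has_vector_derivative_add bracket_deriv)
  then show "bracket G e X (Y + Z) = bracket G e X Y + bracket G e X Z"
    using bracket_deriv[of X "Y + Z"]
    by (simp add: linear_add[OF Ad_linear] vector_derivative_unique_at)
  have "((\<lambda>t. c *\<^sub>R Ad G e (e (t *\<^sub>R X)) Y) has_vector_derivative c *\<^sub>R bracket G e X Y) (at 0)"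
    using bounded_linear.has_vector_derivative[OF bounded_linear_scaleR_right bracket_deriv] .
  then show "bracket G e X (c *\<^sub>R Y) = c *\<^sub>R bracket G e X Y"
    using bracket_deriv[of X "c *\<^sub>R Y"]
    by (simp add: linear_scale[OF Ad_linear] vector_derivative_unique_at)
qed

text \<open>The derivative at 0 is transported to \<open>t\<close> by writing the flow at time
  \<open>s\<close> as the flow at \<open>t\<close> after the flow at \<open>s - t\<close>.\<close>

lemma Ad_flow_deriv:
  "((\<lambda>t. Ad G e (e (t *\<^sub>R X)) Y) has_vector_derivative Ad G e (e (t *\<^sub>R X)) (bracket G e X Y)) (at t)"
proof -
  have bl: "bounded_linear (Ad G e (e (t *\<^sub>R X)))"
    using Ad_linear by (simp add: linear_conv_bounded_linear)
  have 0: "((\<lambda>h. Ad G e (e (h *\<^sub>R X)) Y) has_vector_derivative bracket G e X Y) (at (t - t))"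
    using bracket_deriv by simp
  have 1: "((\<lambda>s. s - t) has_vector_derivative 1) (at t)"
    by (auto intro!: derivative_eq_intros simp: has_vector_derivative_def)
  have 2: "((\<lambda>s. Ad G e (e ((s - t) *\<^sub>R X)) Y) has_vector_derivative bracket G e X Y) (at t)"
    using vector_diff_chain_at[OF 1 0] by (simp add: comp_def)
  have "Ad G e (e (t *\<^sub>R X)) (Ad G e (e ((s - t) *\<^sub>R X)) Y) = Ad G e (e (s *\<^sub>R X)) Y" for s
    using e_add[of t "s - t" X] by (simp add: Ad_mult[symmetric])
  with bounded_linear.has_vector_derivative[OF bl 2] show ?thesis by simp
qed

lemma vector_derivative_eq_unique:
  fixes u v :: "real \<Rightarrow> 'b::real_normed_vector"
  assumes "\<And>t. (u has_vector_derivative w t) (at t)" "\<And>t. (v has_vector_derivative w t) (at t)"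
    and "u 0 = v 0"
  shows "u t = v t"
proof -
  have "((\<lambda>t. u t - v t) has_derivative (\<lambda>h. 0)) (at t)" for t
    using has_vector_derivative_diff[OF assms(1,2), of t] by (simp add: has_vector_derivative_def)
  then have "\<exists>c. \<forall>t. u t - v t = c"
    using has_derivative_zero_constant[of UNIV "\<lambda>t. u t - v t"] by auto
  then obtain c where "\<And>t. u t - v t = c" by blast
  then show ?thesis using assms(3) by (metis diff_self eq_iff_diff_eq_0)
qed

text \<open>Differentiation shifts the coefficients of a truncated exponential series. They are left
  arbitrary so that the series for \<open>Ad\<close> and the one for its primitive are both
  covered.\<close>

lemma pow_sum_deriv:
  fixes q :: "nat \<Rightarrow> 'b::real_normed_vector"
  shows "((\<lambda>t. \<Sum>k<Suc n. (t ^ k / fact k) *\<^sub>R q k) has_vector_derivative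
     (\<Sum>k<n. (t ^ k / fact k) *\<^sub>R q (Suc k))) (at t)"
proof -
  have d: "((\<lambda>t. t ^ Suc k / fact (Suc k)) has_real_derivative t ^ k / fact k) (at t)" for k and t :: real
  proof -
    have "((\<lambda>t. t ^ Suc k / fact (Suc k)) has_real_derivative (real (Suc k) * t ^ k) / fact (Suc k)) (at t)"
      using DERIV_cdivide[OF DERIV_pow[of "Suc k" t], of "fact (Suc k)"] by simp
    moreover have "(real (Suc k) * t ^ k) / fact (Suc k) = t ^ k / fact k"
      by (simp add: field_simps del: of_nat_Suc)
    ultimately show ?thesis by simp
  qed
  have "((\<lambda>t. q 0 + (\<Sum>k<n. (t ^ Suc k / fact (Suc k)) *\<^sub>R q (Suc k))) has_vector_derivative
     0 + (\<Sum>k<n. (t ^ k / fact k) *\<^sub>R q (Suc k))) (at t)"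
  proof (intro has_vector_derivative_add has_vector_derivative_const has_vector_derivative_sum)
    fix k
    show "((\<lambda>t. (t ^ Suc k / fact (Suc k)) *\<^sub>R q (Suc k)) has_vector_derivative (t ^ k / fact k) *\<^sub>R q (Suc k)) (at t)"
      using has_vector_derivative_scaleR[OF d[of k t] has_vector_derivative_const[of "q (Suc k)"]] by simp
  qed
  then show ?thesis by (simp add: sum.lessThan_Suc_shift del: sum.lessThan_Suc fact_Suc power_Suc) 
qed

text \<open>Induction on the nilpotency order of \<open>Y\<close>: the derivative of the flow is the
  flow of \<open>bracket G e X Y\<close>, which has order one less, and the two sides agree at time
  0.\<close>

lemma Ad_nilpotent_flow:
  "(bracket G e X ^^ n) Y = 0 \<Longrightarrow>
    Ad G e (e (t *\<^sub>R X)) Y = (\<Sum>k<n. (t ^ k / fact k) *\<^sub>R (bracket G e X ^^ k) Y)"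
proof (induction n arbitrary: Y t)
  case 0
  then show ?case using linear_0[OF Ad_linear] by simp
next
  case (Suc n)
  let ?d = "bracket G e X"
  have "(?d ^^ n) (?d Y) = 0" using Suc.prems by (simp add: funpow_swap1)
  then have "((\<lambda>t. Ad G e (e (t *\<^sub>R X)) Y) has_vector_derivative
      (\<Sum>k<n. (t ^ k / fact k) *\<^sub>R (?d ^^ k) (?d Y))) (at t)" for t
    using Ad_flow_deriv[of X Y t] Suc.IH by simp
  moreover have "((\<lambda>t. \<Sum>k<Suc n. (t ^ k / fact k) *\<^sub>R (?d ^^ k) Y) has_vector_derivative
      (\<Sum>k<n. (t ^ k / fact k) *\<^sub>R (?d ^^ k) (?d Y))) (at t)" for t
    using pow_sum_deriv[where n=n and t=t and q="\<lambda>k. (?d ^^ k) Y"] by (simp add: funpow_swap1)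
  moreover have "Ad G e (e (0 *\<^sub>R X)) Y = (\<Sum>k<Suc n. (0 ^ k / fact k) *\<^sub>R (?d ^^ k) Y)"
    by (simp add: Ad_one sum.lessThan_Suc_shift del: sum.lessThan_Suc)
  ultimately show ?case
    by (rule vector_derivative_eq_unique[where u="\<lambda>t. Ad G e (e (t *\<^sub>R X)) Y"])
qed

lemma f_curve_deriv':
  assumes "(\<gamma> has_vector_derivative z) (at 0)" "\<gamma> 0 = 0"
  shows "((\<lambda>t. \<phi> (e (\<gamma> t))) has_vector_derivative D z) (at (0::real))"
proof -
  have "(\<gamma> has_derivative (\<lambda>t. t *\<^sub>R z)) (at 0)" using assms by (simp add: has_vector_derivative_def)
  from has_derivative_compose[OF this, of f D] D(1) assms(2)
  show ?thesis by (simp add: f_def has_vector_derivative_def linear_scale[OF linear_D])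
qed

end

subsection \<open>Semidirect product coordinates\<close>

text \<open>The abelian ideal of codimension one is encoded as the kernel of \<open>\<tau>\<close>,
  and \<open>T\<close> spans a complement; \<open>\<pi>\<close> below is the projection onto the
  ideal along \<open>T\<close>.\<close>

locale metabelian = lie_chart G \<A> e U \<phi>
  for G :: "'g::t2_space monoid" (structure)
    and \<A> :: "('g, 'a::euclidean_space) chart set" and e :: "'a \<Rightarrow> 'g"
    and U :: "'g set" and \<phi> :: "'g \<Rightarrow> 'a" +
  fixes \<tau> :: "'a \<Rightarrow> real" and T :: 'a and N :: nat
  assumes linear_tau: "linear \<tau>" and tau_T [simp]: "\<tau> T = 1"
    and abelian: "\<tau> x = 0 \<Longrightarrow> \<tau> y = 0 \<Longrightarrow> bracket G e x y = 0"
    and ideal: "\<tau> y = 0 \<Longrightarrow> \<tau> (bracket G e x y) = 0"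
    and nilpotent: "(bracket G e x ^^ N) y = 0"
    and conn: "connected (UNIV :: 'g set)" and sc: "simply_connected (UNIV :: 'g set)"
begin

definition "\<pi> v = v - \<tau> v *\<^sub>R T"

abbreviation d :: "'a \<Rightarrow> 'a" where "d \<equiv> bracket G e T"

lemmas tau_simps [simp] = linear_add[OF linear_tau] linear_diff[OF linear_tau] linear_neg[OF linear_tau]
  linear_scale[OF linear_tau] linear_0[OF linear_tau] linear_sum[OF linear_tau]

lemma N_pos: "N > 0"
proof (rule ccontr)
  assume "\<not> N > 0"
  then have "T = 0" using nilpotent[of T T] by simp
  then show False using tau_T by (metis linear_0 linear_tau zero_neq_one)
qed

lemma pi_props [simp]: "\<tau> (\<pi> v) = 0" "\<pi> T = 0" "\<tau> x = 0 \<Longrightarrow> \<pi> x = x"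
  "\<pi> (v + w) = \<pi> v + \<pi> w" "\<pi> (v - w) = \<pi> v - \<pi> w" "\<pi> (c *\<^sub>R v) = c *\<^sub>R \<pi> v" "\<pi> 0 = 0"
  by (simp_all add: \<pi>_def algebra_simps)

lemma pi_tau: "v = \<pi> v + \<tau> v *\<^sub>R T" by (simp add: \<pi>_def)

lemma pi_tau_eqI: "\<pi> v = \<pi> w \<Longrightarrow> \<tau> v = \<tau> w \<Longrightarrow> v = w"
  unfolding \<pi>_def by simp

lemma continuous_tau: "continuous_on S g \<Longrightarrow> continuous_on S (\<lambda>x. \<tau> (g x))"
  by (rule bounded_linear.continuous_on[OF linear_tau[unfolded linear_conv_bounded_linear]])

lemma continuous_pi: "continuous_on S g \<Longrightarrow> continuous_on S (\<lambda>x. \<pi> (g x))"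
  unfolding \<pi>_def by (intro continuous_intros continuous_tau)

text \<open>Antisymmetry of the bracket has not been established at this point. The claim comes from
  the commutativity of the subgroup \<open>e (t *\<^sub>R T)\<close>, on which \<open>Ad\<close> is
  constant.\<close>

lemma d_T [simp]: "d T = 0"
proof -
  have "Ad G e (e (t *\<^sub>R T)) T = T" for t
  proof (rule Ad_eqI)
    fix s
    have "e (t *\<^sub>R T) \<otimes> e (s *\<^sub>R T) = e (s *\<^sub>R T) \<otimes> e (t *\<^sub>R T)"
      by (metis e_add add.commute)
    then show "e (t *\<^sub>R T) \<otimes> e (s *\<^sub>R T) \<otimes> inv e (t *\<^sub>R T) = e (s *\<^sub>R T)"
      by (simp add: m_assoc)
  qed
  then have "((\<lambda>t. T) has_vector_derivative d T) (at 0)" using bracket_deriv[of T T] by simp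
  then show ?thesis using has_vector_derivative_const vector_derivative_unique_at by metis
qed

lemma linear_dk: "linear (d ^^ k)"
proof (induction k)
  case (Suc k)
  then show ?case using linear_compose[OF Suc bracket_linear[of T]] by (simp add: comp_def)
qed (simp add: linear_ident)

lemmas dk_simps = linear_add[OF linear_dk] linear_diff[OF linear_dk] linear_scale[OF linear_dk]
  linear_0[OF linear_dk] linear_neg[OF linear_dk]
lemmas d_simps = linear_add[OF bracket_linear] linear_diff[OF bracket_linear]
  linear_scale[OF bracket_linear] linear_0[OF bracket_linear] linear_neg[OF bracket_linear]

lemma tau_d [simp]: "\<tau> (d v) = 0"
proof -
  have "d v = d (\<pi> v)" using arg_cong[OF pi_tau[of v], of d] by (simp add: d_simps)
  then show ?thesis using ideal[of "\<pi> v" T] by simp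
qed

lemma tau_dk: "\<tau> v = 0 \<Longrightarrow> \<tau> ((d ^^ k) v) = 0"
  by (induction k) auto

lemma continuous_dk: "continuous_on S g \<Longrightarrow> continuous_on S (\<lambda>x. (d ^^ k) (g x))"
  by (rule bounded_linear.continuous_on[OF linear_dk[unfolded linear_conv_bounded_linear]])

text \<open>\<open>A t = exp (t d)\<close> and \<open>B t = (exp (t d) - 1) / (t d)\<close>.\<close>

definition "A t v = (\<Sum>k<N. (t ^ k / fact k) *\<^sub>R (d ^^ k) v)" for t :: real
definition "B t v = (\<Sum>k<N. (t ^ k / fact (Suc k)) *\<^sub>R (d ^^ k) v)" for t :: real

lemma A_Ad: "Ad G e (e (t *\<^sub>R T)) v = A t v"
  unfolding A_def by (rule Ad_nilpotent_flow) (rule nilpotent)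

lemma A_linear: "linear (A t)" using Ad_linear[of "e (t *\<^sub>R T)"] by (simp add: A_Ad[abs_def])

lemma B_linear: "linear (B t)"
  unfolding B_def by (rule linearI) (simp_all add: dk_simps scaleR_add_right sum.distrib scaleR_sum_right mult.commute)

lemmas A_simps = linear_add[OF A_linear] linear_diff[OF A_linear] linear_scale[OF A_linear]
  linear_0[OF A_linear] linear_neg[OF A_linear] linear_sum[OF A_linear]
lemmas B_simps = linear_add[OF B_linear] linear_diff[OF B_linear] linear_scale[OF B_linear]
  linear_0[OF B_linear] linear_neg[OF B_linear]

lemma A_add: "A (s + t) v = A s (A t v)"
  using e_add[of s t T] by (simp add: A_Ad[symmetric] Ad_mult)

lemma A_0 [simp]: "A 0 v = v"
  using A_Ad[of 0 v] by (simp add: Ad_one)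

lemma A_cancel [simp]: "A t (A (- t) v) = v" "A (- t) (A t v) = v"
  by (simp_all add: A_add[symmetric])

lemma tau_A: "\<tau> x = 0 \<Longrightarrow> \<tau> (A t x) = 0"
  unfolding A_def by (simp add: tau_dk)

lemma continuous_A:
  "continuous_on S a \<Longrightarrow> continuous_on S b \<Longrightarrow> continuous_on S (\<lambda>x. A (a x) (b x))"
  unfolding A_def by (intro continuous_intros continuous_dk) auto

lemma continuous_B:
  "continuous_on S a \<Longrightarrow> continuous_on S b \<Longrightarrow> continuous_on S (\<lambda>x. B (a x) (b x))"
  unfolding B_def by (intro continuous_intros continuous_dk) auto

lemma A_deriv: "((\<lambda>t. A t v) has_vector_derivative A t (d v)) (at t)"
  using Ad_flow_deriv[of T v t] by (simp add: A_Ad)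

lemma d_A: "d (A t v) = A t (d v)"
  unfolding A_def by (simp add: linear_sum[OF bracket_linear] d_simps funpow_swap1)

text \<open>\<open>t *\<^sub>R B t v\<close> is the primitive of \<open>A t v\<close> vanishing at
  0. The series of \<open>A\<close>, shifted by one place, is the series of this product, so no
  division by \<open>t\<close> occurs.\<close>

lemma tB_deriv: "((\<lambda>t. t *\<^sub>R B t v) has_vector_derivative A t v) (at t)"
proof -
  have "((\<lambda>t. \<Sum>k<Suc N. (t ^ k / fact k) *\<^sub>R (case k of 0 \<Rightarrow> 0 | Suc j \<Rightarrow> (d ^^ j) v)) has_vector_derivative
      A t v) (at t)"
    using pow_sum_deriv[where n=N and t=t and q="\<lambda>k. case k of 0 \<Rightarrow> 0 | Suc j \<Rightarrow> (d ^^ j) v"] by (simp add: A_def)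
  moreover have "(\<Sum>k<Suc N. (t ^ k / fact k) *\<^sub>R (case k of 0 \<Rightarrow> 0 | Suc j \<Rightarrow> (d ^^ j) v)) = t *\<^sub>R B t v" for t
    by (simp add: sum.lessThan_Suc_shift B_def scaleR_sum_right del: sum.lessThan_Suc fact_Suc)
  ultimately show ?thesis by simp
qed

text \<open>The integral of \<open>A\<close> over an interval of length \<open>s + t\<close>, split
  at \<open>s\<close>. This cocycle identity is what makes \<open>e\<close> a homomorphism along
  lines in the coordinates of \<open>P\<close>.\<close>

lemma tB_add: "(s + t) *\<^sub>R B (s + t) v = s *\<^sub>R B s v + A s (t *\<^sub>R B t v)"
proof (rule vector_derivative_eq_unique[where w="\<lambda>t. A (s + t) v" and t=t])
  fix t
  have 1: "((\<lambda>t. s + t) has_vector_derivative 1) (at t)"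
    by (auto intro!: derivative_eq_intros simp: has_vector_derivative_def)
  show "((\<lambda>t. (s + t) *\<^sub>R B (s + t) v) has_vector_derivative A (s + t) v) (at t)"
    using vector_diff_chain_at[OF 1 tB_deriv[of v "s + t"]] by (simp add: comp_def)
  have bl: "bounded_linear (A s)" using A_linear by (simp add: linear_conv_bounded_linear)
  show "((\<lambda>t. s *\<^sub>R B s v + A s (t *\<^sub>R B t v)) has_vector_derivative A (s + t) v) (at t)"
    using has_vector_derivative_add[OF has_vector_derivative_const[of "s *\<^sub>R B s v"]
        bounded_linear.has_vector_derivative[OF bl tB_deriv[of v t]]]
    by (simp add: A_add)
qed (simp add: A_simps)

text \<open>Fundamental theorem of calculus for \<open>A\<close>. With the bijectivity of
  \<open>B t\<close> it links invariance under \<open>A t\<close> to vanishing on the range of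
  \<open>d\<close>.\<close>

lemma d_tB: "d (t *\<^sub>R B t v) = A t v - v"
proof (rule vector_derivative_eq_unique[where w="\<lambda>t. A t (d v)" and t=t])
  fix t
  have bl: "bounded_linear d" using bracket_linear by (simp add: linear_conv_bounded_linear)
  show "((\<lambda>t. d (t *\<^sub>R B t v)) has_vector_derivative A t (d v)) (at t)"
    using bounded_linear.has_vector_derivative[OF bl tB_deriv[of v t]] by (simp add: d_A)
  show "((\<lambda>t. A t v - v) has_vector_derivative A t (d v)) (at t)"
    using has_vector_derivative_diff[OF A_deriv has_vector_derivative_const[of v]] by simp
qed (simp add: d_simps)

lemma B_0 [simp]: "B 0 v = v"
proof -
  obtain n where n: "N = Suc n" using N_pos gr0_implies_Suc by blast
  show ?thesis unfolding B_def unfolding n sum.lessThan_Suc_shift by simp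
qed

lemma tau_B: "\<tau> (B t x) = \<tau> x"
proof -
  obtain n where n: "N = Suc n" using N_pos gr0_implies_Suc by blast
  have "\<tau> ((d ^^ Suc k) x) = 0" for k by simp
  then show ?thesis
    unfolding B_def unfolding n sum.lessThan_Suc_shift by (simp del: funpow.simps fact_Suc)
qed

text \<open>Applying the last \<open>d\<^sup>i\<close> with \<open>d\<^sup>i x \<noteq> 0\<close> leaves only the term \<open>k = 0\<close>.\<close>

lemma unipotent_inj:
  fixes c :: "nat \<Rightarrow> real"
  assumes "(\<Sum>k<N. c k *\<^sub>R (d ^^ k) x) = 0" "c 0 = 1" shows "x = 0"
proof (rule ccontr)
  assume x: "x \<noteq> 0"
  define j where "j = (LEAST j. (d ^^ j) x = 0)"
  have j: "(d ^^ j) x = 0" unfolding j_def by (rule LeastI[of _ N]) (simp add: nilpotent)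
  then obtain i where i: "j = Suc i" using x by (cases j) auto
  have ni: "(d ^^ i) x \<noteq> 0" using not_less_Least[of i "\<lambda>j. (d ^^ j) x = 0"] i j_def by auto
  have z: "(d ^^ (i + k)) x = 0" if "k > 0" for k
  proof -
    have "i + k = (k - 1) + j" using that i by simp
    then show ?thesis using j dk_simps(4) by (metis comp_apply funpow_add)
  qed
  obtain n where n: "N = Suc n" using N_pos gr0_implies_Suc by blast
  have "0 = (d ^^ i) (\<Sum>k<N. c k *\<^sub>R (d ^^ k) x)" using assms by (simp add: dk_simps)
  also have "\<dots> = (\<Sum>k<N. c k *\<^sub>R (d ^^ (i + k)) x)"
    by (simp add: linear_sum[OF linear_dk] dk_simps funpow_add)
  also have "\<dots> = (d ^^ i) x + (\<Sum>k<n. c (Suc k) *\<^sub>R (d ^^ (i + Suc k)) x)"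
    by (simp add: n sum.lessThan_Suc_shift assms del: sum.lessThan_Suc add_Suc_right)
  also have "\<dots> = (d ^^ i) x" using z by (simp del: add_Suc_right)
  finally show False using ni by simp
qed

lemma B_inj: "inj (B t)"
proof (rule linear_injective_0[OF B_linear, THEN iffD2], intro allI impI)
  fix x assume "B t x = 0"
  then show "x = 0" unfolding B_def by (rule unipotent_inj) simp
qed

lemma B_surj: "surj (B t)"
  using B_inj B_linear linear_injective_imp_surjective by blast

lemma d_B: "d (B t v) = B t (d v)"
  unfolding B_def by (simp add: linear_sum[OF bracket_linear] d_simps funpow_swap1)

text \<open>The bracket vanishes on the ideal, so the flow formula for \<open>Ad\<close> stops after
  its first term and conjugation is trivial.\<close>

lemma e_m_commute:
  assumes "\<tau> x = 0" "\<tau> y = 0" shows "e x \<otimes> e y = e y \<otimes> e x"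
proof -
  have "(bracket G e x ^^ 1) y = 0" using abelian assms by simp
  from Ad_nilpotent_flow[OF this, of 1] have "Ad G e (e x) y = y" by simp
  then have "e x \<otimes> e y \<otimes> inv (e x) = e y" using Ad_conj[of "e x" 1 y] by simp
  then have "e x \<otimes> e y \<otimes> inv (e x) \<otimes> e x = e y \<otimes> e x" by simp
  then show ?thesis by (simp add: m_assoc)
qed

lemma e_m_add: "\<tau> x = 0 \<Longrightarrow> \<tau> y = 0 \<Longrightarrow> e (x + y) = e x \<otimes> e y"
  using product_one_param[of x y 1] e_m_commute by simp

lemma e_T_add: "e ((s + t) *\<^sub>R T) = e (s *\<^sub>R T) \<otimes> e (t *\<^sub>R T)" by (rule e_add)

lemma e_T_commute: "e (t *\<^sub>R T) \<otimes> e x = e (A t x) \<otimes> e (t *\<^sub>R T)"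
proof -
  have "e (t *\<^sub>R T) \<otimes> e x \<otimes> inv (e (t *\<^sub>R T)) = e (A t x)"
    using Ad_conj[of "e (t *\<^sub>R T)" 1 x] by (simp add: A_Ad)
  then have "e (t *\<^sub>R T) \<otimes> e x \<otimes> inv (e (t *\<^sub>R T)) \<otimes> e (t *\<^sub>R T) = e (A t x) \<otimes> e (t *\<^sub>R T)" by simp
  then show ?thesis by (simp add: m_assoc)
qed

text \<open>\<open>sd\<close> is the group law of the semidirect product of \<open>\<real>\<close> with the abelian ideal on the vector
  space \<open>'a\<close>. The homomorphism \<open>P\<close> is locally injective and surjective; a loop lifting argument,
  with \<open>G\<close> simply connected, makes it bijective.\<close>

definition "P v = e (\<pi> v) \<otimes> e (\<tau> v *\<^sub>R T)"
definition "sd v w = \<pi> v + A (\<tau> v) (\<pi> w) + (\<tau> v + \<tau> w) *\<^sub>R T"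
text \<open>The left quotient of \<open>w\<close> by \<open>v\<close> under \<open>sd\<close>, that
  is, the increment leading from \<open>v\<close> to \<open>w\<close>.\<close>

definition "sdiff v w = A (- \<tau> v) (\<pi> (w - v)) + \<tau> (w - v) *\<^sub>R T"

lemma P_mult: "P (sd v w) = P v \<otimes> P w"
proof -
  have t: "\<tau> (sd v w) = \<tau> v + \<tau> w" by (simp add: sd_def tau_A)
  have p: "\<pi> (sd v w) = \<pi> v + A (\<tau> v) (\<pi> w)" by (simp add: sd_def tau_A)
  have "P v \<otimes> P w = e (\<pi> v) \<otimes> (e (\<tau> v *\<^sub>R T) \<otimes> e (\<pi> w)) \<otimes> e (\<tau> w *\<^sub>R T)"
    by (simp add: P_def m_assoc)
  also have "\<dots> = (e (\<pi> v) \<otimes> e (A (\<tau> v) (\<pi> w))) \<otimes> (e (\<tau> v *\<^sub>R T) \<otimes> e (\<tau> w *\<^sub>R T))"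
    unfolding e_T_commute[of "\<tau> v" "\<pi> w"] by (simp add: m_assoc)
  also have "\<dots> = P (sd v w)"
    unfolding P_def p t e_T_add by (simp add: e_m_add tau_A)
  finally show ?thesis by simp
qed

lemma sd_sdiff: "sd v (sdiff v w) = w"
  by (rule pi_tau_eqI) (simp_all add: sd_def sdiff_def tau_A)

lemma P_sdiff: "P (sdiff v w) = inv (P v) \<otimes> P w"
  using P_mult[of v "sdiff v w"] by (simp add: sd_sdiff)

lemma P_0: "P 0 = \<one>" by (simp add: P_def)

lemma continuous_P: "continuous_on S g \<Longrightarrow> continuous_on S (\<lambda>x. P (g x))"
  unfolding P_def by (intro continuous_mult continuous_e continuous_pi continuous_intros continuous_tau)

lemma continuous_sd: "continuous_on S g \<Longrightarrow> continuous_on S h \<Longrightarrow> continuous_on S (\<lambda>x. sd (g x) (h x))"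
  unfolding sd_def by (intro continuous_intros continuous_A continuous_pi continuous_tau)

lemma continuous_sdiff: "continuous_on S g \<Longrightarrow> continuous_on S h \<Longrightarrow> continuous_on S (\<lambda>x. sdiff (g x) (h x))"
  unfolding sdiff_def by (intro continuous_intros continuous_A continuous_pi continuous_tau)

text \<open>The exponential map of the semidirect product: \<open>B\<close> averages
  \<open>A\<close> over the segment from 0 to \<open>\<tau> v\<close>.\<close>

definition "\<beta> v = B (\<tau> v) (\<pi> v) + \<tau> v *\<^sub>R T"

lemma e_eq_P: "e v = P (\<beta> v)"
proof -
  define r x where "r = \<tau> v" and "x = \<pi> v"
  have x0 [simp]: "\<tau> x = 0" by (simp add: x_def)
  have beta: "\<pi> (\<beta> (t *\<^sub>R v)) = t *\<^sub>R B (t * r) x" "\<tau> (\<beta> (t *\<^sub>R v)) = t * r" for t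
    by (simp_all add: \<beta>_def r_def x_def tau_B B_simps)
  \<comment> \<open>\<open>tB_add\<close> at the times \<open>s * r\<close> and
    \<open>t * r\<close>, divided by \<open>r\<close>. For \<open>r = 0\<close> both
    \<open>A\<close> and \<open>B\<close> are the identity.\<close>
  have tB: "(s + t) *\<^sub>R B ((s + t) * r) x = s *\<^sub>R B (s * r) x + A (s * r) (t *\<^sub>R B (t * r) x)" for s t
  proof (cases "r = 0")
    case False
    have "r *\<^sub>R ((s + t) *\<^sub>R B ((s + t) * r) x) = (s * r + t * r) *\<^sub>R B (s * r + t * r) x"
      by (simp add: algebra_simps)
    also have "\<dots> = r *\<^sub>R (s *\<^sub>R B (s * r) x + A (s * r) (t *\<^sub>R B (t * r) x))"
      unfolding tB_add by (simp add: A_simps algebra_simps)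
    finally show ?thesis using False by (simp del: scaleR_scaleR)
  qed (simp add: algebra_simps)
  have "P (\<beta> (1 *\<^sub>R v)) = e (1 *\<^sub>R v)"
  proof (rule one_param)
    fix s t
    have "\<beta> ((s + t) *\<^sub>R v) = sd (\<beta> (s *\<^sub>R v)) (\<beta> (t *\<^sub>R v))"
    proof (rule pi_tau_eqI)
      show "\<pi> (\<beta> ((s + t) *\<^sub>R v)) = \<pi> (sd (\<beta> (s *\<^sub>R v)) (\<beta> (t *\<^sub>R v)))"
        unfolding sd_def by (simp add: beta tau_A tau_B tB del: scaleR_left_distrib)
      show "\<tau> (\<beta> ((s + t) *\<^sub>R v)) = \<tau> (sd (\<beta> (s *\<^sub>R v)) (\<beta> (t *\<^sub>R v)))"
        unfolding sd_def by (simp add: beta tau_A tau_B distrib_right)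
    qed
    then show "P (\<beta> ((s + t) *\<^sub>R v)) = P (\<beta> (s *\<^sub>R v)) \<otimes> P (\<beta> (t *\<^sub>R v))"
      by (simp add: P_mult)
  next
    show "continuous_on UNIV (\<lambda>t. P (\<beta> (t *\<^sub>R v)))"
      unfolding \<beta>_def by (intro continuous_P continuous_intros continuous_B continuous_tau continuous_pi)
    have c: "continuous_on UNIV (\<lambda>t. t *\<^sub>R B (t * r) x)" by (intro continuous_intros continuous_B)
    have "((\<lambda>t. t *\<^sub>R B (t * r) x) has_vector_derivative x) (at 0)"
    proof (cases "r = 0")
      case True
      then show ?thesis by (auto intro!: derivative_eq_intros simp: has_vector_derivative_def)
    next
      case False
      have 1: "((\<lambda>t. t * r) has_vector_derivative r) (at 0)"
        by (auto intro!: derivative_eq_intros simp: has_vector_derivative_def)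
      have "((\<lambda>t. (t * r) *\<^sub>R B (t * r) x) has_vector_derivative r *\<^sub>R x) (at 0)"
        using vector_diff_chain_at[OF 1, of "\<lambda>t. t *\<^sub>R B t x" x] tB_deriv[of x 0] by (simp add: comp_def)
      from bounded_linear.has_vector_derivative[OF bounded_linear_scaleR_right[of "1/r"] this]
      show ?thesis using False by simp
    qed
    from f_curve_deriv'[OF this]
    have 1: "((\<lambda>t. \<phi> (e (t *\<^sub>R B (t * r) x))) has_vector_derivative D x) (at 0)" by simp
    have "((\<lambda>t. \<phi> (e (t *\<^sub>R B (t * r) x) \<otimes> e (t *\<^sub>R r *\<^sub>R T))) has_vector_derivative D x + D (r *\<^sub>R T)) (at 0)"
      by (intro product_curve_deriv 1 f_curve_deriv continuous_e c continuous_intros) auto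
    moreover have "D x + D (r *\<^sub>R T) = D v"
      using pi_tau[of v] by (simp add: linear_add[OF linear_D, symmetric] r_def x_def)
    ultimately show "((\<lambda>t. \<phi> (P (\<beta> (t *\<^sub>R v)))) has_vector_derivative D v) (at 0)"
      by (simp add: P_def beta)
  qed
  then show ?thesis by simp
qed

end

subsection \<open>Simple connectedness\<close>

context metabelian begin

lemma local_section:
  obtains W \<sigma> where "open W" "\<one> \<in> W" "continuous_on W \<sigma>" "\<And>x. x \<in> W \<Longrightarrow> P (\<sigma> x) = x"
proof -
  obtain N V g where N: "open N" "0 \<in> N" "N \<subseteq> e -` U" "open V" "homeomorphism N V f g"
    "(g has_derivative iD) (at p0)"
    by (rule local_log)
  define W where "W = U \<inter> \<phi> -` V"
  have phi: "continuous_on U \<phi>" using homeo by (simp add: homeomorphism_def)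
  show ?thesis
  proof (rule that[of W "\<lambda>x. \<beta> (g (\<phi> x))"])
    show "open W" unfolding W_def by (intro continuous_open_preimage phi open_U N)
    have "f 0 \<in> V" using N by (auto simp: homeomorphism_def)
    then show "\<one> \<in> W" using one_U by (simp add: W_def f_def)
    have "continuous_on W (\<lambda>x. g (\<phi> x))"
    proof (rule continuous_on_compose2[of V g])
      show "continuous_on V g" using N by (simp add: homeomorphism_def)
      show "continuous_on W \<phi>" using phi by (rule continuous_on_subset) (auto simp: W_def)
    qed (auto simp: W_def)
    then show "continuous_on W (\<lambda>x. \<beta> (g (\<phi> x)))"
      unfolding \<beta>_def by (intro continuous_intros continuous_B continuous_tau continuous_pi)
    fix x assume x: "x \<in> W"
    then have "\<phi> x \<in> V" "x \<in> U" by (auto simp: W_def)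
    then have "f (g (\<phi> x)) = \<phi> x" "g (\<phi> x) \<in> N" using N by (auto simp: homeomorphism_def)
    then have "\<phi> (e (g (\<phi> x))) = \<phi> x" "e (g (\<phi> x)) \<in> U" using N by (auto simp: f_def)
    then have "e (g (\<phi> x)) = x" using \<open>x \<in> U\<close> by (metis psi_phi)
    then show "P (\<beta> (g (\<phi> x))) = x" by (simp add: e_eq_P)
  qed
qed

text \<open>\<open>P v = \<one>\<close> equates the exponentials of a vector of the ideal and of a
  multiple of \<open>T\<close>. Both lie where \<open>e\<close> is injective, and the two subspaces
  meet only in 0.\<close>

lemma P_discrete: "\<exists>\<epsilon>>0. \<forall>v. norm v < \<epsilon> \<and> P v = \<one> \<longrightarrow> v = 0"
proof -
  obtain N V g where N: "open N" "0 \<in> N" "N \<subseteq> e -` U" "open V" "homeomorphism N V f g"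
    "(g has_derivative iD) (at p0)"
    by (rule local_log)
  have inj: "x = y" if "x \<in> N" "y \<in> N" "e x = e y" for x y
    using that N(5) unfolding homeomorphism_def f_def by metis
  have "open ((\<lambda>v. \<pi> v) -` N \<inter> (\<lambda>v. - (\<tau> v *\<^sub>R T)) -` N)"
    by (intro open_Int open_vimage N continuous_pi continuous_intros continuous_tau)
  moreover have "0 \<in> (\<lambda>v. \<pi> v) -` N \<inter> (\<lambda>v. - (\<tau> v *\<^sub>R T)) -` N" using N by simp
  ultimately obtain \<epsilon> where e: "\<epsilon> > 0" "ball 0 \<epsilon> \<subseteq> (\<lambda>v. \<pi> v) -` N \<inter> (\<lambda>v. - (\<tau> v *\<^sub>R T)) -` N"
    using open_contains_ball by blast
  have "v = 0" if v: "norm v < \<epsilon>" "P v = \<one>" for v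
  proof -
    have "v \<in> ball 0 \<epsilon>" using v by simp
    then have mem: "\<pi> v \<in> N" "- (\<tau> v *\<^sub>R T) \<in> N" using e by auto
    have "e (\<pi> v) \<otimes> e (\<tau> v *\<^sub>R T) = \<one>" using v by (simp add: P_def)
    then have "e (\<pi> v) = e (- (\<tau> v *\<^sub>R T))" using inv_equality by (simp add: e_minus)
    then have eq: "\<pi> v = - (\<tau> v *\<^sub>R T)" using inj mem by blast
    from arg_cong[OF this, of \<tau>] have "\<tau> v = 0" by simp
    with eq show ?thesis using pi_tau[of v] by simp
  qed
  with e show ?thesis by blast
qed

lemma sdiff_eq_0: "sdiff x y = 0 \<Longrightarrow> y = x"
  using sd_sdiff[of x y] by (simp add: sd_def A_simps) (metis pi_tau)

lemma sdiff_self: "sdiff x x = 0"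
  by (simp add: sdiff_def A_simps)

lemma P_locally_injective: "\<exists>\<epsilon>>0. \<forall>y. dist y x < \<epsilon> \<and> P y = P x \<longrightarrow> y = x"
proof -
  obtain \<epsilon> where \<epsilon>: "\<epsilon> > 0" "\<And>v. norm v < \<epsilon> \<Longrightarrow> P v = \<one> \<Longrightarrow> v = 0" using P_discrete by blast
  have "continuous_on UNIV (\<lambda>y. sdiff x y)" by (intro continuous_sdiff continuous_intros)
  then obtain \<delta> where \<delta>: "\<delta> > 0" "\<And>y. dist y x < \<delta> \<Longrightarrow> dist (sdiff x y) (sdiff x x) < \<epsilon>"
    using \<epsilon> unfolding continuous_on_iff by (metis UNIV_I)
  have "y = x" if "dist y x < \<delta>" "P y = P x" for y
    using \<delta>(2)[OF that(1)] \<epsilon>(2)[of "sdiff x y"] that(2) by (simp add: sdiff_self P_sdiff sdiff_eq_0)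
  with \<delta> show ?thesis by blast
qed

text \<open>By local injectivity of \<open>P\<close> a path inside a fibre is locally constant, and
  the interval is connected. This is all that is used of the uniqueness of lifts.\<close>

lemma lift_constant:
  fixes \<kappa> :: "real \<Rightarrow> 'a"
  assumes c: "continuous_on {0..1} \<kappa>" and P: "\<And>s. s \<in> {0..1} \<Longrightarrow> P (\<kappa> s) = p" and s: "s \<in> {0..1}"
  shows "\<kappa> s = \<kappa> 0"
proof -
  have "\<kappa> 0 = \<kappa> s"
  proof (rule connected_local_const[of "{0..1}" 0 s \<kappa>], goal_cases)
    case 4
    show ?case
  proof
    fix x :: real assume x: "x \<in> {0..1}"
    obtain \<epsilon> where \<epsilon>: "\<epsilon> > 0" "\<And>y. dist y (\<kappa> x) < \<epsilon> \<Longrightarrow> P y = P (\<kappa> x) \<Longrightarrow> y = \<kappa> x"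
      using P_locally_injective by blast
    have "(\<kappa> \<longlongrightarrow> \<kappa> x) (at x within {0..1})" using c x by (simp add: continuous_on)
    from tendstoD[OF this \<epsilon>(1)] have "\<forall>\<^sub>F y in at x within {0..1}. dist (\<kappa> y) (\<kappa> x) < \<epsilon> \<and> y \<in> {0..1}"
      by (simp add: eventually_conj_iff eventually_at_topological) blast
    then show "\<forall>\<^sub>F y in at x within {0..1}. \<kappa> x = \<kappa> y"
      by (rule eventually_mono) (use \<epsilon>(2) P x in metis)
  qed
  qed (use s in auto)
  then show ?thesis by simp
qed

text \<open>The lift is a product of increments along the rays from the corner, each of which is so
  close to the identity that the local section applies.\<close>

lemma square_lift:
  fixes h :: "real \<times> real \<Rightarrow> 'g"
  defines "Q \<equiv> {0..1} \<times> {0..1::real}"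
  assumes h: "continuous_on Q h"
  obtains H where "continuous_on Q H" "\<And>z. z \<in> Q \<Longrightarrow> P (H z) = inv (h 0) \<otimes> h z"
proof -
  obtain W \<sigma> where W: "open W" "\<one> \<in> W" "continuous_on W \<sigma>" "\<And>x. x \<in> W \<Longrightarrow> P (\<sigma> x) = x"
    by (rule local_section) blast
  define K where "K = Q \<times> Q"
  define q where "q = (\<lambda>(z, u, v). inv (h (u *\<^sub>R z)) \<otimes> h (v *\<^sub>R z))"
  have sc: "u *\<^sub>R z \<in> Q" if "z \<in> Q" "u \<in> {0..1}" for z :: "real \<times> real" and u
    using that by (auto simp: Q_def mult_le_one)
  have q: "continuous_on K q"
    unfolding q_def split_def
    by (intro continuous_mult continuous_inv continuous_on_compose2[OF h] continuous_intros)
      (auto simp: K_def Q_def intro: mult_le_one)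
  have cK: "compact K" unfolding K_def Q_def by (intro compact_Times compact_Icc)
  \<comment> \<open>The parameters whose increment leaves \<open>W\<close>. On this compact set the
    distance of \<open>u\<close> and \<open>v\<close> has a positive minimum, since
    \<open>u = v\<close> gives the increment \<open>\<one>\<close>; it acts as a Lebesgue
    number.\<close>
  define B where "B = K \<inter> q -` (- W)"
  have "closed B" unfolding B_def
    by (rule continuous_closed_preimage[OF q compact_imp_closed[OF cK]]) (use W in auto)
  then have "compact (K \<inter> B)" by (rule compact_Int_closed[OF cK])
  then have cB: "compact B" by (simp add: B_def Int_absorb1)
  have "\<exists>\<delta>>0. \<forall>(z, u, v)\<in>K. \<bar>u - v\<bar> < \<delta> \<longrightarrow> q (z, u, v) \<in> W"
  proof (cases "B = {}")
    case True
    then show ?thesis by (intro exI[of _ 1]) (auto simp: B_def)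
  next
    case False
    have "continuous_on B (\<lambda>(z, u, v). \<bar>u - v\<bar>)" unfolding split_def by (intro continuous_intros)
    from continuous_attains_inf[OF cB False this]
    obtain b where b: "b \<in> B" "\<And>y. y \<in> B \<Longrightarrow> (\<lambda>(z, u, v). \<bar>u - v\<bar>) b \<le> (\<lambda>(z, u, v). \<bar>u - v\<bar>) y" by blast
    obtain z u v where zuv: "b = (z, u, v)" by (cases b)
    have "u \<noteq> v"
    proof
      assume "u = v"
      then have "q b = \<one>" by (simp add: zuv q_def)
      then show False using b(1) W(2) by (simp add: B_def)
    qed
    show ?thesis
    proof (intro exI[of _ "\<bar>u - v\<bar>"] conjI ballI)
      fix y assume y: "y \<in> K"
      obtain z' u' v' where y': "y = (z', u', v')" by (cases y)
      have "q y \<in> W" if "\<bar>u' - v'\<bar> < \<bar>u - v\<bar>"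
      proof (rule ccontr)
        assume "q y \<notin> W"
        then have "y \<in> B" using y by (simp add: B_def)
        then show False using b(2)[of y] that by (simp add: zuv y')
      qed
      then show "case y of (z, ua, va) \<Rightarrow> \<bar>ua - va\<bar> < \<bar>u - v\<bar> \<longrightarrow> q (z, ua, va) \<in> W" by (simp add: y')
    qed (use \<open>u \<noteq> v\<close> in simp)
  qed
  then obtain \<delta> where \<delta>: "\<delta> > 0" "\<And>z u v. (z, u, v) \<in> K \<Longrightarrow> \<bar>u - v\<bar> < \<delta> \<Longrightarrow> q (z, u, v) \<in> W" by blast
  obtain n where n: "1 / real (Suc n) < \<delta>" using \<delta>(1) nat_approx_posE by metis
  define M where "M = Suc n"
  define r where "r j = real j / real M" for j
  have r: "r j \<in> {0..1}" if "j \<le> M" for j using that by (auto simp: r_def M_def field_simps)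
  have rd: "\<bar>r j - r (Suc j)\<bar> < \<delta>" for j
    using n by (simp add: r_def M_def diff_divide_distrib[symmetric])
  have inW: "q (z, r j, r (Suc j)) \<in> W" if "z \<in> Q" "j < M" for z j
    using that r[of j] r[of "Suc j"] rd[of j] by (intro \<delta>(2)) (auto simp: K_def Q_def)
  define H where "H j z = rec_nat 0 (\<lambda>i w. sd w (\<sigma> (q (z, r i, r (Suc i))))) j" for j z
  have H: "H 0 z = 0" "H (Suc j) z = sd (H j z) (\<sigma> (q (z, r j, r (Suc j))))" for j z
    by (simp_all add: H_def)
  have contH: "continuous_on Q (H j)" if "j \<le> M" for j
    using that
  proof (induction j)
    case (Suc j)
    have "continuous_on Q (\<lambda>z. q (z, r j, r (Suc j)))"
      using Suc r[of j] r[of "Suc j"]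
      by (intro continuous_on_compose2[OF q] continuous_intros) (auto simp: K_def Q_def)
    then have "continuous_on Q (\<lambda>z. \<sigma> (q (z, r j, r (Suc j))))"
      by (rule continuous_on_compose2[OF W(3)]) (use inW Suc in auto)
    then show ?case unfolding H(2)[abs_def] using Suc by (intro continuous_sd) auto
  qed (simp add: H(1)[abs_def])
  have PH: "P (H j z) = inv (h 0) \<otimes> h (r j *\<^sub>R z)" if "j \<le> M" "z \<in> Q" for j z
    using that
  proof (induction j)
    case (Suc j)
    then have "P (H (Suc j) z) = inv (h 0) \<otimes> h (r j *\<^sub>R z) \<otimes> q (z, r j, r (Suc j))"
      by (simp add: H(2) P_mult W(4) inW)
    then show ?case by (simp add: q_def m_assoc)
  qed (simp add: H(1) P_0 r_def)
  have "r M = 1" by (simp add: r_def M_def)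
  then show ?thesis using that[of "H M"] contH[of M] PH[of M] by simp
qed

text \<open>The segment from 0 to \<open>k\<close> projects to a loop. A null homotopy of this loop
  is lifted; the quotient of the two lifted side edges stays in the kernel, hence is constant, and
  it is 0 at the end where the loop is constant. So the lift of the original loop closes up, and
  comparison with the segment gives \<open>k = 0\<close>.\<close>

lemma P_kernel: assumes k: "P k = \<one>" shows "k = 0"
proof -
  define p where "p t = P (t *\<^sub>R k)" for t :: real
  have cp: "continuous_on UNIV p" unfolding p_def by (intro continuous_P continuous_intros)
  have ends: "p 0 = \<one>" "p 1 = \<one>" using k by (simp_all add: p_def P_0)
  have "path p" unfolding path_def using cp continuous_on_subset by blast
  then have "homotopic_loops UNIV p (\<lambda>_. \<one>)"
    using sc ends unfolding simply_connected_def
    by (simp add: pathstart_def pathfinish_def path_def)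
  then obtain h :: "real \<times> real \<Rightarrow> 'g" where h: "continuous_on ({0..1} \<times> {0..1}) h"
      and "\<forall>x\<in>{0..1}. h (0, x) = p x" "\<forall>x\<in>{0..1}. h (1, x) = \<one>"
      and "\<forall>t\<in>{0..1}. h (t, 1) = h (t, 0)"
    unfolding homotopic_loops by (simp add: pathstart_def pathfinish_def) blast
  then have h0: "\<And>x. x \<in> {0..1} \<Longrightarrow> h (0, x) = p x" and h1: "\<And>x. x \<in> {0..1} \<Longrightarrow> h (1, x) = \<one>"
      and hl: "\<And>t. t \<in> {0..1} \<Longrightarrow> h (t, 1) = h (t, 0)"
    by auto
  obtain H where H: "continuous_on ({0..1} \<times> {0..1}) H"
      and PH: "\<And>z. z \<in> {0..1} \<times> {0..1} \<Longrightarrow> P (H z) = inv (h 0) \<otimes> h z"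
    by (rule square_lift[OF h]) blast
  have h00: "h 0 = \<one>" using h0[of 0] ends by (simp add: zero_prod_def)
  have PH: "P (H (s, x)) = h (s, x)" if "s \<in> {0..1}" "x \<in> {0..1}" for s x
    using PH[of "(s, x)"] that by (simp add: h00)
  have cs: "continuous_on {0..1} (\<lambda>s. H (s, x))" if "x \<in> {0..1}" for x
    by (rule continuous_on_compose2[OF H]) (use that in \<open>auto intro!: continuous_intros\<close>)
  have cx: "continuous_on {0..1} (\<lambda>x. H (s, x))" if "s \<in> {0..1}" for s
    by (rule continuous_on_compose2[OF H]) (use that in \<open>auto intro!: continuous_intros\<close>)
  define \<kappa> where "\<kappa> s = sdiff (H (s, 0)) (H (s, 1))" for s
  have "\<kappa> 1 = \<kappa> 0"
  proof (rule lift_constant)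
    show "continuous_on {0..1} \<kappa>" unfolding \<kappa>_def by (intro continuous_sdiff cs) auto
    show "P (\<kappa> s) = \<one>" if "s \<in> {0..1}" for s
      using that hl by (simp add: \<kappa>_def P_sdiff PH)
  qed simp
  moreover have "H (1, 1) = H (1, 0)"
    by (rule lift_constant[OF cx]) (use h1 PH in auto)
  ultimately have "\<kappa> 0 = 0" by (simp add: \<kappa>_def sdiff_self)
  then have H0: "H (0, 1) = H (0, 0)" unfolding \<kappa>_def by (rule sdiff_eq_0)
  define \<rho> where "\<rho> x = sdiff (x *\<^sub>R k) (H (0, x))" for x
  have "\<rho> 1 = \<rho> 0"
  proof (rule lift_constant)
    show "continuous_on {0..1} \<rho>" unfolding \<rho>_def by (intro continuous_sdiff cx continuous_intros) auto
    show "P (\<rho> x) = \<one>" if "x \<in> {0..1}" for x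
      using that by (simp add: \<rho>_def P_sdiff PH h0 p_def)
  qed simp
  moreover have "sdiff 0 w = w" for w using sd_sdiff[of 0 w] by (simp add: sd_def) (metis pi_tau)
  \<comment> \<open>The homotopy is free, so the starting point \<open>H (0, 0)\<close> remains
    unspecified. Applying \<open>\<tau>\<close> first yields \<open>\<tau> k = 0\<close>; after that
    \<open>sdiff k\<close> merely subtracts \<open>k\<close>.\<close>
  ultimately have eq: "sdiff k (H (0, 0)) = H (0, 0)" by (simp add: \<rho>_def H0)
  from arg_cong[OF eq, of \<tau>] have tk: "\<tau> k = 0" by (simp add: sdiff_def tau_A)
  then have "sdiff k (H (0, 0)) = H (0, 0) - k" by (simp add: sdiff_def) (metis diff_zero pi_tau pi_props(5) tau_simps(2) pi_props(3) add_diff_eq diff_add_eq)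
  with eq show ?thesis by simp
qed

lemma P_inj: "inj P"
proof (rule injI)
  fix x y assume "P x = P y"
  then have "P (sdiff x y) = \<one>" by (simp add: P_sdiff)
  then show "x = y" using P_kernel sdiff_eq_0 by metis
qed

text \<open>A subgroup of a connected group that contains a neighbourhood of the identity is
  everything: its range and the complement are both unions of translates of that
  neighbourhood.\<close>

lemma P_surj: "surj P"
proof -
  obtain W \<sigma> where W: "open W" "\<one> \<in> W" "continuous_on W \<sigma>" "\<And>x. x \<in> W \<Longrightarrow> P (\<sigma> x) = x"
    by (rule local_section) blast
  have o: "\<exists>S. open S \<and> g \<in> S \<and> (\<forall>x\<in>S. x \<in> range P \<longleftrightarrow> g \<in> range P)" for g
  proof (intro exI[of _ "(\<lambda>x. inv g \<otimes> x) -` W"] conjI ballI)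
    show "open ((\<lambda>x. inv g \<otimes> x) -` W)"
      by (intro open_vimage W continuous_mult continuous_intros)
    show "g \<in> (\<lambda>x. inv g \<otimes> x) -` W" using W by simp
    fix x assume "x \<in> (\<lambda>x. inv g \<otimes> x) -` W"
    then have x: "x = g \<otimes> P (\<sigma> (inv g \<otimes> x))" by (simp add: W)
    show "x \<in> range P \<longleftrightarrow> g \<in> range P"
    proof
      assume "g \<in> range P"
      then obtain v where "g = P v" by blast
      then have "x = P (sd v (\<sigma> (inv g \<otimes> x)))" using x by (simp add: P_mult)
      then show "x \<in> range P" by (rule range_eqI)
    next
      assume "x \<in> range P"
      then obtain v where v: "x = P v" by blast
      define w where "w = \<sigma> (inv g \<otimes> x)"
      have "g = x \<otimes> inv (P w)" using x by (simp add: w_def[symmetric] m_assoc)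
      also have "\<dots> = P v \<otimes> P (sdiff w 0)" by (simp add: v P_sdiff P_0)
      also have "\<dots> = P (sd v (sdiff w 0))" by (simp add: P_mult)
      finally show "g \<in> range P" by (rule range_eqI)
    qed
  qed
  have "open (range P)" using o by (subst open_subopen) (metis subsetI)
  moreover have "open (- range P)" using o by (subst open_subopen) (metis ComplD ComplI subsetI)
  ultimately have "range P = {} \<or> range P = UNIV"
    using conn connected_clopen[of UNIV] by (auto simp: closed_def)
  then show ?thesis by blast
qed

section \<open>Global coordinates on the group and the explicit bracket\<close>

definition "Pinv g = inv_into UNIV P g"

lemma Pinv [simp]: "P (Pinv g) = g" "Pinv (P v) = v"
  using P_inj P_surj by (simp_all add: Pinv_def surj_f_inv_f)

lemma Pinv_continuous: "continuous_on S g \<Longrightarrow> continuous_on S (\<lambda>x. Pinv (g x))"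
proof -
  obtain W \<sigma> where W: "open W" "\<one> \<in> W" "continuous_on W \<sigma>" "\<And>x. x \<in> W \<Longrightarrow> P (\<sigma> x) = x"
    by (rule local_section) blast
  have *: "isCont Pinv g" for g
  proof -
    define S where "S = (\<lambda>x. inv g \<otimes> x) -` W"
    have oS: "open S" unfolding S_def by (intro open_vimage W continuous_mult continuous_intros)
    have gS: "g \<in> S" using W by (simp add: S_def)
    have "continuous_on S (\<lambda>x. \<sigma> (inv g \<otimes> x))"
      by (intro continuous_on_compose2[OF W(3)] continuous_mult continuous_intros) (auto simp: S_def)
    then have "continuous_on S (\<lambda>x. sd (Pinv g) (\<sigma> (inv g \<otimes> x)))"
      by (intro continuous_sd continuous_intros)
    moreover have "sd (Pinv g) (\<sigma> (inv g \<otimes> x)) = Pinv x" if "x \<in> S" for x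
    proof -
      have "P (sd (Pinv g) (\<sigma> (inv g \<otimes> x))) = x" using that by (simp add: P_mult S_def W)
      then show ?thesis by (metis Pinv(2))
    qed
    ultimately have "continuous_on S Pinv" by (simp cong: continuous_on_cong)
    then show ?thesis using oS gS continuous_on_eq_continuous_at by blast
  qed
  assume "continuous_on S g"
  then show ?thesis using * continuous_on_compose2[of UNIV Pinv S g]
    by (auto simp: continuous_at_imp_continuous_on)
qed

text \<open>The factors come in the order opposite to \<open>P\<close>, with the ideal part on the
  right. Right multiplication by an element of the ideal subgroup then fixes \<open>tt\<close> and
  translates \<open>xx\<close>, so \<open>tt\<close> is a coordinate on the coset space.\<close>

definition "tt g = \<tau> (Pinv g)"
definition "xx g = A (- tt g) (\<pi> (Pinv g))"

lemma tau_xx [simp]: "\<tau> (xx g) = 0" by (simp add: xx_def tau_A)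

lemma decomp: "g = e (tt g *\<^sub>R T) \<otimes> e (xx g)"
proof -
  have "e (tt g *\<^sub>R T) \<otimes> e (xx g) = e (\<pi> (Pinv g)) \<otimes> e (tt g *\<^sub>R T)"
    unfolding e_T_commute by (simp add: xx_def)
  then show ?thesis using Pinv(1)[of g] unfolding P_def tt_def by simp
qed

lemma coords: assumes "\<tau> x = 0"
  shows "tt (e (t *\<^sub>R T) \<otimes> e x) = t" "xx (e (t *\<^sub>R T) \<otimes> e x) = x"
proof -
  have "e (t *\<^sub>R T) \<otimes> e x = P (A t x + t *\<^sub>R T)"
    unfolding e_T_commute P_def using assms by (simp add: tau_A)
  then have "Pinv (e (t *\<^sub>R T) \<otimes> e x) = A t x + t *\<^sub>R T" by simp
  then show "tt (e (t *\<^sub>R T) \<otimes> e x) = t" "xx (e (t *\<^sub>R T) \<otimes> e x) = x"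
    using assms by (simp_all add: tt_def xx_def tau_A)
qed

lemma continuous_tt: "continuous_on S g \<Longrightarrow> continuous_on S (\<lambda>x. tt (g x))"
  unfolding tt_def by (intro continuous_tau Pinv_continuous)

lemma continuous_xx: "continuous_on S g \<Longrightarrow> continuous_on S (\<lambda>x. xx (g x))"
  unfolding xx_def by (intro continuous_A continuous_intros continuous_tt continuous_pi Pinv_continuous)

lemma tt_mult: "tt (g \<otimes> h) = tt g + tt h"
proof -
  have "g \<otimes> h = P (sd (Pinv g) (Pinv h))" by (simp add: P_mult)
  then have "Pinv (g \<otimes> h) = sd (Pinv g) (Pinv h)" by simp
  then show ?thesis by (simp add: tt_def sd_def tau_A)
qed

lemma beta_inj: "inj \<beta>"
proof (rule injI)
  fix v w assume eq: "\<beta> v = \<beta> w"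
  from arg_cong[OF eq, of \<tau>] have t: "\<tau> v = \<tau> w" by (simp add: \<beta>_def tau_B)
  from arg_cong[OF eq, of \<pi>] have "B (\<tau> w) (\<pi> v) = B (\<tau> w) (\<pi> w)" by (simp add: \<beta>_def tau_B t)
  then have "\<pi> v = \<pi> w" using B_inj by (metis injD)
  then show "v = w" using t by (rule pi_tau_eqI)
qed

lemma e_inj: "inj e"
  using P_inj beta_inj by (auto simp: inj_def e_eq_P)

text \<open>\<open>character\<close> is defined through the inverse of \<open>e\<close>, the
  coordinates through \<open>P\<close>. The two logarithms differ by an element of the range of
  \<open>d\<close>, which functionals vanishing on brackets do not see.\<close>

lemma e_ex: "\<exists>v z. g = e v \<and> \<tau> v = tt g \<and> \<pi> v = \<pi> (Pinv g) + d z"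
proof -
  have "\<exists>y. B (tt g) y = \<pi> (Pinv g)" using B_surj by (metis surjD)
  then obtain y where y: "B (tt g) y = \<pi> (Pinv g)" by blast
  have ty: "\<tau> y = 0" using arg_cong[OF y, of \<tau>] by (simp add: tau_B)
  define v where "v = y + tt g *\<^sub>R T"
  have "\<beta> v = Pinv g" by (rule pi_tau_eqI) (simp_all add: \<beta>_def v_def ty y tau_B tt_def[symmetric])
  then have g: "g = e v" by (simp add: e_eq_P)
  have "\<exists>z. B t y = y + d z" for t
  proof -
    obtain n where n: "N = Suc n" using N_pos gr0_implies_Suc by blast
    have "B t y = y + (\<Sum>k<n. (t ^ Suc k / fact (Suc (Suc k))) *\<^sub>R (d ^^ Suc k) y)"
      unfolding B_def unfolding n sum.lessThan_Suc_shift by simp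
    also have "\<dots> = y + d (\<Sum>k<n. (t ^ Suc k / fact (Suc (Suc k))) *\<^sub>R (d ^^ k) y)"
      by (simp add: linear_sum[OF bracket_linear] d_simps del: fact_Suc)
    finally show ?thesis by blast
  qed
  then obtain z where "\<pi> (Pinv g) = y + d z" using y by metis
  then have "\<pi> v = \<pi> (Pinv g) + d (- z)" by (simp add: v_def ty d_simps)
  moreover have "\<tau> v = tt g" by (simp add: v_def ty)
  ultimately show ?thesis using g by blast
qed

lemma Ad_m: assumes "\<tau> x = 0" "\<tau> y = 0" shows "Ad G e (e x) y = y"
proof -
  have "(bracket G e x ^^ 1) y = 0" using abelian assms by simp
  from Ad_nilpotent_flow[OF this, of 1] show ?thesis by simp
qed

text \<open>Moving \<open>e (- x)\<close> past \<open>e (t *\<^sub>R T)\<close> leaves the ideal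
  part \<open>x - A t x\<close>. By \<open>d_tB\<close> this is \<open>- t B t (d x)\<close>,
  exactly the ideal part of the exponential of \<open>t (T - d x)\<close>.\<close>

lemma Ad_m_T: assumes x: "\<tau> x = 0" shows "Ad G e (e x) T = T - d x"
proof (rule Ad_eqI)
  fix t
  have xm: "\<tau> (- x) = 0" using x by simp
  have "e x \<otimes> e (t *\<^sub>R T) \<otimes> inv (e x) = e x \<otimes> (e (t *\<^sub>R T) \<otimes> e (- x))"
    by (simp add: e_minus m_assoc)
  also have "\<dots> = e x \<otimes> e (A t (- x)) \<otimes> e (t *\<^sub>R T)"
    unfolding e_T_commute[of t "- x"] by (simp add: m_assoc)
  also have "e x \<otimes> e (A t (- x)) = e (x + A t (- x))" by (rule e_m_add[symmetric]) (use x xm in \<open>auto simp: tau_A\<close>)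
  also have "x + A t (- x) = - (t *\<^sub>R B t (d x))"
    using d_tB[of t x, unfolded d_simps d_B] by (simp only: A_simps minus_diff_eq add_uminus_conv_diff)
  also have "\<dots> = \<pi> (\<beta> (t *\<^sub>R (T - d x)))" by (simp add: \<beta>_def tau_B B_simps)
  finally have "e x \<otimes> e (t *\<^sub>R T) \<otimes> inv e x = e (\<pi> (\<beta> (t *\<^sub>R (T - d x)))) \<otimes> e (t *\<^sub>R T)" .
  moreover have "\<tau> (\<beta> (t *\<^sub>R (T - d x))) = t" by (simp add: \<beta>_def tau_B)
  ultimately show "e x \<otimes> e (t *\<^sub>R T) \<otimes> inv e x = e (t *\<^sub>R (T - d x))"
    unfolding e_eq_P[of "t *\<^sub>R (T - d x)"] P_def by simp
qed

text \<open>The derivative at 0 of an explicit expression for \<open>Ad\<close>, obtained from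
  \<open>e_eq_P\<close>. It reduces the derived algebra to the values of \<open>d\<close> on the
  ideal.\<close>

lemma bracket_formula: "bracket G e X Y = d (\<tau> X *\<^sub>R \<pi> Y - \<tau> Y *\<^sub>R \<pi> X)"
proof -
  define r x s y where "r = \<tau> X" and "x = \<pi> X" and "s = \<tau> Y" and "y = \<pi> Y"
  have x [simp]: "\<tau> x = 0" and y [simp]: "\<tau> y = 0" by (simp_all add: x_def y_def)
  have Ad: "Ad G e (e (u *\<^sub>R X)) Y = A (u * r) y + s *\<^sub>R T - s *\<^sub>R d (B (u * r) (u *\<^sub>R x))" for u
  proof -
    have "e (u *\<^sub>R X) = e (B (u * r) (u *\<^sub>R x)) \<otimes> e ((u * r) *\<^sub>R T)"
      unfolding e_eq_P[of "u *\<^sub>R X"] P_def \<beta>_def by (simp add: tau_B r_def x_def)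
    moreover have "Y = y + s *\<^sub>R T" using pi_tau[of Y] by (simp add: y_def s_def)
    moreover have "A t T = T" for t
      using A_Ad[of t T] Ad_flow_deriv
    proof -
      have "(bracket G e T ^^ 1) T = 0" by simp
      from Ad_nilpotent_flow[OF this, of t] show ?thesis by (simp add: A_Ad)
    qed
    ultimately show ?thesis
      by (simp add: Ad_mult A_Ad A_simps linear_add[OF Ad_linear] linear_scale[OF Ad_linear] Ad_m Ad_m_T
          tau_A tau_B algebra_simps)
  qed
  have 1: "((\<lambda>u. u * r) has_vector_derivative r) (at 0)"
    by (auto intro!: derivative_eq_intros simp: has_vector_derivative_def)
  have a: "((\<lambda>u. A (u * r) y) has_vector_derivative r *\<^sub>R d y) (at 0)"
    using vector_diff_chain_at[OF 1, of "\<lambda>t. A t y" "d y"] A_deriv[of y 0] by (simp add: comp_def)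
  have b: "((\<lambda>u. B (u * r) (u *\<^sub>R x)) has_vector_derivative x) (at 0)"
  proof (cases "r = 0")
    case True
    then show ?thesis by (auto intro!: derivative_eq_intros simp: has_vector_derivative_def)
  next
    case False
    have "((\<lambda>u. (u * r) *\<^sub>R B (u * r) x) has_vector_derivative r *\<^sub>R x) (at 0)"
      using vector_diff_chain_at[OF 1, of "\<lambda>t. t *\<^sub>R B t x" x] tB_deriv[of x 0] by (simp add: comp_def)
    from bounded_linear.has_vector_derivative[OF bounded_linear_scaleR_right[of "1/r"] this]
    show ?thesis using False by (simp add: B_simps)
  qed
  have bl: "bounded_linear (\<lambda>v. s *\<^sub>R d v)"
    using bracket_linear by (intro bounded_linear_scaleR_right[THEN bounded_linear_compose])
      (simp add: linear_conv_bounded_linear)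
  have "((\<lambda>u. A (u * r) y + s *\<^sub>R T - s *\<^sub>R d (B (u * r) (u *\<^sub>R x))) has_vector_derivative
      r *\<^sub>R d y + 0 - s *\<^sub>R d x) (at 0)"
    by (intro has_vector_derivative_diff has_vector_derivative_add a has_vector_derivative_const
        bounded_linear.has_vector_derivative[OF bl b])
  then have "((\<lambda>u. Ad G e (e (u *\<^sub>R X)) Y) has_vector_derivative r *\<^sub>R d y - s *\<^sub>R d x) (at 0)"
    by (simp add: Ad[abs_def])
  then have "bracket G e X Y = r *\<^sub>R d y - s *\<^sub>R d x"
    using bracket_deriv vector_derivative_unique_at by blast
  then show ?thesis by (simp add: d_simps r_def x_def s_def y_def)
qed

end

subsection \<open>Square-integrable functions on a probability space\<close>

locale L2_space = finite_measure \<mu> for \<mu> :: "'x measure" +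
  assumes total: "emeasure \<mu> (space \<mu>) = 1"
begin

definition L2 :: "('x \<Rightarrow> complex) set" where
  "L2 = {f. f \<in> borel_measurable \<mu> \<and> integrable \<mu> (\<lambda>x. (cmod (f x))\<^sup>2)}"

lemma L2_measurable: "f \<in> L2 \<Longrightarrow> f \<in> borel_measurable \<mu>"
  by (simp add: L2_def)

lemma L2_bounded:
  assumes "f \<in> borel_measurable \<mu>" "\<And>x. x \<in> space \<mu> \<Longrightarrow> cmod (f x) \<le> B"
  shows "f \<in> L2"
proof -
  have "integrable \<mu> (\<lambda>x. (cmod (f x))\<^sup>2)"
    by (rule integrable_const_bound[of _ "B\<^sup>2"])
      (use assms in \<open>auto intro!: AE_I2 power_mono\<close>)
  then show ?thesis using assms by (simp add: L2_def)
qed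

lemma L2_mult_integrable:
  assumes f: "f \<in> L2" and g: "g \<in> L2" shows "integrable \<mu> (\<lambda>x. f x * cnj (g x))"
proof (rule Bochner_Integration.integrable_bound)
  show "integrable \<mu> (\<lambda>x. (cmod (f x))\<^sup>2 + (cmod (g x))\<^sup>2)"
    using f g by (auto simp: L2_def)
  have [measurable]: "f \<in> borel_measurable \<mu>" "g \<in> borel_measurable \<mu>"
    using f g by (auto simp: L2_def)
  have [measurable]: "(\<lambda>x. cnj (g x)) \<in> borel_measurable \<mu>"
    by (rule borel_measurable_continuous_on[of cnj]) (auto intro: continuous_intros)
  show "(\<lambda>x. f x * cnj (g x)) \<in> borel_measurable \<mu>" by measurable
  have "cmod (f x) * cmod (g x) \<le> (cmod (f x))\<^sup>2 + (cmod (g x))\<^sup>2" for x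
    using sum_squares_bound[of "cmod (f x)" "cmod (g x)"]
      zero_le_power2[of "cmod (f x)"] zero_le_power2[of "cmod (g x)"] by linarith
  then show "AE x in \<mu>. norm (f x * cnj (g x)) \<le> norm ((cmod (f x))\<^sup>2 + (cmod (g x))\<^sup>2)"
    by (simp add: norm_mult)
qed

lemma L2_add: assumes f: "f \<in> L2" and g: "g \<in> L2" shows "(\<lambda>x. f x + g x) \<in> L2"
proof -
  have [measurable]: "f \<in> borel_measurable \<mu>" "g \<in> borel_measurable \<mu>"
    using f g by (auto simp: L2_def)
  have "integrable \<mu> (\<lambda>x. (cmod (f x + g x))\<^sup>2)"
  proof (rule Bochner_Integration.integrable_bound)
    show "integrable \<mu> (\<lambda>x. 2 * (cmod (f x))\<^sup>2 + 2 * (cmod (g x))\<^sup>2)"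
      using f g by (auto simp: L2_def)
    have "(cmod (f x + g x))\<^sup>2 \<le> 2 * (cmod (f x))\<^sup>2 + 2 * (cmod (g x))\<^sup>2" for x
    proof -
      have "(cmod (f x + g x))\<^sup>2 \<le> (cmod (f x) + cmod (g x))\<^sup>2"
        by (intro power_mono norm_triangle_ineq) auto
      then show ?thesis
        using sum_squares_bound[of "cmod (f x)" "cmod (g x)"] by (simp add: power2_sum)
    qed
    then show "AE x in \<mu>. norm ((cmod (f x + g x))\<^sup>2) \<le> norm (2 * (cmod (f x))\<^sup>2 + 2 * (cmod (g x))\<^sup>2)"
      by simp
  qed measurable
  then show ?thesis by (simp add: L2_def)
qed

lemma L2_scale: "f \<in> L2 \<Longrightarrow> (\<lambda>x. c * f x) \<in> L2"
  by (auto simp: L2_def norm_mult power_mult_distrib)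

lemma L2_diff: "f \<in> L2 \<Longrightarrow> g \<in> L2 \<Longrightarrow> (\<lambda>x. f x - g x) \<in> L2"
  using L2_add[of f "\<lambda>x. (-1) * g x"] L2_scale[of g "-1"] by simp

definition nrm2 :: "('x \<Rightarrow> complex) \<Rightarrow> real" where
  "nrm2 f = sqrt (\<integral>x. (cmod (f x))\<^sup>2 \<partial>\<mu>)"

lemma nrm2_le_bound:
  assumes "f \<in> borel_measurable \<mu>" "\<And>x. x \<in> space \<mu> \<Longrightarrow> cmod (f x) \<le> B" "0 \<le> B"
  shows "nrm2 f \<le> B"
proof -
  have "integrable \<mu> (\<lambda>x. (cmod (f x))\<^sup>2)" using L2_bounded[OF assms(1,2)] by (simp add: L2_def)
  then have "(\<integral>x. (cmod (f x))\<^sup>2 \<partial>\<mu>) \<le> (\<integral>x. B\<^sup>2 \<partial>\<mu>)"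
    using assms by (intro integral_mono) (auto intro!: power_mono)
  also have "\<dots> = B\<^sup>2" using total by (simp add: measure_def)
  finally show ?thesis using assms by (simp add: nrm2_def real_le_lsqrt)
qed

end

text \<open>Stated for every record with these fields, whatever its action, so that it serves the
  quasi-regular representation as well as the auxiliary \<open>L2_rep\<close>.\<close>

lemma (in L2_space) prehilbert_L2:
  fixes R :: "('g, 'x \<Rightarrow> complex) rep"
  assumes R: "vecs R = L2" "vadd R = (\<lambda>f g x. f x + g x)" "vscale R = (\<lambda>c f x. c * f x)"
    "vinner R = (\<lambda>f g. \<integral>x. f x * cnj (g x) \<partial>\<mu>)"
  shows "prehilbert R"
    and "f \<in> L2 \<Longrightarrow> g \<in> L2 \<Longrightarrow> rep_dist R f g = nrm2 (\<lambda>x. f x - g x)"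
proof -
  have ii: "vinner R f f = of_real (\<integral>x. (cmod (f x))\<^sup>2 \<partial>\<mu>)" for f
    by (simp add: R complex_norm_square[symmetric] del: of_real_power)
  show "prehilbert R"
  proof
    fix x y z c assume "x \<in> vecs R"
    then have x: "x \<in> L2" by (simp add: R)
    show "vscale R c x \<in> vecs R" using x by (simp add: R L2_scale)
    show "0 \<le> Re (vinner R x x)" by (simp add: ii)
    { assume "y \<in> vecs R"
      then have y: "y \<in> L2" by (simp add: R)
      show "vadd R x y \<in> vecs R" using x y by (simp add: R L2_add)
      have "vinner R y x = (\<integral>t. cnj (x t * cnj (y t)) \<partial>\<mu>)" by (simp add: R mult.commute)
      also have "\<dots> = cnj (vinner R x y)"
        using integral_bounded_linear[OF bounded_linear_cnj L2_mult_integrable[OF x y]] by (simp add: R)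
      finally show "vinner R y x = cnj (vinner R x y)" .
      assume "z \<in> vecs R" then have z: "z \<in> L2" by (simp add: R)
      show "vinner R (vadd R x y) z = vinner R x z + vinner R y z"
        using L2_mult_integrable[OF x z] L2_mult_integrable[OF y z] by (simp add: R distrib_right) }
    show "vinner R (vscale R c x) z = c * vinner R x z" by (simp add: R mult.assoc)
  qed
  have "vinner R (vadd R f (vscale R (-1) g)) (vadd R f (vscale R (-1) g))
      = of_real (\<integral>x. (cmod (f x - g x))\<^sup>2 \<partial>\<mu>)" for f g
    unfolding ii by (simp add: R)
  then show "rep_dist R f g = nrm2 (\<lambda>x. f x - g x)"
    by (simp add: rep_dist_def Let_def nrm2_def)
qed

context L2_space begin

abbreviation L2_rep :: "(unit, 'x \<Rightarrow> complex) rep" where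
  "L2_rep \<equiv> \<lparr>vecs = L2, vadd = (\<lambda>f g x. f x + g x), vscale = (\<lambda>c f x. c * f x),
     vinner = (\<lambda>f g. \<integral>x. f x * cnj (g x) \<partial>\<mu>), act = (\<lambda>a f. f)\<rparr>"

lemma nrm2_power2: "(nrm2 f)\<^sup>2 = (\<integral>x. (cmod (f x))\<^sup>2 \<partial>\<mu>)"
  by (simp add: nrm2_def)

lemma nrm2_triangle:
  assumes "f \<in> L2" "g \<in> L2" "h \<in> L2"
  shows "nrm2 (\<lambda>x. f x - h x) \<le> nrm2 (\<lambda>x. f x - g x) + nrm2 (\<lambda>x. g x - h x)"
proof -
  interpret R: prehilbert L2_rep by (rule prehilbert_L2) auto
  show ?thesis
    using R.dist_triangle[of f g h] assms prehilbert_L2(2)[of L2_rep] by simp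
qed

lemma integral_cmod_le_nrm2:
  assumes f: "f \<in> L2"
  shows "integrable \<mu> (\<lambda>x. cmod (f x))" "(\<integral>x. cmod (f x) \<partial>\<mu>) \<le> nrm2 f"
proof -
  have one: "(\<lambda>x. 1) \<in> L2" by (rule L2_bounded[of _ 1]) auto
  have cf: "(\<lambda>x. of_real (cmod (f x))) \<in> L2" using f by (auto simp: L2_def)
  interpret R: prehilbert L2_rep by (rule prehilbert_L2) auto
  have i: "integrable \<mu> (\<lambda>x. complex_of_real (cmod (f x)))"
    using L2_mult_integrable[OF cf one] by simp
  then show "integrable \<mu> (\<lambda>x. cmod (f x))" by (simp add: complex_of_real_integrable_eq)
  have 1: "(\<integral>x. 1 \<partial>\<mu>) = (1::complex)" using total by (simp add: measure_def)
  have "cmod (\<integral>x. of_real (cmod (f x)) \<partial>\<mu>) \<le> nrm2 f"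
    using R.cauchy_schwarz[of "\<lambda>x. of_real (cmod (f x))" "\<lambda>x. 1"] cf one total
    by (simp add: nrm2_def of_real_mult[symmetric] power2_eq_square[symmetric] measure_def
        del: of_real_mult) (simp add: of_real_power[symmetric] del: of_real_power)
  then show "(\<integral>x. cmod (f x) \<partial>\<mu>) \<le> nrm2 f" by simp
qed

text \<open>Riesz-Fischer: along a fast subsequence the increments are summable in the mean, hence
  almost everywhere, since on a probability space the mean of the modulus is at most
  \<open>nrm2\<close>. Fatou's lemma turns the Cauchy bounds into bounds for the limit.\<close>

lemma L2_complete:
  assumes u: "\<And>n. u n \<in> L2"
    and cauchy: "\<And>e. e > 0 \<Longrightarrow> \<exists>N. \<forall>m\<ge>N. \<forall>n\<ge>N. nrm2 (\<lambda>x. u m x - u n x) < e"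
  shows "\<exists>f\<in>L2. (\<lambda>n. nrm2 (\<lambda>x. u n x - f x)) \<longlonglongrightarrow> 0"
proof -
  have [measurable]: "u n \<in> borel_measurable \<mu>" for n using u by (simp add: L2_measurable)
  have "\<exists>N. \<forall>m\<ge>N. \<forall>n\<ge>N. nrm2 (\<lambda>x. u m x - u n x) < (1/2)^k" for k
    using cauchy[of "(1/2)^k"] by simp
  then obtain N where N: "\<And>k m n. m \<ge> N k \<Longrightarrow> n \<ge> N k \<Longrightarrow> nrm2 (\<lambda>x. u m x - u n x) < (1/2)^k"
    by metis
  \<comment> \<open>The indices are monotone, lie beyond \<open>N k\<close>, and are at least
    \<open>k\<close>; the increments use the first two properties and Fatou's lemma the
    third.\<close>
  define r where "r k = (\<Sum>j\<le>k. N j) + k" for k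
  have rN: "r k \<ge> N k" for k unfolding r_def using member_le_sum[of k "{..k}" N] by simp
  have rmono: "r k \<le> r (Suc k)" for k by (simp add: r_def)
  have rk: "r k \<ge> k" for k by (simp add: r_def)
  define d where "d k x = u (r (Suc k)) x - u (r k) x" for k x
  have d: "d k \<in> L2" for k unfolding d_def[abs_def] by (intro L2_diff u)
  then have [measurable]: "d k \<in> borel_measurable \<mu>" for k by (simp add: L2_measurable)
  have dn: "(\<integral>x. cmod (d k x) \<partial>\<mu>) \<le> (1/2)^k" for k
  proof -
    have "nrm2 (d k) < (1/2)^k"
      unfolding d_def[abs_def] using rN[of k] rmono[of k] by (intro N) auto
    then show ?thesis using integral_cmod_le_nrm2(2)[OF d[of k]] by linarith
  qed
  have ae: "AE x in \<mu>. summable (\<lambda>k. d k x)"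
  proof -
    have "(\<integral>\<^sup>+x. (\<Sum>k. ennreal (cmod (d k x))) \<partial>\<mu>) = (\<Sum>k. \<integral>\<^sup>+x. ennreal (cmod (d k x)) \<partial>\<mu>)"
      by (intro nn_integral_suminf) measurable
    also have "\<dots> \<le> (\<Sum>k. ennreal ((1/2)^k))"
    proof (intro suminf_le)
      show "(\<integral>\<^sup>+x. ennreal (cmod (d k x)) \<partial>\<mu>) \<le> ennreal ((1/2)^k)" for k
        using nn_integral_eq_integral[OF integral_cmod_le_nrm2(1)[OF d[of k]]] dn[of k]
        by (simp add: ennreal_leI)
    qed auto
    also have "\<dots> = ennreal (\<Sum>k. (1/2)^k)" by (intro suminf_ennreal2) auto
    also have "\<dots> < \<infinity>" by simp
    finally have "(\<integral>\<^sup>+x. (\<Sum>k. ennreal (cmod (d k x))) \<partial>\<mu>) \<noteq> \<infinity>" by simp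
    then have "AE x in \<mu>. (\<Sum>k. ennreal (cmod (d k x))) \<noteq> \<infinity>"
      by (intro nn_integral_PInf_AE) measurable
    then show ?thesis
    proof (eventually_elim)
      case (elim x)
      then have "summable (\<lambda>k. cmod (d k x))" by (intro summable_suminf_not_top) auto
      then show ?case by (rule summable_norm_cancel)
    qed
  qed
  define f where "f x = lim (\<lambda>k. u (r k) x)" for x
  have [measurable]: "f \<in> borel_measurable \<mu>" unfolding f_def[abs_def] by measurable
  have lim: "AE x in \<mu>. (\<lambda>k. u (r k) x) \<longlonglongrightarrow> f x"
    using ae
  proof eventually_elim
    case (elim x)
    have "(\<lambda>n. \<Sum>k<n. d k x) = (\<lambda>n. u (r n) x - u (r 0) x)"
      by (simp add: d_def sum_lessThan_telescope[of "\<lambda>k. u (r k) x" for x] fun_eq_iff)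
    then have "convergent (\<lambda>n. u (r n) x - u (r 0) x)"
      using elim by (simp add: summable_iff_convergent)
    then have "convergent (\<lambda>n. u (r n) x - u (r 0) x + u (r 0) x)"
      by (intro convergent_add convergent_const)
    then show ?case by (simp add: f_def convergent_LIMSEQ_iff)
  qed
  have fatou: "(\<integral>\<^sup>+x. ennreal ((cmod (u n x - f x))\<^sup>2) \<partial>\<mu>) \<le> ennreal (e\<^sup>2)"
    if e: "e > 0" and M: "\<And>m. m \<ge> M \<Longrightarrow> nrm2 (\<lambda>x. u n x - u m x) < e" for n M e
  proof -
    have "(\<integral>\<^sup>+x. ennreal ((cmod (u n x - f x))\<^sup>2) \<partial>\<mu>)
       = (\<integral>\<^sup>+x. liminf (\<lambda>k. ennreal ((cmod (u n x - u (r k) x))\<^sup>2)) \<partial>\<mu>)"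
    proof (rule nn_integral_cong_AE, use lim in eventually_elim)
      case (elim x)
      have "(\<lambda>k. ennreal ((cmod (u n x - u (r k) x))\<^sup>2)) \<longlonglongrightarrow> ennreal ((cmod (u n x - f x))\<^sup>2)"
        by (intro tendsto_intros elim)
      then show ?case using lim_imp_Liminf[OF trivial_limit_sequentially] by metis
    qed
    also have "\<dots> \<le> liminf (\<lambda>k. \<integral>\<^sup>+x. ennreal ((cmod (u n x - u (r k) x))\<^sup>2) \<partial>\<mu>)"
      by (intro nn_integral_liminf) measurable
    also have "\<dots> \<le> liminf (\<lambda>k. ennreal (e\<^sup>2))"
    proof (intro Liminf_mono, unfold eventually_sequentially, intro exI[of _ M] allI impI)
      fix k assume "M \<le> k"
      then have "nrm2 (\<lambda>x. u n x - u (r k) x) < e" using M[of "r k"] rk[of k] by simp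
      moreover have "0 \<le> nrm2 (\<lambda>x. u n x - u (r k) x)" by (simp add: nrm2_def)
      ultimately have "(\<integral>x. (cmod (u n x - u (r k) x))\<^sup>2 \<partial>\<mu>) \<le> e\<^sup>2"
        unfolding nrm2_power2[symmetric] by (intro power_mono) auto
      moreover have "integrable \<mu> (\<lambda>x. (cmod (u n x - u (r k) x))\<^sup>2)"
        using L2_diff[OF u u] by (simp add: L2_def)
      ultimately show "(\<integral>\<^sup>+x. ennreal ((cmod (u n x - u (r k) x))\<^sup>2) \<partial>\<mu>) \<le> ennreal (e\<^sup>2)"
        by (simp add: nn_integral_eq_integral ennreal_leI)
    qed
    also have "\<dots> = ennreal (e\<^sup>2)" by (simp add: Liminf_const)
    finally show ?thesis .
  qed
  have near: "(\<lambda>x. u n x - f x) \<in> L2 \<and> nrm2 (\<lambda>x. u n x - f x) \<le> e"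
    if e: "e > 0" and M: "\<And>m. m \<ge> M \<Longrightarrow> nrm2 (\<lambda>x. u n x - u m x) < e" for n M e
  proof -
    note fat = fatou[OF that]
    have "(\<lambda>x. (cmod (u n x - f x))\<^sup>2) \<in> borel_measurable \<mu>" by measurable
    then have i: "integrable \<mu> (\<lambda>x. (cmod (u n x - f x))\<^sup>2)"
      using fat by (intro integrableI_bounded) (auto simp: top_unique less_top[symmetric])
    then have "(\<integral>x. (cmod (u n x - f x))\<^sup>2 \<partial>\<mu>) \<le> e\<^sup>2"
      using fat by (simp add: nn_integral_eq_integral)
    then have "nrm2 (\<lambda>x. u n x - f x) \<le> e"
      using e by (simp add: nrm2_def real_le_lsqrt)
    then show ?thesis using i by (simp add: L2_def)
  qed
  have "f \<in> L2"
  proof -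
    have "(\<lambda>x. u (N 0) x - f x) \<in> L2" using near[of 1 "N 0" "N 0"] N[of 0 "N 0"] by simp
    from L2_diff[OF u[of "N 0"] this] show ?thesis by simp
  qed
  moreover have "(\<lambda>n. nrm2 (\<lambda>x. u n x - f x)) \<longlonglongrightarrow> 0"
  proof (rule LIMSEQ_I)
    fix e :: real assume e: "e > 0"
    obtain M where M: "\<And>m n. m \<ge> M \<Longrightarrow> n \<ge> M \<Longrightarrow> nrm2 (\<lambda>x. u m x - u n x) < e/2"
      using cauchy[of "e/2"] e by auto
    have "nrm2 (\<lambda>x. u n x - f x) \<le> e/2" if "n \<ge> M" for n
      using near[of "e/2" M n] M[OF that] e by simp
    moreover have "0 \<le> nrm2 (\<lambda>x. u n x - f x)" for n by (simp add: nrm2_def)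
    ultimately show "\<exists>no. \<forall>n\<ge>no. norm (nrm2 (\<lambda>x. u n x - f x) - 0) < e"
      using e by (intro exI[of _ M]) (auto intro: le_less_trans[of _ "e/2"])
  qed
  ultimately show ?thesis by blast
qed

end

locale L2_subspace = L2_space \<mu> for \<mu> :: "'x measure" +
  fixes S :: "('x \<Rightarrow> complex) set"
  assumes S: "\<And>f g. f \<in> S \<Longrightarrow> g \<in> S \<Longrightarrow> (\<lambda>x. f x + g x) \<in> S"
    and Sc: "\<And>c f. f \<in> S \<Longrightarrow> (\<lambda>x. c * f x) \<in> S"
    and SL: "S \<subseteq> L2"
begin

definition cl :: "('x \<Rightarrow> complex) set" where
  "cl = {f\<in>L2. \<forall>e>0. \<exists>s\<in>S. nrm2 (\<lambda>x. f x - s x) < e}"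

lemma cl_L2: "f \<in> L2" if "f \<in> cl" for f using that by (simp add: cl_def)

lemma nrm2_add_le: "nrm2 (\<lambda>x. a x + b x) \<le> nrm2 a + nrm2 b" if "a \<in> L2" "b \<in> L2" for a b
  using nrm2_triangle[of a "\<lambda>x. 0" "\<lambda>x. - b x"] that L2_scale[of b "-1"] L2_scale[of b 0] by simp

lemma nrm2_scale: "nrm2 (\<lambda>x. c * a x) = cmod c * nrm2 a" for c a
  by (simp add: nrm2_def norm_mult power_mult_distrib real_sqrt_mult)

lemma cl_closed: "f \<in> cl" if f: "f \<in> L2" and near: "\<And>e. e > 0 \<Longrightarrow> \<exists>h\<in>cl. nrm2 (\<lambda>x. f x - h x) < e" for f
  unfolding cl_def
proof (intro CollectI conjI allI impI f)
  fix e :: real assume e: "e > 0"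
  then obtain h where h: "h \<in> cl" "nrm2 (\<lambda>x. f x - h x) < e/2" using near[of "e/2"] by auto
  have "\<forall>e>0. \<exists>s\<in>S. nrm2 (\<lambda>x. h x - s x) < e" using h(1) by (simp add: cl_def)
  then obtain s where s: "s \<in> S" "nrm2 (\<lambda>x. h x - s x) < e/2" using e half_gt_zero by blast
  have "s \<in> L2" using s SL by blast
  from nrm2_triangle[OF f cl_L2[OF h(1)] this] have "nrm2 (\<lambda>x. f x - s x) < e" using h(2) s(2) by linarith
  then show "\<exists>s\<in>S. nrm2 (\<lambda>x. f x - s x) < e" using s by blast
qed

lemma cl_add: "(\<lambda>x. f x + g x) \<in> cl" if f: "f \<in> cl" and g: "g \<in> cl" for f g
  unfolding cl_def
proof (intro CollectI conjI allI impI)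
  show "(\<lambda>x. f x + g x) \<in> L2" using f g by (intro L2_add cl_L2)
  fix e :: real assume "e > 0"
  then have e2: "e/2 > 0" by simp
  obtain s where s: "s \<in> S" "nrm2 (\<lambda>x. f x - s x) < e/2" using f e2 unfolding cl_def by blast
  obtain t where t: "t \<in> S" "nrm2 (\<lambda>x. g x - t x) < e/2" using g e2 unfolding cl_def by blast
  have "nrm2 (\<lambda>x. (f x - s x) + (g x - t x)) \<le> nrm2 (\<lambda>x. f x - s x) + nrm2 (\<lambda>x. g x - t x)"
    using f g s t SL by (intro nrm2_add_le L2_diff) (auto dest: cl_L2)
  then have "nrm2 (\<lambda>x. f x + g x - (s x + t x)) < e" using s t by (simp add: algebra_simps)
  then show "\<exists>s\<in>S. nrm2 (\<lambda>x. f x + g x - s x) < e"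
    using S[OF s(1) t(1)] by (intro bexI[where x="\<lambda>x. s x + t x"])
qed

lemma cl_scale: "(\<lambda>x. c * f x) \<in> cl" if f: "f \<in> cl" for c f
  unfolding cl_def
proof (intro CollectI conjI allI impI)
  show "(\<lambda>x. c * f x) \<in> L2" using f by (intro L2_scale cl_L2)
  fix e :: real assume e: "e > 0"
  have c: "cmod c + 1 > 0" by (simp add: add_nonneg_pos)
  then have "e / (cmod c + 1) > 0" using e by simp
  then obtain s where s: "s \<in> S" "nrm2 (\<lambda>x. f x - s x) < e / (cmod c + 1)"
    using f unfolding cl_def by blast
  have "nrm2 (\<lambda>x. c * f x - c * s x) = cmod c * nrm2 (\<lambda>x. f x - s x)"
    using nrm2_scale[of c "\<lambda>x. f x - s x"] by (simp add: right_diff_distrib)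
  also have "\<dots> \<le> (cmod c + 1) * nrm2 (\<lambda>x. f x - s x)" by (intro mult_right_mono) (auto simp: nrm2_def)
  also have "\<dots> < e" using s c by (simp add: field_simps)
  finally show "\<exists>t\<in>S. nrm2 (\<lambda>x. c * f x - t x) < e"
    using Sc[OF s(1)] by (intro bexI[where x="\<lambda>x. c * s x"])
qed

lemma S_cl: "s \<in> S \<Longrightarrow> s \<in> cl"
  using SL by (auto simp: cl_def nrm2_def intro!: bexI[of _ s])

lemma cl_uniform:
  assumes f: "f \<in> borel_measurable \<mu>"
    and near: "\<And>e. e > 0 \<Longrightarrow> \<exists>h\<in>cl. \<forall>x\<in>space \<mu>. cmod (f x - h x) \<le> e"
  shows "f \<in> cl"
proof -
  have d: "(\<lambda>x. f x - h x) \<in> L2 \<and> nrm2 (\<lambda>x. f x - h x) \<le> e"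
    if "h \<in> cl" "\<forall>x\<in>space \<mu>. cmod (f x - h x) \<le> e" "e > 0" for h e
  proof -
    have m: "(\<lambda>x. f x - h x) \<in> borel_measurable \<mu>"
      using f L2_measurable[OF cl_L2[OF that(1)]] by measurable
    then show ?thesis using that by (auto intro!: L2_bounded[of _ e] nrm2_le_bound)
  qed
  have fL: "f \<in> L2"
  proof -
    obtain h where h: "h \<in> cl" "\<forall>x\<in>space \<mu>. cmod (f x - h x) \<le> 1" using near[of 1] by auto
    from L2_add[OF cl_L2[OF h(1)], of "\<lambda>x. f x - h x"] d[OF h] show ?thesis by simp
  qed
  show ?thesis
  proof (rule cl_closed[OF fL])
    fix e :: real assume e: "e > 0"
    then obtain h where "h \<in> cl" "\<forall>x\<in>space \<mu>. cmod (f x - h x) \<le> e/2" using near[of "e/2"] by auto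
    with d[of h "e/2"] e show "\<exists>h\<in>cl. nrm2 (\<lambda>x. f x - h x) < e" by force
  qed
qed

text \<open>Dominated convergence: the constant \<open>(2 * B)\<^sup>2\<close> is integrable because
  the measure is finite.\<close>

lemma cl_limit:
  assumes F: "\<And>n. F n \<in> cl" and lim: "\<And>x. x \<in> space \<mu> \<Longrightarrow> (\<lambda>n. F n x) \<longlonglongrightarrow> f x"
    and B: "\<And>n x. x \<in> space \<mu> \<Longrightarrow> cmod (F n x) \<le> B"
  shows "f \<in> cl"
proof -
  have [measurable]: "F n \<in> borel_measurable \<mu>" for n using cl_L2[OF F] by (rule L2_measurable)
  have [measurable]: "f \<in> borel_measurable \<mu>" using borel_measurable_LIMSEQ_metric[of F \<mu> f] lim by simp
  have fB: "cmod (f x) \<le> B" if "x \<in> space \<mu>" for x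
    using tendsto_norm[OF lim[OF that]] B[OF that] by (intro LIMSEQ_le_const2) auto
  have fL: "f \<in> L2" using fB by (intro L2_bounded) auto
  have "(\<lambda>i. \<integral>x. (cmod (f x - F i x))\<^sup>2 \<partial>\<mu>) \<longlonglongrightarrow> (\<integral>x. 0 \<partial>\<mu>)"
  proof (rule integral_dominated_convergence[of _ _ _ "\<lambda>x. (2 * B)\<^sup>2"])
    show "AE x in \<mu>. (\<lambda>i. (cmod (f x - F i x))\<^sup>2) \<longlonglongrightarrow> 0"
    proof (rule AE_I2)
      fix x assume "x \<in> space \<mu>"
      then have "(\<lambda>i. (cmod (f x - F i x))\<^sup>2) \<longlonglongrightarrow> (cmod (f x - f x))\<^sup>2"
        by (intro tendsto_intros lim)
      then show "(\<lambda>i. (cmod (f x - F i x))\<^sup>2) \<longlonglongrightarrow> 0" by simp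
    qed
    show "AE x in \<mu>. norm ((cmod (f x - F i x))\<^sup>2) \<le> (2 * B)\<^sup>2" for i
    proof (rule AE_I2)
      fix x assume x: "x \<in> space \<mu>"
      have "cmod (f x - F i x) \<le> 2 * B"
        using norm_triangle_ineq4[of "f x" "F i x"] fB[OF x] B[OF x, of i] by simp
      then have "(cmod (f x - F i x))\<^sup>2 \<le> (2 * B)\<^sup>2" by (intro power_mono) auto
      then show "norm ((cmod (f x - F i x))\<^sup>2) \<le> (2 * B)\<^sup>2" by simp
    qed
  qed measurable
  note lim0 = this
  show ?thesis
  proof (rule cl_closed[OF fL])
    fix e :: real assume e: "e > 0"
    from LIMSEQ_D[OF lim0, of "e\<^sup>2"] e
    obtain i where "norm (\<integral>x. (cmod (f x - F i x))\<^sup>2 \<partial>\<mu>) < e\<^sup>2" by auto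
    then have "nrm2 (\<lambda>x. f x - F i x) < e" using e by (simp add: nrm2_def real_less_lsqrt)
    then show "\<exists>h\<in>cl. nrm2 (\<lambda>x. f x - h x) < e" using F by blast
  qed
qed

text \<open>The measurable sets whose indicators lie in a closed subspace form a Dynkin system.\<close>

lemma cl_from_indicators:
  assumes gen: "sets \<mu> = sigma_sets (space \<mu>) E" and E: "E \<subseteq> Pow (space \<mu>)" and "Int_stable E"
    and ind: "\<And>A. A \<in> E \<Longrightarrow> (\<lambda>x. indicator A x) \<in> cl"
    and one: "(\<lambda>x. 1) \<in> cl"
    and f: "f \<in> L2"
  shows "f \<in> cl"
proof -
  have indL: "(\<lambda>x. indicator A x :: complex) \<in> L2" if "A \<in> sets \<mu>" for A
    by (rule L2_bounded[of _ 1]) (use that in \<open>auto simp: indicator_def\<close>)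
  have indH: "(\<lambda>x. indicator A x :: complex) \<in> cl" if A: "A \<in> sets \<mu>" for A
  proof -
    have "A \<in> sigma_sets (space \<mu>) E" using A gen by simp
    with \<open>Int_stable E\<close> E show ?thesis
    proof (induction rule: sigma_sets_induct_disjoint)
      case (basic A)
      then have "A \<in> sets \<mu>" using gen by auto
      then show ?case using ind[OF basic] by simp
    next
      case empty
      then show ?case using cl_scale[OF one, of 0] by simp
    next
      case (compl A)
      have A: "A \<in> sets \<mu>" using compl gen by simp
      have "(\<lambda>x. 1 + (-1) * indicator A x :: complex) \<in> cl" using compl by (intro cl_add cl_scale one)
      \<comment> \<open>The two functions agree on \<open>space \<mu>\<close> but not outside it, so
        membership in \<open>cl\<close> is transferred through their distance 0.\<close>
      moreover have "nrm2 (\<lambda>x. indicator (space \<mu> - A) x - (1 + (-1) * indicator A x)) = 0"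
        unfolding nrm2_def
        by (subst Bochner_Integration.integral_cong[of _ _ _ "\<lambda>_. 0"]) (auto simp: indicator_def)
      ultimately have "\<exists>h\<in>cl. nrm2 (\<lambda>x. indicator (space \<mu> - A) x - h x) < e" if "e > 0" for e
        using that by force
      then show ?case using A by (intro cl_closed indL) auto
    next
      case (union A)
      have A: "A i \<in> sets \<mu>" for i using union gen by auto
      have sumH: "(\<lambda>x. \<Sum>i<n. indicator (A i) x :: complex) \<in> cl" for n
        by (induction n) (use union cl_add cl_scale[OF one, of 0] in auto)
      have lim: "(\<lambda>n. \<integral>x. (cmod (indicator (\<Union>i. A i) x - (\<Sum>i<n. indicator (A i) x)))\<^sup>2 \<partial>\<mu>)
           \<longlonglongrightarrow> (\<integral>x. 0 \<partial>\<mu>)"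
      proof (rule integral_dominated_convergence[of _ _ _ "\<lambda>x. 1"])
        have s: "(\<Sum>i<n. indicator (A i) x :: complex) = indicator (\<Union>i<n. A i) x" for n x
          using union by (intro indicator_UN_disjoint[symmetric]) (auto simp: disjoint_family_on_def)
        show "AE x in \<mu>. (\<lambda>n. (cmod (indicator (\<Union>i. A i) x - (\<Sum>i<n. indicator (A i) x)))\<^sup>2) \<longlonglongrightarrow> 0"
        proof (rule AE_I2)
          fix x
          have "(\<lambda>n. indicator (\<Union>i<n. A i) x :: complex) \<longlonglongrightarrow> indicator (\<Union>i. A i) x"
            by (rule LIMSEQ_indicator_UN)
          then have "(\<lambda>n. (cmod (indicator (\<Union>i. A i) x - (\<Sum>i<n. indicator (A i) x)))\<^sup>2)
             \<longlonglongrightarrow> (cmod (indicator (\<Union>i. A i) x - indicator (\<Union>i. A i) x))\<^sup>2"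
            unfolding s by (intro tendsto_intros)
          then show "(\<lambda>n. (cmod (indicator (\<Union>i. A i) x - (\<Sum>i<n. indicator (A i) x)))\<^sup>2) \<longlonglongrightarrow> 0"
            by simp
        qed
        show "AE x in \<mu>. norm ((cmod (indicator (\<Union>i. A i) x - (\<Sum>i<n. indicator (A i) x)))\<^sup>2) \<le> 1" for n
          unfolding s by (auto simp: indicator_def)
        have [measurable]: "A i \<in> sets \<mu>" for i by (rule A)
        show "(\<lambda>x. (cmod (indicator (\<Union>i. A i) x - (\<Sum>i<n. indicator (A i) x)))\<^sup>2) \<in> borel_measurable \<mu>" for n
          by measurable
      qed auto
      show ?case
      proof (rule cl_closed)
        show "(\<lambda>x. indicator (\<Union>i. A i) x :: complex) \<in> L2" using A by (intro indL) auto
        fix e :: real assume "e > 0"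
        then have "e\<^sup>2 > 0" by simp
        from LIMSEQ_D[OF lim this] obtain n where
          "norm (\<integral>x. (cmod (indicator (\<Union>i. A i) x - (\<Sum>i<n. indicator (A i) x)))\<^sup>2 \<partial>\<mu>) < e\<^sup>2"
          by auto
        then have "nrm2 (\<lambda>x. indicator (\<Union>i. A i) x - (\<Sum>i<n. indicator (A i) x)) < e"
          using \<open>e > 0\<close> by (simp add: nrm2_def real_less_lsqrt)
        then show "\<exists>h\<in>cl. nrm2 (\<lambda>x. indicator (\<Union>i. A i) x - h x) < e"
          using sumH[of n] by (intro bexI[where x="\<lambda>x. \<Sum>i<n. indicator (A i) x"])
      qed
    qed
  qed
  show ?thesis
  proof (rule cl_closed[OF f])
    fix e :: real assume e: "e > 0"
    have [measurable]: "f \<in> borel_measurable \<mu>" using f by (rule L2_measurable)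
    from borel_measurable_implies_sequence_metric[OF \<open>f \<in> borel_measurable \<mu>\<close>, of 0]
    obtain s where "\<forall>i. simple_function \<mu> (s i)" "\<forall>x\<in>space \<mu>. (\<lambda>i. s i x) \<longlonglongrightarrow> f x"
      "\<forall>i. \<forall>x\<in>space \<mu>. dist (s i x) 0 \<le> 2 * dist (f x) 0"
      by blast
    then have s: "\<And>i. simple_function \<mu> (s i)"
      and ls: "\<And>x. x \<in> space \<mu> \<Longrightarrow> (\<lambda>i. s i x) \<longlonglongrightarrow> f x"
      and bs: "\<And>i x. x \<in> space \<mu> \<Longrightarrow> norm (s i x) \<le> 2 * norm (f x)"
      by auto
    have [measurable]: "s i \<in> borel_measurable \<mu>" for i using s by (rule borel_measurable_simple_function)
    have sH: "s i \<in> cl" for i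
    proof -
      have fin: "finite (s i ` space \<mu>)" using s by (simp add: simple_function_def)
      have "(\<lambda>x. \<Sum>y\<in>F. y * indicator (s i -` {y} \<inter> space \<mu>) x) \<in> cl" if "finite F" for F
        using that
      proof (induction F)
        case (insert y F)
        have "(\<lambda>x. y * indicator (s i -` {y} \<inter> space \<mu>) x) \<in> cl"
          by (intro cl_scale indH) measurable
        from cl_add[OF this insert.IH] show ?case by (simp only: sum.insert[OF insert.hyps])
      qed (use cl_scale[OF one, of 0] in simp)
      note * = this[OF fin]
      have "nrm2 (\<lambda>x. s i x - (\<Sum>y\<in>s i ` space \<mu>. y * indicator (s i -` {y} \<inter> space \<mu>) x)) = 0"
        unfolding nrm2_def
      proof (subst Bochner_Integration.integral_cong[of _ _ _ "\<lambda>_. 0"])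
        fix x assume x: "x \<in> space \<mu>"
        have "(\<Sum>y\<in>s i ` space \<mu>. y * indicator (s i -` {y} \<inter> space \<mu>) x)
            = (\<Sum>y\<in>s i ` space \<mu>. if y = s i x then y else 0)"
          using x by (intro sum.cong) (auto simp: indicator_def)
        also have "\<dots> = s i x" using fin x by simp
        finally show "(cmod (s i x - (\<Sum>y\<in>s i ` space \<mu>. y * indicator (s i -` {y} \<inter> space \<mu>) x)))\<^sup>2 = 0"
          by simp
      qed auto
      moreover have "s i \<in> L2"
      proof -
        have "integrable \<mu> (\<lambda>x. (cmod (s i x))\<^sup>2)"
        proof (rule Bochner_Integration.integrable_bound)
          show "integrable \<mu> (\<lambda>x. 4 * (cmod (f x))\<^sup>2)" using f by (simp add: L2_def)
          have "(cmod (s i x))\<^sup>2 \<le> (2 * cmod (f x))\<^sup>2" if "x \<in> space \<mu>" for x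
            using bs[OF that] by (intro power_mono) auto
          then show "AE x in \<mu>. norm ((cmod (s i x))\<^sup>2) \<le> norm (4 * (cmod (f x))\<^sup>2)"
            by (intro AE_I2) (simp add: power_mult_distrib)
        qed measurable
        then show ?thesis by (simp add: L2_def)
      qed
      moreover have "\<exists>h\<in>cl. nrm2 (\<lambda>x. s i x - h x) < e" if "e > 0" for e
        using that * calculation by force
      ultimately show ?thesis by (intro cl_closed)
    qed
    have "(\<lambda>i. \<integral>x. (cmod (f x - s i x))\<^sup>2 \<partial>\<mu>) \<longlonglongrightarrow> (\<integral>x. 0 \<partial>\<mu>)"
    \<comment> \<open>The simple functions are bounded by twice the modulus of \<open>f\<close>, so
      the error is at most three times that modulus; hence the factor 9.\<close>
    proof (rule integral_dominated_convergence[of _ _ _ "\<lambda>x. 9 * (cmod (f x))\<^sup>2"])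
      show "integrable \<mu> (\<lambda>x. 9 * (cmod (f x))\<^sup>2)" using f by (simp add: L2_def)
      show "AE x in \<mu>. (\<lambda>i. (cmod (f x - s i x))\<^sup>2) \<longlonglongrightarrow> 0"
      proof (rule AE_I2)
        fix x assume "x \<in> space \<mu>"
        then have "(\<lambda>i. (cmod (f x - s i x))\<^sup>2) \<longlonglongrightarrow> (cmod (f x - f x))\<^sup>2"
          by (intro tendsto_intros ls)
        then show "(\<lambda>i. (cmod (f x - s i x))\<^sup>2) \<longlonglongrightarrow> 0" by simp
      qed
      show "AE x in \<mu>. norm ((cmod (f x - s i x))\<^sup>2) \<le> 9 * (cmod (f x))\<^sup>2" for i
      proof (rule AE_I2)
        fix x assume "x \<in> space \<mu>"
        then have "cmod (f x - s i x) \<le> 3 * cmod (f x)"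
          using bs[of x i] norm_triangle_ineq4[of "f x" "s i x"] by simp
        then have "(cmod (f x - s i x))\<^sup>2 \<le> (3 * cmod (f x))\<^sup>2" by (intro power_mono) auto
        then show "norm ((cmod (f x - s i x))\<^sup>2) \<le> 9 * (cmod (f x))\<^sup>2" by (simp add: power_mult_distrib)
      qed
    qed measurable
    from LIMSEQ_D[OF this, of "e\<^sup>2"] e
    obtain i where "norm (\<integral>x. (cmod (f x - s i x))\<^sup>2 \<partial>\<mu>) < e\<^sup>2" by auto
    then have "nrm2 (\<lambda>x. f x - s i x) < e" using e by (simp add: nrm2_def real_less_lsqrt)
    then show "\<exists>h\<in>cl. nrm2 (\<lambda>x. f x - h x) < e" using sH by blast
  qed
qed

end

subsection \<open>Trigonometric polynomials on a torus\<close>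

definition ee :: "real \<Rightarrow> complex" where "ee t = cis (2 * pi * t)"

lemma ee_add: "ee (s + t) = ee s * ee t"
  by (simp add: ee_def cis_mult[symmetric] distrib_left)

lemma ee_0 [simp]: "ee 0 = 1" and ee_norm [simp]: "cmod (ee t) = 1"
  and ee_cnj: "cnj (ee t) = ee (- t)" and ee_nonzero [simp]: "ee t \<noteq> 0"
  by (simp_all add: ee_def cis_cnj)

lemma ee_int: "k \<in> \<int> \<Longrightarrow> ee k = 1"
  by (auto simp: ee_def elim!: Ints_cases)

lemma ee_half: "ee (1/2) = -1"
  by (simp add: ee_def)

lemma continuous_ee: "continuous_on S g \<Longrightarrow> continuous_on S (\<lambda>x. ee (g x))"
  unfolding ee_def by (intro continuous_intros)

text \<open>The torus is the quotient of the space by the lattice with basis \<open>Y\<close>. Two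
  bases occur later: the adapted basis \<open>X\<close> and the one in which \<open>T\<close> is
  stretched by 4.\<close>

locale torus =
  fixes I :: "'i set" and c :: "'i \<Rightarrow> 'a::euclidean_space \<Rightarrow> real" and Y :: "'i \<Rightarrow> 'a"
  assumes fin: "finite I" and lin: "\<And>i. i \<in> I \<Longrightarrow> linear (c i)"
    and expand: "\<And>v. (\<Sum>i\<in>I. c i v *\<^sub>R Y i) = v"
    and dual: "\<And>i j. i \<in> I \<Longrightarrow> j \<in> I \<Longrightarrow> c i (Y j) = (if i = j then 1 else 0)"
begin

inductive_set trig :: "('a \<Rightarrow> complex) set" where
  mono: "(\<lambda>v. a * ee (\<Sum>i\<in>I. of_int (k i) * c i v)) \<in> trig"
| add: "f \<in> trig \<Longrightarrow> g \<in> trig \<Longrightarrow> (\<lambda>v. f v + g v) \<in> trig"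

lemma trig_const: "(\<lambda>v. a) \<in> trig"
  using mono[of a "\<lambda>_. 0"] by simp

lemma trig_sum: "finite J \<Longrightarrow> (\<And>j. j \<in> J \<Longrightarrow> f j \<in> trig) \<Longrightarrow> (\<lambda>v. \<Sum>j\<in>J. f j v) \<in> trig"
  by (induction J rule: finite_induct) (use trig_const[of 0] trig.add in auto)

lemma trig_mult: assumes "f \<in> trig" "g \<in> trig" shows "(\<lambda>v. f v * g v) \<in> trig"
  using assms(1)
proof induction
  case (mono a k)
  show ?case using assms(2)
  proof induction
    case (mono b j)
    have "(\<Sum>i\<in>I. of_int (k i + j i) * c i v) = (\<Sum>i\<in>I. of_int (k i) * c i v) + (\<Sum>i\<in>I. of_int (j i) * c i v)" for v
      by (simp add: sum.distrib distrib_right)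
    then have "(\<lambda>v. a * ee (\<Sum>i\<in>I. of_int (k i) * c i v) * (b * ee (\<Sum>i\<in>I. of_int (j i) * c i v)))
      = (\<lambda>v. (a * b) * ee (\<Sum>i\<in>I. of_int (k i + j i) * c i v))"
      by (simp add: ee_add mult_ac)
    then show ?case using trig.mono[of "a * b" "\<lambda>i. k i + j i"] by simp
  next
    case (add f g)
    then show ?case using trig.add by (simp add: distrib_left)
  qed
next
  case (add f g)
  then show ?case using trig.add by (simp add: distrib_right)
qed

lemma trig_ee: assumes "i \<in> I" shows "(\<lambda>v. ee (of_int k * c i v)) \<in> trig"
proof -
  have "(\<lambda>v. 1 * ee (\<Sum>j\<in>I. of_int (if j = i then k else 0) * c j v)) \<in> trig" by (rule trig.mono)
  moreover have "(\<Sum>j\<in>I. of_int (if j = i then k else 0) * c j v) = of_int k * c i v" for v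
  proof -
    have "(\<Sum>j\<in>I. of_int (if j = i then k else 0) * c j v) = (\<Sum>j\<in>I. if j = i then of_int k * c j v else 0)"
      by (intro sum.cong) auto
    then show ?thesis using fin assms by simp
  qed
  ultimately show ?thesis by simp
qed

text \<open>\<open>\<iota>\<close> realizes the torus as a compact subset of a Euclidean space, where Stone-Weierstrass applies.\<close>

definition \<iota> :: "'a \<Rightarrow> 'a \<times> 'a" where
  "\<iota> v = (\<Sum>i\<in>I. cos (2 * pi * c i v) *\<^sub>R Y i, \<Sum>i\<in>I. sin (2 * pi * c i v) *\<^sub>R Y i)"

lemma trig_cos: "i \<in> I \<Longrightarrow> (\<lambda>v. complex_of_real (cos (2 * pi * c i v))) \<in> trig"
  and trig_sin: "i \<in> I \<Longrightarrow> (\<lambda>v. complex_of_real (sin (2 * pi * c i v))) \<in> trig"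
proof -
  assume i: "i \<in> I"
  have 1: "complex_of_real (cos (2 * pi * t)) = 1/2 * ee (of_int 1 * t) + 1/2 * ee (of_int (-1) * t)" for t
    by (simp add: ee_def complex_eq_iff)
  have 2: "complex_of_real (sin (2 * pi * t)) = (- \<i>/2) * ee (of_int 1 * t) + (\<i>/2) * ee (of_int (-1) * t)" for t
    by (simp add: ee_def complex_eq_iff)
  show "(\<lambda>v. complex_of_real (cos (2 * pi * c i v))) \<in> trig"
    unfolding 1 by (intro trig.add trig_mult trig_const trig_ee i)
  show "(\<lambda>v. complex_of_real (sin (2 * pi * c i v))) \<in> trig"
    unfolding 2 by (intro trig.add trig_mult trig_const trig_ee i)
qed

lemma trig_polynomial: "real_polynomial_function p \<Longrightarrow> (\<lambda>v. complex_of_real (p (\<iota> v))) \<in> trig"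
proof (induction rule: real_polynomial_function.induct)
  case (linear f)
  have l: "linear f" using linear by (rule bounded_linear.linear)
  have "f (\<iota> v) = (\<Sum>i\<in>I. cos (2 * pi * c i v) * f (Y i, 0)) + (\<Sum>i\<in>I. sin (2 * pi * c i v) * f (0, Y i))" for v
  proof -
    have "\<iota> v = (\<Sum>i\<in>I. cos (2 * pi * c i v) *\<^sub>R (Y i, 0)) + (\<Sum>i\<in>I. sin (2 * pi * c i v) *\<^sub>R (0, Y i))"
      by (simp add: \<iota>_def prod_eq_iff fst_sum snd_sum)
    then show ?thesis by (simp only: linear_add[OF l] linear_sum[OF l] linear_scale[OF l] real_scaleR_def)
  qed
  then show ?case
    by (simp only: of_real_add of_real_sum of_real_mult)
      (intro trig.add trig_sum fin trig_mult trig_const trig_cos trig_sin)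
next
  case (const c)
  then show ?case by (rule trig_const)
next
  case (add f g)
  then show ?case using trig.add by simp
next
  case (mult f g)
  then show ?case using trig_mult by simp
qed

lemma continuous_c: "i \<in> I \<Longrightarrow> continuous_on S (c i)"
  using lin linear_conv_bounded_linear linear_continuous_on by blast

lemma continuous_iota: "continuous_on S \<iota>"
  unfolding \<iota>_def by (intro continuous_intros continuous_on_compose2[OF continuous_c]) auto

definition "cube = {v. \<forall>i\<in>I. c i v \<in> {0..1}}"

lemma compact_cube: "compact cube"
proof -
  have "closed cube"
  proof -
    have "cube = (\<Inter>i\<in>I. c i -` {0..1})" by (auto simp: cube_def)
    moreover have "closed (c i -` {0..1})" if "i \<in> I" for i
      using continuous_c[OF that] by (intro closed_vimage) auto
    ultimately show ?thesis by auto
  qed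
  moreover have "bounded cube"
  proof (rule boundedI)
    fix v assume v: "v \<in> cube"
    have "norm v = norm (\<Sum>i\<in>I. c i v *\<^sub>R Y i)" by (simp add: expand)
    also have "\<dots> \<le> (\<Sum>i\<in>I. norm (c i v *\<^sub>R Y i))" by (rule norm_sum)
    also have "\<dots> \<le> (\<Sum>i\<in>I. norm (Y i))"
      using v by (intro sum_mono) (auto simp: cube_def intro!: mult_left_le_one_le)
    finally show "norm v \<le> (\<Sum>i\<in>I. norm (Y i))" .
  qed
  ultimately show ?thesis by (simp add: compact_eq_bounded_closed)
qed

lemma c_combination: "i \<in> I \<Longrightarrow> c i (\<Sum>j\<in>I. a j *\<^sub>R Y j) = a i"
  using fin by (simp add: linear_sum[OF lin] linear_scale[OF lin] dual if_distrib cong: if_cong)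

lemma periodic_int:
  assumes per: "\<And>i v. i \<in> I \<Longrightarrow> f (v + Y i) = f v"
  shows "f (v + (\<Sum>i\<in>I. of_int (k i) *\<^sub>R Y i)) = f v"
proof -
  have n: "f (v + real n *\<^sub>R Y i) = f v" if "i \<in> I" for v n i
    by (induction n) (use per[OF that, of "v + real _ *\<^sub>R Y i"] in \<open>auto simp: algebra_simps\<close>)
  have z: "f (v + of_int k *\<^sub>R Y i) = f v" if "i \<in> I" for v k i
  proof (cases "k \<ge> 0")
    case True
    then show ?thesis using n[OF that, of v "nat k"] by simp
  next
    case False
    then show ?thesis using n[OF that, of "v + of_int k *\<^sub>R Y i" "nat (- k)"] by simp
  qed
  have "f (v + (\<Sum>i\<in>J. of_int (k i) *\<^sub>R Y i)) = f v" if "finite J" "J \<subseteq> I" for J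
    using that
  proof (induction J)
    case (insert j J)
    have "f (v + (\<Sum>i\<in>insert j J. of_int (k i) *\<^sub>R Y i)) = f ((v + (\<Sum>i\<in>J. of_int (k i) *\<^sub>R Y i)) + of_int (k j) *\<^sub>R Y j)"
      using insert by (simp add: algebra_simps)
    then show ?case using insert z[of j] by simp
  qed simp
  then show ?thesis using fin by simp
qed

text \<open>Equal cosines and sines force coordinates that differ by integers. So
  \<open>\<iota>\<close> separates the points of the torus, and periodic functions factor through
  it.\<close>

lemma iota_eq:
  assumes per: "\<And>i v. i \<in> I \<Longrightarrow> f (v + Y i) = f v" and eq: "\<iota> v = \<iota> w"
  shows "f v = f w"
proof -
  have "\<exists>k::int. c i v - c i w = of_int k" if i: "i \<in> I" for i
  proof -
    have "cos (2 * pi * c i v) = cos (2 * pi * c i w)" "sin (2 * pi * c i v) = sin (2 * pi * c i w)"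
      using arg_cong[OF eq, of "\<lambda>z. c i (fst z)"] arg_cong[OF eq, of "\<lambda>z. c i (snd z)"] i
      by (simp_all add: \<iota>_def c_combination)
    then have "cos (2 * pi * c i v - 2 * pi * c i w) = 1"
      by (simp add: cos_diff power2_eq_square[symmetric])
    then obtain k :: int where "2 * pi * c i v - 2 * pi * c i w = k * 2 * pi" by (auto simp: cos_one_2pi_int)
    then have "2 * pi * (c i v - c i w) = 2 * pi * of_int k" by (simp add: algebra_simps)
    then show ?thesis by auto
  qed
  then obtain k :: "'i \<Rightarrow> int" where k: "\<And>i. i \<in> I \<Longrightarrow> c i v - c i w = of_int (k i)" by metis
  have "v = w + (\<Sum>i\<in>I. (c i v - c i w) *\<^sub>R Y i)"
    by (simp add: scaleR_diff_left sum_subtractf expand)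
  also have "(\<Sum>i\<in>I. (c i v - c i w) *\<^sub>R Y i) = (\<Sum>i\<in>I. of_int (k i) *\<^sub>R Y i)"
    by (intro sum.cong) (auto simp: k)
  finally show ?thesis using periodic_int[of f w k, OF per] by simp
qed

text \<open>Fractional parts of the coordinates give a representative in the cube; hence the range
  of \<open>\<iota>\<close> is the image of a compact set.\<close>

lemma iota_cube: "\<exists>w\<in>cube. \<iota> w = \<iota> v"
proof (intro bexI)
  define w where "w = v + (\<Sum>i\<in>I. of_int (- \<lfloor>c i v\<rfloor>) *\<^sub>R Y i)"
  have cw: "c i w = frac (c i v)" if "i \<in> I" for i
    using that unfolding w_def by (simp add: linear_add[OF lin] frac_def c_combination del: of_int_minus)
  then show "w \<in> cube" by (auto simp: cube_def less_imp_le[OF frac_lt_1])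
  have p: "\<iota> (v + Y j) = \<iota> v" if "j \<in> I" for v j
  proof -
    have "cos (2 * pi * c i (v + Y j)) = cos (2 * pi * c i v)"
        "sin (2 * pi * c i (v + Y j)) = sin (2 * pi * c i v)" if "i \<in> I" for i
      using that \<open>j \<in> I\<close> by (simp_all add: linear_add[OF lin] dual distrib_left)
    then show ?thesis by (simp add: \<iota>_def)
  qed
  show "\<iota> w = \<iota> v" unfolding w_def using periodic_int[of \<iota> v, OF p] .
qed

lemma trig_dense_real:
  fixes f :: "'a \<Rightarrow> real"
  assumes f: "continuous_on UNIV f" and per: "\<And>i v. i \<in> I \<Longrightarrow> f (v + Y i) = f v" and e: "\<epsilon> > 0"
  obtains p where "p \<in> trig" "\<And>v. cmod (of_real (f v) - p v) < \<epsilon>"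
proof -
  define K where "K = \<iota> ` cube"
  have K: "compact K" unfolding K_def by (intro compact_continuous_image continuous_iota compact_cube)
  have iK: "\<iota> v \<in> K" for v using iota_cube[of v] unfolding K_def by (metis imageI)
  define F where "F y = f (SOME v. \<iota> v = y)" for y
  have F: "F (\<iota> v) = f v" for v
  proof -
    have "\<iota> (SOME w. \<iota> w = \<iota> v) = \<iota> v" by (rule someI[of "\<lambda>w. \<iota> w = \<iota> v" v]) simp
    from iota_eq[where f=f, OF per this] show ?thesis unfolding F_def by simp
  qed
  \<comment> \<open>Closed sets pull back to images of compact subsets of the cube: a continuous map
    from a compact space to a Hausdorff space is closed.\<close>
  have "continuous_on K F"
  proof (rule continuous_on_closed_vimage[OF compact_imp_closed[OF K], THEN iffD2], intro allI impI)
    fix B :: "real set" assume B: "closed B"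
    have "F -` B \<inter> K = \<iota> ` (cube \<inter> f -` B)" by (auto simp: K_def F)
    moreover have "compact (cube \<inter> f -` B)"
      using compact_cube closed_vimage[OF B f] by (rule compact_Int_closed)
    ultimately show "closed (F -` B \<inter> K)"
      by (simp add: compact_imp_closed compact_continuous_image[OF continuous_iota])
  qed
  from Stone_Weierstrass_real_polynomial_function[OF K this e]
  obtain g where g: "real_polynomial_function g" "\<And>x. x \<in> K \<Longrightarrow> \<bar>F x - g x\<bar> < \<epsilon>" by blast
  show ?thesis
  proof (rule that[OF trig_polynomial[OF g(1)]])
    fix v
    have "complex_of_real (f v) - of_real (g (\<iota> v)) = of_real (f v - g (\<iota> v))" by simp
    then have "cmod (of_real (f v) - of_real (g (\<iota> v))) = \<bar>f v - g (\<iota> v)\<bar>" by (metis norm_of_real)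
    then show "cmod (of_real (f v) - of_real (g (\<iota> v))) < \<epsilon>" using g(2)[OF iK[of v]] by (simp add: F)
  qed
qed

lemma trig_dense:
  fixes f :: "'a \<Rightarrow> complex"
  assumes f: "continuous_on UNIV f" and per: "\<And>i v. i \<in> I \<Longrightarrow> f (v + Y i) = f v" and e: "\<epsilon> > 0"
  obtains p where "p \<in> trig" "\<And>v. cmod (f v - p v) < \<epsilon>"
proof -
  have e2: "\<epsilon>/2 > 0" using e by simp
  obtain p where p: "p \<in> trig" "\<And>v. cmod (of_real (Re (f v)) - p v) < \<epsilon>/2"
    using trig_dense_real[of "\<lambda>v. Re (f v)" "\<epsilon>/2"] f per e2 by (auto intro: continuous_intros)
  obtain q where q: "q \<in> trig" "\<And>v. cmod (of_real (Im (f v)) - q v) < \<epsilon>/2"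
    using trig_dense_real[of "\<lambda>v. Im (f v)" "\<epsilon>/2"] f per e2 by (auto intro: continuous_intros)
  show ?thesis
  proof (rule that)
    show "(\<lambda>v. p v + \<i> * q v) \<in> trig" by (intro trig.add trig_mult trig_const p q)
    fix v
    have "f v - (p v + \<i> * q v) = (of_real (Re (f v)) - p v) + \<i> * (of_real (Im (f v)) - q v)"
      by (subst complex_eq[of "f v"]) (simp add: algebra_simps)
    also have "cmod \<dots> \<le> cmod (of_real (Re (f v)) - p v) + cmod (\<i> * (of_real (Im (f v)) - q v))"
      by (rule norm_triangle_ineq)
    also have "\<dots> < \<epsilon>" using p(2)[of v] q(2)[of v] by (simp add: norm_mult)
    finally show "cmod (f v - (p v + \<i> * q v)) < \<epsilon>" .
  qed
qed

end

subsection \<open>Locally finite sums\<close>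

text \<open>Junk value \<open>0\<close> for infinite support.\<close>

definition zsum :: "(int \<Rightarrow> complex) \<Rightarrow> complex" where
  "zsum a = (\<Sum>k | a k \<noteq> 0. a k)"

lemma zsum_eq: "finite K \<Longrightarrow> (\<And>k. a k \<noteq> 0 \<Longrightarrow> k \<in> K) \<Longrightarrow> zsum a = sum a K"
  unfolding zsum_def by (rule sum.mono_neutral_left) auto

lemma finite_int_near:
  fixes s b c :: real
  assumes "c > 0" shows "finite {k::int. \<bar>s + of_int k * c\<bar> \<le> b}"
proof (rule finite_subset)
  show "{k::int. \<bar>s + of_int k * c\<bar> \<le> b} \<subseteq> {\<lfloor>(- b - s) / c\<rfloor>..\<lceil>(b - s) / c\<rceil>}"
  proof
    fix k assume "k \<in> {k::int. \<bar>s + of_int k * c\<bar> \<le> b}"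
    then have "(- b - s) / c \<le> of_int k" "of_int k \<le> (b - s) / c"
      using assms by (auto simp: field_simps abs_le_iff)
    then show "k \<in> {\<lfloor>(- b - s) / c\<rfloor>..\<lceil>(b - s) / c\<rceil>}" by (auto; linarith)
  qed
qed simp

lemma zsum_shift: "zsum (\<lambda>k. a (k + j)) = zsum a"
proof -
  have "(\<Sum>k | a (k + j) \<noteq> 0. a (k + j)) = (\<Sum>k | a k \<noteq> 0. a k)"
    by (rule sum.reindex_bij_witness[of _ "\<lambda>k. k - j" "\<lambda>k. k + j"]) auto
  then show ?thesis by (simp add: zsum_def)
qed

lemma zsum_add: "finite {k. a k \<noteq> 0} \<Longrightarrow> finite {k. b k \<noteq> 0} \<Longrightarrow> zsum (\<lambda>k. a k + b k) = zsum a + zsum b"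
  by (subst (1 2 3) zsum_eq[of "{k. a k \<noteq> 0} \<union> {k. b k \<noteq> 0}"]) (auto simp: sum.distrib)

lemma zsum_mult: "zsum (\<lambda>k. c * a k) = c * zsum a"
  by (cases "c = 0") (simp_all add: zsum_def sum_distrib_left)

text \<open>Around \<open>x0\<close> a single finite index set serves all points: the 1 added to
  \<open>b\<close> absorbs the variation of \<open>t\<close> on the unit ball around
  \<open>t x0\<close>.\<close>

lemma zsum_continuous:
  fixes F :: "'x::t2_space \<Rightarrow> int \<Rightarrow> complex" and t :: "'x \<Rightarrow> real"
  assumes F: "\<And>k. continuous_on UNIV (\<lambda>x. F x k)" and t: "continuous_on UNIV t" and c: "c > 0"
    and sup: "\<And>x k. F x k \<noteq> 0 \<Longrightarrow> \<bar>t x + of_int k * c\<bar> \<le> b"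
  shows "continuous_on UNIV (\<lambda>x. zsum (F x))"
proof -
  have "isCont (\<lambda>x. zsum (F x)) x0" for x0
  proof -
    define S where "S = t -` ball (t x0) 1"
    have S: "open S" "x0 \<in> S" unfolding S_def by (auto intro!: open_vimage t)
    define K where "K = {k::int. \<bar>t x0 + of_int k * c\<bar> \<le> b + 1}"
    have K: "finite K" unfolding K_def by (rule finite_int_near[OF c])
    have "zsum (F x) = (\<Sum>k\<in>K. F x k)" if "x \<in> S" for x
    proof (rule zsum_eq[OF K])
      fix k assume "F x k \<noteq> 0"
      then have "\<bar>t x + of_int k * c\<bar> \<le> b" by (rule sup)
      moreover have "\<bar>t x0 - t x\<bar> < 1" using that by (simp add: S_def dist_real_def)
      ultimately show "k \<in> K" unfolding K_def by (simp add: abs_le_iff abs_less_iff) 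
    qed
    then have "continuous_on S (\<lambda>x. zsum (F x)) \<longleftrightarrow> continuous_on S (\<lambda>x. \<Sum>k\<in>K. F x k)"
      by (intro continuous_on_cong) auto
    moreover have "continuous_on S (\<lambda>x. \<Sum>k\<in>K. F x k)"
      using F by (intro continuous_intros) (blast intro: continuous_on_subset)
    ultimately show ?thesis using S continuous_on_eq_continuous_at by blast
  qed
  then show ?thesis by (simp add: continuous_at_imp_continuous_on)
qed

text \<open>With \<open>s + m\<close> in the half-open unit interval the hats at \<open>m\<close>
  and \<open>m - 1\<close> have the values \<open>1 - (s + m)\<close> and \<open>s + m\<close>; all
  others vanish.\<close>

lemma hat_sum:
  fixes s :: real
  defines "w \<equiv> \<lambda>k::int. complex_of_real (max 0 (1 - \<bar>s + of_int k\<bar>))"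
  shows "zsum w = 1"
proof -
  define m where "m = - \<lfloor>s\<rfloor>"
  have fr: "0 \<le> s + of_int m" "s + of_int m < 1" unfolding m_def by (simp_all; linarith)+
  have "zsum w = sum w {m, m - 1}"
  proof (rule zsum_eq)
    fix k assume "w k \<noteq> 0"
    then have "\<bar>s + of_int k\<bar> < 1" by (auto simp: w_def max_def split: if_splits)
    then have "of_int k - of_int m < (1::real)" "of_int k - of_int m > (-2::real)" using fr by linarith+
    then have "k - m < 1" "k - m > -2" by linarith+
    then show "k \<in> {m, m - 1}" by auto
  qed auto
  also have "\<dots> = 1" using fr by (simp add: w_def max_def abs_if)
  finally show ?thesis .
qed

subsection \<open>The lattice, the dual lattice and its orbits\<close>

locale lattice_model = metabelian G \<A> e U \<phi> \<tau> T N
  for G :: "'g::t2_space monoid" (structure)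
    and \<A> :: "('g, 'a::euclidean_space) chart set" and e :: "'a \<Rightarrow> 'g"
    and U :: "'g set" and \<phi> :: "'g \<Rightarrow> 'a" and \<tau> :: "'a \<Rightarrow> real" and T :: 'a and N :: nat +
  fixes X :: "nat \<Rightarrow> 'a" and n p :: nat and \<Gamma> :: "'g set"
  assumes n_pos: "n \<ge> 1" and X_inj: "inj_on X {1..n}" and X_indep: "independent (X ` {1..n})"
    and X_span: "span (X ` {1..n}) = UNIV"
    and tau_eq: "\<tau> = dual_basis X n n" and T_eq: "T = X n"
    and Gamma: "\<Gamma> = range (malcev_product G e X n)" and Gamma_subgroup: "subgroup \<Gamma> G"
    and brackets: "bracket_span (bracket G e) UNIV UNIV = span (X ` {1..p})" and p_less: "p < n"
begin

abbreviation c :: "nat \<Rightarrow> 'a \<Rightarrow> real" where "c \<equiv> dual_basis X n"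

lemma c_linear: "linear (c i)"
  unfolding dual_basis_def
  by (rule linearI)
    (simp_all add: representation_add[OF X_indep] representation_scale[OF X_indep] X_span del: One_nat_def)

lemma c_torus: "torus {1..n} c X"
proof (rule torus.intro)
  show "linear (c i)" if "i \<in> {1..n}" for i by (rule c_linear)
  show "(\<Sum>i\<in>{1..n}. c i v *\<^sub>R X i) = v" for v
  proof -
    have "(\<Sum>b\<in>X ` {1..n}. representation (X ` {1..n}) v b *\<^sub>R b) = v"
      by (rule sum_representation_eq[OF X_indep]) (auto simp: X_span simp del: One_nat_def)
    then show ?thesis by (simp add: sum.reindex[OF X_inj] dual_basis_def del: One_nat_def)
  qed
  show "c i (X j) = (if i = j then 1 else 0)" if ij: "i \<in> {1..n}" "j \<in> {1..n}" for i j
  proof -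
    have "X j \<in> X ` {1..n}" using ij by blast
    moreover have "X i = X j \<longleftrightarrow> i = j" using ij X_inj by (meson inj_on_eq_iff)
    ultimately show ?thesis by (simp add: dual_basis_def representation_basis[OF X_indep] del: One_nat_def)
  qed
qed simp

sublocale XT: torus "{1..n}" c X by (rule c_torus)

lemma sum_split: "sum h {1..n} = sum h {1..n-1} + h n"
  using n_pos by (cases n) auto

lemma c_T: "i \<in> {1..n} \<Longrightarrow> c i T = (if i = n then 1 else 0)"
  using n_pos by (simp add: T_eq XT.dual)

lemma c_n: "c n = \<tau>" by (simp add: tau_eq)

lemma tau_X: "i \<in> {1..n-1} \<Longrightarrow> \<tau> (X i) = 0"
  using XT.dual[of n i] n_pos by (auto simp: tau_eq)

lemma expand_linear:
  assumes "linear l" shows "l v = (\<Sum>i\<in>{1..n-1}. c i v * l (X i)) + \<tau> v * l T"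
proof -
  have "l v = l (\<Sum>i\<in>{1..n}. c i v *\<^sub>R X i)" by (simp only: XT.expand)
  also have "\<dots> = (\<Sum>i\<in>{1..n}. c i v * l (X i))"
    by (simp add: linear_sum[OF assms] linear_scale[OF assms])
  finally show ?thesis unfolding sum_split by (simp only: c_n T_eq)
qed

text \<open>\<open>Lam\<close> is the logarithm of the intersection of \<open>\<Gamma>\<close> with
  the ideal subgroup; \<open>dual_lattice\<close> below is its dual lattice, extended by 0 on
  \<open>T\<close>.\<close>

definition "Lam = {x. \<tau> x = 0 \<and> (\<forall>i\<in>{1..n}. c i x \<in> \<int>)}"

definition "dual_lattice = range (\<lambda>(k::nat \<Rightarrow> int) v. \<Sum>i\<in>{1..n-1}. of_int (k i) * c i v)"

lemma dual_lattice_iff: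
  "l \<in> dual_lattice \<longleftrightarrow> linear l \<and> l T = 0 \<and> (\<forall>i\<in>{1..n-1}. l (X i) \<in> \<int>)"
proof
  assume "l \<in> dual_lattice"
  then obtain k :: "nat \<Rightarrow> int" where l: "l = (\<lambda>v. \<Sum>i\<in>{1..n-1}. of_int (k i) * c i v)"
    by (auto simp: dual_lattice_def)
  have lin: "linear l" unfolding l
    by (rule linearI) (auto simp: linear_add[OF c_linear] linear_scale[OF c_linear] sum.distrib
        distrib_left sum_distrib_left mult_ac intro!: sum.cong)
  have cX: "l (X j) = (\<Sum>i\<in>{1..n-1}. if i = j then of_int (k i) else 0)" if "j \<in> {1..n}" for j
    unfolding l using that by (intro sum.cong refl) (auto simp: XT.dual)
  have "l T = 0" using cX[of n] n_pos by (auto simp: T_eq intro!: sum.neutral)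
  moreover have "l (X j) \<in> \<int>" if "j \<in> {1..n-1}" for j
    using cX[of j] that by auto
  ultimately show "linear l \<and> l T = 0 \<and> (\<forall>i\<in>{1..n-1}. l (X i) \<in> \<int>)" using lin by blast
next
  assume l: "linear l \<and> l T = 0 \<and> (\<forall>i\<in>{1..n-1}. l (X i) \<in> \<int>)"
  have "l = (\<lambda>v. \<Sum>i\<in>{1..n-1}. of_int \<lfloor>l (X i)\<rfloor> * c i v)"
  proof
    fix v
    have "l v = (\<Sum>i\<in>{1..n-1}. c i v * l (X i)) + \<tau> v * l T" by (rule expand_linear) (use l in blast)
    also have "(\<Sum>i\<in>{1..n-1}. c i v * l (X i)) = (\<Sum>i\<in>{1..n-1}. of_int \<lfloor>l (X i)\<rfloor> * c i v)"
      using l by (intro sum.cong) (auto simp: mult.commute)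
    finally show "l v = (\<Sum>i\<in>{1..n-1}. of_int \<lfloor>l (X i)\<rfloor> * c i v)" using l by simp
  qed
  then show "l \<in> dual_lattice"
    unfolding dual_lattice_def by (rule range_eqI[where x="\<lambda>i. \<lfloor>l (X i)\<rfloor>"])
qed

lemma dual_lattice_Lam: "l \<in> dual_lattice \<Longrightarrow> y \<in> Lam \<Longrightarrow> l y \<in> \<int>"
proof -
  assume l: "l \<in> dual_lattice" and y: "y \<in> Lam"
  have "l y = (\<Sum>i\<in>{1..n-1}. c i y * l (X i)) + \<tau> y * l T"
    by (rule expand_linear) (use l in \<open>simp add: dual_lattice_iff\<close>)
  moreover have "(\<Sum>i\<in>{1..n-1}. c i y * l (X i)) \<in> \<int>"
    using l y by (intro Ints_sum Ints_mult) (auto simp: dual_lattice_iff Lam_def)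
  ultimately show ?thesis using l by (simp add: dual_lattice_iff)
qed

lemma X_Lam: "i \<in> {1..n-1} \<Longrightarrow> X i \<in> Lam"
  by (auto simp: Lam_def tau_X XT.dual)

text \<open>All factors but the last lie in the abelian ideal subgroup, where \<open>e\<close> is
  additive. The ordered product is therefore \<open>P\<close> of the linear combination, and
  \<open>\<Gamma>\<close> becomes the integer points in the coordinates of \<open>P\<close>.\<close>

lemma malcev_P: "malcev_product G e X n k = P (\<Sum>i\<in>{1..n}. of_int (k i) *\<^sub>R X i)"
proof -
  have *: "foldr (\<lambda>i g. e (of_int (k i) *\<^sub>R X i) \<otimes> g) xs g = e (\<Sum>i\<leftarrow>xs. of_int (k i) *\<^sub>R X i) \<otimes> g \<and>
      \<tau> (\<Sum>i\<leftarrow>xs. of_int (k i) *\<^sub>R X i) = 0" if "set xs \<subseteq> {1..n-1}" for xs g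
    using that
  proof (induction xs)
    case (Cons i xs)
    then show ?case by (simp add: e_m_add tau_X m_assoc del: One_nat_def)
  qed simp
  define v where "v = (\<Sum>i\<in>{1..n-1}. of_int (k i) *\<^sub>R X i)"
  have v: "(\<Sum>i\<leftarrow>[1..<n]. of_int (k i) *\<^sub>R X i) = v"
  proof -
    have "{1..n-1} = set [1..<n]" using n_pos by auto
    then show ?thesis unfolding v_def by (simp only: sum_set_upt_conv_sum_list_nat[symmetric])
  qed
  have s: "set [1..<n] \<subseteq> {1..n-1}" by auto
  have "malcev_product G e X n k = e v \<otimes> e (of_int (k n) *\<^sub>R T)"
    using *[OF s] v n_pos by (simp add: malcev_product_def T_eq del: One_nat_def)
  moreover have "\<tau> v = 0" using *[OF s] v by simp
  moreover have "(\<Sum>i\<in>{1..n}. of_int (k i) *\<^sub>R X i) = v + of_int (k n) *\<^sub>R T"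
    unfolding sum_split v_def by (simp only: T_eq)
  ultimately show ?thesis by (simp add: P_def)
qed

lemma Gamma_P: "\<Gamma> = P ` {v. \<forall>i\<in>{1..n}. c i v \<in> \<int>}"
proof (intro equalityI subsetI)
  fix g assume "g \<in> \<Gamma>"
  then obtain k where "g = P (\<Sum>i\<in>{1..n}. of_int (k i) *\<^sub>R X i)" unfolding Gamma malcev_P by blast
  then show "g \<in> P ` {v. \<forall>i\<in>{1..n}. c i v \<in> \<int>}"
    by (simp only:) (rule imageI, auto simp: XT.c_combination simp del: One_nat_def)
next
  fix g assume "g \<in> P ` {v. \<forall>i\<in>{1..n}. c i v \<in> \<int>}"
  then obtain v where v: "g = P v" "\<And>i. i \<in> {1..n} \<Longrightarrow> c i v \<in> \<int>" by blast
  have "v = (\<Sum>i\<in>{1..n}. of_int \<lfloor>c i v\<rfloor> *\<^sub>R X i)"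
    using XT.expand[of v] v(2) by (auto intro!: sum.cong)
  then have "g = malcev_product G e X n (\<lambda>i. \<lfloor>c i v\<rfloor>)" using v by (simp add: malcev_P)
  then show "g \<in> \<Gamma>" unfolding Gamma by (simp only: rangeI)
qed

lemma Lam_Gamma: "y \<in> Lam \<Longrightarrow> e y \<in> \<Gamma>"
  unfolding Gamma_P by (rule image_eqI[of _ _ y]) (auto simp: Lam_def P_def)

lemma T_Gamma: "e (of_int k *\<^sub>R T) \<in> \<Gamma>"
  unfolding Gamma_P
  by (rule image_eqI[of _ _ "of_int k *\<^sub>R T"])
    (auto simp: P_def linear_scale[OF c_linear] c_T)

lemma Gamma_cases:
  assumes "\<gamma> \<in> \<Gamma>" obtains y and k :: int where "y \<in> Lam" "\<gamma> = e y \<otimes> e (of_int k *\<^sub>R T)"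
proof -
  obtain v where v: "\<gamma> = P v" "\<And>i. i \<in> {1..n} \<Longrightarrow> c i v \<in> \<int>" using assms unfolding Gamma_P by blast
  have "\<tau> v \<in> \<int>" using v(2)[of n] n_pos by (simp add: tau_eq)
  then obtain k :: int where k: "\<tau> v = of_int k" by (auto elim: Ints_cases)
  have "c i (\<pi> v) \<in> \<int>" if "i \<in> {1..n}" for i
    using that v(2) n_pos by (auto simp: \<pi>_def linear_diff[OF c_linear] linear_scale[OF c_linear] k c_T)
  then have "\<pi> v \<in> Lam" by (simp add: Lam_def)
  then show ?thesis using that[of "\<pi> v" k] v k by (simp add: P_def)
qed

text \<open>Conjugation by \<open>e (of_int k *\<^sub>R T)\<close> preserves both
  \<open>\<Gamma>\<close> and the ideal subgroup, and on logarithms it is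
  \<open>A (of_int k)\<close>. Thus the integrality of this map comes from \<open>\<Gamma>\<close>
  being a subgroup.\<close>

lemma A_Lam: assumes y: "y \<in> Lam" shows "A (of_int k) y \<in> Lam"
proof -
  have t: "\<tau> (A (of_int k) y) = 0" using y by (simp add: Lam_def tau_A)
  have "e (of_int k *\<^sub>R T) \<otimes> e y \<otimes> inv (e (of_int k *\<^sub>R T)) \<in> \<Gamma>"
    using Gamma_subgroup Lam_Gamma[OF y] T_Gamma by (simp add: subgroup.m_closed subgroup.m_inv_closed)
  also have "e (of_int k *\<^sub>R T) \<otimes> e y \<otimes> inv (e (of_int k *\<^sub>R T)) = P (A (of_int k) y)"
    unfolding e_T_commute P_def using t by (simp add: m_assoc)
  finally have "A (of_int k) y \<in> {v. \<forall>i\<in>{1..n}. c i v \<in> \<int>}"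
    using P_inj unfolding Gamma_P by (auto simp: inj_image_mem_iff)
  then show ?thesis using t by (simp add: Lam_def)
qed

text \<open>The coadjoint action on functionals of the ideal, extended by 0 on \<open>T\<close>: the
  time \<open>t\<close> belongs to the group element \<open>e ((- t) *\<^sub>R T)\<close>.\<close>

definition "lA l t = (\<lambda>v. l (A t (\<pi> v)) :: real)" for t :: real

lemma lA_dual_lattice: assumes l: "l \<in> dual_lattice" shows "lA l (of_int k) \<in> dual_lattice"
proof -
  have lin: "linear l" using l by (simp add: dual_lattice_iff)
  have "linear (lA l (of_int k))"
    unfolding lA_def by (rule linearI) (simp_all add: A_simps linear_add[OF lin] linear_scale[OF lin])
  moreover have "lA l (of_int k) T = 0" by (simp add: lA_def A_simps linear_0[OF lin])
  moreover have "lA l (of_int k) (X i) \<in> \<int>" if "i \<in> {1..n-1}" for i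
    using that by (simp add: lA_def tau_X dual_lattice_Lam[OF l A_Lam] X_Lam del: One_nat_def)
  ultimately show ?thesis by (simp add: dual_lattice_iff del: One_nat_def)
qed

lemma lA_0: "l \<in> dual_lattice \<Longrightarrow> lA l 0 = l"
proof
  fix v assume l: "l \<in> dual_lattice"
  then have lin: "linear l" and "l T = 0" by (simp_all add: dual_lattice_iff)
  then show "lA l 0 v = l v"
    by (simp add: lA_def \<pi>_def linear_diff[OF lin] linear_scale[OF lin])
qed

text \<open>\<open>A t - 1\<close> is \<open>d\<close> after \<open>t B t\<close>, and
  \<open>B t\<close> is bijective. So invariance under one \<open>A t\<close> with
  \<open>t \<noteq> 0\<close> already kills the range of \<open>d\<close> on the ideal; this gives
  elements of \<open>W_set\<close> their trivial stabilizer.\<close>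

lemma lA_fixed:
  assumes l: "linear l" and eq: "\<And>x. \<tau> x = 0 \<Longrightarrow> l (A t x) = l x" and t: "t \<noteq> 0"
  shows "\<tau> z = 0 \<Longrightarrow> l (d z) = 0"
proof -
  assume z: "\<tau> z = 0"
  obtain x where x: "z = B t x" using B_surj by (metis surjD)
  then have "\<tau> x = 0" using z by (simp add: tau_B)
  then have "l (d (t *\<^sub>R B t x)) = 0" using eq by (simp add: d_tB linear_diff[OF l])
  then show ?thesis using t x by (simp add: d_simps linear_scale[OF l])
qed

lemma lA_invariant:
  assumes l: "linear l" and eq: "\<And>z. \<tau> z = 0 \<Longrightarrow> l (d z) = 0" and x: "\<tau> x = 0"
  shows "l (A t x) = l x"
proof -
  have "A t x = x + d (t *\<^sub>R B t x)" by (simp add: d_tB)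
  moreover have "l (d (t *\<^sub>R B t x)) = 0" using x by (intro eq) (simp add: tau_B)
  ultimately show ?thesis by (simp only: linear_add[OF l] add_0_right)
qed

lemma d_in_brackets: "d z \<in> bracket_span (bracket G e) UNIV UNIV"
  unfolding bracket_span_def by (rule span_base) blast

lemma brackets_vanish:
  assumes l: "linear l" and eq: "\<And>z. \<tau> z = 0 \<Longrightarrow> l (d z) = (0::real)"
    and x: "x \<in> bracket_span (bracket G e) UNIV UNIV"
  shows "l x = 0"
proof (rule linear_eq_0_on_span[OF l _ x[unfolded bracket_span_def]])
  fix b assume "b \<in> {bracket G e x y |x y. x \<in> UNIV \<and> y \<in> UNIV}"
  then obtain x y where b: "b = bracket G e x y" by blast
  have "l (d (\<tau> x *\<^sub>R \<pi> y - \<tau> y *\<^sub>R \<pi> x)) = 0" by (rule eq) simp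
  then show "l b = 0" unfolding b bracket_formula[of x y] .
qed

lemma W_iff: "l \<in> W_set (bracket G e) X n \<longleftrightarrow> l \<in> dual_lattice \<and> (\<exists>z. \<tau> z = 0 \<and> l (d z) \<noteq> 0)"
proof -
  have "(\<exists>x\<in>bracket_span (bracket G e) UNIV UNIV. l x \<noteq> 0) \<longleftrightarrow> (\<exists>z. \<tau> z = 0 \<and> l (d z) \<noteq> 0)"
    if "l \<in> dual_lattice"
  proof -
    have "linear l" using that by (simp add: dual_lattice_iff)
    then show ?thesis using brackets_vanish[of l] d_in_brackets by blast
  qed
  then show ?thesis unfolding W_set_def dual_lattice_def by blast
qed

lemma V_iff: "q \<in> V_set X n p \<longleftrightarrow>
    linear q \<and> (\<forall>z. \<tau> z = 0 \<longrightarrow> q (d z) = 0) \<and> (\<forall>i\<in>{1..n}. q (X i) \<in> \<int>)"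
proof
  assume "q \<in> V_set X n p"
  then obtain k :: "nat \<Rightarrow> int" where q: "q = (\<lambda>v. \<Sum>i\<in>{p+1..n}. of_int (k i) * c i v)"
    by (auto simp: V_set_def)
  have lin: "linear q" unfolding q
    by (rule linearI) (auto simp: linear_add[OF c_linear] linear_scale[OF c_linear] sum.distrib
        distrib_left sum_distrib_left mult_ac intro!: sum.cong)
  have cX: "q (X j) = (\<Sum>i\<in>{p+1..n}. if i = j then of_int (k i) else 0)" if "j \<in> {1..n}" for j
    unfolding q using that by (intro sum.cong refl) (auto simp: XT.dual)
  have "q (X j) = 0" if "j \<in> {1..p}" for j
    using cX[of j] that p_less by (auto intro!: sum.neutral)
  then have "q x = 0" if "x \<in> span (X ` {1..p})" for x
    using linear_eq_0_on_span[OF lin _ that] by blast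
  then have "q (d z) = 0" for z using d_in_brackets brackets by blast
  moreover have "q (X j) \<in> \<int>" if "j \<in> {1..n}" for j
    using cX[OF that] by (auto intro!: Ints_sum)
  ultimately show "linear q \<and> (\<forall>z. \<tau> z = 0 \<longrightarrow> q (d z) = 0) \<and> (\<forall>i\<in>{1..n}. q (X i) \<in> \<int>)"
    using lin by blast
next
  assume q: "linear q \<and> (\<forall>z. \<tau> z = 0 \<longrightarrow> q (d z) = 0) \<and> (\<forall>i\<in>{1..n}. q (X i) \<in> \<int>)"
  then have lin: "linear q" by blast
  have z: "q (X j) = 0" if "j \<in> {1..p}" for j
  proof (rule brackets_vanish[OF lin])
    show "X j \<in> bracket_span (bracket G e) UNIV UNIV"
      unfolding brackets by (rule span_base) (use that in blast)
  qed (use q in blast)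
  have "q v = (\<Sum>i\<in>{p+1..n}. of_int \<lfloor>q (X i)\<rfloor> * c i v)" for v
  proof -
    have "q v = q (\<Sum>i\<in>{1..n}. c i v *\<^sub>R X i)" by (simp only: XT.expand)
    also have "\<dots> = (\<Sum>i\<in>{1..n}. c i v * q (X i))"
      by (simp add: linear_sum[OF lin] linear_scale[OF lin])
    also have "\<dots> = (\<Sum>i\<in>{p+1..n}. c i v * q (X i))"
      by (rule sum.mono_neutral_right) (use p_less z in \<open>auto simp: not_less_eq_eq\<close>)
    also have "\<dots> = (\<Sum>i\<in>{p+1..n}. of_int \<lfloor>q (X i)\<rfloor> * c i v)"
      using q by (intro sum.cong) (auto simp: mult.commute)
    finally show ?thesis .
  qed
  then have "q = (\<lambda>v. \<Sum>i\<in>{p+1..n}. of_int \<lfloor>q (X i)\<rfloor> * c i v)" by blast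
  then show "q \<in> V_set X n p"
    unfolding V_set_def by (rule range_eqI[where x="\<lambda>i. \<lfloor>q (X i)\<rfloor>"])
qed

lemma character_ee: "character e l (e x) = ee (l x)"
  using e_inj by (simp add: character_def ee_def cis_conv_exp mult_ac)

text \<open>For \<open>q\<close> in \<open>V_set\<close> this is \<open>character e q\<close>,
  written in the coordinates \<open>tt\<close> and \<open>xx\<close>, where multiplicativity and
  continuity can be checked without the inverse of \<open>e\<close>.\<close>

definition chi :: "('a \<Rightarrow> real) \<Rightarrow> 'g \<Rightarrow> complex" where
  "chi q g = ee (q (xx g) + tt g * q T)"

lemma chi_character:
  assumes q: "q \<in> V_set X n p" shows "character e q g = chi q g"
proof -
  have lin: "linear q" and qd: "\<And>z. \<tau> z = 0 \<Longrightarrow> q (d z) = 0" using q by (auto simp: V_iff)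
  obtain v z where v: "g = e v" "\<tau> v = tt g" "\<pi> v = \<pi> (Pinv g) + d z" using e_ex by blast
  have dz: "q (d z) = 0"
  proof -
    have "d z = d (\<pi> z)" by (simp add: \<pi>_def d_simps)
    then show ?thesis using qd[of "\<pi> z"] by simp
  qed
  have "q v = q (\<pi> v) + tt g * q T"
    using arg_cong[OF pi_tau[of v], of q] v by (simp add: linear_add[OF lin] linear_scale[OF lin])
  also have "q (\<pi> v) = q (\<pi> (Pinv g))" by (simp add: v(3) linear_add[OF lin] dz)
  also have "\<dots> = q (xx g)"
    unfolding xx_def by (rule lA_invariant[OF lin qd, symmetric]) auto
  finally show ?thesis using v(1) by (simp add: character_ee chi_def)
qed

lemma character_hom:
  assumes q: "linear q" "\<And>z. \<tau> z = 0 \<Longrightarrow> q (d z) = 0"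
  shows "chi q (g \<otimes> h) = chi q g * chi q h"
proof -
  have "g \<otimes> h = e (tt g *\<^sub>R T) \<otimes> (e (xx g) \<otimes> e (tt h *\<^sub>R T)) \<otimes> e (xx h)"
    by (subst decomp[of g], subst decomp[of h]) (simp add: m_assoc)
  also have "e (xx g) \<otimes> e (tt h *\<^sub>R T) = e (tt h *\<^sub>R T) \<otimes> e (A (- tt h) (xx g))"
    unfolding e_T_commute by simp
  also have "e (tt g *\<^sub>R T) \<otimes> (e (tt h *\<^sub>R T) \<otimes> e (A (- tt h) (xx g))) \<otimes> e (xx h) =
      e ((tt g + tt h) *\<^sub>R T) \<otimes> e (A (- tt h) (xx g) + xx h)"
    unfolding e_T_add by (simp add: e_m_add tau_A m_assoc)
  finally have gh: "g \<otimes> h = e ((tt g + tt h) *\<^sub>R T) \<otimes> e (A (- tt h) (xx g) + xx h)" .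
  have "xx (g \<otimes> h) = A (- tt h) (xx g) + xx h"
    unfolding gh by (rule coords) (simp add: tau_A)
  moreover have "q (A (- tt h) (xx g)) = q (xx g)" by (rule lA_invariant[OF q]) auto
  ultimately show ?thesis
    by (simp add: chi_def tt_mult linear_add[OF q(1)] ee_add distrib_left mult_ac)
qed

text \<open>The factor \<open>e y\<close> acts trivially on the abelian ideal, so an orbit sees only
  the integer \<open>k\<close>. The sign stems from the inverse in \<open>coAd\<close>.\<close>

lemma coAd0_Gamma:
  assumes l: "l \<in> dual_lattice" and y: "y \<in> Lam"
  shows "coAd0 G e X n (e y \<otimes> e (of_int k *\<^sub>R T)) l = lA l (- of_int k)"
proof
  fix v
  have lin: "linear l" using l by (simp add: dual_lattice_iff)
  have Ad: "Ad G e (inv (e y \<otimes> e (of_int k *\<^sub>R T))) (X i) = A (- of_int k) (X i)" if "i \<in> {1..n-1}" for i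
  proof -
    have "inv (e y \<otimes> e (of_int k *\<^sub>R T)) = e ((- of_int k) *\<^sub>R T) \<otimes> e (- y)"
      by (simp add: inv_mult_group e_minus[symmetric])
    then show ?thesis
      using y that by (simp add: Ad_mult A_Ad Ad_m Lam_def tau_X del: scaleR_minus_left One_nat_def)
  qed
  have "coAd0 G e X n (e y \<otimes> e (of_int k *\<^sub>R T)) l v
      = (\<Sum>i\<in>{1..n-1}. l (A (- of_int k) (X i)) * c i v)"
    unfolding coAd0_def restrict_functional_def coAd_def by (intro sum.cong refl) (simp add: Ad)
  also have "\<dots> = l (A (- of_int k) (\<Sum>i\<in>{1..n-1}. c i v *\<^sub>R X i))"
    by (simp add: linear_sum[OF lin] linear_scale[OF lin] A_simps mult.commute)
  also have "(\<Sum>i\<in>{1..n-1}. c i v *\<^sub>R X i) = \<pi> v"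
    using XT.expand[of v] unfolding sum_split c_n T_eq[symmetric] by (simp add: \<pi>_def eq_diff_eq)
  finally show "coAd0 G e X n (e y \<otimes> e (of_int k *\<^sub>R T)) l v = lA l (- of_int k) v"
    by (simp add: lA_def)
qed

lemma orbit_iff:
  assumes l: "l \<in> dual_lattice"
  shows "s \<in> (\<lambda>\<gamma>. coAd0 G e X n \<gamma> l) ` \<Gamma> \<longleftrightarrow> (\<exists>k::int. s = lA l (of_int k))"
proof
  assume "s \<in> (\<lambda>\<gamma>. coAd0 G e X n \<gamma> l) ` \<Gamma>"
  then obtain \<gamma> where \<gamma>: "\<gamma> \<in> \<Gamma>" "s = coAd0 G e X n \<gamma> l" by blast
  obtain y k where "y \<in> Lam" "\<gamma> = e y \<otimes> e (of_int k *\<^sub>R T)" using Gamma_cases[OF \<gamma>(1)] .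
  then have "s = lA l (of_int (- k))" using \<gamma> coAd0_Gamma[OF l] by simp
  then show "\<exists>k::int. s = lA l (of_int k)" by blast
next
  assume "\<exists>k::int. s = lA l (of_int k)"
  then obtain k :: int where k: "s = lA l (of_int k)" by blast
  have "0 \<in> Lam" by (simp add: Lam_def linear_0[OF c_linear])
  then have "s = coAd0 G e X n (e 0 \<otimes> e (of_int (- k) *\<^sub>R T)) l" using coAd0_Gamma[OF l, of 0 "- k"] k by simp
  then have "s = coAd0 G e X n (e (of_int (- k) *\<^sub>R T)) l" by (simp only: e_0 l_one carrier UNIV_I)
  then show "s \<in> (\<lambda>\<gamma>. coAd0 G e X n \<gamma> l) ` \<Gamma>" using T_Gamma[of "- k"] by blast
qed

text \<open>The last claim combines the uniqueness of representatives with the triviality of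
  stabilizers from \<open>lA_fixed\<close>. It is the form in which the cross section enters the
  orthogonality relations.\<close>

lemma cross_section_props:
  assumes cs: "cross_section (coAd0 G e X n) \<Gamma> (W_set (bracket G e) X n) \<Sigma>"
  shows "\<Sigma> \<subseteq> W_set (bracket G e) X n"
    and "l \<in> W_set (bracket G e) X n \<Longrightarrow> \<exists>s\<in>\<Sigma>. \<exists>k::int. s = lA l (of_int k)"
    and "l \<in> \<Sigma> \<Longrightarrow> l' \<in> \<Sigma> \<Longrightarrow> l = lA l' (of_int k) \<Longrightarrow> l = l' \<and> k = 0"
proof -
  show sub: "\<Sigma> \<subseteq> W_set (bracket G e) X n" using cs by (simp add: cross_section_def)
  have dl: "l \<in> dual_lattice" if "l \<in> W_set (bracket G e) X n" for l using that by (simp add: W_iff)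
  show "\<exists>s\<in>\<Sigma>. \<exists>k::int. s = lA l (of_int k)" if "l \<in> W_set (bracket G e) X n" for l
    using cs that orbit_iff[OF dl[OF that]] unfolding cross_section_def by blast
  show "l = l' \<and> k = 0" if "l \<in> \<Sigma>" "l' \<in> \<Sigma>" "l = lA l' (of_int k)" for l l' k
  proof -
    have W: "l' \<in> W_set (bracket G e) X n" using that sub by blast
    note l' = dl[OF W]
    have "\<exists>!s. s \<in> \<Sigma> \<and> s \<in> (\<lambda>\<gamma>. coAd0 G e X n \<gamma> l') ` \<Gamma>"
      using cs W unfolding cross_section_def by blast
    moreover have "l \<in> (\<lambda>\<gamma>. coAd0 G e X n \<gamma> l') ` \<Gamma>" unfolding orbit_iff[OF l'] using that by blast
    moreover have "l' \<in> (\<lambda>\<gamma>. coAd0 G e X n \<gamma> l') ` \<Gamma>"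
      unfolding orbit_iff[OF l'] using lA_0[OF l'] by (intro exI[of _ 0]) simp
    ultimately have eq: "l = l'" using that by blast
    have "k = 0"
    proof (rule ccontr)
      assume "k \<noteq> 0"
      have lin: "linear l'" using l' by (simp add: dual_lattice_iff)
      have "l' (A (of_int k) x) = l' x" if "\<tau> x = 0" for x
        using fun_cong[OF \<open>l = lA l' (of_int k)\<close>, of x] eq that by (simp add: lA_def)
      from lA_fixed[OF lin this] \<open>k \<noteq> 0\<close> have "\<tau> z = 0 \<Longrightarrow> l' (d z) = 0" for z by simp
      then show False using W by (auto simp: W_iff)
    qed
    with eq show ?thesis by blast
  qed
qed

text \<open>The last nonvanishing functional \<open>l \<circ> d\<^sup>r\<close> is invariant under \<open>A\<close>.\<close>

lemma half_translation:
  assumes l: "linear l" and x: "\<tau> x = 0" "l x \<noteq> (0::real)"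
  obtains y where "\<tau> y = 0" "\<And>t. l (A t y) = 1/2"
proof -
  define r where "r = (LEAST r. \<forall>x. \<tau> x = 0 \<longrightarrow> l ((d ^^ r) x) = 0)"
  have "\<forall>x. \<tau> x = 0 \<longrightarrow> l ((d ^^ r) x) = 0"
    unfolding r_def by (rule LeastI[of _ N]) (simp add: nilpotent linear_0[OF l])
  moreover have "r \<noteq> 0"
  proof
    assume "r = 0"
    then show False using calculation x by simp
  qed
  then obtain m where m: "r = Suc m" using not0_implies_Suc by blast
  then obtain z where z: "\<tau> z = 0" "l ((d ^^ m) z) \<noteq> 0"
    using not_less_Least[of m "\<lambda>r. \<forall>x. \<tau> x = 0 \<longrightarrow> l ((d ^^ r) x) = 0"] unfolding r_def by auto
  \<comment> \<open>Scaled so that \<open>l y = 1/2\<close>, where \<open>ee\<close> takes the value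
    -1.\<close>
  define y where "y = (1 / (2 * l ((d ^^ m) z))) *\<^sub>R (d ^^ m) z"
  have ty: "\<tau> y = 0" using z by (simp add: y_def tau_dk)
  have "l (A t y) = 1/2" for t
  proof -
    have ld: "l (d ((d ^^ m) x)) = 0" if "\<tau> x = 0" for x
      using calculation that unfolding m by simp
    have "A t y = y + d (t *\<^sub>R B t y)" by (simp add: d_tB)
    also have "t *\<^sub>R B t y = (d ^^ m) ((t / (2 * l ((d ^^ m) z))) *\<^sub>R B t z)"
    proof -
      have "B t ((d ^^ m) z) = (d ^^ m) (B t z)"
        by (induction m) (auto simp: d_B[symmetric])
      then show ?thesis by (simp add: y_def B_simps dk_simps)
    qed
    finally have "l (A t y) = l y" using ld z by (simp add: linear_add[OF l] tau_B)
    then show ?thesis using z by (simp add: y_def linear_scale[OF l])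
  qed
  with ty that show ?thesis by blast
qed

end

subsection \<open>Functions and measures on coset spaces\<close>

locale quotient = lie_exp G \<A> e
  for G :: "'g::t2_space monoid" (structure)
    and \<A> :: "('g, 'a::euclidean_space) chart set" and e :: "'a \<Rightarrow> 'g" +
  fixes H :: "'g set"
  assumes H: "subgroup H G"
begin

text \<open>All functions are evaluated at the same chosen representative, so \<open>lift\<close>
  commutes with pointwise operations by unfolding. Invariance is what permits evaluation at another
  representative.\<close>

definition lift :: "('g \<Rightarrow> 'b) \<Rightarrow> 'g set \<Rightarrow> 'b" where
  "lift h C = h (SOME g. g \<in> C)"

definition invariant :: "('g \<Rightarrow> 'b) \<Rightarrow> bool" where
  "invariant h \<longleftrightarrow> (\<forall>g. \<forall>k\<in>H. h (g \<otimes> k) = h g)"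

lemma cosets: "C \<in> lcosets H \<longleftrightarrow> (\<exists>g. C = g <# H)"
  by (auto simp: LCOSETS_def)

lemma coset_mem: "x \<in> g <# H \<longleftrightarrow> (\<exists>k\<in>H. x = g \<otimes> k)"
  by (auto simp: l_coset_def)

lemma coset_translate: "a <# (g <# H) = (a \<otimes> g) <# H"
  by (rule lcos_m_assoc) auto

lemma coset_absorb: "k \<in> H \<Longrightarrow> (g \<otimes> k) <# H = g <# H"
proof -
  assume k: "k \<in> H"
  have "k <# H = H" using k H lcos_m_assoc by (metis carrier UNIV_I coset_join3)
  then show ?thesis using coset_translate[of g k] by simp
qed

lemma lift_coset: "invariant h \<Longrightarrow> lift h (g <# H) = h g"
proof -
  assume h: "invariant h"
  have "g \<in> g <# H" using subgroup.one_closed[OF H] by (auto simp: coset_mem intro!: bexI[of _ \<one>])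
  then have "(SOME x. x \<in> g <# H) \<in> g <# H" by (rule someI)
  then obtain k where "k \<in> H" "(SOME x. x \<in> g <# H) = g \<otimes> k" by (auto simp: coset_mem)
  then show ?thesis using h by (simp add: lift_def invariant_def)
qed

lemma translate_invariant: "invariant h \<Longrightarrow> invariant (\<lambda>g. h (a \<otimes> g))"
  by (simp add: invariant_def m_assoc[symmetric])

lemma translate_cosets: "C \<in> lcosets H \<Longrightarrow> a <# C \<in> lcosets H"
  unfolding cosets using coset_translate by metis

lemma lift_translate:
  "invariant h \<Longrightarrow> C \<in> lcosets H \<Longrightarrow> lift (\<lambda>g. h (a \<otimes> g)) C = lift h (a <# C)"
  by (auto simp: cosets coset_translate lift_coset translate_invariant)

lemma topspace_coset [simp]: "topspace (coset_topology G H) = lcosets H"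
proof -
  have "{g. g <# H \<in> lcosets H} = UNIV" by (auto simp: cosets)
  then have "openin (coset_topology G H) (lcosets H)"
    by (simp add: openin_coset_topology[OF carrier])
  then show ?thesis
    using openin_subset openin_topspace openin_coset_topology[OF carrier] by (metis subset_antisym)
qed

lemma continuous_map_lift:
  fixes h :: "'g \<Rightarrow> 'b::topological_space"
  assumes h: "continuous_on UNIV h" "invariant h"
  shows "continuous_map (coset_topology G H) euclidean (lift h)"
  unfolding continuous_map_def
proof (intro conjI allI impI)
  fix S :: "'b set" assume "openin euclidean S"
  then have S: "open S" by simp
  have "{g. g <# H \<in> {C \<in> topspace (coset_topology G H). lift h C \<in> S}} = h -` S"
    using h by (auto simp: lift_coset cosets)
  then show "openin (coset_topology G H) {C \<in> topspace (coset_topology G H). lift h C \<in> S}"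
    using open_vimage[OF S h(1)] by (simp add: openin_coset_topology[OF carrier])
qed auto

lemma continuous_map_coset: "continuous_map euclidean (coset_topology G H) (\<lambda>g. g <# H)"
  unfolding continuous_map_def
  by (auto simp: openin_coset_topology[OF carrier] cosets)

lemma compactin_lift_image:
  assumes "continuous_on UNIV h" "invariant h" "compactin (coset_topology G H) K"
  shows "compact (lift h ` K)"
  using image_compactin[OF assms(3) continuous_map_lift[OF assms(1,2)]] by simp

context
  fixes \<kappa> :: "'g set measure"
  assumes \<kappa>: "invariant_borel_measure G H \<kappa>"
begin

lemma space_kappa: "space \<kappa> = lcosets H"
  and sets_kappa: "sets \<kappa> = sigma_sets (lcosets H) {W. openin (coset_topology G H) W}"
  and emeasure_kappa: "A \<in> sets \<kappa> \<Longrightarrow> emeasure \<kappa> ((\<lambda>C. a <# C) ` A) = emeasure \<kappa> A"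
  using \<kappa> by (simp_all add: invariant_borel_measure_def)

lemma openin_sets: "openin (coset_topology G H) W \<Longrightarrow> W \<in> sets \<kappa>"
  by (simp add: sets_kappa)

lemma lift_measurable:
  fixes h :: "'g \<Rightarrow> 'b::topological_space"
  assumes h: "continuous_on UNIV h" "invariant h" shows "lift h \<in> borel_measurable \<kappa>"
proof (rule borel_measurableI)
  fix S :: "'b set" assume S: "open S"
  have "lift h -` S \<inter> space \<kappa> = {C \<in> topspace (coset_topology G H). lift h C \<in> S}"
    by (auto simp: space_kappa)
  then show "lift h -` S \<inter> space \<kappa> \<in> sets \<kappa>"
    using continuous_map_lift[OF h] S by (auto simp: continuous_map_def intro!: openin_sets)
qed

lemma translate_measurable: "(\<lambda>C. a <# C) \<in> measurable \<kappa> \<kappa>"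
proof (rule measurable_sigma_sets[OF sets_kappa])
  show "{W. openin (coset_topology G H) W} \<subseteq> Pow (lcosets H)"
    using openin_subset by (force simp flip: topspace_coset)
  show "(\<lambda>C. a <# C) \<in> space \<kappa> \<rightarrow> lcosets H" by (auto simp: space_kappa translate_cosets)
  fix W assume "W \<in> {W. openin (coset_topology G H) W}"
  then have W: "open {g. g <# H \<in> W}" by (simp add: openin_coset_topology[OF carrier])
  have "{g. g <# H \<in> (\<lambda>C. a <# C) -` W \<inter> space \<kappa>} = (\<lambda>g. a \<otimes> g) -` {g. g <# H \<in> W}"
    by (auto simp: space_kappa cosets coset_translate)
  moreover have "open ((\<lambda>g. a \<otimes> g) -` {g. g <# H \<in> W})"
    by (intro open_vimage W continuous_mult continuous_intros)
  ultimately show "(\<lambda>C. a <# C) -` W \<inter> space \<kappa> \<in> sets \<kappa>"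
    by (intro openin_sets) (simp add: openin_coset_topology[OF carrier] space_kappa)
qed

text \<open>The hypothesis speaks of images; the preimage under translation by \<open>a\<close> is
  the image under translation by \<open>inv a\<close>.\<close>

lemma distr_translate: "distr \<kappa> \<kappa> (\<lambda>C. a <# C) = \<kappa>"
proof (rule measure_eqI)
  fix A assume "A \<in> sets (distr \<kappa> \<kappa> (\<lambda>C. a <# C))"
  then have A: "A \<in> sets \<kappa>" by simp
  have Asub: "A \<subseteq> lcosets H" using sets.sets_into_space[OF A] by (simp add: space_kappa)
  have c: "a <# (inv a <# C) = C" "inv a <# (a <# C) = C" if "C \<in> lcosets H" for C
    using that by (auto simp: cosets coset_translate)
  have "(\<lambda>C. a <# C) -` A \<inter> space \<kappa> = (\<lambda>C. inv a <# C) ` A"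
    using Asub c translate_cosets by (auto simp: space_kappa image_iff) (metis subsetD)+
  then show "emeasure (distr \<kappa> \<kappa> (\<lambda>C. a <# C)) A = emeasure \<kappa> A"
    using A by (simp add: emeasure_distr[OF translate_measurable] emeasure_kappa)
qed simp

lemma integral_translate:
  fixes f :: "'g set \<Rightarrow> 'b::{banach, second_countable_topology}"
  assumes "f \<in> borel_measurable \<kappa>"
  shows "(\<integral>C. f (a <# C) \<partial>\<kappa>) = (\<integral>C. f C \<partial>\<kappa>)"
  using integral_distr[OF translate_measurable assms, of a] by (simp add: distr_translate)

lemma integral_lift_translate:
  fixes h :: "'g \<Rightarrow> complex"
  assumes h: "continuous_on UNIV h" "invariant h"
  shows "(\<integral>C. lift (\<lambda>g. h (a \<otimes> g)) C \<partial>\<kappa>) = (\<integral>C. lift h C \<partial>\<kappa>)"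
proof -
  have "(\<integral>C. lift (\<lambda>g. h (a \<otimes> g)) C \<partial>\<kappa>) = (\<integral>C. lift h (a <# C) \<partial>\<kappa>)"
    by (rule Bochner_Integration.integral_cong) (auto simp: space_kappa lift_translate h)
  then show ?thesis using integral_translate[OF lift_measurable[OF h]] by simp
qed

end

end

subsection \<open>Periodization\<close>

locale measure_model = lattice_model G \<A> e U \<phi> \<tau> T N X n p \<Gamma>
  for G :: "'g::t2_space monoid" (structure)
    and \<A> :: "('g, 'a::euclidean_space) chart set" and e :: "'a \<Rightarrow> 'g"
    and U :: "'g set" and \<phi> :: "'g \<Rightarrow> 'a" and \<tau> :: "'a \<Rightarrow> real" and T :: 'a and N :: nat
    and X :: "nat \<Rightarrow> 'a" and n p :: nat and \<Gamma> :: "'g set" +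
  fixes \<mu> \<nu> :: "'g set measure"
  assumes mu: "invariant_prob_measure G \<Gamma> \<mu>" and nu: "invariant_radon_measure G (e ` {x. \<tau> x = 0}) \<nu>"
    and cpt: "compact_space (coset_topology G \<Gamma>)"
begin

abbreviation "M \<equiv> e ` {x. \<tau> x = 0}"

lemma M_subgroup: "subgroup M G"
proof
  show "\<one> \<in> M" by (rule image_eqI[of _ _ 0]) auto
  show "x \<otimes> y \<in> M" if "x \<in> M" "y \<in> M" for x y
    using that by (auto simp: e_m_add[symmetric])
  show "inv x \<in> M" if "x \<in> M" for x
    using that by (auto simp: e_minus[symmetric])
qed auto

sublocale QG: quotient G \<A> e \<Gamma>
  by (rule quotient.intro[OF lie_exp_axioms quotient_axioms.intro[OF Gamma_subgroup]])
sublocale QM: quotient G \<A> e M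
  by (rule quotient.intro[OF lie_exp_axioms quotient_axioms.intro[OF M_subgroup]])

lemma mu': "invariant_borel_measure G \<Gamma> \<mu>" and mu_total: "emeasure \<mu> (space \<mu>) = 1"
  using mu by (simp_all add: invariant_prob_measure_def)
lemma nu': "invariant_borel_measure G M \<nu>"
  using nu by (simp add: invariant_radon_measure_def)

sublocale L2: L2_space \<mu>
  by (rule L2_space.intro[OF finite_measureI L2_space_axioms.intro]) (simp_all add: mu_total)

lemma tt_T [simp]: "tt (e (t *\<^sub>R T)) = t" and tt_m [simp]: "\<tau> x = 0 \<Longrightarrow> tt (e x) = 0"
  using coords(1)[of 0 t] coords(1)[of x 0] by simp_all

lemma xx_m: "\<tau> x = 0 \<Longrightarrow> xx (g \<otimes> e x) = xx g + x"
proof -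
  assume x: "\<tau> x = 0"
  have "g \<otimes> e x = e (tt g *\<^sub>R T) \<otimes> e (xx g + x)"
    by (subst decomp[of g]) (simp add: e_m_add x m_assoc)
  then show ?thesis using coords(2)[of "xx g + x"] x by simp
qed

lemma e_commute_T: "e y \<otimes> e (s *\<^sub>R T) = e (s *\<^sub>R T) \<otimes> e (A (- s) y)"
  unfolding e_T_commute by simp

text \<open>A left translation by the ideal subgroup becomes a right translation whose direction is
  twisted by \<open>A (- tt g)\<close>. On functions equivariant under \<open>l\<close> it is
  therefore a phase, in general varying with \<open>tt g\<close>.\<close>

lemma m_translate: "\<tau> y = 0 \<Longrightarrow> e y \<otimes> g = g \<otimes> e (A (- tt g) y)"
proof -
  assume y: "\<tau> y = 0"
  have "e y \<otimes> g = e y \<otimes> e (tt g *\<^sub>R T) \<otimes> e (xx g)" by (subst decomp[of g]) (simp add: m_assoc)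
  also have "\<dots> = e (tt g *\<^sub>R T) \<otimes> (e (A (- tt g) y) \<otimes> e (xx g))"
    unfolding e_commute_T by (simp add: m_assoc)
  also have "e (A (- tt g) y) \<otimes> e (xx g) = e (xx g) \<otimes> e (A (- tt g) y)"
    by (rule e_m_commute) (simp_all add: tau_A y)
  also have "e (tt g *\<^sub>R T) \<otimes> \<dots> = g \<otimes> e (A (- tt g) y)"
    by (subst (4) decomp[of g]) (simp add: m_assoc)
  finally show ?thesis .
qed

text \<open>The space of \<open>Ind\<close> before completion: compact support modulo
  \<open>M\<close> is expressed as a bound on \<open>tt\<close>, which \<open>induced_vecs\<close>
  justifies.\<close>

definition equivariant :: "('a \<Rightarrow> real) \<Rightarrow> ('g \<Rightarrow> complex) \<Rightarrow> bool" where
  "equivariant l F \<longleftrightarrow> continuous_on UNIV F \<and> (\<exists>b. \<forall>g. F g \<noteq> 0 \<longrightarrow> \<bar>tt g\<bar> \<le> b) \<and>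
     (\<forall>g x. \<tau> x = 0 \<longrightarrow> F (g \<otimes> e x) = ee (- l x) * F g)"

definition shift :: "int \<Rightarrow> ('g \<Rightarrow> complex) \<Rightarrow> 'g \<Rightarrow> complex" where
  "shift j F g = F (g \<otimes> e (of_int j *\<^sub>R T))"

text \<open>The elements \<open>e (of_int k *\<^sub>R T)\<close> represent \<open>\<Gamma>\<close>
  modulo its intersection with \<open>M\<close>. A bound on \<open>tt\<close> over the support makes
  the sum locally finite.\<close>

definition psum :: "('g \<Rightarrow> complex) \<Rightarrow> 'g \<Rightarrow> complex" where
  "psum F g = zsum (\<lambda>k. shift k F g)"

lemma equivariantD:
  assumes "equivariant l F"
  shows "continuous_on UNIV F" "\<tau> x = 0 \<Longrightarrow> F (g \<otimes> e x) = ee (- l x) * F g"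
  using assms by (auto simp: equivariant_def)

lemma equivariant_add:
  assumes "equivariant l F" "equivariant l F'" shows "equivariant l (\<lambda>g. F g + F' g)"
proof -
  obtain b b' where b: "\<And>g. F g \<noteq> 0 \<Longrightarrow> \<bar>tt g\<bar> \<le> b" "\<And>g. F' g \<noteq> 0 \<Longrightarrow> \<bar>tt g\<bar> \<le> b'"
    using assms unfolding equivariant_def by metis
  have "\<bar>tt g\<bar> \<le> max b b'" if "F g + F' g \<noteq> 0" for g
  proof -
    have "F g \<noteq> 0 \<or> F' g \<noteq> 0" using that by auto
    then show ?thesis using b by (auto simp: le_max_iff_disj)
  qed
  then show ?thesis using assms
    by (auto simp: equivariant_def distrib_left intro!: continuous_intros)
qed

lemma equivariant_scale: "equivariant l F \<Longrightarrow> equivariant l (\<lambda>g. a * F g)"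
  by (auto simp: equivariant_def intro!: continuous_intros)

lemma equivariant_0: "equivariant l (\<lambda>g. 0)"
  by (auto simp: equivariant_def)

lemma equivariant_translate: assumes F: "equivariant l F" shows "equivariant l (\<lambda>g. F (a \<otimes> g))"
proof -
  obtain b where b: "\<And>g. F g \<noteq> 0 \<Longrightarrow> \<bar>tt g\<bar> \<le> b" using F unfolding equivariant_def by metis
  have "\<bar>tt g\<bar> \<le> b + \<bar>tt a\<bar>" if "F (a \<otimes> g) \<noteq> 0" for g
    using b[OF that] by (simp add: tt_mult)
  moreover have "continuous_on UNIV (\<lambda>g. F (a \<otimes> g))"
    by (rule continuous_on_compose2[OF equivariantD(1)[OF F]])
      (auto intro: continuous_mult continuous_intros)
  ultimately show ?thesis using F by (auto simp: equivariant_def m_assoc[symmetric])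
qed

lemma equivariant_mult_cnj:
  assumes F: "equivariant l F" and F': "equivariant l' F'"
  shows "equivariant (\<lambda>x. l x - l' x) (\<lambda>g. F g * cnj (F' g))"
proof -
  obtain b where b: "\<And>g. F g \<noteq> 0 \<Longrightarrow> \<bar>tt g\<bar> \<le> b" using F unfolding equivariant_def by metis
  then have "\<And>g. F g * cnj (F' g) \<noteq> 0 \<Longrightarrow> \<bar>tt g\<bar> \<le> b" by auto
  moreover have "F (g \<otimes> e x) * cnj (F' (g \<otimes> e x)) = ee (- (l x - l' x)) * (F g * cnj (F' g))"
    if "\<tau> x = 0" for g x
    using that ee_add[of "- l x" "l' x"]
    by (simp add: equivariantD(2)[OF F] equivariantD(2)[OF F'] ee_cnj mult_ac)
  ultimately show ?thesis using equivariantD(1)[OF F] equivariantD(1)[OF F']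
    unfolding equivariant_def by (auto intro!: continuous_intros)
qed

text \<open>Moving \<open>e x\<close> past \<open>e (of_int j *\<^sub>R T)\<close> replaces
  \<open>x\<close> by its image under \<open>A (- of_int j)\<close>. A shift thus passes to another
  functional in the orbit.\<close>

lemma equivariant_shift:
  assumes F: "equivariant l F" shows "equivariant (lA l (of_int (- j))) (shift j F)"
proof -
  obtain b where b: "\<And>g. F g \<noteq> 0 \<Longrightarrow> \<bar>tt g\<bar> \<le> b" using F unfolding equivariant_def by metis
  have "\<bar>tt g\<bar> \<le> b + \<bar>of_int j\<bar>" if "shift j F g \<noteq> 0" for g
    using b[of "g \<otimes> e (of_int j *\<^sub>R T)"] that by (simp add: shift_def tt_mult)
  moreover have "continuous_on UNIV (shift j F)"
    unfolding shift_def
    by (rule continuous_on_compose2[OF equivariantD(1)[OF F]])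
      (auto intro: continuous_mult continuous_intros)
  moreover have "shift j F (g \<otimes> e x) = ee (- lA l (of_int (- j)) x) * shift j F g" if "\<tau> x = 0" for g x
  proof -
    have "g \<otimes> e x \<otimes> e (of_int j *\<^sub>R T) = g \<otimes> e (of_int j *\<^sub>R T) \<otimes> e (A (- of_int j) x)"
      using e_commute_T[of x "of_int j"] by (simp add: m_assoc)
    then show ?thesis
      using equivariantD(2)[OF F, of "A (- of_int j) x"] that by (simp add: shift_def lA_def tau_A)
  qed
  ultimately show ?thesis by (auto simp: equivariant_def)
qed

lemma shift_support:
  assumes F: "equivariant l F"
  obtains b where "\<And>g k. shift k F g \<noteq> 0 \<Longrightarrow> \<bar>tt g + of_int k * 1\<bar> \<le> b"
    "\<And>g. finite {k. shift k F g \<noteq> 0}"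
proof -
  obtain b where b: "\<And>g. F g \<noteq> 0 \<Longrightarrow> \<bar>tt g\<bar> \<le> b" using F unfolding equivariant_def by metis
  have 1: "\<bar>tt g + of_int k * 1\<bar> \<le> b" if "shift k F g \<noteq> 0" for g k
    using b[of "g \<otimes> e (of_int k *\<^sub>R T)"] that by (simp add: shift_def tt_mult)
  have "finite {k. shift k F g \<noteq> 0}" for g
    by (rule finite_subset[OF _ finite_int_near[of 1 "tt g" b]]) (use 1 in auto)
  with 1 that show ?thesis by blast
qed

lemma psum_continuous: "equivariant l F \<Longrightarrow> continuous_on UNIV (psum F)"
proof -
  assume F: "equivariant l F"
  obtain b where b: "\<And>g k. shift k F g \<noteq> 0 \<Longrightarrow> \<bar>tt g + of_int k * 1\<bar> \<le> b"
    using shift_support[OF F] by metis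
  show ?thesis unfolding psum_def
    by (rule zsum_continuous[where t=tt and c=1, OF _ _ _ b])
      (use equivariantD(1)[OF equivariant_shift[OF F]] in \<open>auto intro: continuous_tt continuous_intros\<close>)
qed

lemma shift_shift: "shift k F (g \<otimes> e (of_int j *\<^sub>R T)) = shift (k + j) F g"
proof -
  have "e (of_int j *\<^sub>R T) \<otimes> e (of_int k *\<^sub>R T) = e (of_int (k + j) *\<^sub>R T)"
    using e_T_add[of "of_int j" "of_int k"] by (simp add: add.commute)
  then show ?thesis by (simp add: shift_def m_assoc)
qed

lemma psum_shift: "psum F (g \<otimes> e (of_int j *\<^sub>R T)) = psum F g"
  unfolding psum_def shift_shift by (rule zsum_shift)

text \<open>The sum is only reindexed. With \<open>equivariant_shift\<close> it allows a function
  for any functional of an orbit to be replaced by one for the representative in the cross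
  section.\<close>

lemma psum_of_shift: "psum (shift j F) g = psum F g"
proof -
  have "shift k (shift j F) g = shift (k + j) F g" for k
  proof -
    have "e (of_int k *\<^sub>R T) \<otimes> e (of_int j *\<^sub>R T) = e (of_int (k + j) *\<^sub>R T)"
      using e_T_add[of "of_int k" "of_int j"] by simp
    then show ?thesis by (simp add: shift_def m_assoc)
  qed
  then show ?thesis unfolding psum_def by (simp add: zsum_shift[of "\<lambda>k. shift k F g"])
qed

text \<open>Integrality of \<open>l\<close> is what makes the periodization \<open>\<Gamma>\<close>-invariant.\<close>

lemma periodic_invariant:
  assumes per: "\<And>g x. x \<in> Lam \<Longrightarrow> F (g \<otimes> e x) = F g"
  shows "QG.invariant (psum F)"
  unfolding QG.invariant_def
proof (intro allI ballI)
  fix g \<gamma> assume "\<gamma> \<in> \<Gamma>"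
  then obtain y and j :: int where y: "y \<in> Lam" "\<gamma> = e y \<otimes> e (of_int j *\<^sub>R T)" by (rule Gamma_cases)
  have "shift k F (g \<otimes> e y) = shift k F g" for k
  proof -
    have "g \<otimes> e y \<otimes> e (of_int k *\<^sub>R T) = g \<otimes> e (of_int k *\<^sub>R T) \<otimes> e (A (of_int (- k)) y)"
      using e_commute_T[of y "of_int k"] by (simp add: m_assoc)
    then show ?thesis unfolding shift_def using per A_Lam[OF y(1), of "- k"] by simp
  qed
  then have "psum F (g \<otimes> e y) = psum F g" by (simp add: psum_def)
  then show "psum F (g \<otimes> \<gamma>) = psum F g" using psum_shift[of F "g \<otimes> e y" j] by (simp add: y(2) m_assoc)
qed

lemma psum_invariant:
  assumes F: "equivariant l F" and l: "l \<in> dual_lattice" shows "QG.invariant (psum F)"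
proof (rule periodic_invariant)
  fix g x assume x: "x \<in> Lam"
  then have "- l x \<in> \<int>" using dual_lattice_Lam[OF l] by simp
  then show "F (g \<otimes> e x) = F g" using equivariantD(2)[OF F, of x g] x by (simp add: Lam_def ee_int)
qed

lemma bounded_invariant:
  fixes h :: "'g \<Rightarrow> complex"
  assumes h: "continuous_on UNIV h" "QG.invariant h"
  obtains b where "\<And>g. cmod (h g) \<le> b"
proof -
  have "compactin (coset_topology G \<Gamma>) (lcosets \<Gamma>)" using cpt by (simp add: compact_space_def)
  then have "bounded (QG.lift h ` (lcosets \<Gamma>))"
    using QG.compactin_lift_image[OF h] compact_imp_bounded by blast
  then obtain b where "\<And>C. C \<in> lcosets \<Gamma> \<Longrightarrow> cmod (QG.lift h C) \<le> b" by (auto simp: bounded_iff)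
  then have "cmod (h g) \<le> b" for g
    using QG.lift_coset[OF h(2), of g] QG.cosets by metis
  then show ?thesis using that by blast
qed

lemma lift_L2:
  assumes h: "continuous_on UNIV h" "QG.invariant h" shows "QG.lift h \<in> L2.L2"
proof -
  obtain b where b: "\<And>g. cmod (h g) \<le> b" using bounded_invariant[OF h] by blast
  show ?thesis
    by (rule L2.L2_bounded[OF QG.lift_measurable[OF mu' h], of b])
      (auto simp: QG.lift_def b)
qed

definition mean :: "('g \<Rightarrow> complex) \<Rightarrow> complex" where
  "mean h = (\<integral>C. QG.lift h C \<partial>\<mu>)"

lemma mean_translate:
  "continuous_on UNIV h \<Longrightarrow> QG.invariant h \<Longrightarrow> mean (\<lambda>g. h (a \<otimes> g)) = mean h"
  unfolding mean_def by (rule QG.integral_lift_translate[OF mu'])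

lemma mean_eq_0:
  assumes h: "continuous_on UNIV h" "QG.invariant h" and a: "\<And>g. h (a \<otimes> g) = - h g"
  shows "mean h = 0"
proof -
  have "mean h = mean (\<lambda>g. - h g)" using mean_translate[OF h, of a] a by simp
  also have "\<dots> = - mean h" by (simp add: mean_def QG.lift_def)
  finally show ?thesis by simp
qed

text \<open>Left translation by \<open>e y\<close> multiplies \<open>F\<close> at \<open>g\<close>
  by \<open>ee (- l (A (- tt g) y))\<close>. With \<open>l (A t y) = 1/2\<close> for every
  \<open>t\<close> this factor is -1 in all terms at once, so the mean is its own negative.\<close>

lemma mean_psum_0:
  assumes l: "l \<in> dual_lattice" and x: "\<tau> x = 0" "l x \<noteq> 0" and F: "equivariant l F"
  shows "mean (psum F) = 0"
proof -
  have "linear l" using l by (simp add: dual_lattice_iff)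
  then obtain y where y: "\<tau> y = 0" "\<And>t. l (A t y) = 1/2" using half_translation x by blast
  have "F (e y \<otimes> g) = - F g" for g
    using equivariantD(2)[OF F, of "A (- tt g) y" g] y
    by (simp add: m_translate tau_A ee_cnj[symmetric] ee_half)
  then have "shift k F (e y \<otimes> g) = (-1) * shift k F g" for k g by (simp add: shift_def m_assoc)
  then have "psum F (e y \<otimes> g) = - psum F g" for g
    unfolding psum_def using zsum_mult[of "-1" "\<lambda>k. shift k F g"] by simp
  then show ?thesis by (rule mean_eq_0[OF psum_continuous[OF F] psum_invariant[OF F l]])
qed

end

subsection \<open>The invariant measure on the line\<close>

context measure_model begin

lemma M_tt_invariant: "QM.invariant tt"
  by (auto simp: QM.invariant_def tt_mult)

lemma lift_tt_measurable: "QM.lift tt \<in> borel_measurable \<nu>"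
  by (rule QM.lift_measurable[OF nu' continuous_tt[OF continuous_on_id] M_tt_invariant])

text \<open>The image of \<open>\<nu>\<close> when \<open>G/M\<close> is identified with the real
  line: translation invariant and locally finite, hence a multiple of Lebesgue measure.\<close>

definition "line = distr \<nu> borel (QM.lift tt)"

lemma sets_line [simp, measurable_cong]: "sets line = sets borel" and space_line [simp]: "space line = UNIV"
  by (simp_all add: line_def)

lemma coset_eq_T: "g <# M = e (tt g *\<^sub>R T) <# M"
proof -
  have "e (xx g) \<in> M" by simp
  from QM.coset_absorb[OF this, of "e (tt g *\<^sub>R T)"] show ?thesis using decomp[of g] by simp
qed

lemma line_translate: "distr line borel (\<lambda>t. s + t) = line"
proof -
  have "distr line borel (\<lambda>t. s + t) = distr \<nu> borel (\<lambda>C. s + QM.lift tt C)"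
    unfolding line_def using lift_tt_measurable by (subst distr_distr) (auto simp: comp_def)
  also have "\<dots> = distr \<nu> borel (\<lambda>C. QM.lift tt (e (s *\<^sub>R T) <# C))"
  proof (rule distr_cong)
    fix C assume "C \<in> space \<nu>"
    then have "C \<in> lcosets M" by (simp add: QM.space_kappa[OF nu'])
    from QM.lift_translate[OF M_tt_invariant this, of "e (s *\<^sub>R T)"]
    show "s + QM.lift tt C = QM.lift tt (e (s *\<^sub>R T) <# C)" by (simp add: tt_mult QM.lift_def)
  qed auto
  also have "\<dots> = distr (distr \<nu> \<nu> (\<lambda>C. e (s *\<^sub>R T) <# C)) borel (QM.lift tt)"
    using lift_tt_measurable QM.translate_measurable[OF nu']
    by (subst distr_distr) (auto simp: comp_def)
  also have "\<dots> = line" by (simp add: QM.distr_translate[OF nu'] line_def)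
  finally show ?thesis .
qed

lemma line_integral_translate:
  fixes h :: "real \<Rightarrow> complex"
  assumes [measurable]: "h \<in> borel_measurable borel"
  shows "(\<integral>t. h (s + t) \<partial>line) = (\<integral>t. h t \<partial>line)"
  using integral_distr[of "\<lambda>t. s + t" line borel h] by (simp add: line_translate)

lemma continuous_T: "continuous_on S (\<lambda>s. e (s *\<^sub>R T))"
  by (intro continuous_e continuous_intros)

lemma line_finite: "emeasure line {a..b} < \<infinity>"
proof -
  define K where "K = {C \<in> lcosets M. QM.lift tt C \<in> {a..b}}"
  have K: "K = (\<lambda>s. e (s *\<^sub>R T) <# M) ` {a..b}"
  proof (intro equalityI subsetI)
    fix C assume "C \<in> K"
    then obtain g where "C = g <# M" "tt g \<in> {a..b}"
      by (auto simp: K_def QM.cosets QM.lift_coset[OF M_tt_invariant])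
    then show "C \<in> (\<lambda>s. e (s *\<^sub>R T) <# M) ` {a..b}" using coset_eq_T by blast
  qed (auto simp: K_def QM.cosets QM.lift_coset[OF M_tt_invariant])
  have "continuous_map (top_of_set {a..b}) euclidean (\<lambda>s. e (s *\<^sub>R T))"
    using continuous_T by simp
  then have "continuous_map (top_of_set {a..b}) (coset_topology G M) (\<lambda>s. e (s *\<^sub>R T) <# M)"
    by (rule continuous_map_compose[OF _ QM.continuous_map_coset, unfolded comp_def])
  moreover have "compactin (top_of_set {a..b}) {a..b}" by (simp add: compactin_subtopology)
  ultimately have "compactin (coset_topology G M) K" unfolding K by (rule image_compactin[rotated])
  moreover have "K = QM.lift tt -` {a..b} \<inter> space \<nu>" by (auto simp: K_def QM.space_kappa[OF nu'])
  moreover have "QM.lift tt -` {a..b} \<inter> space \<nu> \<in> sets \<nu>" using lift_tt_measurable by measurable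
  ultimately have "emeasure \<nu> (QM.lift tt -` {a..b} \<inter> space \<nu>) < \<infinity>"
    using nu unfolding invariant_radon_measure_def by metis
  then show ?thesis by (simp add: line_def emeasure_distr[OF lift_tt_measurable])
qed

text \<open>The mass of a fundamental domain for the integers. It compares the free normalization of
  \<open>\<nu>\<close> with the total mass 1 of \<open>\<mu>\<close>.\<close>

definition "\<kappa>0 = measure line {0..<1}"

lemma unit_finite: "emeasure line {0..<1} < \<infinity>"
proof -
  have "emeasure line {0..<1} \<le> emeasure line {0..1}" by (rule emeasure_mono) auto
  also have "\<dots> < \<infinity>" by (rule line_finite)
  finally show ?thesis .
qed

text \<open>If the unit interval were null, so would be its integer translates, which cover the
  line, and \<open>\<nu>\<close> would vanish.\<close>

lemma kappa0_pos: "\<kappa>0 > 0"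
proof (rule ccontr)
  assume "\<not> \<kappa>0 > 0"
  then have "\<kappa>0 = 0" using measure_nonneg[of line "{0..<1}"] by (simp add: \<kappa>0_def)
  then have z: "emeasure line {0..<1} = 0"
    using unit_finite by (simp add: \<kappa>0_def emeasure_eq_ennreal_measure less_top)
  have shift: "emeasure line {of_int k..<of_int k + 1} = 0" for k :: int
  proof -
    have "(\<lambda>t. of_int k + t) -` {of_int k..<of_int k + 1} = {0..<1::real}" by auto
    then have "emeasure (distr line borel (\<lambda>t. of_int k + t)) {of_int k..<of_int k + 1} = 0"
      using z by (subst emeasure_distr) auto
    then show ?thesis by (simp add: line_translate)
  qed
  have "emeasure line (\<Union>k::int. {of_int k..<of_int k + 1}) \<le> 0"
  proof -
    have "(\<Union>k::int. {of_int k..<of_int k + 1::real}) \<in> null_sets line"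
      using shift by (intro null_sets_UN) (auto simp: null_sets_def)
    then show ?thesis by (simp add: null_sets_def)
  qed
  moreover have "(\<Union>k::int. {of_int k..<of_int k + 1}) = (UNIV::real set)"
  proof -
    have "x \<in> {of_int \<lfloor>x\<rfloor>..<of_int \<lfloor>x\<rfloor> + 1}" for x :: real by simp
    then show ?thesis by blast
  qed
  ultimately have "emeasure \<nu> (space \<nu>) = 0"
    unfolding line_def by (simp add: emeasure_distr[OF lift_tt_measurable])
  then show False using nu by (simp add: invariant_radon_measure_def)
qed

abbreviation "profile F \<equiv> (\<lambda>s. F (e (s *\<^sub>R T)))"

lemma continuous_profile: "continuous_on UNIV F \<Longrightarrow> continuous_on UNIV (profile F)"
  by (rule continuous_on_compose2[of UNIV F]) (auto intro: continuous_T)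

lemma profile_integrable:
  assumes F: "equivariant l F" shows "integrable line (profile F)"
proof -
  obtain b where b: "\<And>g. F g \<noteq> 0 \<Longrightarrow> \<bar>tt g\<bar> \<le> b" using F unfolding equivariant_def by metis
  have c: "continuous_on UNIV (profile F)" by (rule continuous_profile[OF equivariantD(1)[OF F]])
  then have [measurable]: "profile F \<in> borel_measurable borel" by (rule borel_measurable_continuous_onI)
  have "compact (profile F ` {-b..b})"
    using c by (intro compact_continuous_image) (auto intro: continuous_on_subset)
  from compact_imp_bounded[OF this]
  obtain B where B: "\<And>s. s \<in> {-b..b} \<Longrightarrow> cmod (profile F s) \<le> B"
    unfolding bounded_iff by blast
  show ?thesis
  proof (rule Bochner_Integration.integrable_bound)
    show "integrable line (\<lambda>s. B * indicator {-b..b} s)"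
      using line_finite[of "-b" b] by (intro integrable_mult_right integrable_real_indicator) auto
    show "AE s in line. norm (profile F s) \<le> norm (B * indicator {-b..b} s)"
    proof (rule AE_I2)
      fix s
      have "profile F s = 0" if s: "s \<notin> {-b..b}"
      proof (rule ccontr)
        assume "profile F s \<noteq> 0"
        from b[OF this] show False using s by (auto simp: abs_le_iff)
      qed
      then show "norm (profile F s) \<le> norm (B * indicator {-b..b} s)"
        using B[of s] by (cases "s \<in> {-b..b}") auto
    qed
  qed measurable
qed

text \<open>Averaging the \<open>\<mu>\<close>-invariant mean over a unit interval of translations and exchanging the
  integrals unfolds the periodization into an integral over the line.\<close>

lemma mean_psum:
  assumes F: "equivariant (\<lambda>x. 0) F"
  shows "of_real \<kappa>0 * mean (psum F) = (\<integral>s. profile F s \<partial>line)"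
proof -
  define J where "J = restrict_space line {0..<1}"
  have finJ: "finite_measure J"
    unfolding J_def using unit_finite
    by (intro finite_measureI) (simp add: emeasure_restrict_space space_restrict_space)
  have c: "continuous_on UNIV (psum F)" by (rule psum_continuous[OF F])
  have "(\<lambda>x. 0) \<in> dual_lattice" by (simp add: dual_lattice_iff linear_zero)
  then have i: "QG.invariant (psum F)" by (rule psum_invariant[OF F])
  obtain B where B: "\<And>g. cmod (psum F g) \<le> B" using bounded_invariant[OF c i] by blast
  define L where "L u = QG.lift (\<lambda>g. psum F (e (u *\<^sub>R T) \<otimes> g))" for u
  have ct: "continuous_on UNIV (\<lambda>g. psum F (e (u *\<^sub>R T) \<otimes> g))" for u
    by (rule continuous_on_compose2[OF c]) (auto intro: continuous_mult continuous_intros)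
  have [measurable]: "L u \<in> borel_measurable \<mu>" for u
    unfolding L_def by (rule QG.lift_measurable[OF mu' ct QG.translate_invariant[OF i]])
  have LB: "cmod (L u C) \<le> B" for u C by (simp add: L_def QG.lift_def B)
  have Lint: "(\<integral>C. L u C \<partial>\<mu>) = mean (psum F)" for u
    using mean_translate[OF c i, of "e (u *\<^sub>R T)"] by (simp add: L_def mean_def)
  \<comment> \<open>\<open>L\<close> is continuous in \<open>u\<close> and measurable in
    \<open>C\<close>. Rounding \<open>u\<close> down to multiples of \<open>1 / real (Suc m)\<close>
    leaves countably many values and gives jointly measurable approximations.\<close>
  have meas: "case_prod L \<in> borel_measurable (J \<Otimes>\<^sub>M \<mu>)"
  proof (rule borel_measurable_LIMSEQ_metric)
    fix m :: nat
    have id: "(\<lambda>z. fst z) \<in> borel_measurable (J \<Otimes>\<^sub>M \<mu>)"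
      by (rule measurable_compose[OF measurable_fst]) (simp add: J_def measurable_restrict_space1)
    have fl: "(\<lambda>z. \<lfloor>fst z * real (Suc m)\<rfloor>) \<in> measurable (J \<Otimes>\<^sub>M \<mu>) (count_space UNIV)"
      using id by measurable
    show "(\<lambda>z. L (of_int \<lfloor>fst z * real (Suc m)\<rfloor> / real (Suc m)) (snd z)) \<in> borel_measurable (J \<Otimes>\<^sub>M \<mu>)"
      by (rule measurable_compose_countable[OF _ fl, where f="\<lambda>k z. L (of_int k / real (Suc m)) (snd z)"])
        measurable
  next
    fix z assume "z \<in> space (J \<Otimes>\<^sub>M \<mu>)"
    then obtain u C where z: "z = (u, C)" and C: "C \<in> lcosets \<Gamma>"
      by (auto simp: space_pair_measure QG.space_kappa[OF mu'])
    then obtain g where g: "C = g <# \<Gamma>" by (auto simp: QG.cosets)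
    have Lg: "L v C = psum F (e (v *\<^sub>R T) \<otimes> g)" for v
      unfolding L_def g by (rule QG.lift_coset[OF QG.translate_invariant[OF i]])
    have cu: "continuous_on UNIV (\<lambda>v. psum F (e (v *\<^sub>R T) \<otimes> g))"
      by (rule continuous_on_compose2[OF c]) (auto intro: continuous_mult continuous_T continuous_intros)
    have lim: "(\<lambda>m. of_int \<lfloor>u * real (Suc m)\<rfloor> / real (Suc m)) \<longlonglongrightarrow> u"
    proof (rule tendsto_sandwich[of "\<lambda>m. u - 1 / real (Suc m)" _ _ "\<lambda>m. u"])
      have "u - 1 / real (Suc m) \<le> of_int \<lfloor>u * real (Suc m)\<rfloor> / real (Suc m)" for m
      proof -
        have "u - 1 / real (Suc m) = (u * real (Suc m) - 1) / real (Suc m)"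
          by (simp add: diff_divide_distrib del: of_nat_Suc)
        also have "\<dots> \<le> of_int \<lfloor>u * real (Suc m)\<rfloor> / real (Suc m)"
          by (rule divide_right_mono) (linarith, simp)
        finally show ?thesis .
      qed
      then show "\<forall>\<^sub>F m in sequentially. u - 1 / real (Suc m) \<le> of_int \<lfloor>u * real (Suc m)\<rfloor> / real (Suc m)"
        by (intro always_eventually allI)
      have "of_int \<lfloor>u * real (Suc m)\<rfloor> \<le> u * real (Suc m)" for m by linarith
      then show "\<forall>\<^sub>F m in sequentially. of_int \<lfloor>u * real (Suc m)\<rfloor> / real (Suc m) \<le> u"
        by (intro always_eventually allI) (simp add: field_simps)
      have "(\<lambda>m. u - 1 / real (Suc m)) \<longlonglongrightarrow> u - 0"
        using LIMSEQ_inverse_real_of_nat by (intro tendsto_intros) (simp add: inverse_eq_divide)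
      then show "(\<lambda>m. u - 1 / real (Suc m)) \<longlonglongrightarrow> u" by simp
    qed auto
    have "(\<lambda>m. psum F (e ((of_int \<lfloor>u * real (Suc m)\<rfloor> / real (Suc m)) *\<^sub>R T) \<otimes> g)) \<longlonglongrightarrow> psum F (e (u *\<^sub>R T) \<otimes> g)"
      by (rule continuous_on_tendsto_compose[OF cu lim]) auto
    then show "(\<lambda>m. L (of_int \<lfloor>fst z * real (Suc m)\<rfloor> / real (Suc m)) (snd z)) \<longlonglongrightarrow> (case z of (x, xa) \<Rightarrow> L x xa)"
      by (simp add: z Lg)
  qed
  interpret J: finite_measure J by (rule finJ)
  interpret JM: pair_sigma_finite J \<mu> ..
  interpret JP: finite_measure "J \<Otimes>\<^sub>M \<mu>"
    by (rule finite_measure_pair_measure) (unfold_locales)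
  have "integrable (J \<Otimes>\<^sub>M \<mu>) (case_prod L)"
    by (rule JP.integrable_const_bound[of _ B]) (auto simp: LB meas split: prod.split)
  from JM.Fubini_integral[OF this]
  have "(\<integral>C. (\<integral>u. L u C \<partial>J) \<partial>\<mu>) = (\<integral>u. (\<integral>C. L u C \<partial>\<mu>) \<partial>J)" .
  also have "\<dots> = of_real (measure J (space J)) * mean (psum F)"
    by (simp add: Lint scaleR_conv_of_real)
  also have "measure J (space J) = \<kappa>0"
    by (simp add: J_def \<kappa>0_def measure_restrict_space space_restrict_space)
  finally have 1: "of_real \<kappa>0 * mean (psum F) = (\<integral>C. (\<integral>u. L u C \<partial>J) \<partial>\<mu>)" by simp
  define \<phi>F where "\<phi>F = profile F"
  have [measurable]: "\<phi>F \<in> borel_measurable borel"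
    unfolding \<phi>F_def by (intro borel_measurable_continuous_onI continuous_profile equivariantD(1)[OF F])
  have Fprofile: "F g = \<phi>F (tt g)" for g
    using equivariantD(2)[OF F, of "xx g" "e (tt g *\<^sub>R T)"] decomp[of g] by (simp add: \<phi>F_def)
  obtain b where b: "\<And>g. F g \<noteq> 0 \<Longrightarrow> \<bar>tt g\<bar> \<le> b" using F unfolding equivariant_def by metis
  have \<phi>b: "\<bar>s\<bar> \<le> b" if "\<phi>F s \<noteq> 0" for s using b[of "e (s *\<^sub>R T)"] that by (simp add: \<phi>F_def)
  have \<phi>int: "integrable line \<phi>F" unfolding \<phi>F_def by (rule profile_integrable[OF F])
  have \<phi>shift: "integrable line (\<lambda>u. \<phi>F (r + u))" for r
    using integrable_distr_eq[of "\<lambda>t. r + t" line borel \<phi>F] \<phi>int by (simp add: line_translate)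
  have inner: "(\<integral>u. L u C \<partial>J) = (\<integral>s. \<phi>F s \<partial>line)" if C: "C \<in> space \<mu>" for C
  proof -
    obtain g where g: "C = g <# \<Gamma>" using C by (auto simp: QG.space_kappa[OF mu'] QG.cosets)
    \<comment> \<open>One finite index set for all \<open>u\<close> of the unit interval; this
      accounts for the 1 added to \<open>b\<close>.\<close>
    define K where "K = {k::int. \<bar>tt g + of_int k * 1\<bar> \<le> b + 1}"
    have K: "finite K" unfolding K_def by (rule finite_int_near) simp
    have Lg: "L u C = (\<Sum>k\<in>K. \<phi>F (tt g + of_int k + u))" if u: "u \<in> {0..<1}" for u
    proof -
      have s: "shift k F (e (u *\<^sub>R T) \<otimes> g) = \<phi>F (tt g + of_int k + u)" for k
        by (simp add: shift_def Fprofile tt_mult algebra_simps)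
      have "L u C = psum F (e (u *\<^sub>R T) \<otimes> g)"
        unfolding L_def g by (rule QG.lift_coset[OF QG.translate_invariant[OF i]])
      also have "\<dots> = (\<Sum>k\<in>K. \<phi>F (tt g + of_int k + u))"
        unfolding psum_def s
      proof (rule zsum_eq[OF K])
        fix k assume "\<phi>F (tt g + of_int k + u) \<noteq> 0"
        then have "\<bar>tt g + of_int k + u\<bar> \<le> b" by (rule \<phi>b)
        then show "k \<in> K" using u by (simp add: K_def abs_le_iff)
      qed
      finally show ?thesis .
    qed
    have "(\<integral>u. L u C \<partial>J) = (\<integral>u. indicator {0..<1} u *\<^sub>R L u C \<partial>line)"
      unfolding J_def by (rule integral_restrict_space) simp
    also have "\<dots> = (\<integral>u. (\<Sum>k\<in>K. indicator {0..<1} u *\<^sub>R \<phi>F (tt g + of_int k + u)) \<partial>line)"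
      by (rule Bochner_Integration.integral_cong) (auto simp: indicator_def Lg)
    also have "\<dots> = (\<Sum>k\<in>K. \<integral>u. indicator {0..<1} u *\<^sub>R \<phi>F (tt g + of_int k + u) \<partial>line)"
      by (intro Bochner_Integration.integral_sum integrable_mult_indicator \<phi>shift) auto
    also have "\<dots> = (\<Sum>k\<in>K. \<integral>v. indicator {0..<1} (v - (tt g + of_int k)) *\<^sub>R \<phi>F v \<partial>line)"
    proof (rule sum.cong[OF refl])
      fix k
      show "(\<integral>u. indicator {0..<1} u *\<^sub>R \<phi>F (tt g + of_int k + u) \<partial>line)
          = (\<integral>v. indicator {0..<1} (v - (tt g + of_int k)) *\<^sub>R \<phi>F v \<partial>line)"
        using line_integral_translate[of "\<lambda>v. indicator {0..<1} (v - (tt g + of_int k)) *\<^sub>R \<phi>F v" "tt g + of_int k"]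
        by simp
    qed
    also have "\<dots> = (\<integral>v. (\<Sum>k\<in>K. indicator {0..<1} (v - (tt g + of_int k)) *\<^sub>R \<phi>F v) \<partial>line)"
    proof (rule Bochner_Integration.integral_sum[symmetric])
      fix k
      have "integrable line (\<lambda>v. indicator {tt g + of_int k..<tt g + of_int k + 1} v *\<^sub>R \<phi>F v)"
        by (intro integrable_mult_indicator \<phi>int) auto
      moreover have "indicator {tt g + of_int k..<tt g + of_int k + 1} v = (indicator {0..<1} (v - (tt g + of_int k)) :: real)" for v
        by (auto simp: indicator_def)
      ultimately show "integrable line (\<lambda>v. indicator {0..<1} (v - (tt g + of_int k)) *\<^sub>R \<phi>F v)" by simp
    qed
    also have "\<dots> = (\<integral>v. \<phi>F v \<partial>line)"
    proof (rule Bochner_Integration.integral_cong[OF refl])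
      fix v
      show "(\<Sum>k\<in>K. indicator {0..<1} (v - (tt g + of_int k)) *\<^sub>R \<phi>F v) = \<phi>F v"
      proof (cases "\<phi>F v = 0")
        case False
        then have v: "\<bar>v\<bar> \<le> b" by (rule \<phi>b)
        \<comment> \<open>The half-open unit intervals starting at the points
          \<open>tt g + of_int k\<close> tile the line, and \<open>m\<close> is the index of the one
          containing \<open>v\<close>.\<close>
        define m where "m = \<lfloor>v - tt g\<rfloor>"
        have m: "of_int m \<le> v - tt g" "v - tt g < of_int m + 1" by (simp_all add: m_def)
        have mK: "m \<in> K" using v m by (auto simp: K_def abs_le_iff)
        have "(indicator {0..<1} (v - (tt g + of_int k)) :: real) = (if k = m then 1 else 0)" for k
        proof -
          have "v - (tt g + of_int k) \<in> {0..<1} \<longleftrightarrow> \<lfloor>v - tt g\<rfloor> = k"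
            unfolding floor_eq_iff by auto
          then show ?thesis by (auto simp: m_def indicator_def)
        qed
        then have "(\<Sum>k\<in>K. indicator {0..<1} (v - (tt g + of_int k)) *\<^sub>R \<phi>F v) = (\<Sum>k\<in>K. if k = m then \<phi>F v else 0)"
          by (intro sum.cong) auto
        then show ?thesis using K mK by simp
      qed simp
    qed
    finally show ?thesis .
  qed
  have "(\<integral>C. (\<integral>u. L u C \<partial>J) \<partial>\<mu>) = (\<integral>C. (\<integral>s. \<phi>F s \<partial>line) \<partial>\<mu>)"
    by (rule Bochner_Integration.integral_cong) (auto simp: inner)
  also have "\<dots> = (\<integral>s. \<phi>F s \<partial>line)" using mu_total by (simp add: measure_def)
  finally show ?thesis using 1 by (simp add: \<phi>F_def)
qed

text \<open>Compactness modulo \<open>M\<close> corresponds to bounded \<open>tt\<close>: a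
  continuous function on the coset space is bounded on compact sets, and conversely the cosets over
  a closed interval are the continuous image of that interval.\<close>

lemma induced_vecs:
  "vecs (induced_pre_rep G M (character e l) \<nu>) = {F. equivariant l F}"
proof -
  have ch: "(\<forall>g. \<forall>h\<in>M. F (g \<otimes> h) = inverse (character e l h) * F g) \<longleftrightarrow>
      (\<forall>g x. \<tau> x = 0 \<longrightarrow> F (g \<otimes> e x) = ee (- l x) * F g)" for F
    by (auto simp: character_ee ee_cnj[symmetric] inverse_eq_divide complex_div_cnj[of 1])
  have co: "(\<exists>K. compactin (coset_topology G M) K \<and> (\<forall>g. F g \<noteq> 0 \<longrightarrow> g <# M \<in> K)) \<longleftrightarrow>
      (\<exists>b. \<forall>g. F g \<noteq> 0 \<longrightarrow> \<bar>tt g\<bar> \<le> b)" for F :: "'g \<Rightarrow> complex"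
  proof
    assume "\<exists>K. compactin (coset_topology G M) K \<and> (\<forall>g. F g \<noteq> 0 \<longrightarrow> g <# M \<in> K)"
    then obtain K where K: "compactin (coset_topology G M) K" "\<And>g. F g \<noteq> 0 \<Longrightarrow> g <# M \<in> K" by blast
    have "bounded (QM.lift tt ` K)"
      using QM.compactin_lift_image[OF continuous_tt[OF continuous_on_id] M_tt_invariant K(1)]
      by (rule compact_imp_bounded)
    then obtain b where b: "\<And>C. C \<in> K \<Longrightarrow> \<bar>QM.lift tt C\<bar> \<le> b" by (auto simp: bounded_iff)
    show "\<exists>b. \<forall>g. F g \<noteq> 0 \<longrightarrow> \<bar>tt g\<bar> \<le> b"
      using b[OF K(2)] QM.lift_coset[OF M_tt_invariant] by (intro exI[of _ b]) metis
  next
    assume "\<exists>b. \<forall>g. F g \<noteq> 0 \<longrightarrow> \<bar>tt g\<bar> \<le> b"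
    then obtain b where b: "\<And>g. F g \<noteq> 0 \<Longrightarrow> \<bar>tt g\<bar> \<le> b" by blast
    have "continuous_map (top_of_set {-b..b}) euclidean (\<lambda>s. e (s *\<^sub>R T))"
      using continuous_T by simp
    then have "continuous_map (top_of_set {-b..b}) (coset_topology G M) (\<lambda>s. e (s *\<^sub>R T) <# M)"
      by (rule continuous_map_compose[OF _ QM.continuous_map_coset, unfolded comp_def])
    moreover have "compactin (top_of_set {-b..b}) {-b..b}" by (simp add: compactin_subtopology)
    ultimately have "compactin (coset_topology G M) ((\<lambda>s. e (s *\<^sub>R T) <# M) ` {-b..b})"
      by (rule image_compactin[rotated])
    moreover have "g <# M \<in> (\<lambda>s. e (s *\<^sub>R T) <# M) ` {-b..b}" if "F g \<noteq> 0" for g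
      using b[OF that] coset_eq_T[of g] by (intro image_eqI[of _ _ "tt g"]) (auto simp: abs_le_iff)
    ultimately show "\<exists>K. compactin (coset_topology G M) K \<and> (\<forall>g. F g \<noteq> 0 \<longrightarrow> g <# M \<in> K)" by blast
  qed
  show ?thesis unfolding induced_pre_rep_def equivariant_def ch co by simp
qed

lemma induced_inner:
  assumes F: "equivariant l F" and F': "equivariant l F'"
  shows "vinner (induced_pre_rep G M (character e l) \<nu>) F F' = (\<integral>s. profile F s * cnj (profile F' s) \<partial>line)"
proof -
  let ?h = "\<lambda>g. F g * cnj (F' g)"
  have "equivariant (\<lambda>x. l x - l x) ?h" by (rule equivariant_mult_cnj[OF F F'])
  then have h: "equivariant (\<lambda>x. 0) ?h" by simp
  have [measurable]: "profile ?h \<in> borel_measurable borel"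
    by (intro borel_measurable_continuous_onI continuous_profile equivariantD(1)[OF h])
  have hp: "?h g = profile ?h (tt g)" for g
    using equivariantD(2)[OF h, of "xx g" "e (tt g *\<^sub>R T)"] decomp[of g] by simp
  have "vinner (induced_pre_rep G M (character e l) \<nu>) F F' = (\<integral>C. profile ?h (QM.lift tt C) \<partial>\<nu>)"
    unfolding induced_pre_rep_def rep.simps Let_def QM.lift_def hp[symmetric] ..
  also have "\<dots> = (\<integral>s. profile ?h s \<partial>line)"
    unfolding line_def using lift_tt_measurable by (subst integral_distr) auto
  finally show ?thesis by simp
qed

end

subsection \<open>The two representations and the isometry on the core\<close>

locale decomposition_model = measure_model G \<A> e U \<phi> \<tau> T N X n p \<Gamma> \<mu> \<nu>
  for G :: "'g::t2_space monoid" (structure)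
    and \<A> :: "('g, 'a::euclidean_space) chart set" and e :: "'a \<Rightarrow> 'g"
    and U :: "'g set" and \<phi> :: "'g \<Rightarrow> 'a" and \<tau> :: "'a \<Rightarrow> real" and T :: 'a and N :: nat
    and X :: "nat \<Rightarrow> 'a" and n p :: nat and \<Gamma> :: "'g set" and \<mu> \<nu> :: "'g set measure" +
  fixes \<Sigma> :: "('a \<Rightarrow> real) set"
  assumes cs: "cross_section (coAd0 G e X n) \<Gamma> (W_set (bracket G e) X n) \<Sigma>"
begin

abbreviation "V \<equiv> V_set X n p"
abbreviation "W \<equiv> W_set (bracket G e) X n"
abbreviation "pre l \<equiv> induced_pre_rep G M (character e l) \<nu>"
abbreviation "R \<equiv> quasi_regular_rep G \<mu>"
abbreviation "S1 \<equiv> hilbert_sum \<Sigma> (\<lambda>l. Ind G M (character e l) \<nu>)"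
abbreviation "S2 \<equiv> hilbert_sum V (\<lambda>q. character_rep (character e q))"

lemma pre_simps:
  "vadd (pre l) F F' = (\<lambda>g. F g + F' g)" "vscale (pre l) a F = (\<lambda>g. a * F g)"
  "act (pre l) x F = (\<lambda>g. F (inv x \<otimes> g))"
  by (simp_all add: induced_pre_rep_def)

lemma profile_mult_integrable:
  assumes "equivariant l F" "equivariant l F'"
  shows "integrable line (\<lambda>s. profile F s * cnj (profile F' s))"
  using profile_integrable[OF equivariant_mult_cnj[OF assms]] .

lemma unitary_pre: "unitary_rep (pre l)"
  unfolding unitary_rep_def
proof (intro conjI allI ballI)
  show "prehilbert (pre l)"
  proof
    fix F F' K c
    assume "F \<in> vecs (pre l)" then have F: "equivariant l F" by (simp add: induced_vecs)
    show "vscale (pre l) c F \<in> vecs (pre l)" using F by (simp add: pre_simps induced_vecs equivariant_scale)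
    have "vinner (pre l) F F = of_real (\<integral>s. (cmod (profile F s))\<^sup>2 \<partial>line)"
      by (simp add: induced_inner[OF F F] complex_norm_square[symmetric] del: of_real_power)
    then show "0 \<le> Re (vinner (pre l) F F)" by simp
    { assume "F' \<in> vecs (pre l)" then have F': "equivariant l F'" by (simp add: induced_vecs)
      show "vadd (pre l) F F' \<in> vecs (pre l)" using F F' by (simp add: pre_simps induced_vecs equivariant_add)
      have "vinner (pre l) F' F = (\<integral>s. cnj (profile F s * cnj (profile F' s)) \<partial>line)"
        by (simp add: induced_inner[OF F' F] mult.commute)
      also have "\<dots> = cnj (vinner (pre l) F F')"
        using integral_bounded_linear[OF bounded_linear_cnj profile_mult_integrable[OF F F']]
        by (simp add: induced_inner[OF F F'])
      finally show "vinner (pre l) F' F = cnj (vinner (pre l) F F')" .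
      assume "K \<in> vecs (pre l)" then have K: "equivariant l K" by (simp add: induced_vecs)
      show "vinner (pre l) (vadd (pre l) F F') K = vinner (pre l) F K + vinner (pre l) F' K"
        using profile_mult_integrable[OF F K] profile_mult_integrable[OF F' K]
        by (simp add: pre_simps induced_inner[OF equivariant_add[OF F F'] K] induced_inner[OF F K]
            induced_inner[OF F' K] distrib_right) }
    assume "K \<in> vecs (pre l)" then have K: "equivariant l K" by (simp add: induced_vecs)
    show "vinner (pre l) (vscale (pre l) c F) K = c * vinner (pre l) F K"
      by (simp add: pre_simps induced_inner[OF equivariant_scale[OF F] K] induced_inner[OF F K] mult.assoc)
  qed
  fix a F assume "F \<in> vecs (pre l)" then have F: "equivariant l F" by (simp add: induced_vecs)
  show "act (pre l) a F \<in> vecs (pre l)" using F by (simp add: pre_simps induced_vecs equivariant_translate)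
  fix F' assume "F' \<in> vecs (pre l)" then have F': "equivariant l F'" by (simp add: induced_vecs)
  let ?h = "\<lambda>g. F g * cnj (F' g)"
  have "equivariant (\<lambda>x. l x - l x) ?h" by (rule equivariant_mult_cnj[OF F F'])
  then have h: "equivariant (\<lambda>x. 0) ?h" by simp
  have hp: "?h g = profile ?h (tt g)" for g
    using equivariantD(2)[OF h, of "xx g" "e (tt g *\<^sub>R T)"] decomp[of g] by simp
  have "?h (inv a \<otimes> e (s *\<^sub>R T)) = profile ?h (tt (inv a) + s)" for s
    using hp[of "inv a \<otimes> e (s *\<^sub>R T)"] by (simp add: tt_mult)
  moreover have "(\<integral>s. profile ?h (tt (inv a) + s) \<partial>line) = (\<integral>s. profile ?h s \<partial>line)"
    by (rule line_integral_translate)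
      (intro borel_measurable_continuous_onI continuous_profile equivariantD(1)[OF h])
  ultimately show "vinner (pre l) (act (pre l) a F) (act (pre l) a F') = vinner (pre l) F F'"
    by (simp add: pre_simps induced_inner[OF equivariant_translate[OF F] equivariant_translate[OF F']]
        induced_inner[OF F F'])
qed

lemma unitary_Ind: "unitary_rep (Ind G M (character e l) \<nu>)"
  unfolding Ind_def by (rule unitary_completion[OF unitary_pre])

lemma complete_Ind: "rep_complete (Ind G M (character e l) \<nu>)"
  unfolding Ind_def by (rule prehilbert.complete_completion[OF unitary_prehilbert[OF unitary_pre]])

sublocale F1: hilbert_family \<Sigma> "\<lambda>l. Ind G M (character e l) \<nu>"
  by (rule hilbert_family.intro[OF unitary_prehilbert[OF unitary_Ind]])

sublocale F2: hilbert_family V "\<lambda>q. character_rep (character e q)"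
  by (rule hilbert_family.intro[OF prehilbert_character])

lemma cmod_character: "cmod (character e q a) = 1"
proof -
  have "character e q a = ee (q (inv_into UNIV e a))" by (simp add: character_def ee_def cis_conv_exp mult_ac)
  then show ?thesis by simp
qed

lemma unitary_S: "unitary_rep (hilbert_plus S1 S2)"
  by (intro unitary_plus F1.unitary_sum F2.unitary_sum unitary_Ind unitary_character cmod_character)

lemma complete_S: "rep_complete (hilbert_plus S1 S2)"
  by (intro complete_plus F1.prehilbert_sum F2.prehilbert_sum F1.complete_sum F2.complete_sum
      complete_Ind complete_character)

lemma R_simps:
  "vecs R = L2.L2" "vadd R = (\<lambda>f g x. f x + g x)" "vscale R = (\<lambda>c f x. c * f x)"
  "vinner R = (\<lambda>f g. \<integral>x. f x * cnj (g x) \<partial>\<mu>)" "act R = (\<lambda>a f C. f (inv a <# C))"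
  by (simp_all add: quasi_regular_rep_def L2.L2_def)

lemma prehilbert_R: "prehilbert R"
  by (rule L2.prehilbert_L2(1)[OF R_simps(1-4)])

lemma dist_R: "u \<in> L2.L2 \<Longrightarrow> v \<in> L2.L2 \<Longrightarrow> rep_dist R u v = L2.nrm2 (\<lambda>x. u x - v x)"
  by (rule L2.prehilbert_L2(2)[OF R_simps(1-4)])

lemma unitary_R: "unitary_rep R"
  unfolding unitary_rep_def
proof (intro conjI allI ballI prehilbert_R)
  fix a f assume "f \<in> vecs R"
  then have f: "f \<in> borel_measurable \<mu>" "integrable \<mu> (\<lambda>C. (cmod (f C))\<^sup>2)"
    by (auto simp: R_simps L2.L2_def)
  note tm = QG.translate_measurable[OF mu', of "inv a"]
  have "(\<lambda>C. f (inv a <# C)) \<in> borel_measurable \<mu>" by (rule measurable_compose[OF tm f(1)])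
  moreover have "integrable \<mu> (\<lambda>C. (cmod (f (inv a <# C)))\<^sup>2)"
    using integrable_distr_eq[OF tm, of "\<lambda>C. (cmod (f C))\<^sup>2"] f
    by (simp add: QG.distr_translate[OF mu'])
  ultimately show "act R a f \<in> vecs R" by (simp add: R_simps L2.L2_def)
  fix g assume "g \<in> vecs R"
  then have g: "g \<in> borel_measurable \<mu>" by (auto simp: R_simps L2.L2_def)
  have "(\<lambda>C. cnj (g C)) \<in> borel_measurable \<mu>"
    by (rule borel_measurable_continuous_on[of cnj]) (auto intro: continuous_intros g)
  then have "(\<lambda>C. f C * cnj (g C)) \<in> borel_measurable \<mu>" using f by measurable
  from QG.integral_translate[OF mu' this, of "inv a"]
  show "vinner R (act R a f) (act R a g) = vinner R f g" by (simp add: R_simps)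
qed

lemma complete_R: "rep_complete R"
  unfolding rep_complete_def
proof (intro allI impI)
  fix u assume u: "rep_cauchy R u"
  then have uL: "u n \<in> L2.L2" for n by (simp add: rep_cauchy_def R_simps)
  have "\<exists>f\<in>L2.L2. (\<lambda>n. L2.nrm2 (\<lambda>x. u n x - f x)) \<longlonglongrightarrow> 0"
    by (rule L2.L2_complete[OF uL]) (use u in \<open>simp add: rep_cauchy_def dist_R uL\<close>)
  then show "\<exists>x\<in>vecs R. (\<lambda>n. rep_dist R (u n) x) \<longlonglongrightarrow> 0"
    by (auto simp: R_simps dist_R uL)
qed

lemma V_linear: "q \<in> V \<Longrightarrow> linear q" and V_d: "q \<in> V \<Longrightarrow> q (d z) = 0"
  and V_T: "q \<in> V \<Longrightarrow> q T \<in> \<int>" and V_Lam: "q \<in> V \<Longrightarrow> y \<in> Lam \<Longrightarrow> q y \<in> \<int>"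
proof -
  assume q: "q \<in> V"
  then show l: "linear q" by (simp add: V_iff)
  have "d z = d (\<pi> z)" by (simp add: \<pi>_def d_simps)
  then show "q (d z) = 0" using q by (simp add: V_iff)
  show T: "q T \<in> \<int>" using q n_pos by (simp add: V_iff T_eq)
  assume y: "y \<in> Lam"
  have "q y = (\<Sum>i\<in>{1..n-1}. c i y * q (X i)) + \<tau> y * q T" by (rule expand_linear[OF l])
  moreover have "(\<Sum>i\<in>{1..n-1}. c i y * q (X i)) \<in> \<int>"
    using q y by (intro Ints_sum Ints_mult) (auto simp: V_iff Lam_def)
  ultimately show "q y \<in> \<int>" using y by (simp add: Lam_def)
qed

lemma V_diff: "q \<in> V \<Longrightarrow> q' \<in> V \<Longrightarrow> (\<lambda>v. q v - q' v) \<in> V"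
  by (auto simp: V_iff linear_compose_sub)

lemma V_0: "(\<lambda>v. 0) \<in> V" by (simp add: V_iff linear_zero)

lemma V_uminus: "q \<in> V \<Longrightarrow> (\<lambda>v. - q v) \<in> V" using V_diff[OF V_0] by simp

lemma chi_mult: "q \<in> V \<Longrightarrow> chi q (g \<otimes> h) = chi q g * chi q h"
  by (rule character_hom) (auto simp: V_linear V_d)

lemma continuous_chi: "q \<in> V \<Longrightarrow> continuous_on UNIV (chi q)"
proof -
  assume q: "q \<in> V"
  have "continuous_on UNIV (\<lambda>g. q (xx g))"
    using bounded_linear.continuous_on[OF V_linear[OF q, unfolded linear_conv_bounded_linear]
        continuous_xx[OF continuous_on_id]] .
  then show ?thesis
    unfolding chi_def by (intro continuous_ee continuous_intros continuous_tt)
qed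

lemma chi_T: "chi q (e (s *\<^sub>R T)) = ee (s * q T)" if "q \<in> V"
  using coords(2)[of 0 s] linear_0[OF V_linear[OF that]] by (simp add: chi_def)

lemma chi_m: "\<tau> x = 0 \<Longrightarrow> chi q (e x) = ee (q x)"
  using coords(2)[of x 0] by (simp add: chi_def)

lemma chi_invariant: assumes q: "q \<in> V" shows "QG.invariant (chi q)"
  unfolding QG.invariant_def
proof (intro allI ballI)
  fix g \<gamma> assume "\<gamma> \<in> \<Gamma>"
  then obtain y and k :: int where y: "y \<in> Lam" "\<gamma> = e y \<otimes> e (of_int k *\<^sub>R T)" by (rule Gamma_cases)
  have "chi q \<gamma> = 1"
    using y V_Lam[OF q y(1)] V_T[OF q] by (simp add: chi_mult q chi_m chi_T Lam_def ee_int)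
  then show "chi q (g \<otimes> \<gamma>) = chi q g" by (simp add: chi_mult q)
qed

lemma chi_e: "q \<in> V \<Longrightarrow> chi q (e v) = ee (q v)"
  by (metis chi_character character_ee)

lemma cnj_chi: "cnj (chi q g) = chi (\<lambda>v. - q v) g"
  by (simp add: chi_def ee_cnj)

lemma chi_diff: "chi (\<lambda>v. q v - q' v) g = chi q g * cnj (chi q' g)"
  by (simp add: chi_def ee_cnj ee_add[symmetric] algebra_simps)

text \<open>If \<open>q\<close> is nonzero, a multiple \<open>w\<close> of some vector has
  \<open>q w = 1/2\<close>, and translation by \<open>e w\<close> reverses the sign of the
  character.\<close>

lemma mean_chi: assumes q: "q \<in> V" shows "mean (chi q) = (if q = (\<lambda>v. 0) then 1 else 0)"
proof (cases "q = (\<lambda>v. 0)")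
  case True
  then have "chi q = (\<lambda>g. 1)" by (simp add: chi_def[abs_def])
  then show ?thesis using mu_total True by (simp add: mean_def QG.lift_def measure_def)
next
  case False
  then obtain v where v: "q v \<noteq> 0" by blast
  define w where "w = (1 / (2 * q v)) *\<^sub>R v"
  have "q w = 1/2" using v by (simp add: w_def linear_scale[OF V_linear[OF q]])
  then have "chi q (e w \<otimes> g) = - chi q g" for g
    unfolding chi_mult[OF q] chi_e[OF q] by (simp only: ee_half) simp
  then show ?thesis using mean_eq_0[OF continuous_chi[OF q] chi_invariant[OF q], of "e w"] False by simp
qed

lemma lift_integrable:
  fixes h :: "'g \<Rightarrow> complex"
  assumes h: "continuous_on UNIV h" "QG.invariant h" shows "integrable \<mu> (QG.lift h)"
proof -
  obtain b where "\<And>g. cmod (h g) \<le> b" using bounded_invariant[OF h] by blast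
  then show ?thesis
    by (intro L2.integrable_const_bound[of _ b] QG.lift_measurable[OF mu' h]) (simp add: QG.lift_def)
qed

lemma mean_sum:
  assumes "\<And>j. j \<in> J \<Longrightarrow> continuous_on UNIV (h j) \<and> QG.invariant (h j)"
  shows "mean (\<lambda>g. \<Sum>j\<in>J. h j g) = (\<Sum>j\<in>J. mean (h j))"
proof -
  have "mean (\<lambda>g. \<Sum>j\<in>J. h j g) = (\<integral>C. (\<Sum>j\<in>J. QG.lift (h j) C) \<partial>\<mu>)"
    by (simp add: mean_def QG.lift_def)
  also have "\<dots> = (\<Sum>j\<in>J. mean (h j))"
    unfolding mean_def using assms by (intro Bochner_Integration.integral_sum lift_integrable) auto
  finally show ?thesis .
qed

lemma mean_scale: "mean (\<lambda>g. a * h g) = a * mean h"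
  by (simp add: mean_def QG.lift_def)

lemma mean_cnj: "continuous_on UNIV h \<Longrightarrow> QG.invariant h \<Longrightarrow> mean (\<lambda>g. cnj (h g)) = cnj (mean h)"
  using integral_bounded_linear[OF bounded_linear_cnj lift_integrable, of h]
  by (simp add: mean_def QG.lift_def)

lemma invariant_mult_cnj:
  fixes h h' :: "'g \<Rightarrow> complex"
  shows "QG.invariant h \<Longrightarrow> QG.invariant h' \<Longrightarrow> QG.invariant (\<lambda>g. h g * cnj (h' g))"
  by (simp add: QG.invariant_def)

lemma shift_shift': "shift k (shift j F) g = shift (k + j) F g"
proof -
  have "e (of_int k *\<^sub>R T) \<otimes> e (of_int j *\<^sub>R T) = e (of_int (k + j) *\<^sub>R T)"
    using e_T_add[of "of_int k" "of_int j"] by simp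
  then show ?thesis by (simp add: shift_def m_assoc)
qed

text \<open>The double sum over pairs of indices is arranged by their difference \<open>j\<close>.
  The supports confine \<open>j\<close> to a finite range independent of \<open>g\<close>, and each
  fixed \<open>j\<close> contributes a single periodization.\<close>

lemma psum_mult_cnj:
  assumes F: "equivariant l F" and F': "equivariant l' F'"
  obtains m where "m \<ge> 0"
    "\<And>g. psum F g * cnj (psum F' g) = (\<Sum>j\<in>{-m..m}. psum (\<lambda>g. F g * cnj (shift j F' g)) g)"
proof -
  obtain b where b: "\<And>g k. shift k F g \<noteq> 0 \<Longrightarrow> \<bar>tt g + of_int k * 1\<bar> \<le> b"
     and fin: "\<And>g. finite {k. shift k F g \<noteq> 0}" by (rule shift_support[OF F]) blast
  obtain b' where b': "\<And>g k. shift k F' g \<noteq> 0 \<Longrightarrow> \<bar>tt g + of_int k * 1\<bar> \<le> b'"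
     and fin': "\<And>g. finite {k. shift k F' g \<noteq> 0}" by (rule shift_support[OF F']) blast
  define m where "m = \<lceil>\<bar>b\<bar> + \<bar>b'\<bar>\<rceil>"
  have m0: "m \<ge> 0" by (simp add: m_def)
  have "psum F g * cnj (psum F' g) = (\<Sum>j\<in>{-m..m}. psum (\<lambda>g. F g * cnj (shift j F' g)) g)" for g
  proof -
    let ?K = "{k. shift k F g \<noteq> 0}"
    have sh: "shift k (\<lambda>g. F g * cnj (shift j F' g)) g = shift k F g * cnj (shift (k + j) F' g)" for k j
      using shift_shift'[of k j F' g] by (simp add: shift_def)
    have row: "shift k F g * cnj (psum F' g) = (\<Sum>j\<in>{-m..m}. shift k F g * cnj (shift (k + j) F' g))"
      if k: "shift k F g \<noteq> 0" for k
    proof -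
      have "psum F' g = zsum (\<lambda>j. shift (j + k) F' g)"
        unfolding psum_def by (rule zsum_shift[symmetric])
      also have "\<dots> = (\<Sum>j\<in>{-m..m}. shift (j + k) F' g)"
      proof (rule zsum_eq)
        fix j assume "shift (j + k) F' g \<noteq> 0"
        then have "\<bar>tt g + of_int (j + k) * 1\<bar> \<le> b'" by (rule b')
        then have "\<bar>of_int j :: real\<bar> \<le> \<bar>b\<bar> + \<bar>b'\<bar>" using b[OF k] by simp
        then have "\<bar>j\<bar> \<le> m" unfolding m_def by linarith
        then show "j \<in> {-m..m}" by auto
      qed simp
      finally show ?thesis by (simp add: sum_distrib_left add.commute)
    qed
    have "psum F g * cnj (psum F' g) = (\<Sum>k\<in>?K. shift k F g * cnj (psum F' g))"
      by (simp add: psum_def zsum_def sum_distrib_right)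
    also have "\<dots> = (\<Sum>k\<in>?K. \<Sum>j\<in>{-m..m}. shift k F g * cnj (shift (k + j) F' g))"
      by (rule sum.cong) (simp_all add: row)
    also have "\<dots> = (\<Sum>j\<in>{-m..m}. \<Sum>k\<in>?K. shift k F g * cnj (shift (k + j) F' g))" by (rule sum.swap)
    also have "\<dots> = (\<Sum>j\<in>{-m..m}. psum (\<lambda>g. F g * cnj (shift j F' g)) g)"
      unfolding psum_def sh by (intro sum.cong refl zsum_eq[symmetric] fin) auto
    finally show ?thesis .
  qed
  with m0 that show ?thesis by blast
qed

lemma dual_lattice_diff: "l \<in> dual_lattice \<Longrightarrow> l' \<in> dual_lattice \<Longrightarrow> (\<lambda>v. l v - l' v) \<in> dual_lattice"
  by (auto simp: dual_lattice_iff linear_compose_sub)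

lemma Sigma_W: "l \<in> \<Sigma> \<Longrightarrow> l \<in> W" using cross_section_props(1)[OF cs] by blast
lemma Sigma_dual: "l \<in> \<Sigma> \<Longrightarrow> l \<in> dual_lattice" using Sigma_W by (simp add: W_iff)

lemma dual_lattice_eqI:
  assumes "l \<in> dual_lattice" "l' \<in> dual_lattice" "\<And>x. \<tau> x = 0 \<Longrightarrow> l x = l' x" shows "l = l'"
proof
  fix v
  have "l (\<pi> v) = l v" "l' (\<pi> v) = l' v"
    using assms by (auto simp: dual_lattice_iff \<pi>_def linear_diff linear_scale)
  then show "l v = l' v" using assms(3)[of "\<pi> v"] by simp
qed

text \<open>The \<open>j\<close>-th term belongs to the functional \<open>l - lA l' (- j)\<close>.
  It vanishes only for \<open>l = l'\<close> and \<open>j = 0\<close>; all other terms have mean 0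
  by \<open>mean_psum_0\<close>, and \<open>mean_psum\<close> evaluates the remaining one.\<close>

lemma mean_psum_psum:
  assumes l: "l \<in> \<Sigma>" and l': "l' \<in> \<Sigma>" and F: "equivariant l F" and F': "equivariant l' F'"
  shows "of_real \<kappa>0 * mean (\<lambda>g. psum F g * cnj (psum F' g)) =
    (if l = l' then \<integral>s. profile F s * cnj (profile F' s) \<partial>line else 0)"
proof -
  obtain m where m: "m \<ge> 0"
    "\<And>g. psum F g * cnj (psum F' g) = (\<Sum>j\<in>{-m..m}. psum (\<lambda>g. F g * cnj (shift j F' g)) g)"
    by (rule psum_mult_cnj[OF F F']) blast
  note dl = Sigma_dual[OF l] and dl' = Sigma_dual[OF l']
  define H where "H j = (\<lambda>g. F g * cnj (shift j F' g))" for j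
  define D where "D j = (\<lambda>v. l v - lA l' (of_int (- j)) v)" for j
  have H: "equivariant (D j) (H j)" for j
    unfolding D_def H_def by (rule equivariant_mult_cnj[OF F equivariant_shift[OF F']])
  have Dd: "D j \<in> dual_lattice" for j
    unfolding D_def by (rule dual_lattice_diff[OF dl lA_dual_lattice[OF dl']])
  have zero: "mean (psum (H j)) = 0" if "\<not> (l = l' \<and> j = 0)" for j
  proof -
    have "l \<noteq> lA l' (of_int (- j))" using cross_section_props(3)[OF cs l l', of "- j"] that by auto
    then obtain x where "\<tau> x = 0" "l x \<noteq> lA l' (of_int (- j)) x"
      using dual_lattice_eqI[OF dl lA_dual_lattice[OF dl']] by blast
    then show ?thesis using mean_psum_0[OF Dd _ _ H, of x j] by (simp add: D_def)
  qed
  have "mean (\<lambda>g. psum F g * cnj (psum F' g)) = (\<Sum>j\<in>{-m..m}. mean (psum (H j)))"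
    unfolding m(2) H_def[symmetric]
    by (rule mean_sum) (use psum_continuous[OF H] psum_invariant[OF H Dd] in blast)
  also have "\<dots> = (\<Sum>j\<in>{-m..m}. if j = 0 then (if l = l' then mean (psum (H 0)) else 0) else 0)"
    by (rule sum.cong) (auto simp: zero)
  also have "\<dots> = (if l = l' then mean (psum (H 0)) else 0)" using m(1) by simp
  finally have eq: "mean (\<lambda>g. psum F g * cnj (psum F' g)) = (if l = l' then mean (psum (H 0)) else 0)" .
  have "of_real \<kappa>0 * mean (psum (H 0)) = (\<integral>s. profile F s * cnj (profile F' s) \<partial>line)" if "l = l'"
  proof -
    have "H 0 = (\<lambda>g. F g * cnj (F' g))" by (simp add: H_def shift_def)
    moreover have "D 0 = (\<lambda>v. 0)" using that lA_0[OF dl'] by (simp add: D_def)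
    ultimately show ?thesis using mean_psum[of "H 0"] H[of 0] by simp
  qed
  then show ?thesis using eq by simp
qed

text \<open>The character is invariant under \<open>e (of_int k *\<^sub>R T)\<close> and can be
  moved inside the periodization. The resulting functional is nonzero on the range of
  \<open>d\<close>, where \<open>q\<close> vanishes and \<open>l\<close> does not.\<close>

lemma mean_psum_chi:
  assumes l: "l \<in> \<Sigma>" and q: "q \<in> V" and F: "equivariant l F"
  shows "mean (\<lambda>g. psum F g * chi q g) = 0"
proof -
  define K where "K = (\<lambda>g. F g * chi q g)"
  define m where "m = (\<lambda>v. l v - q (\<pi> v))"
  note lq = V_linear[OF q]
  have K: "equivariant m K"
  proof -
    obtain b where b: "\<And>g. F g \<noteq> 0 \<Longrightarrow> \<bar>tt g\<bar> \<le> b" using F unfolding equivariant_def by metis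
    then have "\<And>g. K g \<noteq> 0 \<Longrightarrow> \<bar>tt g\<bar> \<le> b" by (auto simp: K_def)
    moreover have "K (g \<otimes> e x) = ee (- m x) * K g" if "\<tau> x = 0" for g x
      using that ee_add[of "- l x" "q x"]
      by (simp add: K_def m_def chi_mult q chi_m equivariantD(2)[OF F] mult_ac)
    moreover have "continuous_on UNIV K"
      unfolding K_def by (intro continuous_intros equivariantD(1)[OF F] continuous_chi[OF q])
    ultimately show ?thesis by (auto simp: equivariant_def)
  qed
  have "psum F g * chi q g = psum K g" for g
  proof -
    have "shift k K g = chi q g * shift k F g" for k
      using V_T[OF q] by (simp add: shift_def K_def chi_mult q chi_T ee_int mult_ac)
    then show ?thesis unfolding psum_def by (simp only: zsum_mult mult.commute[of _ "chi q g"])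
  qed
  moreover have "m \<in> dual_lattice"
  proof -
    have lin: "linear (\<lambda>v. q (\<pi> v))"
      by (rule linearI) (simp_all add: linear_add[OF lq] linear_scale[OF lq])
    have "q (X i) \<in> \<int>" if "i \<in> {1..n-1}" for i using q that by (auto simp: V_iff)
    then have "(\<lambda>v. q (\<pi> v)) \<in> dual_lattice"
      using lin by (auto simp: dual_lattice_iff linear_0[OF lq] tau_X simp del: One_nat_def)
    then show ?thesis unfolding m_def by (rule dual_lattice_diff[OF Sigma_dual[OF l]])
  qed
  moreover obtain z where "\<tau> z = 0" "l (d z) \<noteq> 0" using Sigma_W[OF l] by (auto simp: W_iff)
  then have "\<tau> (d z) = 0" "m (d z) \<noteq> 0" by (simp_all add: m_def V_d[OF q])
  ultimately show ?thesis using mean_psum_0[of m "d z" K] K by simp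
qed

text \<open>Constant sequences stand for vectors before completion. Values outside
  \<open>\<Sigma>\<close> and \<open>V\<close> stay free, as in \<open>hilbert_sum\<close>; supports
  are accordingly always cut down to these sets.\<close>

definition core where
  "core = {(x :: ('a \<Rightarrow> real) \<Rightarrow> nat \<Rightarrow> 'g \<Rightarrow> complex, z :: ('a \<Rightarrow> real) \<Rightarrow> complex).
     (\<forall>l\<in>\<Sigma>. \<exists>F. equivariant l F \<and> x l = (\<lambda>_. F)) \<and>
     finite {l\<in>\<Sigma>. x l 0 \<noteq> (\<lambda>_. 0)} \<and> finite {q\<in>V. z q \<noteq> 0}}"

text \<open>A function on \<open>G/\<Gamma>\<close> on which \<open>a\<close> acts by \<open>\<chi>\<^sub>q(a)\<close> is a multiple of the conjugate character,
  whence \<open>- q\<close>. The factor \<open>sqrt \<kappa>0\<close> compensates the normalization of \<open>\<nu>\<close>, which is arbitrary.\<close>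

definition summand where
  "summand w i g = (case i of Inl l \<Rightarrow> of_real (sqrt \<kappa>0) * psum (fst w l (0::nat)) g
     | Inr q \<Rightarrow> snd w q * chi (\<lambda>v. - q v) g)"

definition core_fun where
  "core_fun w g = (\<Sum>i\<in>{l\<in>\<Sigma>. fst w l (0::nat) \<noteq> (\<lambda>_. 0)} <+> {q\<in>V. snd w q \<noteq> 0}. summand w i g)"

definition core_map where "core_map w = QG.lift (core_fun w)"

lemma core_eq:
  assumes "w \<in> core" "l \<in> \<Sigma>" shows "equivariant l (fst w l 0)" "fst w l = (\<lambda>_. fst w l 0)"
proof -
  from assms have "\<exists>F. equivariant l F \<and> fst w l = (\<lambda>_. F)" by (auto simp: core_def)
  then obtain F where F: "equivariant l F" "fst w l = (\<lambda>_. F)" by blast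
  then show "equivariant l (fst w l 0)" by simp
  show "fst w l = (\<lambda>_. fst w l 0)" unfolding F(2) ..
qed

lemma psum_0: "psum (\<lambda>_. 0) g = 0"
  by (simp add: psum_def zsum_def shift_def)

text \<open>Two elements of the core have different supports; this lets both be expanded over one
  common index set.\<close>

lemma core_fun_eq:
  assumes "finite I1" "{l\<in>\<Sigma>. fst w l 0 \<noteq> (\<lambda>_. 0)} \<subseteq> I1" "I1 \<subseteq> \<Sigma>"
    and "finite I2" "{q\<in>V. snd w q \<noteq> 0} \<subseteq> I2" "I2 \<subseteq> V"
  shows "core_fun w g = (\<Sum>i\<in>I1 <+> I2. summand w i g)"
  unfolding core_fun_def
proof (rule sum.mono_neutral_left)
  show "finite (I1 <+> I2)" using assms by simp
  show "{l\<in>\<Sigma>. fst w l 0 \<noteq> (\<lambda>_. 0)} <+> {q\<in>V. snd w q \<noteq> 0} \<subseteq> I1 <+> I2" using assms by auto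
  show "\<forall>i\<in>I1 <+> I2 - ({l\<in>\<Sigma>. fst w l 0 \<noteq> (\<lambda>_. 0)} <+> {q\<in>V. snd w q \<noteq> 0}). summand w i g = 0"
    using assms(3,6) by (auto simp: summand_def psum_0 split: sum.split)
qed

lemma summand_props:
  assumes w: "w \<in> core" and i: "i \<in> \<Sigma> <+> V"
  shows "continuous_on UNIV (summand w i)" "QG.invariant (summand w i)"
proof -
  have "continuous_on UNIV (summand w i) \<and> QG.invariant (summand w i)"
  proof (cases i)
    case (Inl l)
    then have l: "l \<in> \<Sigma>" using i by auto
    have s: "summand w i = (\<lambda>g. of_real (sqrt \<kappa>0) * psum (fst w l 0) g)"
      by (simp add: summand_def[abs_def] Inl)
    show ?thesis
      unfolding s using psum_continuous[OF core_eq(1)[OF w l]]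
        psum_invariant[OF core_eq(1)[OF w l] Sigma_dual[OF l]]
      by (auto simp: QG.invariant_def intro!: continuous_intros)
  next
    case (Inr q)
    then have q: "(\<lambda>v. - q v) \<in> V" using i V_uminus by auto
    have s: "summand w i = (\<lambda>g. snd w q * chi (\<lambda>v. - q v) g)"
      by (simp add: summand_def[abs_def] Inr)
    show ?thesis
      unfolding s using continuous_chi[OF q] chi_invariant[OF q]
      by (auto simp: QG.invariant_def intro!: continuous_intros)
  qed
  then show "continuous_on UNIV (summand w i)" "QG.invariant (summand w i)" by auto
qed

text \<open>The two factors \<open>sqrt \<kappa>0\<close> multiply to the \<open>\<kappa>0\<close>
  in \<open>mean_psum_psum\<close>, so no constant is left over. One mixed case is
  \<open>mean_psum_chi\<close>, the other follows by conjugation.\<close>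

lemma summand_gram:
  assumes w: "w \<in> core" and w': "w' \<in> core" and i: "i \<in> \<Sigma> <+> V" and j: "j \<in> \<Sigma> <+> V"
  shows "mean (\<lambda>g. summand w i g * cnj (summand w' j g)) = (if i = j then
    (case i of Inl l \<Rightarrow> \<integral>s. profile (fst w l 0) s * cnj (profile (fst w' l 0) s) \<partial>line
     | Inr q \<Rightarrow> snd w q * cnj (snd w' q)) else 0)"
proof -
  have mixed: "mean (\<lambda>g. summand w (Inl l) g * cnj (summand w' (Inr q) g)) = 0"
    if "l \<in> \<Sigma>" "q \<in> V" "w \<in> core" for l q w w'
  proof -
    have "summand w (Inl l) g * cnj (summand w' (Inr q) g)
        = (of_real (sqrt \<kappa>0) * cnj (snd w' q)) * (psum (fst w l 0) g * chi q g)" for g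
      by (simp add: summand_def cnj_chi[symmetric])
    then show ?thesis using mean_psum_chi[OF that(1,2) core_eq(1)[OF that(3,1)]] by (simp only: mean_scale) simp
  qed
  consider (a) l l' where "i = Inl l" "j = Inl l'" "l \<in> \<Sigma>" "l' \<in> \<Sigma>"
    | (b) l q where "i = Inl l" "j = Inr q" "l \<in> \<Sigma>" "q \<in> V"
    | (c) l q where "i = Inr q" "j = Inl l" "l \<in> \<Sigma>" "q \<in> V"
    | (d) q q' where "i = Inr q" "j = Inr q'" "q \<in> V" "q' \<in> V"
    using i j by auto
  then show ?thesis
  proof cases
    case a
    have "complex_of_real (sqrt \<kappa>0) * complex_of_real (sqrt \<kappa>0) = of_real \<kappa>0"
      using kappa0_pos by (simp flip: of_real_mult)
    then have "summand w i g * cnj (summand w' j g)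
        = of_real \<kappa>0 * (psum (fst w l 0) g * cnj (psum (fst w' l' 0) g))" for g
      by (simp add: summand_def a mult_ac)
    then show ?thesis
      using mean_psum_psum[OF a(3,4) core_eq(1)[OF w a(3)] core_eq(1)[OF w' a(4)]]
      by (simp only: mean_scale) (auto simp: a)
  next
    case b
    then show ?thesis using mixed[OF b(3,4) w, of w'] by simp
  next
    case c
    have "mean (\<lambda>g. summand w i g * cnj (summand w' j g))
        = mean (\<lambda>g. cnj (summand w' j g * cnj (summand w i g)))" by (simp add: mult.commute)
    also have "\<dots> = cnj (mean (\<lambda>g. summand w' j g * cnj (summand w i g)))"
      by (intro mean_cnj invariant_mult_cnj continuous_intros summand_props w w' i j)
    also have "\<dots> = 0" using mixed[OF c(3,4) w', of w] by (simp add: c)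
    finally show ?thesis by (simp add: c)
  next
    case d
    have "summand w i g * cnj (summand w' j g) = (snd w q * cnj (snd w' q')) * chi (\<lambda>v. q' v - q v) g" for g
      by (simp add: summand_def d chi_diff cnj_chi[symmetric] mult_ac)
    moreover have "(\<lambda>v. q' v - q v) = (\<lambda>v. 0) \<longleftrightarrow> q = q'" by (auto simp: fun_eq_iff)
    ultimately show ?thesis using mean_chi[OF V_diff[OF d(4,3)]] by (simp only: mean_scale) (auto simp: d)
  qed
qed

lemma core_supports:
  assumes "w \<in> core" shows "finite {l\<in>\<Sigma>. fst w l 0 \<noteq> (\<lambda>_. 0)}" "finite {q\<in>V. snd w q \<noteq> 0}"
  using assms by (auto simp: core_def)

lemma core_fun_props:
  assumes w: "w \<in> core" shows "continuous_on UNIV (core_fun w)" "QG.invariant (core_fun w)"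
proof -
  have "continuous_on UNIV (\<lambda>g. summand w i g)" "QG.invariant (\<lambda>g. summand w i g)"
    if "i \<in> {l\<in>\<Sigma>. fst w l 0 \<noteq> (\<lambda>_. 0)} <+> {q\<in>V. snd w q \<noteq> 0}" for i
    using summand_props[OF w, of i] that by auto
  then show "continuous_on UNIV (core_fun w)" "QG.invariant (core_fun w)"
    unfolding core_fun_def[abs_def]
    by (auto intro!: continuous_on_sum simp: QG.invariant_def intro: sum.cong)
qed

lemma core_map_vecs: "w \<in> core \<Longrightarrow> core_map w \<in> vecs R"
  unfolding core_map_def R_simps by (intro lift_L2 core_fun_props)

lemma Ind_inner_const:
  assumes "equivariant l F" "equivariant l F'"
  shows "vinner (Ind G M (character e l) \<nu>) (\<lambda>_. F) (\<lambda>_. F') = (\<integral>s. profile F s * cnj (profile F' s) \<partial>line)"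
  by (simp add: Ind_def hilbert_completion_def induced_inner[OF assms])

lemma core_isometric:
  assumes w: "w \<in> core" and w': "w' \<in> core"
  shows "vinner R (core_map w) (core_map w') = vinner (hilbert_plus S1 S2) w w'"
proof -
  define A where "A = {l\<in>\<Sigma>. fst w l 0 \<noteq> (\<lambda>_. 0)} \<union> {l\<in>\<Sigma>. fst w' l 0 \<noteq> (\<lambda>_. 0)}"
  define B where "B = {q\<in>V. snd w q \<noteq> 0} \<union> {q\<in>V. snd w' q \<noteq> 0}"
  have fin: "finite A" "finite B" using core_supports[OF w] core_supports[OF w'] by (auto simp: A_def B_def)
  have sub: "A \<subseteq> \<Sigma>" "B \<subseteq> V" by (auto simp: A_def B_def)
  let ?J = "A <+> B"
  let ?ip = "\<lambda>i. case i of Inl l \<Rightarrow> \<integral>s. profile (fst w l 0) s * cnj (profile (fst w' l 0) s) \<partial>line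
     | Inr q \<Rightarrow> snd w q * cnj (snd w' q)"
  have J: "i \<in> \<Sigma> <+> V" if "i \<in> ?J" for i using that sub by auto
  have cf: "core_fun w g = (\<Sum>i\<in>?J. summand w i g)" "core_fun w' g = (\<Sum>i\<in>?J. summand w' i g)" for g
    by (rule core_fun_eq; use fin sub in \<open>auto simp: A_def B_def\<close>)+
  have "vinner R (core_map w) (core_map w') = mean (\<lambda>g. core_fun w g * cnj (core_fun w' g))"
    by (simp add: R_simps core_map_def mean_def QG.lift_def)
  also have "\<dots> = mean (\<lambda>g. \<Sum>i\<in>?J. \<Sum>j\<in>?J. summand w i g * cnj (summand w' j g))"
    by (simp add: cf sum_product)
  also have "\<dots> = (\<Sum>i\<in>?J. mean (\<lambda>g. \<Sum>j\<in>?J. summand w i g * cnj (summand w' j g)))"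
  proof (rule mean_sum)
    fix i assume i: "i \<in> ?J"
    have "QG.invariant (\<lambda>g. \<Sum>j\<in>?J. summand w i g * cnj (summand w' j g))"
      using summand_props(2)[OF w J[OF i]] summand_props(2)[OF w' J]
      by (auto simp: QG.invariant_def intro!: sum.cong)
    moreover have "continuous_on UNIV (\<lambda>g. \<Sum>j\<in>?J. summand w i g * cnj (summand w' j g))"
      by (intro continuous_intros summand_props w w' J i) auto
    ultimately show "continuous_on UNIV (\<lambda>g. \<Sum>j\<in>?J. summand w i g * cnj (summand w' j g)) \<and>
       QG.invariant (\<lambda>g. \<Sum>j\<in>?J. summand w i g * cnj (summand w' j g))" by blast
  qed
  also have "\<dots> = (\<Sum>i\<in>?J. \<Sum>j\<in>?J. mean (\<lambda>g. summand w i g * cnj (summand w' j g)))"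
    by (intro sum.cong refl mean_sum conjI invariant_mult_cnj continuous_intros summand_props w w' J)
  also have "\<dots> = (\<Sum>i\<in>?J. \<Sum>j\<in>?J. if i = j then ?ip i else 0)"
    by (intro sum.cong refl summand_gram w w' J)
  also have "\<dots> = (\<Sum>i\<in>?J. ?ip i)" using fin by (intro sum.cong refl) simp
  also have "\<dots> = (\<Sum>l\<in>A. ?ip (Inl l)) + (\<Sum>q\<in>B. ?ip (Inr q))" using sum.Plus[OF fin, of ?ip] by (simp add: comp_def)
  also have "(\<Sum>l\<in>A. ?ip (Inl l)) = vinner S1 (fst w) (fst w')"
  proof -
    have in_eq: "vinner (Ind G M (character e l) \<nu>) (fst w l) (fst w' l) = ?ip (Inl l)" if "l \<in> \<Sigma>" for l
      using core_eq[OF w that] core_eq[OF w' that]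
        Ind_inner_const[OF core_eq(1)[OF w that] core_eq(1)[OF w' that]] by (simp only: sum.case)
    have "vinner S1 (fst w) (fst w') = (\<Sum>\<^sub>\<infinity>l\<in>\<Sigma>. ?ip (Inl l))"
      unfolding hilbert_sum_def rep.simps by (rule infsum_cong) (rule in_eq)
    also have "\<dots> = (\<Sum>\<^sub>\<infinity>l\<in>A. ?ip (Inl l))"
      using sub by (intro infsum_cong_neutral) (auto simp: A_def)
    finally show ?thesis using fin by simp
  qed
  also have "(\<Sum>q\<in>B. ?ip (Inr q)) = vinner S2 (snd w) (snd w')"
  proof -
    have "vinner S2 (snd w) (snd w') = (\<Sum>\<^sub>\<infinity>q\<in>V. ?ip (Inr q))"
      by (simp add: hilbert_sum_def character_rep_def)
    also have "\<dots> = (\<Sum>\<^sub>\<infinity>q\<in>B. ?ip (Inr q))"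
      using sub by (intro infsum_cong_neutral) (auto simp: B_def)
    finally show ?thesis using fin by simp
  qed
  also have "vinner S1 (fst w) (fst w') + vinner S2 (snd w) (snd w') = vinner (hilbert_plus S1 S2) w w'"
    by (simp add: hilbert_plus_def split: prod.split)
  finally show ?thesis .
qed

end

subsection \<open>The core is dense and its map is equivariant\<close>

context decomposition_model begin

lemma core_obtain:
  assumes "w \<in> core" "l \<in> \<Sigma>" obtains F where "equivariant l F" "fst w l = (\<lambda>_. F)"
proof -
  from assms have "\<exists>F. equivariant l F \<and> fst w l = (\<lambda>_. F)" by (auto simp: core_def)
  then show ?thesis using that by blast
qed

lemma core_vecs: "core \<subseteq> vecs (hilbert_plus S1 S2)"
proof
  fix w assume w: "w \<in> core"
  have "fst w \<in> vecs S1"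
    unfolding F1.vecs_sum
  proof (intro conjI ballI)
    fix l assume l: "l \<in> \<Sigma>"
    obtain F where F: "equivariant l F" "fst w l = (\<lambda>_. F)" by (rule core_obtain[OF w l])
    have "rep_cauchy (pre l) (\<lambda>_. F)"
      by (rule prehilbert.rep_cauchy_const[OF unitary_prehilbert[OF unitary_pre]])
        (simp add: induced_vecs F)
    then show "fst w l \<in> vecs (Ind G M (character e l) \<nu>)"
      unfolding Ind_def rep_cauchy_completion F(2) by simp
  next
    have "{l\<in>\<Sigma>. F1.sq (fst w) l \<noteq> 0} \<subseteq> {l\<in>\<Sigma>. fst w l 0 \<noteq> (\<lambda>_. 0)}"
    proof
      fix l assume "l \<in> {l\<in>\<Sigma>. F1.sq (fst w) l \<noteq> 0}"
      then have l: "l \<in> \<Sigma>" "F1.sq (fst w) l \<noteq> 0" by auto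
      obtain F where F: "equivariant l F" "fst w l = (\<lambda>_. F)" by (rule core_obtain[OF w l(1)])
      then have "fst w l 0 \<noteq> (\<lambda>_. 0)"
        using l(2) Ind_inner_const[OF F(1) F(1)] by (auto simp: F1.sq_def)
      then show "l \<in> {l\<in>\<Sigma>. fst w l 0 \<noteq> (\<lambda>_. 0)}" using l by simp
    qed
    then show "F1.sq (fst w) summable_on \<Sigma>"
      using core_supports(1)[OF w] finite_nonzero_values_imp_summable_on finite_subset by blast
  qed
  moreover have "snd w \<in> vecs S2"
    unfolding F2.vecs_sum
  proof (intro conjI ballI)
    have "finite {q\<in>V. F2.sq (snd w) q \<noteq> 0}"
      by (rule finite_subset[OF _ core_supports(2)[OF w]]) (unfold F2.sq_def, auto simp: character_rep_def)
    then show "F2.sq (snd w) summable_on V" by (rule finite_nonzero_values_imp_summable_on)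
  qed (simp add: character_rep_def)
  ultimately show "w \<in> vecs (hilbert_plus S1 S2)" by (simp add: hilbert_plus_def mem_Times_iff)
qed

lemma core_dense:
  assumes v: "v \<in> vecs (hilbert_plus S1 S2)" and \<epsilon>: "\<epsilon> > 0"
  shows "\<exists>w\<in>core. rep_dist (hilbert_plus S1 S2) v w < \<epsilon>"
proof -
  have x: "fst v \<in> vecs S1" and z: "snd v \<in> vecs S2" using v by (auto simp: hilbert_plus_def)
  have e2: "\<epsilon>/2 > 0" using \<epsilon> by simp
  define E where "E l = {(\<lambda>_::nat. F) | F. equivariant l F}" for l
  have E: "E l \<subseteq> vecs (Ind G M (character e l) \<nu>)" for l
    using prehilbert.rep_cauchy_const[OF unitary_prehilbert[OF unitary_pre]]
    by (auto simp: E_def Ind_def rep_cauchy_completion induced_vecs)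
  obtain I1 y where y: "finite I1" "I1 \<subseteq> \<Sigma>" "y \<in> vecs S1" "\<And>l. l \<in> I1 \<Longrightarrow> y l \<in> E l"
    "\<And>l. l \<notin> I1 \<Longrightarrow> y l = (\<lambda>_ _. 0)" "rep_dist S1 (fst v) y < \<epsilon>/2"
  proof (rule F1.finite_support_dense[OF x e2, of E "\<lambda>l _ _. 0"])
    fix l u and \<delta> :: real assume l: "l \<in> \<Sigma>" "u \<in> vecs (Ind G M (character e l) \<nu>)" "\<delta> > 0"
    have P: "prehilbert (pre l)" by (rule unitary_prehilbert[OF unitary_pre])
    obtain m where "rep_dist (Ind G M (character e l) \<nu>) u (\<lambda>_. u m) < \<delta>"
      using prehilbert.completion_dense[OF P, of u \<delta>] l unfolding Ind_def by blast
    moreover have "equivariant l (u m)"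
      using l(2) by (simp add: Ind_def rep_cauchy_completion rep_cauchy_def induced_vecs)
    ultimately show "\<exists>d\<in>E l. rep_dist (Ind G M (character e l) \<nu>) u d < \<delta>" by (auto simp: E_def)
  next
    fix l
    show "(\<lambda>_ _. 0) \<in> E l \<and> vinner (Ind G M (character e l) \<nu>) (\<lambda>_ _. 0) (\<lambda>_ _. 0) = 0"
      using equivariant_0 Ind_inner_const[OF equivariant_0 equivariant_0] by (auto simp: E_def)
  qed (use E in auto)
  obtain I2 y' where y': "finite I2" "I2 \<subseteq> V" "y' \<in> vecs S2"
    "\<And>q. q \<notin> I2 \<Longrightarrow> y' q = 0" "rep_dist S2 (snd v) y' < \<epsilon>/2"
  proof (rule F2.finite_support_dense[OF z e2, of "\<lambda>_. UNIV" "\<lambda>_. 0"])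
    fix q and u :: complex and \<delta> :: real assume "\<delta> > 0"
    then show "\<exists>d\<in>UNIV. rep_dist (character_rep (character e q)) u d < \<delta>"
      by (intro bexI[of _ u]) (simp_all add: dist_character)
  qed (auto simp: character_rep_def)
  have "(y, y') \<in> core"
  proof -
    have "\<exists>F. equivariant l F \<and> y l = (\<lambda>_. F)" for l
    proof (cases "l \<in> I1")
      case True
      then show ?thesis using y(4) by (auto simp: E_def)
    next
      case False
      then show ?thesis using y(5) equivariant_0 by (intro exI[of _ "\<lambda>_. 0"]) auto
    qed
    moreover have "finite {l\<in>\<Sigma>. y l 0 \<noteq> (\<lambda>_. 0)}"
      by (rule finite_subset[OF _ y(1)]) (use y(5) in force)
    moreover have "finite {q\<in>V. y' q \<noteq> 0}"
      by (rule finite_subset[OF _ y'(1)]) (use y'(4) in force)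
    ultimately show ?thesis by (simp add: core_def)
  qed
  moreover have "rep_dist (hilbert_plus S1 S2) v (y, y') < \<epsilon>"
  proof -
    have "(rep_dist (hilbert_plus S1 S2) (fst v, snd v) (y, y'))\<^sup>2
        = (rep_dist S1 (fst v) y)\<^sup>2 + (rep_dist S2 (snd v) y')\<^sup>2"
      by (rule dist_plus[OF F1.prehilbert_sum F2.prehilbert_sum x y(3) z y'(3)])
    also have "(rep_dist S1 (fst v) y)\<^sup>2 \<le> (\<epsilon>/2)\<^sup>2"
      using y(6) prehilbert.dist_ge0[OF F1.prehilbert_sum x y(3)] by (intro power_mono) auto
    also have "(rep_dist S2 (snd v) y')\<^sup>2 \<le> (\<epsilon>/2)\<^sup>2"
      using y'(5) prehilbert.dist_ge0[OF F2.prehilbert_sum z y'(3)] by (intro power_mono) auto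
    finally have "(rep_dist (hilbert_plus S1 S2) v (y, y'))\<^sup>2 \<le> (\<epsilon>/2)\<^sup>2 + (\<epsilon>/2)\<^sup>2" by simp
    also have "\<dots> < \<epsilon>\<^sup>2" using \<epsilon> by (simp add: power2_eq_square)
    finally show ?thesis using \<epsilon> by (meson power2_less_imp_less less_imp_le)
  qed
  ultimately show ?thesis by blast
qed

lemma S_act: "act (hilbert_plus S1 S2) a w = (\<lambda>l k g. fst w l k (inv a \<otimes> g), \<lambda>q. character e q a * snd w q)"
  by (simp add: hilbert_plus_def hilbert_sum_def Ind_def hilbert_completion_def pre_simps
      character_rep_def split: prod.split)

lemma translate_eq_0: "(\<lambda>g. F (inv a \<otimes> g)) = (\<lambda>_. 0) \<longleftrightarrow> F = (\<lambda>_. 0)"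
proof
  assume *: "(\<lambda>g. F (inv a \<otimes> g)) = (\<lambda>_. 0)"
  show "F = (\<lambda>_. 0)"
  proof
    fix g
    from fun_cong[OF *, of "a \<otimes> g"] show "F g = 0" by simp
  qed
qed simp

lemma character_nonzero: "character e q a \<noteq> 0"
  using cmod_character[of q a] by (metis norm_zero zero_neq_one)

lemma core_act: assumes w: "w \<in> core" shows "act (hilbert_plus S1 S2) a w \<in> core"
proof -
  have "\<exists>F. equivariant l F \<and> (\<lambda>k g. fst w l k (inv a \<otimes> g)) = (\<lambda>_. F)" if l: "l \<in> \<Sigma>" for l
  proof -
    obtain F where F: "equivariant l F" "fst w l = (\<lambda>_. F)" by (rule core_obtain[OF w l])
    show ?thesis using equivariant_translate[OF F(1)] by (auto simp: F(2))
  qed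
  then show ?thesis
    using core_supports[OF w] by (simp add: S_act core_def translate_eq_0 character_nonzero)
qed

lemma psum_translate: "psum (\<lambda>g. F (b \<otimes> g)) g = psum F (b \<otimes> g)"
  by (simp add: psum_def shift_def m_assoc)

lemma core_fun_act:
  assumes w: "w \<in> core"
  shows "core_fun (act (hilbert_plus S1 S2) a w) g = core_fun w (inv a \<otimes> g)"
proof -
  have "summand (act (hilbert_plus S1 S2) a w) i g = summand w i (inv a \<otimes> g)" if "i \<in> \<Sigma> <+> V" for i
  proof (cases i)
    case (Inl l)
    then show ?thesis using psum_translate[of "fst w l 0" "inv a" g] by (simp add: summand_def S_act)
  next
    case (Inr q)
    then have q: "q \<in> V" using that by auto
    \<comment> \<open>The character is unimodular, so its value at \<open>inv a\<close> is conjugate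
      to its value at \<open>a\<close>. Passing to the functional \<open>- q\<close> undoes this
      conjugation, and the factor is the one by which the representation acts.\<close>
    have "chi (\<lambda>v. - q v) (inv a \<otimes> g) = chi q a * chi (\<lambda>v. - q v) g"
    proof -
      have "chi q a * chi q (inv a) = 1"
        using chi_mult[OF q, of a "inv a"] chi_m[of 0 q] V_linear[OF q] by (simp add: linear_0)
      then have "cnj (chi q (inv a)) = chi q a"
      proof -
        assume h: "chi q a * chi q (inv a) = 1"
        have "cmod (chi q (inv a)) = 1" by (simp add: chi_def)
        then have "chi q (inv a) * cnj (chi q (inv a)) = 1" by (simp add: complex_norm_square[symmetric])
        with h show ?thesis by (metis mult.commute mult.left_neutral mult.assoc)
      qed
      then show ?thesis by (simp add: cnj_chi[symmetric] chi_mult[OF q])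
    qed
    then show ?thesis by (simp add: summand_def S_act Inr chi_character[OF q])
  qed
  note s = this
  have sup: "{l\<in>\<Sigma>. fst (act (hilbert_plus S1 S2) a w) l 0 \<noteq> (\<lambda>_. 0)} = {l\<in>\<Sigma>. fst w l 0 \<noteq> (\<lambda>_. 0)}"
    "{q\<in>V. snd (act (hilbert_plus S1 S2) a w) q \<noteq> 0} = {q\<in>V. snd w q \<noteq> 0}"
    by (simp_all add: S_act translate_eq_0 character_nonzero)
  show ?thesis
    unfolding core_fun_def sup by (rule sum.cong[OF refl], rule s) auto
qed

lemma core_map_act:
  assumes w: "w \<in> core"
  shows "rep_eq R (core_map (act (hilbert_plus S1 S2) a w)) (act R a (core_map w))"
proof (rule prehilbert.rep_eqI[OF prehilbert_R])
  have act: "core_fun (act (hilbert_plus S1 S2) a w) = (\<lambda>g. core_fun w (inv a \<otimes> g))"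
    by (rule ext) (rule core_fun_act[OF w])
  show "core_map (act (hilbert_plus S1 S2) a w) \<in> vecs R" by (rule core_map_vecs[OF core_act[OF w]])
  show "act R a (core_map w) \<in> vecs R"
    using core_map_vecs[OF w] unitary_R by (simp add: unitary_rep_def)
  \<comment> \<open>Equality is proved only on actual cosets, where the choice of representative is
    immaterial; this suffices for \<open>rep_eq\<close>.\<close>
  have eq: "core_map (act (hilbert_plus S1 S2) a w) C = act R a (core_map w) C" if "C \<in> space \<mu>" for C
  proof -
    have "C \<in> lcosets \<Gamma>" using that by (simp add: QG.space_kappa[OF mu'])
    from QG.lift_translate[OF core_fun_props(2)[OF w] this, of "inv a"]
    show ?thesis by (simp add: core_map_def R_simps act)
  qed
  show "vinner R (core_map (act (hilbert_plus S1 S2) a w)) (core_map (act (hilbert_plus S1 S2) a w))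
     = vinner R (core_map (act (hilbert_plus S1 S2) a w)) (act R a (core_map w))"
    unfolding R_simps(4) by (rule Bochner_Integration.integral_cong) (simp_all add: eq)
  show "vinner R (act R a (core_map w)) (act R a (core_map w))
     = vinner R (core_map (act (hilbert_plus S1 S2) a w)) (act R a (core_map w))"
    unfolding R_simps(4) by (rule Bochner_Integration.integral_cong) (simp_all add: eq)
qed

subsection \<open>Density of the image\<close>

text \<open>Separated from \<open>psum_add\<close> because the products of a cutoff with
  trigonometric polynomials mix several functionals and are not equivariant for one of them.\<close>

lemma psum_add_bounded:
  assumes "\<And>g. F g \<noteq> 0 \<Longrightarrow> \<bar>tt g\<bar> \<le> b" "\<And>g. F' g \<noteq> 0 \<Longrightarrow> \<bar>tt g\<bar> \<le> b"
  shows "psum (\<lambda>g. F g + F' g) g = psum F g + psum F' g"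
proof -
  have fin: "finite {k. shift k K g \<noteq> 0}" if K: "\<And>g. K g \<noteq> 0 \<Longrightarrow> \<bar>tt g\<bar> \<le> b" for K
  proof (rule finite_subset[OF _ finite_int_near[of 1 "tt g" b]])
    show "{k. shift k K g \<noteq> 0} \<subseteq> {k. \<bar>tt g + of_int k * 1\<bar> \<le> b}"
    proof
      fix k assume "k \<in> {k. shift k K g \<noteq> 0}"
      then show "k \<in> {k. \<bar>tt g + of_int k * 1\<bar> \<le> b}"
        using K[of "g \<otimes> e (of_int k *\<^sub>R T)"] by (simp add: shift_def tt_mult)
    qed
  qed simp
  show ?thesis
    unfolding psum_def using zsum_add[OF fin[of F] fin[of F']] assms by (simp add: shift_def)
qed

lemma psum_add:
  assumes F: "equivariant l F" and F': "equivariant l F'"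
  shows "psum (\<lambda>g. F g + F' g) g = psum F g + psum F' g"
proof -
  obtain b b' where b: "\<And>g. F g \<noteq> 0 \<Longrightarrow> \<bar>tt g\<bar> \<le> b" "\<And>g. F' g \<noteq> 0 \<Longrightarrow> \<bar>tt g\<bar> \<le> b'"
    using F F' unfolding equivariant_def by metis
  then show ?thesis by (intro psum_add_bounded[of F "max b b'"]) (auto simp: le_max_iff_disj)
qed

lemma psum_scale: "psum (\<lambda>g. a * F g) g = a * psum F g"
  by (simp add: psum_def shift_def zsum_mult)

lemma core_map_add:
  assumes w: "w \<in> core" and w': "w' \<in> core"
  shows "\<exists>u\<in>core. core_map u = (\<lambda>C. core_map w C + core_map w' C)"
proof -
  define u where "u = (\<lambda>l (k::nat) g. fst w l k g + fst w' l k g, \<lambda>q. snd w q + snd w' q)"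
  define I1 I2 where "I1 = {l\<in>\<Sigma>. fst w l 0 \<noteq> (\<lambda>_. 0)} \<union> {l\<in>\<Sigma>. fst w' l 0 \<noteq> (\<lambda>_. 0)}"
    and "I2 = {q\<in>V. snd w q \<noteq> 0} \<union> {q\<in>V. snd w' q \<noteq> 0}"
  have fin: "finite I1" "finite I2" using core_supports[OF w] core_supports[OF w'] by (auto simp: I1_def I2_def)
  have sub: "I1 \<subseteq> \<Sigma>" "I2 \<subseteq> V" by (auto simp: I1_def I2_def)
  have su: "{l\<in>\<Sigma>. fst u l 0 \<noteq> (\<lambda>_. 0)} \<subseteq> I1" "{q\<in>V. snd u q \<noteq> 0} \<subseteq> I2"
    by (auto simp: u_def I1_def I2_def)
  have "u \<in> core"
  proof -
    have "\<exists>F. equivariant l F \<and> fst u l = (\<lambda>_. F)" if l: "l \<in> \<Sigma>" for l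
    proof -
      obtain F where F: "equivariant l F" "fst w l = (\<lambda>_. F)" by (rule core_obtain[OF w l])
      obtain F' where F': "equivariant l F'" "fst w' l = (\<lambda>_. F')" by (rule core_obtain[OF w' l])
      show ?thesis using equivariant_add[OF F(1) F'(1)] by (auto simp: u_def F(2) F'(2))
    qed
    then show ?thesis
      using finite_subset[OF su(1) fin(1)] finite_subset[OF su(2) fin(2)]
      by (auto simp: core_def split: prod.split)
  qed
  moreover have "core_map u = (\<lambda>C. core_map w C + core_map w' C)"
  proof -
    have s: "summand u i g = summand w i g + summand w' i g" if "i \<in> \<Sigma> <+> V" for i g
      using that psum_add[OF core_eq(1)[OF w] core_eq(1)[OF w']]
      by (auto simp: summand_def u_def distrib_left distrib_right)
    have "core_fun u g = core_fun w g + core_fun w' g" for g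
    proof -
      have "core_fun u g = (\<Sum>i\<in>I1 <+> I2. summand u i g)"
        by (rule core_fun_eq[OF fin(1) su(1) sub(1) fin(2) su(2) sub(2)])
      also have "\<dots> = (\<Sum>i\<in>I1 <+> I2. summand w i g + summand w' i g)"
        by (rule sum.cong[OF refl], rule s) (use sub in auto)
      also have "\<dots> = core_fun w g + core_fun w' g"
        unfolding sum.distrib
        by (intro arg_cong2[of _ _ _ _ "(+)"] core_fun_eq[symmetric] fin sub) (auto simp: I1_def I2_def)
      finally show ?thesis .
    qed
    then show ?thesis by (simp add: core_map_def QG.lift_def fun_eq_iff)
  qed
  ultimately show ?thesis by blast
qed

lemma core_map_scale:
  assumes w: "w \<in> core" shows "\<exists>u\<in>core. core_map u = (\<lambda>C. a * core_map w C)"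
proof -
  define u where "u = (\<lambda>l (k::nat) g. a * fst w l k g, \<lambda>q. a * snd w q)"
  define I1 I2 where "I1 = {l\<in>\<Sigma>. fst w l 0 \<noteq> (\<lambda>_. 0)}" and "I2 = {q\<in>V. snd w q \<noteq> 0}"
  have fin: "finite I1" "finite I2" using core_supports[OF w] by (auto simp: I1_def I2_def)
  have sub: "I1 \<subseteq> \<Sigma>" "I2 \<subseteq> V" by (auto simp: I1_def I2_def)
  have su: "{l\<in>\<Sigma>. fst u l 0 \<noteq> (\<lambda>_. 0)} \<subseteq> I1" "{q\<in>V. snd u q \<noteq> 0} \<subseteq> I2"
    by (auto simp: u_def I1_def I2_def)
  have "u \<in> core"
  proof -
    have "\<exists>F. equivariant l F \<and> fst u l = (\<lambda>_. F)" if l: "l \<in> \<Sigma>" for l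
    proof -
      obtain F where F: "equivariant l F" "fst w l = (\<lambda>_. F)" by (rule core_obtain[OF w l])
      show ?thesis using equivariant_scale[OF F(1), of a] by (auto simp: u_def F(2))
    qed
    then show ?thesis
      using finite_subset[OF su(1) fin(1)] finite_subset[OF su(2) fin(2)]
      by (auto simp: core_def split: prod.split)
  qed
  moreover have "core_map u = (\<lambda>C. a * core_map w C)"
  proof -
    have s: "summand u i g = a * summand w i g" for i g
      by (cases i) (auto simp: summand_def u_def psum_scale mult_ac)
    have "core_fun u g = a * core_fun w g" for g
    proof -
      have "core_fun u g = (\<Sum>i\<in>I1 <+> I2. summand u i g)"
        by (rule core_fun_eq[OF fin(1) su(1) sub(1) fin(2) su(2) sub(2)])
      also have "\<dots> = a * core_fun w g"
        unfolding s sum_distrib_left[symmetric] by (simp add: core_fun_def I1_def I2_def)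
      finally show ?thesis .
    qed
    then show ?thesis by (simp add: core_map_def QG.lift_def fun_eq_iff)
  qed
  ultimately show ?thesis by blast
qed

sublocale CL: L2_subspace \<mu> "core_map ` core"
proof (unfold_locales, goal_cases)
  case (1 u v)
  then obtain w w' where w: "w \<in> core" "w' \<in> core" "u = core_map w" "v = core_map w'" by blast
  obtain t where "t \<in> core" "core_map t = (\<lambda>C. u C + v C)" using core_map_add[OF w(1,2)] w(3,4) by blast
  then show ?case by (intro image_eqI[of _ core_map t]) simp_all
next
  case (2 c u)
  then obtain w where w: "w \<in> core" "u = core_map w" by blast
  obtain t where "t \<in> core" "core_map t = (\<lambda>C. c * u C)" using core_map_scale[OF w(1), of c] w(2) by blast
  then show ?case by (intro image_eqI[of _ core_map t]) simp_all
next
  case 3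
  then show ?case using core_map_vecs by (auto simp: R_simps)
qed

lemma psum_Sigma_cl:
  assumes s: "s \<in> \<Sigma>" and F: "equivariant s F" shows "QG.lift (psum F) \<in> CL.cl"
proof -
  define w :: "(('a \<Rightarrow> real) \<Rightarrow> nat \<Rightarrow> 'g \<Rightarrow> complex) \<times> (('a \<Rightarrow> real) \<Rightarrow> complex)"
    where "w = (\<lambda>l k g. if l = s then of_real (1 / sqrt \<kappa>0) * F g else 0, \<lambda>q. 0)"
  have "w \<in> core"
  proof -
    have "\<exists>F. equivariant l F \<and> fst w l = (\<lambda>_. F)" for l
      using equivariant_scale[OF F, of "of_real (1 / sqrt \<kappa>0)"] equivariant_0[of l]
      by (cases "l = s") (auto simp: w_def)
    moreover have "finite {l\<in>\<Sigma>. fst w l 0 \<noteq> (\<lambda>_. 0)}"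
      by (rule finite_subset[of _ "{s}"]) (auto simp: w_def)
    ultimately show ?thesis by (simp add: core_def w_def)
  qed
  moreover have "core_map w = QG.lift (psum F)"
  proof -
    have "core_fun w g = (\<Sum>i\<in>{s} <+> {}. summand w i g)" for g
      by (rule core_fun_eq) (use s in \<open>auto simp: w_def\<close>)
    also have "\<dots> g = psum F g" for g
    proof -
      have "(\<Sum>i\<in>{s} <+> {}. summand w i g)
          = of_real (sqrt \<kappa>0) * psum (\<lambda>g. of_real (1 / sqrt \<kappa>0) * F g) g"
        by (simp add: Plus_def summand_def w_def)
      also have "\<dots> = (of_real (sqrt \<kappa>0) * of_real (1 / sqrt \<kappa>0)) * psum F g"
        by (simp only: psum_scale mult.assoc)
      also have "of_real (sqrt \<kappa>0) * of_real (1 / sqrt \<kappa>0) = (1::complex)"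
        using kappa0_pos by (simp flip: of_real_mult)
      finally show ?thesis by simp
    qed
    finally show ?thesis by (simp add: core_map_def QG.lift_def fun_eq_iff)
  qed
  ultimately show ?thesis by (metis CL.S_cl imageI)
qed

lemma chi_cl: assumes q: "q \<in> V" shows "QG.lift (chi q) \<in> CL.cl"
proof -
  define r where "r = (\<lambda>v. - q v)"
  have r: "r \<in> V" unfolding r_def by (rule V_uminus[OF q])
  define w :: "(('a \<Rightarrow> real) \<Rightarrow> nat \<Rightarrow> 'g \<Rightarrow> complex) \<times> (('a \<Rightarrow> real) \<Rightarrow> complex)"
    where "w = (\<lambda>l k g. 0, \<lambda>s. if s = r then 1 else 0)"
  have "w \<in> core"
  proof -
    have "finite {s\<in>V. snd w s \<noteq> 0}" by (rule finite_subset[of _ "{r}"]) (auto simp: w_def)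
    then show ?thesis using equivariant_0 by (auto simp: core_def w_def)
  qed
  moreover have "core_map w = QG.lift (chi q)"
  proof -
    have "core_fun w g = (\<Sum>i\<in>{} <+> {r}. summand w i g)" for g
      by (rule core_fun_eq) (use r in \<open>auto simp: w_def\<close>)
    also have "\<dots> g = chi q g" for g by (simp add: Plus_def summand_def w_def r_def)
    finally show ?thesis by (simp add: core_map_def QG.lift_def fun_eq_iff)
  qed
  ultimately show ?thesis by (metis CL.S_cl imageI)
qed

lemma lift_cl_add:
  "QG.lift u \<in> CL.cl \<Longrightarrow> QG.lift v \<in> CL.cl \<Longrightarrow> QG.lift (\<lambda>g. u g + v g :: complex) \<in> CL.cl"
  using CL.cl_add[of "QG.lift u" "QG.lift v"] by (simp add: QG.lift_def[abs_def])

lemma lift_cl_scale: "QG.lift u \<in> CL.cl \<Longrightarrow> QG.lift (\<lambda>g. a * u g :: complex) \<in> CL.cl"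
  using CL.cl_scale[of "QG.lift u" a] by (simp add: QG.lift_def[abs_def])

lemma lift_cl_uniform:
  assumes h: "continuous_on UNIV h" "QG.invariant h"
    and near: "\<And>\<epsilon>. \<epsilon> > 0 \<Longrightarrow> \<exists>u. QG.lift u \<in> CL.cl \<and> (\<forall>g. cmod (h g - u g) \<le> \<epsilon>)"
  shows "QG.lift h \<in> CL.cl"
proof (rule CL.cl_uniform[OF QG.lift_measurable[OF mu' h]])
  fix \<epsilon> :: real assume "\<epsilon> > 0"
  then obtain u where "QG.lift u \<in> CL.cl" "\<And>g. cmod (h g - u g) \<le> \<epsilon>" using near by blast
  then show "\<exists>v\<in>CL.cl. \<forall>x\<in>space \<mu>. cmod (QG.lift h x - v x) \<le> \<epsilon>"
    by (intro bexI[of _ "QG.lift u"]) (auto simp: QG.lift_def)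
qed

lemma shift_T: "g \<otimes> e (s *\<^sub>R T) = e ((tt g + s) *\<^sub>R T) \<otimes> e (A (- s) (xx g))"
proof -
  have "g \<otimes> e (s *\<^sub>R T) = e (tt g *\<^sub>R T) \<otimes> (e (xx g) \<otimes> e (s *\<^sub>R T))"
    by (subst decomp[of g]) (simp add: m_assoc)
  also have "\<dots> = e (tt g *\<^sub>R T) \<otimes> e (s *\<^sub>R T) \<otimes> e (A (- s) (xx g))"
    unfolding e_commute_T[of "xx g" s] by (simp add: m_assoc)
  finally show ?thesis by (simp add: e_T_add)
qed

text \<open>Outside \<open>W\<close> the periodization is a periodic function of \<open>tt\<close> times a character, so that
  trigonometric approximation produces the characters in \<open>V\<close>.\<close>

lemma psum_cl:
  assumes l: "l \<in> dual_lattice" and F: "equivariant l F" shows "QG.lift (psum F) \<in> CL.cl"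
proof (cases "l \<in> W")
  case True
  then obtain s and k :: int where s: "s \<in> \<Sigma>" "s = lA l (of_int k)"
    using cross_section_props(2)[OF cs] by blast
  have "equivariant s (shift (- k) F)" using equivariant_shift[OF F, of "- k"] s by simp
  from psum_Sigma_cl[OF s(1) this] show ?thesis by (simp add: psum_of_shift[abs_def])
next
  case False
  have lin: "linear l" and lT: "l T = 0" and lX: "\<And>i. i \<in> {1..n-1} \<Longrightarrow> l (X i) \<in> \<int>"
    using l by (auto simp: dual_lattice_iff)
  have ld: "\<And>z. \<tau> z = 0 \<Longrightarrow> l (d z) = 0" using False l by (auto simp: W_iff)
  define \<Phi> where "\<Phi> t = zsum (\<lambda>k. profile F (t + of_int k))" for t
  have psum: "psum F g = \<Phi> (tt g) * ee (- l (xx g))" for g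
  proof -
    have "shift k F g = ee (- l (xx g)) * profile F (tt g + of_int k)" for k
      using equivariantD(2)[OF F, of "A (- of_int k) (xx g)" "e ((tt g + of_int k) *\<^sub>R T)"]
        lA_invariant[OF lin ld, of "xx g" "- of_int k"]
      by (simp add: shift_def shift_T tau_A)
    then show ?thesis by (simp only: psum_def \<Phi>_def zsum_mult mult.commute)
  qed
  obtain b where b: "\<And>g. F g \<noteq> 0 \<Longrightarrow> \<bar>tt g\<bar> \<le> b" using F unfolding equivariant_def by metis
  have c\<Phi>: "continuous_on UNIV \<Phi>"
    unfolding \<Phi>_def
  proof (rule zsum_continuous[where t="\<lambda>t. t" and c=1 and b=b])
    show "continuous_on UNIV (\<lambda>t. profile F (t + of_int k))" for k
      by (rule continuous_on_compose2[OF continuous_profile[OF equivariantD(1)[OF F]]])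
        (auto intro: continuous_intros)
    show "\<bar>t + of_int k * 1\<bar> \<le> b" if "profile F (t + of_int k) \<noteq> 0" for t k
      using b[OF that] by simp
  qed (auto intro: continuous_intros)
  have per: "\<Phi> (t + 1) = \<Phi> t" for t
    using zsum_shift[of "\<lambda>k. profile F (t + of_int k)" 1] by (simp add: \<Phi>_def algebra_simps)
  have tX: "\<tau> (X i) = (if i = n then 1 else 0)" if "i \<in> {1..n}" for i
    using that n_pos by (simp add: tau_eq XT.dual del: One_nat_def)
  \<comment> \<open>The torus of full dimension is reused for a function of \<open>tt\<close> alone:
    \<open>p\<close> is evaluated on the line spanned by \<open>T\<close>, where only the last
    exponent survives. That exponent and \<open>- l\<close> combine to an element of
    \<open>V\<close>.\<close>
  have trig: "QG.lift (\<lambda>g. p (tt g *\<^sub>R T) * ee (- l (xx g))) \<in> CL.cl" if "p \<in> XT.trig" for p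
    using that
  proof induction
    case (mono a k)
    define q where "q = (\<lambda>v. - l v + of_int (k n) * \<tau> v)"
    have lq: "linear q"
      unfolding q_def by (rule linearI) (simp_all add: linear_add[OF lin] linear_scale[OF lin] algebra_simps)
    have "q (X i) \<in> \<int>" if i: "i \<in> {1..n}" for i
    proof (cases "i = n")
      case True
      then show ?thesis using lT tX[OF i] by (simp add: q_def T_eq)
    next
      case False
      then have "i \<in> {1..n-1}" using i by auto
      then show ?thesis using lX[of i] tX[OF i] False by (simp add: q_def)
    qed
    then have q: "q \<in> V" using lq ld by (simp add: V_iff) (simp add: q_def)
    have eq: "a * ee (\<Sum>i\<in>{1..n}. of_int (k i) * c i (tt g *\<^sub>R T)) * ee (- l (xx g)) = a * chi q g" for g
    proof -
      have "(\<Sum>i\<in>{1..n}. of_int (k i) * c i (tt g *\<^sub>R T)) = (\<Sum>i\<in>{1..n}. if i = n then of_int (k n) * tt g else 0)"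
        by (intro sum.cong refl) (simp add: linear_scale[OF c_linear] c_T)
      also have "\<dots> = of_int (k n) * tt g" using n_pos by simp
      finally show ?thesis by (simp add: chi_def q_def lT ee_add[symmetric] algebra_simps)
    qed
    show ?case unfolding eq by (rule lift_cl_scale[OF chi_cl[OF q]])
  next
    case (add u v)
    then show ?case using lift_cl_add by (simp add: distrib_right)
  qed
  show ?thesis
  proof (rule lift_cl_uniform[OF psum_continuous[OF F] psum_invariant[OF F l]])
    fix \<epsilon> :: real assume \<epsilon>: "\<epsilon> > 0"
    obtain p where p: "p \<in> XT.trig" "\<And>v. cmod (\<Phi> (\<tau> v) - p v) < \<epsilon>"
    proof (rule XT.trig_dense[of "\<lambda>v. \<Phi> (\<tau> v)" \<epsilon>])
      show "continuous_on UNIV (\<lambda>v. \<Phi> (\<tau> v))"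
        by (rule continuous_on_compose2[OF c\<Phi>]) (auto intro: continuous_tau continuous_intros)
      show "\<Phi> (\<tau> (v + X i)) = \<Phi> (\<tau> v)" if "i \<in> {1..n}" for i v
        using per by (simp add: tX[OF that])
    qed (use \<epsilon> in auto)
    have "cmod (psum F g - p (tt g *\<^sub>R T) * ee (- l (xx g))) \<le> \<epsilon>" for g
    proof -
      have "psum F g - p (tt g *\<^sub>R T) * ee (- l (xx g)) = (\<Phi> (tt g) - p (tt g *\<^sub>R T)) * ee (- l (xx g))"
        by (simp add: psum algebra_simps)
      then show ?thesis using p(2)[of "tt g *\<^sub>R T"] by (simp add: norm_mult)
    qed
    then show "\<exists>u. QG.lift u \<in> CL.cl \<and> (\<forall>g. cmod (psum F g - u g) \<le> \<epsilon>)" using trig[OF p(1)] by blast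
  qed
qed

end

section \<open>Approximation of indicators of open sets by periodizations\<close>

context decomposition_model begin

text \<open>The coordinates \<open>xx\<close> and \<open>tt\<close> packed into one vector. Right
  multiplication by the ideal subgroup becomes addition, so functions on the vector space that are
  periodic under \<open>Lam\<close> give right invariant functions on the group.\<close>

definition "lc g = xx g + tt g *\<^sub>R T"

lemma lc_props: "\<tau> (lc g) = tt g" "\<pi> (lc g) = xx g"
  by (simp_all add: lc_def)

lemma continuous_lc: "continuous_on S lc"
  unfolding lc_def by (intro continuous_intros continuous_xx continuous_tt)

lemma lc_m: "\<tau> x = 0 \<Longrightarrow> lc (g \<otimes> e x) = lc g + x"
  by (simp add: lc_def xx_m tt_mult)

lemma lattice_periodic:
  assumes per: "\<And>i v. i \<in> {1..n-1} \<Longrightarrow> h (v + X i) = h v" and x: "x \<in> Lam"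
  shows "h (v + x) = h v"
proof -
  have "x = (\<Sum>i\<in>{1..n-1}. c i x *\<^sub>R X i)"
    using XT.expand[of x] x unfolding sum_split c_n by (simp add: Lam_def)
  also have "\<dots> = (\<Sum>i\<in>{1..n-1}. of_int \<lfloor>c i x\<rfloor> *\<^sub>R X i)"
    using x by (intro sum.cong refl) (auto simp: Lam_def)
  finally have x: "x = (\<Sum>i\<in>{1..n-1}. of_int \<lfloor>c i x\<rfloor> *\<^sub>R X i)" .
  have nat: "h (v + real m *\<^sub>R X i) = h v" if "i \<in> {1..n-1}" for v m i
    by (induction m) (use per[OF that, of "v + real _ *\<^sub>R X i"] in \<open>auto simp: algebra_simps\<close>)
  have int: "h (v + of_int k *\<^sub>R X i) = h v" if "i \<in> {1..n-1}" for v k i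
  proof (cases "k \<ge> 0")
    case True
    then show ?thesis using nat[OF that, of v "nat k"] by simp
  next
    case False
    then show ?thesis using nat[OF that, of "v + of_int k *\<^sub>R X i" "nat (- k)"] by simp
  qed
  have "h (v + (\<Sum>i\<in>J. of_int (k i) *\<^sub>R X i)) = h v" if "finite J" "J \<subseteq> {1..n-1}" for J k
    using that
  proof (induction J)
    case (insert j J)
    have "h (v + (\<Sum>i\<in>insert j J. of_int (k i) *\<^sub>R X i))
        = h ((v + (\<Sum>i\<in>J. of_int (k i) *\<^sub>R X i)) + of_int (k j) *\<^sub>R X j)"
      using insert.hyps by (simp add: algebra_simps)
    also have "\<dots> = h v" using insert.prems insert.IH int[of j] by simp
    finally show ?case .
  qed simp
  from this[of "{1..n-1}" "\<lambda>i. \<lfloor>c i x\<rfloor>"] show ?thesis using x by simp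
qed

lemma lc_psum_props:
  assumes h: "continuous_on UNIV h" and per: "\<And>i v. i \<in> {1..n-1} \<Longrightarrow> h (v + X i) = h v"
    and sup: "\<And>v. h v \<noteq> 0 \<Longrightarrow> \<bar>\<tau> v\<bar> \<le> b"
  shows "continuous_on UNIV (psum (\<lambda>g. h (lc g)))" "QG.invariant (psum (\<lambda>g. h (lc g)))"
    and "shift k (\<lambda>g. h (lc g)) g \<noteq> 0 \<Longrightarrow> \<bar>tt g + of_int k * 1\<bar> \<le> b"
proof -
  show s: "\<bar>tt g + of_int k * 1\<bar> \<le> b" if "shift k (\<lambda>g. h (lc g)) g \<noteq> 0" for k g
    using sup[of "lc (g \<otimes> e (of_int k *\<^sub>R T))"] that by (simp add: shift_def lc_props tt_mult)
  show "continuous_on UNIV (psum (\<lambda>g. h (lc g)))"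
    unfolding psum_def
  proof (rule zsum_continuous[where t=tt and c=1, OF _ _ _ s])
    fix k
    have "continuous_on UNIV (\<lambda>g. g \<otimes> e (of_int k *\<^sub>R T))" by (intro continuous_mult continuous_intros)
    then have "continuous_on UNIV (\<lambda>g. lc (g \<otimes> e (of_int k *\<^sub>R T)))"
      by (rule continuous_on_compose2[OF continuous_lc]) auto
    then show "continuous_on UNIV (\<lambda>g. shift k (\<lambda>g. h (lc g)) g)"
      unfolding shift_def by (rule continuous_on_compose2[OF h]) auto
  qed (auto intro: continuous_tt continuous_intros)
  show "QG.invariant (psum (\<lambda>g. h (lc g)))"
    by (rule periodic_invariant) (simp add: lc_m Lam_def, rule lattice_periodic[OF per], auto simp: Lam_def)
qed

text \<open>Period \<open>4\<close> in the direction of \<open>T\<close> leaves room for the cutoff \<open>\<eta>\<close>.\<close>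

lemma periodic_cl:
  fixes h :: "'a \<Rightarrow> complex"
  assumes h: "continuous_on UNIV h" and per: "\<And>i v. i \<in> {1..n-1} \<Longrightarrow> h (v + X i) = h v"
    and sup: "\<And>v. h v \<noteq> 0 \<Longrightarrow> \<bar>\<tau> v\<bar> \<le> 1"
  shows "QG.lift (psum (\<lambda>g. h (lc g))) \<in> CL.cl"
proof -
  define Y where "Y i = (if i = n then 4 *\<^sub>R T else X i)" for i
  define c' where "c' i v = (if i = n then \<tau> v / 4 else c i v)" for i v
  have XX: "c i T = 0" "\<tau> (X i) = 0" if "i \<in> {1..n-1}" for i
    using that n_pos by (auto simp: c_T tau_X simp del: One_nat_def)
  have sub: "i \<in> {1..n-1}" if "i \<in> {1..n}" "i \<noteq> n" for i using that by auto
  interpret Q: torus "{1..n}" c' Y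
  proof (rule torus.intro)
    show "linear (c' i)" if "i \<in> {1..n}" for i
    proof (cases "i = n")
      case True
      then show ?thesis unfolding c'_def by (intro linearI) (simp_all add: add_divide_distrib)
    next
      case False
      then show ?thesis unfolding c'_def using c_linear by simp
    qed
    show "(\<Sum>i\<in>{1..n}. c' i v *\<^sub>R Y i) = v" for v
    proof -
      have "(\<Sum>i\<in>{1..n}. c' i v *\<^sub>R Y i) = (\<Sum>i\<in>{1..n}. c i v *\<^sub>R X i)"
        by (intro sum.cong refl) (simp add: c'_def Y_def c_n T_eq)
      then show ?thesis by (simp only: XT.expand)
    qed
    show "c' i (Y j) = (if i = j then 1 else 0)" if "i \<in> {1..n}" "j \<in> {1..n}" for i j
      using that XX[OF sub[of i]] XX[OF sub[of j]] XT.dual[of i j]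
      by (auto simp: c'_def Y_def linear_scale[OF c_linear] simp del: One_nat_def)
  qed simp
  define F where "F v = zsum (\<lambda>k. h (v + (of_int k * 4) *\<^sub>R T))" for v
  have cF: "continuous_on UNIV F"
    unfolding F_def
  proof (rule zsum_continuous[where t=\<tau> and c=4 and b=1])
    show "continuous_on UNIV (\<lambda>v. h (v + (of_int k * 4) *\<^sub>R T))" for k
      by (rule continuous_on_compose2[OF h]) (auto intro: continuous_intros)
    show "\<bar>\<tau> v + of_int k * 4\<bar> \<le> 1" if "h (v + (of_int k * 4) *\<^sub>R T) \<noteq> 0" for v k
      using sup[OF that] by simp
  qed (auto intro: continuous_tau continuous_intros)
  have perF: "F (v + Y i) = F v" if i: "i \<in> {1..n}" for i v
  proof (cases "i = n")
    case True
    have "v + Y i + (of_int k * 4) *\<^sub>R T = v + (of_int (k + 1) * 4) *\<^sub>R T" for k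
      by (simp add: True Y_def algebra_simps)
    then show ?thesis using zsum_shift[of "\<lambda>k. h (v + (of_int k * 4) *\<^sub>R T)" 1] by (simp only: F_def)
  next
    case False
    have "v + Y i + (of_int k * 4) *\<^sub>R T = (v + (of_int k * 4) *\<^sub>R T) + X i" for k
      using False by (simp add: Y_def algebra_simps)
    then show ?thesis using per[OF sub[OF i False]] by (simp only: F_def)
  qed
  have Fh: "F v = h v" if "\<bar>\<tau> v\<bar> \<le> 2" for v
  proof -
    have "F v = (\<Sum>k\<in>{0}. h (v + (of_int k * 4) *\<^sub>R T))"
      unfolding F_def
    proof (rule zsum_eq)
      fix k assume "h (v + (of_int k * 4) *\<^sub>R T) \<noteq> 0"
      from sup[OF this] have "\<bar>\<tau> v + of_int k * 4\<bar> \<le> 1" by simp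
      then have "\<bar>of_int k * 4 :: real\<bar> \<le> 3" using that by (simp add: abs_le_iff)
      then have "\<bar>k * 4\<bar> \<le> 3" by linarith
      then show "k \<in> {0}" by auto
    qed simp
    then show ?thesis by simp
  qed
  \<comment> \<open>The cutoff is 1 on the support of \<open>h\<close> and 0 beyond 2, the bound up
    to which \<open>F\<close> and \<open>h\<close> are known to agree. It restores compact support
    to the trigonometric approximation.\<close>
  define \<eta> :: "real \<Rightarrow> complex" where "\<eta> t = of_real (max 0 (min 1 (2 - \<bar>t\<bar>)))" for t
  have \<eta>0: "\<bar>t\<bar> \<le> 2" if "\<eta> t \<noteq> 0" for t using that by (auto simp: \<eta>_def max_def split: if_splits)
  have \<eta>1: "\<eta> t = 1" if "\<bar>t\<bar> \<le> 1" for t using that by (simp add: \<eta>_def)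
  have \<eta>b: "cmod (\<eta> t) \<le> 1" for t by (simp add: \<eta>_def)
  have \<eta>c: "continuous_on S \<eta>" for S unfolding \<eta>_def by (intro continuous_intros)
  have trig: "QG.lift (psum (\<lambda>g. \<eta> (tt g) * p (lc g))) \<in> CL.cl" if "p \<in> Q.trig" for p
    using that
  proof induction
    case (mono a k)
    \<comment> \<open>The exponents are negated because equivariance carries the phase
      \<open>ee (- l x)\<close>.\<close>
    define l where "l = (\<lambda>v. \<Sum>i\<in>{1..n-1}. of_int (- k i) * c i v)"
    have l: "l \<in> dual_lattice"
      unfolding l_def dual_lattice_def by (rule range_eqI[where x="\<lambda>i. - k i"]) simp
    have lin: "linear l" using l by (simp add: dual_lattice_iff)
    have ex: "(\<Sum>i\<in>{1..n}. of_int (k i) * c' i (lc g)) = of_int (k n) * (tt g / 4) - l (xx g)" for g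
    proof -
      have "(\<Sum>i\<in>{1..n-1}. of_int (k i) * c' i (lc g)) = (\<Sum>i\<in>{1..n-1}. - (of_int (- k i) * c i (xx g)))"
      proof (intro sum.cong refl)
        fix i assume i: "i \<in> {1..n-1}"
        then have "i \<noteq> n" using n_pos by auto
        then show "of_int (k i) * c' i (lc g) = - (of_int (- k i) * c i (xx g))"
          using XX[OF i] by (simp add: c'_def lc_def linear_add[OF c_linear] linear_scale[OF c_linear])
      qed
      then show ?thesis
        unfolding sum_split by (simp add: l_def sum_negf c'_def lc_props del: One_nat_def)
    qed
    define K where "K g = \<eta> (tt g) * (a * ee (\<Sum>i\<in>{1..n}. of_int (k i) * c' i (lc g)))" for g
    have "equivariant l K"
      unfolding equivariant_def
    proof (intro conjI allI impI exI[of _ 2])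
      have "continuous_on UNIV (\<lambda>g. l (xx g))"
        by (rule bounded_linear.continuous_on[OF lin[unfolded linear_conv_bounded_linear]
            continuous_xx[OF continuous_on_id]])
      then show "continuous_on UNIV K"
        unfolding K_def ex
        by (intro continuous_intros continuous_ee continuous_tt continuous_on_compose2[OF \<eta>c]) auto
      show "\<bar>tt g\<bar> \<le> 2" if "K g \<noteq> 0" for g using that by (intro \<eta>0) (auto simp: K_def)
      show "K (g \<otimes> e x) = ee (- l x) * K g" if "\<tau> x = 0" for g x
      proof -
        have "of_int (k n) * (tt g / 4) - (l (xx g) + l x) = - l x + (of_int (k n) * (tt g / 4) - l (xx g))"
          by simp
        then have "ee (of_int (k n) * (tt g / 4) - (l (xx g) + l x))
            = ee (- l x) * ee (of_int (k n) * (tt g / 4) - l (xx g))" by (simp only: ee_add)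
        then show ?thesis
          using that by (simp only: K_def ex tt_mult tt_m xx_m linear_add[OF lin]) simp
      qed
    qed
    from psum_cl[OF l this] show ?case unfolding K_def[abs_def] .
  next
    case (add u v)
    have "psum (\<lambda>g. \<eta> (tt g) * (u (lc g) + v (lc g))) g
        = psum (\<lambda>g. \<eta> (tt g) * u (lc g)) g + psum (\<lambda>g. \<eta> (tt g) * v (lc g)) g" for g
      unfolding distrib_left by (rule psum_add_bounded[of _ 2]) (auto intro: \<eta>0)
    then show ?case using lift_cl_add[OF add.IH] by simp
  qed
  show ?thesis
  proof (rule lift_cl_uniform[OF lc_psum_props(1,2)[OF h per sup]])
    fix \<epsilon> :: real assume \<epsilon>: "\<epsilon> > 0"
    \<comment> \<open>At most 5 integers \<open>k\<close> satisfy
      \<open>\<bar>tt g + of_int k\<bar> \<le> 2\<close>, so the errors of the shifted terms add up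
      to at most \<open>\<epsilon>\<close>.\<close>
    then have "\<epsilon>/5 > 0" by simp
    then obtain p where p: "p \<in> Q.trig" "\<And>v. cmod (F v - p v) < \<epsilon>/5"
      using Q.trig_dense[OF cF perF] by blast
    let ?K = "\<lambda>g. \<eta> (tt g) * p (lc g)"
    have near: "cmod (h (lc g) - ?K g) \<le> \<epsilon>/5" for g
    proof (cases "\<bar>tt g\<bar> \<le> 2")
      case True
      have "h (lc g) = \<eta> (tt g) * h (lc g)"
        using sup[of "lc g"] \<eta>1[of "tt g"] by (cases "h (lc g) = 0") (auto simp: lc_props)
      then have "h (lc g) - ?K g = \<eta> (tt g) * (F (lc g) - p (lc g))"
        using True by (simp add: Fh lc_props right_diff_distrib)
      then have "cmod (h (lc g) - ?K g) \<le> 1 * cmod (F (lc g) - p (lc g))"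
        using mult_right_mono[OF \<eta>b[of "tt g"] norm_ge_zero[of "F (lc g) - p (lc g)"]] by (simp only: norm_mult)
      then show ?thesis using p(2)[of "lc g"] by simp
    next
      case False
      then have "h (lc g) = 0" using sup[of "lc g"] by (auto simp: lc_props)
      moreover have "\<eta> (tt g) = 0" using \<eta>0[of "tt g"] False by blast
      ultimately show ?thesis using \<epsilon> by simp
    qed
    have "cmod (psum (\<lambda>g. h (lc g)) g - psum ?K g) \<le> \<epsilon>" for g
    proof -
      define J where "J = {\<lceil>- 2 - tt g\<rceil>..\<lfloor>2 - tt g\<rfloor>}"
      have mem: "k \<in> J" if "\<bar>tt g + of_int k\<bar> \<le> 2" for k
        using that unfolding J_def by (auto simp: abs_le_iff; linarith)
      have card: "real (card J) \<le> 5"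
      proof -
        have "of_int \<lfloor>2 - tt g\<rfloor> \<le> 2 - tt g" "- 2 - tt g \<le> of_int \<lceil>- 2 - tt g\<rceil>" by linarith+
        then have "of_int (\<lfloor>2 - tt g\<rfloor> - \<lceil>- 2 - tt g\<rceil>) \<le> (4::real)" unfolding of_int_diff by linarith
        then have "\<lfloor>2 - tt g\<rfloor> - \<lceil>- 2 - tt g\<rceil> \<le> 4" by linarith
        then show ?thesis by (simp add: J_def)
      qed
      have 1: "psum (\<lambda>g. h (lc g)) g = (\<Sum>k\<in>J. shift k (\<lambda>g. h (lc g)) g)"
        unfolding psum_def
      proof (rule zsum_eq)
        fix k assume "shift k (\<lambda>g. h (lc g)) g \<noteq> 0"
        from lc_psum_props(3)[OF h per sup this] show "k \<in> J" by (intro mem) simp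
      qed (simp add: J_def)
      have 2: "psum ?K g = (\<Sum>k\<in>J. shift k ?K g)"
        unfolding psum_def
      proof (rule zsum_eq)
        fix k assume "shift k ?K g \<noteq> 0"
        then have "\<bar>tt (g \<otimes> e (of_int k *\<^sub>R T))\<bar> \<le> 2" by (intro \<eta>0) (auto simp: shift_def)
        then show "k \<in> J" by (intro mem) (simp add: tt_mult)
      qed (simp add: J_def)
      have "cmod (psum (\<lambda>g. h (lc g)) g - psum ?K g)
          = cmod (\<Sum>k\<in>J. shift k (\<lambda>g. h (lc g)) g - shift k ?K g)"
        unfolding 1 2 sum_subtractf ..
      also have "\<dots> \<le> (\<Sum>k\<in>J. \<epsilon>/5)"
        by (rule sum_norm_le) (use near in \<open>simp add: shift_def\<close>)
      also have "\<dots> = real (card J) * (\<epsilon>/5)" by simp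
      also have "\<dots> \<le> 5 * (\<epsilon>/5)" using card \<epsilon> by (intro mult_right_mono) auto
      finally show ?thesis by simp
    qed
    then show "\<exists>u. QG.lift u \<in> CL.cl \<and> (\<forall>g. cmod (psum (\<lambda>g. h (lc g)) g - u g) \<le> \<epsilon>)"
      using trig[OF p(1)] by blast
  qed
qed

lemma one_cl: "(\<lambda>C. 1) \<in> CL.cl"
proof -
  have "QG.lift (chi (\<lambda>v. 0)) = (\<lambda>C. 1)" by (simp add: QG.lift_def chi_def fun_eq_iff)
  then show ?thesis using chi_cl[OF V_0] by simp
qed

lemma infdist_periodic:
  fixes B :: "'a set"
  assumes B: "closed B" "B \<noteq> {}" and per: "\<And>v. v \<in> B \<longleftrightarrow> v + x \<in> B"
  shows "infdist (v + x) B = infdist v B"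
proof (rule antisym)
  obtain a where a: "a \<in> B" "infdist v B = dist v a" using infdist_attains_inf[OF B] by blast
  then have "infdist (v + x) B \<le> dist (v + x) (a + x)" using per by (intro infdist_le) auto
  then show "infdist (v + x) B \<le> infdist v B" using a by simp
  obtain b where b: "b \<in> B" "infdist (v + x) B = dist (v + x) b" using infdist_attains_inf[OF B] by blast
  then have "infdist v B \<le> dist v (b - x)" using per[of "b - x"] by (intro infdist_le) auto
  also have "\<dots> = dist (v + x) b" by (simp add: dist_norm algebra_simps)
  finally show "infdist v B \<le> infdist (v + x) B" using b by simp
qed

text \<open>The hat functions \<open>max 0 (1 - \<bar>t + k\<bar>)\<close> form a partition of unity, so the indicator of an
  open set is the periodization of its product with one hat, and the latter is a limit of continuous
  periodic functions.\<close>

lemma indicator_cl: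
  assumes O: "openin (coset_topology G \<Gamma>) S" shows "(\<lambda>C. indicator S C) \<in> CL.cl"
proof -
  define B where "B = {v. (e (\<tau> v *\<^sub>R T) \<otimes> e (\<pi> v)) <# \<Gamma> \<notin> S}"
  have oS: "open {g. g <# \<Gamma> \<in> S}" using O by (simp add: openin_coset_topology[OF carrier])
  have "open ((\<lambda>v. e (\<tau> v *\<^sub>R T) \<otimes> e (\<pi> v)) -` {g. g <# \<Gamma> \<in> S})"
    by (intro open_vimage oS continuous_mult continuous_e continuous_intros continuous_tau continuous_pi)
  moreover have "(\<lambda>v. e (\<tau> v *\<^sub>R T) \<otimes> e (\<pi> v)) -` {g. g <# \<Gamma> \<in> S} = - B" by (auto simp: B_def)
  ultimately have cB: "closed B" by (simp add: open_closed)
  have lcB: "lc g \<in> B \<longleftrightarrow> g <# \<Gamma> \<notin> S" for g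
    using decomp[of g] by (simp add: B_def lc_props)
  have perB: "v \<in> B \<longleftrightarrow> v + X i \<in> B" if i: "i \<in> {1..n-1}" for v i
  proof -
    have t: "\<tau> (X i) = 0" by (rule tau_X[OF i])
    have "e (\<tau> (v + X i) *\<^sub>R T) \<otimes> e (\<pi> (v + X i)) = (e (\<tau> v *\<^sub>R T) \<otimes> e (\<pi> v)) \<otimes> e (X i)"
      using t by (simp add: e_m_add m_assoc)
    then show ?thesis
      using QG.coset_absorb[OF Lam_Gamma[OF X_Lam[OF i]]] by (simp add: B_def)
  qed
  show ?thesis
  \<comment> \<open>The distance to the empty set is 0 by convention, which would make the
    approximants below vanish; the case is treated separately.\<close>
  proof (cases "B = {}")
    case True
    then have "g <# \<Gamma> \<in> S" for g using lcB by blast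
    then have "indicator S C = (1::complex)" if "C \<in> space \<mu>" for C
      using that by (auto simp: QG.space_kappa[OF mu'] QG.cosets)
    then show ?thesis
      by - (rule CL.cl_limit[where F="\<lambda>_ _. 1" and B=1, OF one_cl], simp_all)
  next
    case False
    \<comment> \<open>The second factor increases with \<open>j\<close> to the indicator of the
      complement of \<open>B\<close>; the first is one hat of the partition of unity in
      \<open>tt\<close>.\<close>
    define h where "h j v = complex_of_real (max 0 (1 - \<bar>\<tau> v\<bar>) * min 1 (real j * infdist v B))" for j v
    have ch: "continuous_on UNIV (h j)" for j
      unfolding h_def by (intro continuous_intros continuous_tau)
    have perh: "h j (v + X i) = h j v" if i: "i \<in> {1..n-1}" for j i v
      using infdist_periodic[OF cB False perB[OF i]] tau_X[OF i] by (simp add: h_def)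
    have suph: "\<bar>\<tau> v\<bar> \<le> 1" if "h j v \<noteq> 0" for j v
      using that by (auto simp: h_def max_def split: if_splits)
    let ?K = "\<lambda>g. {k::int. \<bar>tt g + of_int k * 1\<bar> \<le> 1}"
    have fin: "finite (?K g)" for g by (rule finite_int_near) simp
    have w1: "(\<Sum>k\<in>?K g. max 0 (1 - \<bar>tt g + of_int k\<bar>)) = 1" for g
    proof -
      have "zsum (\<lambda>k. complex_of_real (max 0 (1 - \<bar>tt g + of_int k\<bar>)))
          = (\<Sum>k\<in>?K g. complex_of_real (max 0 (1 - \<bar>tt g + of_int k\<bar>)))"
        by (rule zsum_eq[OF fin]) (auto simp: max_def split: if_splits)
      then have "complex_of_real (\<Sum>k\<in>?K g. max 0 (1 - \<bar>tt g + of_int k\<bar>)) = 1"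
        by (simp only: hat_sum[of "tt g"] of_real_sum)
      then show ?thesis by (simp only: of_real_eq_1_iff)
    qed
    have ps: "psum (\<lambda>g. h j (lc g)) g = of_real (\<Sum>k\<in>?K g. max 0 (1 - \<bar>tt g + of_int k\<bar>) *
        min 1 (real j * infdist (lc (g \<otimes> e (of_int k *\<^sub>R T))) B))" for j g
    proof -
      have "psum (\<lambda>g. h j (lc g)) g = (\<Sum>k\<in>?K g. shift k (\<lambda>g. h j (lc g)) g)"
        unfolding psum_def
      proof (rule zsum_eq[OF fin])
        fix k assume "shift k (\<lambda>g. h j (lc g)) g \<noteq> 0"
        from lc_psum_props(3)[OF ch perh suph this] show "k \<in> ?K g" by simp
      qed
      then show ?thesis by (simp add: shift_def h_def lc_props tt_mult)
    qed
    have inf: "infdist (lc (g \<otimes> e (of_int k *\<^sub>R T))) B = 0 \<longleftrightarrow> g <# \<Gamma> \<notin> S" for g k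
    proof -
      have "infdist (lc (g \<otimes> e (of_int k *\<^sub>R T))) B = 0 \<longleftrightarrow> lc (g \<otimes> e (of_int k *\<^sub>R T)) \<in> B"
        using cB False in_closed_iff_infdist_zero by blast
      then show ?thesis using QG.coset_absorb[OF T_Gamma, of g k] by (simp add: lcB)
    qed
    have lim: "(\<lambda>j. psum (\<lambda>g. h j (lc g)) g) \<longlonglongrightarrow> indicator S (g <# \<Gamma>)" for g
    proof -
      have "(\<lambda>j. min 1 (real j * infdist (lc (g \<otimes> e (of_int k *\<^sub>R T))) B)) \<longlonglongrightarrow> indicator S (g <# \<Gamma>)" for k
      proof (cases "g <# \<Gamma> \<in> S")
        case True
        define \<delta> where "\<delta> = infdist (lc (g \<otimes> e (of_int k *\<^sub>R T))) B"
        have "\<delta> \<noteq> 0" using inf True by (simp add: \<delta>_def)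
        then have \<delta>: "\<delta> > 0" using infdist_nonneg by (simp add: \<delta>_def less_le)
        obtain m :: nat where m: "1 / \<delta> < real m" using reals_Archimedean2 by blast
        have "\<forall>\<^sub>F j in sequentially. min 1 (real j * \<delta>) = 1"
          unfolding eventually_sequentially
        proof (intro exI allI impI)
          fix j assume "m \<le> j"
          then have "1 / \<delta> < real j" using m by simp
          then show "min 1 (real j * \<delta>) = 1" using \<delta> by (simp add: field_simps)
        qed
        then show ?thesis using True by (simp add: \<delta>_def[symmetric] tendsto_eventually)
      next
        case False
        then have "infdist (lc (g \<otimes> e (of_int k *\<^sub>R T))) B = 0" using inf by blast
        then show ?thesis using False by simp
      qed
      then have "(\<lambda>j. \<Sum>k\<in>?K g. max 0 (1 - \<bar>tt g + of_int k\<bar>) *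
        min 1 (real j * infdist (lc (g \<otimes> e (of_int k *\<^sub>R T))) B)) \<longlonglongrightarrow>
        (\<Sum>k\<in>?K g. max 0 (1 - \<bar>tt g + of_int k\<bar>) * indicator S (g <# \<Gamma>))"
        by (intro tendsto_sum tendsto_mult tendsto_const)
      also have "(\<Sum>k\<in>?K g. max 0 (1 - \<bar>tt g + of_int k\<bar>) * indicator S (g <# \<Gamma>)) = (indicator S (g <# \<Gamma>) :: real)"
        unfolding sum_distrib_right[symmetric] w1 by simp
      finally have "(\<lambda>j. psum (\<lambda>g. h j (lc g)) g) \<longlonglongrightarrow> complex_of_real (indicator S (g <# \<Gamma>))"
        unfolding ps by (rule tendsto_of_real)
      then show ?thesis by (cases "g <# \<Gamma> \<in> S") simp_all
    qed
    have bound: "cmod (psum (\<lambda>g. h j (lc g)) g) \<le> 1" for j g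
    proof -
      have "(\<Sum>k\<in>?K g. max 0 (1 - \<bar>tt g + of_int k\<bar>) *
          min 1 (real j * infdist (lc (g \<otimes> e (of_int k *\<^sub>R T))) B)) \<le> (\<Sum>k\<in>?K g. max 0 (1 - \<bar>tt g + of_int k\<bar>) * 1)"
        by (intro sum_mono mult_left_mono) auto
      moreover have "0 \<le> (\<Sum>k\<in>?K g. max 0 (1 - \<bar>tt g + of_int k\<bar>) *
          min 1 (real j * infdist (lc (g \<otimes> e (of_int k *\<^sub>R T))) B))"
        by (intro sum_nonneg mult_nonneg_nonneg) (auto simp: infdist_nonneg)
      ultimately show ?thesis unfolding ps norm_of_real using w1[of g] by simp
    qed
    show ?thesis
    proof (rule CL.cl_limit)
      show "QG.lift (psum (\<lambda>g. h j (lc g))) \<in> CL.cl" for j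
        by (rule periodic_cl[OF ch perh suph])
      show "cmod (QG.lift (psum (\<lambda>g. h j (lc g))) C) \<le> 1" for j C
        unfolding QG.lift_def by (rule bound)
      fix C assume "C \<in> space \<mu>"
      then obtain g where g: "C = g <# \<Gamma>" by (auto simp: QG.space_kappa[OF mu'] QG.cosets)
      have "QG.lift (psum (\<lambda>g. h j (lc g))) C = psum (\<lambda>g. h j (lc g)) g" for j
        unfolding g by (rule QG.lift_coset[OF lc_psum_props(2)[OF ch perh suph]])
      then show "(\<lambda>j. QG.lift (psum (\<lambda>g. h j (lc g))) C) \<longlonglongrightarrow> indicator S C"
        using lim[of g] by (simp add: g)
    qed
  qed
qed

lemma L2_cl: "u \<in> L2.L2 \<Longrightarrow> u \<in> CL.cl"
proof (rule CL.cl_from_indicators[of "{W. openin (coset_topology G \<Gamma>) W}"])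
  show "sets \<mu> = sigma_sets (space \<mu>) {W. openin (coset_topology G \<Gamma>) W}"
    by (simp add: QG.sets_kappa[OF mu'] QG.space_kappa[OF mu'])
  show "{W. openin (coset_topology G \<Gamma>) W} \<subseteq> Pow (space \<mu>)"
    using openin_subset by (force simp: QG.space_kappa[OF mu'] simp flip: QG.topspace_coset)
  show "Int_stable {W. openin (coset_topology G \<Gamma>) W}" by (auto simp: Int_stable_def)
qed (auto simp: indicator_cl one_cl)

theorem decomposition: "unitarily_equivalent R (hilbert_plus S1 S2)"
proof (rule unitarily_equivalent_of_core[where D=core and U=core_map])
  show "prehilbert R" "rep_complete R" by (rule prehilbert_R, rule complete_R)
  show "prehilbert (hilbert_plus S1 S2)" "rep_complete (hilbert_plus S1 S2)"
    by (rule unitary_prehilbert[OF unitary_S], rule complete_S)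
  fix x \<epsilon> assume x: "x \<in> vecs R" and \<epsilon>: "(\<epsilon>::real) > 0"
  have "x \<in> CL.cl" using x by (intro L2_cl) (simp add: R_simps)
  then obtain w where "w \<in> core" "L2.nrm2 (\<lambda>C. x C - core_map w C) < \<epsilon>"
    using \<epsilon> unfolding CL.cl_def by blast
  then show "\<exists>w\<in>core. rep_dist R x (core_map w) < \<epsilon>"
    using x core_map_vecs by (intro bexI[of _ w]) (auto simp: dist_R R_simps)
next
  show "act R a x \<in> vecs R" if "x \<in> vecs R" for a x using unitary_R that by (simp add: unitary_rep_def)
  show "vinner R (act R a x) (act R a y) = vinner R x y" if "x \<in> vecs R" "y \<in> vecs R" for a x y
    using unitary_R that by (simp add: unitary_rep_def)
  show "act (hilbert_plus S1 S2) a x \<in> vecs (hilbert_plus S1 S2)" if "x \<in> vecs (hilbert_plus S1 S2)" for a x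
    using unitary_S that by (simp add: unitary_rep_def)
  show "vinner (hilbert_plus S1 S2) (act (hilbert_plus S1 S2) a x) (act (hilbert_plus S1 S2) a y)
      = vinner (hilbert_plus S1 S2) x y"
    if "x \<in> vecs (hilbert_plus S1 S2)" "y \<in> vecs (hilbert_plus S1 S2)" for a x y
    using unitary_S that by (simp add: unitary_rep_def)
qed (use core_vecs core_map_vecs core_isometric core_dense core_act core_map_act in auto)

end

section \<open>From the hypotheses of the theorem to the model\<close>

lemma lower_central_pow:
  "(bracket G e x ^^ k) y \<in> lower_central (bracket G e) k"
proof (induction k)
  case (Suc k)
  then show ?case by (auto simp: bracket_span_def intro!: span_base)
qed simp

theorem corollary1:
  fixes G :: "'g::t2_space monoid"
    and \<A> :: "('g, 'a::euclidean_space) chart set"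
    and e :: "'a \<Rightarrow> 'g"
    and \<Gamma> :: "'g set"
    and \<mm> :: "'a set"
    and X :: "nat \<Rightarrow> 'a"
    and n p :: nat
    and \<Sigma> :: "('a \<Rightarrow> real) set"
    and \<mu> \<nu> :: "'g set measure"
  assumes "one_parameter_metabelian G \<A> e" and "n = DIM('a)"
    and "discrete_uniform_subgroup G \<Gamma>"
    and "abelian_ideal_codim1 (bracket G e) \<mm>" and "rational_subspace e \<Gamma> \<mm>"
    and "adapted_basis G e \<Gamma> \<mm> n p X"
    and "cross_section (coAd0 G e X n) \<Gamma> (W_set (bracket G e) X n) \<Sigma>"
    and "invariant_prob_measure G \<Gamma> \<mu>"
    and "invariant_radon_measure G (e ` \<mm>) \<nu>"
  shows "unitarily_equivalent (quasi_regular_rep G \<mu>)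
           (hilbert_plus
             (hilbert_sum \<Sigma> (\<lambda>l. Ind G (e ` \<mm>) (character e l) \<nu>))
             (hilbert_sum (V_set X n p) (\<lambda>l. character_rep (character e l))))"
proof -
  have opm: "lie_group G \<A>" "lie_exponential G \<A> e" "connected (UNIV :: 'g set)"
    "simply_connected (UNIV :: 'g set)" "nilpotent_lie (bracket G e)"
    using assms(1) by (auto simp: one_parameter_metabelian_def)
  interpret lie_exp G \<A> e by (rule lie_exp.intro) (rule opm)+
  obtain U \<phi> where U: "(U, \<phi>) \<in> \<A>" "\<one>\<^bsub>G\<^esub> \<in> U" by (rule chart_at)
  have chart: "lie_chart G \<A> e U \<phi>"
    by (rule lie_chart.intro[OF lie_exp_axioms lie_chart_axioms.intro[OF U]])
  have ab: "inj_on X {1..n}" "independent (X ` {1..n})" "span (X ` {1..n}) = UNIV"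
    "\<Gamma> = range (malcev_product G e X n)"
    "bracket_span (bracket G e) UNIV UNIV = span (X ` {1..p})" "\<mm> = span (X ` {1..n-1})" "p \<le> n"
    using assms(6) by (auto simp: adapted_basis_def)
  have n: "n \<ge> 1" using assms(2) DIM_positive[where 'a='a] by simp
  define \<tau> where "\<tau> = dual_basis X n n"
  have lin: "linear (dual_basis X n i)" for i
    unfolding dual_basis_def
    by (rule linearI) (simp_all add: representation_add[OF ab(2)] representation_scale[OF ab(2)] ab(3) del: One_nat_def)
  have tX: "\<tau> (X i) = (if i = n then 1 else 0)" if "i \<in> {1..n}" for i
  proof -
    have "X i \<in> X ` {1..n}" using that by blast
    moreover have "X n = X i \<longleftrightarrow> n = i" using that n ab(1) by (intro inj_on_eq_iff[OF ab(1)]) auto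
    ultimately show ?thesis by (auto simp: \<tau>_def dual_basis_def representation_basis[OF ab(2)] simp del: One_nat_def)
  qed
  have ex: "v = (\<Sum>i\<in>{1..n-1}. dual_basis X n i v *\<^sub>R X i) + \<tau> v *\<^sub>R X n" for v
  proof -
    have "(\<Sum>b\<in>X ` {1..n}. representation (X ` {1..n}) v b *\<^sub>R b) = v"
      by (rule sum_representation_eq[OF ab(2)]) (auto simp: ab(3) simp del: One_nat_def)
    then have "(\<Sum>i\<in>{1..n}. dual_basis X n i v *\<^sub>R X i) = v"
      by (simp add: sum.reindex[OF ab(1)] dual_basis_def del: One_nat_def)
    moreover have "sum h {1..n} = sum h {1..n-1} + h n" for h :: "nat \<Rightarrow> 'a"
      using n by (cases n) auto
    ultimately show ?thesis by (simp add: \<tau>_def del: One_nat_def)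
  qed
  have m: "\<mm> = {x. \<tau> x = 0}"
  proof (intro equalityI subsetI)
    fix x assume "x \<in> \<mm>"
    then have "x \<in> span (X ` {1..n-1})" by (simp only: ab(6))
    then have "\<tau> x = 0"
      by (rule linear_eq_0_on_span[OF lin[of n, folded \<tau>_def], rotated]) (use tX in auto)
    then show "x \<in> {x. \<tau> x = 0}" by simp
  next
    fix x assume "x \<in> {x. \<tau> x = 0}"
    then have "x = (\<Sum>i\<in>{1..n-1}. dual_basis X n i x *\<^sub>R X i)" using ex[of x] by simp
    also have "\<dots> \<in> span (X ` {1..n-1})" by (intro span_sum span_scale span_base) auto
    finally show "x \<in> \<mm>" unfolding ab(6) .
  qed
  have ideal: "\<And>x y. y \<in> \<mm> \<Longrightarrow> bracket G e x y \<in> \<mm>" and abelian: "\<And>x y. x \<in> \<mm> \<Longrightarrow> y \<in> \<mm> \<Longrightarrow> bracket G e x y = 0"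
    using assms(4) by (auto simp: abelian_ideal_codim1_def lie_ideal_def)
  obtain N where N: "lower_central (bracket G e) N = {0}" using opm(5) by (auto simp: nilpotent_lie_def)
  have metab: "metabelian G \<A> e U \<phi> \<tau> (X n) N"
  proof (rule metabelian.intro[OF chart metabelian_axioms.intro])
    show "linear \<tau>" unfolding \<tau>_def by (rule lin)
    show "\<tau> (X n) = 1" using tX[of n] n by simp
    show "bracket G e x y = 0" if "\<tau> x = 0" "\<tau> y = 0" for x y using abelian that by (simp add: m)
    show "\<tau> (bracket G e x y) = 0" if "\<tau> y = 0" for x y using ideal that by (simp add: m)
    show "(bracket G e x ^^ N) y = 0" for x y using lower_central_pow[where G=G and e=e and x=x and k=N and y=y] N by simp
  qed (rule opm)+
  interpret M: metabelian G \<A> e U \<phi> \<tau> "X n" N by (rule metab)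
  \<comment> \<open>Otherwise \<open>X n\<close> would lie in the derived algebra, whereas every
    bracket is in the kernel of \<open>\<tau>\<close>.\<close>
  have pn: "p < n"
  proof (rule ccontr)
    assume "\<not> p < n"
    then have "X n \<in> span (X ` {1..p})" using n ab(7) by (intro span_base) auto
    then have "X n \<in> bracket_span (bracket G e) UNIV UNIV" by (simp only: ab(5))
    moreover have "\<tau> b = 0" if "b \<in> {bracket G e x y | x y. x \<in> UNIV \<and> y \<in> UNIV}" for b
    proof -
      have "\<exists>x y. b = bracket G e x y" using that by blast
      then obtain x y where "b = bracket G e x y" by blast
      then have "b = M.d (\<tau> x *\<^sub>R M.\<pi> y - \<tau> y *\<^sub>R M.\<pi> x)" by (simp only: M.bracket_formula[of x y])
      then show ?thesis by (simp only: M.tau_d)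
    qed
    ultimately have "\<tau> (X n) = 0"
      unfolding bracket_span_def using linear_eq_0_on_span[OF M.linear_tau] by blast
    then show False by simp
  qed
  have sg: "subgroup \<Gamma> G" and cp: "compact_space (coset_topology G \<Gamma>)"
    using assms(3) by (auto simp: discrete_uniform_subgroup_def)
  have "decomposition_model G \<A> e U \<phi> \<tau> (X n) N X n p \<Gamma> \<mu> \<nu> \<Sigma>"
    by (intro decomposition_model.intro measure_model.intro lattice_model.intro metab
        lattice_model_axioms.intro measure_model_axioms.intro decomposition_model_axioms.intro
        n ab sg pn cp assms(7,8) refl \<tau>_def assms(9)[unfolded m])
  from decomposition_model.decomposition[OF this] show ?thesis unfolding m .
qed

end
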